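(* Let $n\ge 3$, let $\mathcal{K}_n$ be the boundary of an $n$-gon and let $\mathbb{Z}_n=\langle\sigma\rangle$ be the cyclic group of order $n$. Then, as a $\mathbb{Z}[\mathbb{Z}_n]$-module, the homology group $H_1(\mathcal{Z}_{\mathcal{K}_n}(D^1,S^0))$ is isomorphic to a direct sum of induced representations $$\bigoplus_{w\in\mathfrak{L}}\operatorname{Ind}_{\mathbb{Z}_{n/d}}^{\mathbb{Z}_n} N_w,$$ where, for each $w\in\mathfrak{L}$, $d=|w|>1$ is the length of $w$ (a divisor of $n$), $\mathbb{Z}_{n/d}=\langle\sigma^d\rangle\subset\mathbb{Z}_n$, and $N_w$ is a $\mathbb{Z}[\mathbb{Z}_{n/d}]$-module which is a direct summand of $H_1(\mathcal{Z}_{\mathcal{K}_n}(D^1,S^0))$ as an abelian group. Moreover: (i) If $1<d<n$, then $N_w$ is isomorphic to $\mathbb{Z}^{\iota(w)n/d-1}$ as a $\mathbb{Z}$-module, and the action of the generator $\sigma^d$ of $\mathbb{Z}_{n/d}$ on $N_w$ is represented, with respect to the standard basis of $\mathbb{Z}^{\iota(w)n/d-1}$, by the square matrix of dimension $\iota(w)n/d-1$ $$\left(\begin{array}{c|c|c} \begin{array}{cccc}\mathbf{A}_{n/d}&&&\mathbf{0}\\&\mathbf{A}_{n/d}&&\\&&\ddots&\\\mathbf{0}&&&\mathbf{A}_{n/d}\end{array}&\mathbf{0}&\mathbf{-1}\\ \hline \mathbf{0}&\begin{array}{c}0\\\mathbf{I}_{n/d-2}\end{array}&\begin{array}{c}-1\\\mathbf{-1}\end{array}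 \end{array}\right)$$ with $\iota(w)-1$ copies of the standard cycle matrix $\mathbf{A}_{n/d}$ on the upper-left block diagonal. (ii) If $d=n$, then $\operatorname{Ind}_{\mathbb{Z}_{n/d}}^{\mathbb{Z}_n}N_w$ is isomorphic to $(\mathbb{Z}[\mathbb{Z}_n])^{\iota(w)-1}$.
   Context: The boundary $\mathcal{K}_n$ of an $n$-gon is the 1-dimensional simplicial complex on $[n]=\{1,\dots,n\}$ with edges $\{i,i+1\}$, indices mod $n$. $\mathcal{Z}_{\mathcal{K}_n}(D^1,S^0)=\bigcup_{\tau\in\mathcal{K}_n}Y_1^\tau\times\cdots\times Y_n^\tau\subset (D^1)^n$, where $Y_i^\tau=D^1=[0,1]$ if $i\in\tau$ and $Y_i^\tau=S^0=\{0,1\}$ if $i\notin\tau$. $\mathbb{Z}_n=\langle\sigma\rangle$ acts by $\sigma(x_1,\dots,x_n)=(x_2,\dots,x_n,x_1)$, which induces the $\mathbb{Z}[\mathbb{Z}_n]$-module structure on integral homology. A binary Lyndon word of length $m$ is a word of length $m$ in the alphabet $\{0,1\}$ (with $0<1$) having $m$ distinct circular rotations and being the lexicographically smallest of them; $\mathfrak{L}_m$ is the set of these. $\iota(w)$ is the number of times $01$ appears as a substring of $w$. Put $\mathfrak{L}=\Big(\bigcup_{d\mid n,\,1<d<n}\mathfrak{L}_d\Big)\cup\{w\in\mathfrak{L}_n:\iota(w)>1\}$. For $H\subset G$ and a left $\mathbb{Z}[H]$-module $M$, $\operatorname{Ind}_H^G M=\mathbb{Z}[G]\otimes_{\mathbb{Z}[H]}M$.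 The standard cycle matrix $\mathbf{A}_m$ is the $m\times m$ matrix with entries $1$ at positions $(i+1,i)$ for $1\le i\le m-1$ and at position $(1,m)$, and $0$ elsewhere. $\mathbf{I}_k$ is the $k\times k$ identity matrix. In the displayed block matrix the row blocks have sizes $(\iota(w)-1)n/d$ and $n/d-1$; the column blocks have sizes $(\iota(w)-1)n/d$, $n/d-2$ and $1$; the entire last column consists of $-1$'s; and in the lower-middle block the first row is zero and the remaining $n/d-2$ rows form $\mathbf{I}_{n/d-2}$. *)

theory Defs
  imports "HOL-Homology.Homology" "HOL-Algebra.Module" "Jordan_Normal_Form.Matrix"
begin

section \<open>The real moment-angle complex of a polygon\<close>

text \<open>The faces are the subsets of the edges \<open>{i, i + 1}\<close>; the successor of \<open>i\<close> modulo \<open>n\<close>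
  in \<open>{1..n}\<close> is \<open>i mod n + 1\<close>.\<close>

definition polygon_boundary :: "nat \<Rightarrow> nat set set" where
  "polygon_boundary n = {\<tau>. \<exists>i\<in>{1..n}. \<tau> \<subseteq> {i, i mod n + 1}}"

text \<open>Points of \<open>(D\<^sup>1)\<^sup>n\<close> are extensional functions on \<open>{1..n}\<close>.\<close>

definition real_moment_angle_set :: "nat \<Rightarrow> nat set set \<Rightarrow> (nat \<Rightarrow> real) set" where
  "real_moment_angle_set n K = (\<Union>\<tau>\<in>K. \<Pi>\<^sub>E i\<in>{1..n}. if i \<in> \<tau> then {0..1} else {0, 1})"

definition real_moment_angle_complex :: "nat \<Rightarrow> nat set set \<Rightarrow> (nat \<Rightarrow> real) topology" where
  "real_moment_angle_complex n K =
     subtopology (product_topology (\<lambda>_. top_of_set {0..1}) {1..n}) (real_moment_angle_set n K)"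

definition cyclic_shift :: "nat \<Rightarrow> (nat \<Rightarrow> real) \<Rightarrow> (nat \<Rightarrow> real)" where
  "cyclic_shift n x = (\<lambda>i\<in>{1..n}. x (i mod n + 1))"


section \<open>Group rings and their modules\<close>

definition group_ring :: "('g, 'm) monoid_scheme \<Rightarrow> ('g \<Rightarrow>\<^sub>0 int) ring" where
  "group_ring G =
     \<lparr>carrier = {r. Poly_Mapping.keys r \<subseteq> carrier G},
      monoid.mult = (\<lambda>r s. frag_extend (\<lambda>g. frag_extend (\<lambda>h. frag_of (g \<otimes>\<^bsub>G\<^esub> h)) s) r),
      one = frag_of \<one>\<^bsub>G\<^esub>,
      zero = 0,
      add = (+)\<rparr>"

text \<open>An abelian group \<open>A\<close>, written multiplicatively as homology groups are, with an action \<open>\<rho>\<close> of a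
  group, as a module over the group ring. The ring fields \<open>mult\<close> and \<open>one\<close> of the record type play no
  role in modules.\<close>

definition action_module ::
  "('x, 'b) monoid_scheme \<Rightarrow> ('g \<Rightarrow> 'x \<Rightarrow> 'x) \<Rightarrow> ('g \<Rightarrow>\<^sub>0 int, 'x) module" where
  "action_module A \<rho> =
     \<lparr>carrier = carrier A, monoid.mult = undefined, one = undefined,
      zero = \<one>\<^bsub>A\<^esub>, add = (\<otimes>\<^bsub>A\<^esub>),
      smult = (\<lambda>r x. \<Otimes>\<^bsub>A\<^esub>g\<in>Poly_Mapping.keys r. \<rho> g x [^]\<^bsub>A\<^esub> Poly_Mapping.lookup r g)\<rparr>"

definition module_iso ::
  "('r, 'a) ring_scheme \<Rightarrow> ('r, 'x, 'b) module_scheme \<Rightarrow> ('r, 'y, 'c) module_scheme \<Rightarrow> ('x \<Rightarrow> 'y) set"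
  where
  "module_iso R M N =
     {f \<in> iso (add_monoid M) (add_monoid N).
        \<forall>r\<in>carrier R. \<forall>x\<in>carrier M. f (r \<odot>\<^bsub>M\<^esub> x) = r \<odot>\<^bsub>N\<^esub> f x}"

definition module_isomorphic ::
  "('r, 'a) ring_scheme \<Rightarrow> ('r, 'x, 'b) module_scheme \<Rightarrow> ('r, 'y, 'c) module_scheme \<Rightarrow> bool" where
  "module_isomorphic R M N \<longleftrightarrow> module_iso R M N \<noteq> {}"

definition regular_module :: "('r, 'a) ring_scheme \<Rightarrow> ('r, 'r) module" where
  "regular_module R =
     \<lparr>carrier = carrier R, monoid.mult = undefined, one = undefined,
      zero = \<zero>\<^bsub>R\<^esub>, add = (\<oplus>\<^bsub>R\<^esub>), smult = (\<otimes>\<^bsub>R\<^esub>)\<rparr>"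

definition direct_sum_module ::
  "'i set \<Rightarrow> ('i \<Rightarrow> ('r, 'x, 'b) module_scheme) \<Rightarrow> ('r, 'i \<Rightarrow> 'x) module" where
  "direct_sum_module I M =
     \<lparr>carrier = {f \<in> \<Pi>\<^sub>E i\<in>I. carrier (M i). finite {i \<in> I. f i \<noteq> \<zero>\<^bsub>M i\<^esub>}},
      monoid.mult = undefined, one = undefined,
      zero = (\<lambda>i\<in>I. \<zero>\<^bsub>M i\<^esub>),
      add = (\<lambda>f g. \<lambda>i\<in>I. f i \<oplus>\<^bsub>M i\<^esub> g i),
      smult = (\<lambda>r f. \<lambda>i\<in>I. r \<odot>\<^bsub>M i\<^esub> f i)\<rparr>"

definition abelian_direct_summand :: "'x set \<Rightarrow> ('r, 'x, 'b) module_scheme \<Rightarrow> bool" where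
  "abelian_direct_summand A M \<longleftrightarrow>
     subgroup A (add_monoid M) \<and>
     (\<exists>B. subgroup B (add_monoid M) \<and> A \<inter> B = {\<zero>\<^bsub>M\<^esub>} \<and> A <+>\<^bsub>M\<^esub> B = carrier M)"


section \<open>Induced modules\<close>

text \<open>For a subring \<open>R\<close> of \<open>S\<close>, the tensor product of \<open>S\<close> and \<open>M\<close> over \<open>R\<close> is the free abelian group
  on the pairs \<open>(a, x)\<close> modulo the subgroup generated by the following elements.\<close>

definition tensor_relations ::
  "('s, 'a) ring_scheme \<Rightarrow> ('s, 'b) ring_scheme \<Rightarrow> ('s, 'x, 'c) module_scheme \<Rightarrow> ('s \<times> 'x \<Rightarrow>\<^sub>0 int) set"
  where
  "tensor_relations S R M =
     {frag_of (a \<oplus>\<^bsub>S\<^esub> b, x) - frag_of (a, x) - frag_of (b, x) | a b x.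
        a \<in> carrier S \<and> b \<in> carrier S \<and> x \<in> carrier M} \<union>
     {frag_of (a, x \<oplus>\<^bsub>M\<^esub> y) - frag_of (a, x) - frag_of (a, y) | a x y.
        a \<in> carrier S \<and> x \<in> carrier M \<and> y \<in> carrier M} \<union>
     {frag_of (a \<otimes>\<^bsub>S\<^esub> r, x) - frag_of (a, r \<odot>\<^bsub>M\<^esub> x) | a r x.
        a \<in> carrier S \<and> r \<in> carrier R \<and> x \<in> carrier M}"

abbreviation tensor_free ::
  "('s, 'a) ring_scheme \<Rightarrow> ('s, 'x, 'c) module_scheme \<Rightarrow> ('s \<times> 'x \<Rightarrow>\<^sub>0 int) monoid" where
  "tensor_free S M \<equiv> free_Abelian_group (carrier S \<times> carrier M)"

definition tensor_kernel ::
  "('s, 'a) ring_scheme \<Rightarrow> ('s, 'b) ring_scheme \<Rightarrow> ('s, 'x, 'c) module_scheme \<Rightarrow> ('s \<times> 'x \<Rightarrow>\<^sub>0 int) set"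
  where
  "tensor_kernel S R M = generate (tensor_free S M) (tensor_relations S R M)"

text \<open>The scalar \<open>s\<close> sends the class of \<open>(a, x)\<close> to that of \<open>(s \<otimes> a, x)\<close>. The image of a coset lies in
  one coset, and adding the kernel to it fills that coset.\<close>

definition extend_scalars ::
  "('s, 'a) ring_scheme \<Rightarrow> ('s, 'b) ring_scheme \<Rightarrow> ('s, 'x, 'c) module_scheme
     \<Rightarrow> ('s, ('s \<times> 'x \<Rightarrow>\<^sub>0 int) set) module"
  where
  "extend_scalars S R M =
     \<lparr>carrier = carrier (tensor_free S M Mod tensor_kernel S R M),
      monoid.mult = undefined, one = undefined,
      zero = \<one>\<^bsub>tensor_free S M Mod tensor_kernel S R M\<^esub>,
      add = (\<otimes>\<^bsub>tensor_free S M Mod tensor_kernel S R M\<^esub>),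
      smult = (\<lambda>s X. tensor_kernel S R M <#>\<^bsub>tensor_free S M\<^esub>
                 frag_extend (\<lambda>(a, x). frag_of (s \<otimes>\<^bsub>S\<^esub> a, x)) ` X)\<rparr>"

definition induced_module ::
  "('g, 'a) monoid_scheme \<Rightarrow> ('g, 'b) monoid_scheme \<Rightarrow> ('g \<Rightarrow>\<^sub>0 int, 'x, 'c) module_scheme
     \<Rightarrow> ('g \<Rightarrow>\<^sub>0 int, (('g \<Rightarrow>\<^sub>0 int) \<times> 'x \<Rightarrow>\<^sub>0 int) set) module"
  where
  "induced_module G H M = extend_scalars (group_ring G) (group_ring H) M"


section \<open>The cyclic group action on homology\<close>

text \<open>The element \<open>k\<close> of \<open>integer_mod_group n\<close> stands for \<open>\<sigma>\<^sup>k\<close>.\<close>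

definition sigma_pow :: "nat \<Rightarrow> nat \<Rightarrow> int" where
  "sigma_pow n d = (1::int) [^]\<^bsub>integer_mod_group n\<^esub> d"

definition sigma_subgroup :: "nat \<Rightarrow> nat \<Rightarrow> int monoid" where
  "sigma_subgroup n d = subgroup_generated (integer_mod_group n) {sigma_pow n d}"

definition polygon_H1 ::
  "nat \<Rightarrow> (int \<Rightarrow>\<^sub>0 int, (((nat \<Rightarrow> real) \<Rightarrow> (nat \<Rightarrow> real)) \<Rightarrow>\<^sub>0 int) set) module" where
  "polygon_H1 n =
     (let X = real_moment_angle_complex n (polygon_boundary n)
      in action_module (homology_group 1 X)
           (\<lambda>k. hom_induced 1 X {} X {} (cyclic_shift n ^^ nat k)))"


section \<open>Binary Lyndon words\<close>

definition lyndon_words :: "nat \<Rightarrow> nat list set" where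
  "lyndon_words m =
     {w. length w = m \<and> set w \<subseteq> {0, 1} \<and> card ((\<lambda>k. rotate k w) ` {..<m}) = m \<and>
         (\<forall>k<m. ord_class.lexordp_eq w (rotate k w))}"

definition iota :: "nat list \<Rightarrow> nat" where
  "iota w = card {i. Suc i < length w \<and> w ! i = 0 \<and> w ! Suc i = 1}"

definition polygon_words :: "nat \<Rightarrow> nat list set" where
  "polygon_words n =
     (\<Union>d\<in>{d. d dvd n \<and> 1 < d \<and> d < n}. lyndon_words d) \<union> {w \<in> lyndon_words n. iota w > 1}"


section \<open>The matrix of the action\<close>

definition cycle_mat :: "nat \<Rightarrow> int mat" where
  "cycle_mat m = Matrix.mat m m (\<lambda>(i, j). if i = j + 1 \<or> (i = 0 \<and> j + 1 = m) then 1 else 0)"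

text \<open>The block matrix with parameters \<open>c = \<iota>(w)\<close> and \<open>m = n/d\<close>, acting on column vectors.\<close>

definition action_mat :: "nat \<Rightarrow> nat \<Rightarrow> int mat" where
  "action_mat c m =
     (let p = (c - 1) * m;
          L = four_block_mat
                (diag_block_mat (replicate (c - 1) (cycle_mat m))) (0\<^sub>m p (m - 2))
                (0\<^sub>m (m - 1) p) (0\<^sub>m 1 (m - 2) @\<^sub>r 1\<^sub>m (m - 2))
      in four_block_mat
           L (Matrix.mat (p + (m - 1)) 1 (\<lambda>_. - 1))
           (0\<^sub>m 0 (p + (m - 2))) (0\<^sub>m 0 1))"


section \<open>The structures above are modules\<close>

lemma frag_extend_compose2: "frag_extend f (frag_extend g c) = frag_extend (\<lambda>x. frag_extend f (g x)) c"
  using subset_UNIV by (induction c rule: frag_induction) (auto simp: frag_extend_diff)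

lemma frag_extend_swap:
  "frag_extend (\<lambda>x. frag_extend (\<lambda>y. f x y) d) c = frag_extend (\<lambda>y. frag_extend (\<lambda>x. f x y) c) d"
  unfolding frag_extend_def frag_cmul_sum
  by (subst sum.swap) (simp add: mult.commute)

lemma cring_group_ring:
  assumes "comm_group G" shows "cring (group_ring G)"
proof -
  interpret comm_group G by fact
  let ?m = "\<lambda>r s. frag_extend (\<lambda>g. frag_extend (\<lambda>h. frag_of (g \<otimes>\<^bsub>G\<^esub> h)) s) r"
  have cl: "Poly_Mapping.keys (?m r s) \<subseteq> carrier G" if "Poly_Mapping.keys r \<subseteq> carrier G" "Poly_Mapping.keys s \<subseteq> carrier G" for r s
    using that by (intro order_trans[OF keys_frag_extend] UN_least) auto
  have com: "?m r s = ?m s r" if "Poly_Mapping.keys r \<subseteq> carrier G" "Poly_Mapping.keys s \<subseteq> carrier G" for r s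
  proof -
    have "?m r s = frag_extend (\<lambda>h. frag_extend (\<lambda>g. frag_of (g \<otimes>\<^bsub>G\<^esub> h)) r) s" by (rule frag_extend_swap)
    also have "\<dots> = ?m s r" using that by (intro frag_extend_eq) (auto intro!: arg_cong[where f=frag_of] m_comm)
    finally show ?thesis .
  qed
  have ass: "?m (?m r s) t = ?m r (?m s t)" if "Poly_Mapping.keys r \<subseteq> carrier G" "Poly_Mapping.keys s \<subseteq> carrier G" "Poly_Mapping.keys t \<subseteq> carrier G" for r s t
    unfolding frag_extend_compose2 frag_extend_of using that
    by (intro frag_extend_eq) (auto intro!: arg_cong[where f=frag_of] m_assoc)
  have one: "?m (frag_of \<one>\<^bsub>G\<^esub>) r = r" if "Poly_Mapping.keys r \<subseteq> carrier G" for r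
  proof -
    have "?m (frag_of \<one>\<^bsub>G\<^esub>) r = frag_extend frag_of r" using that by (auto intro!: frag_extend_eq arg_cong[where f=frag_of])
    then show ?thesis by (simp flip: frag_expansion)
  qed
  have ka: "Poly_Mapping.keys (r + s) \<subseteq> carrier G" if "Poly_Mapping.keys r \<subseteq> carrier G" "Poly_Mapping.keys s \<subseteq> carrier G" for r s
    using that keys_add[of r s] by blast
  show ?thesis
  proof (rule cringI)
    show "abelian_group (group_ring G)"
      proof (rule abelian_groupI, goal_cases)
      case (6 x)
      then show ?case by (intro bexI[of _ "- x"]) (auto simp: group_ring_def)
    qed (auto simp: group_ring_def ka add.assoc add.commute)
    show "comm_monoid (group_ring G)"
    proof (rule comm_monoidI, goal_cases)
      case (1 x y) then show ?case using cl[of x y] by (simp add: group_ring_def)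
    next
      case 2 show ?case by (simp add: group_ring_def)
    next
      case (3 x y z) then show ?case using ass[of x y z] by (simp add: group_ring_def)
    next
      case (4 x) then show ?case using one[of x] by (simp add: group_ring_def)
    next
      case (5 x y) then show ?case using com[of x y] by (simp add: group_ring_def)
    qed
  next
    fix x y z
    show "(x \<oplus>\<^bsub>group_ring G\<^esub> y) \<otimes>\<^bsub>group_ring G\<^esub> z = x \<otimes>\<^bsub>group_ring G\<^esub> z \<oplus>\<^bsub>group_ring G\<^esub> y \<otimes>\<^bsub>group_ring G\<^esub> z"
      by (simp add: group_ring_def frag_extend_add)
  qed
qed

lemma module_action_module:
  assumes G: "comm_group G" and A: "comm_group A"
    and cl: "\<And>g. g \<in> carrier G \<Longrightarrow> \<rho> g \<in> hom A A"
    and one: "\<And>x. x \<in> carrier A \<Longrightarrow> \<rho> \<one>\<^bsub>G\<^esub> x = x"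
    and mul: "\<And>g h x. g \<in> carrier G \<Longrightarrow> h \<in> carrier G \<Longrightarrow> x \<in> carrier A \<Longrightarrow> \<rho> (g \<otimes>\<^bsub>G\<^esub> h) x = \<rho> g (\<rho> h x)"
  shows "module (group_ring G) (action_module A \<rho>)"
proof -
  interpret G: comm_group G by fact
  interpret A: comm_group A by fact
  let ?s = "\<lambda>r x. \<Otimes>\<^bsub>A\<^esub>g\<in>Poly_Mapping.keys r. \<rho> g x [^]\<^bsub>A\<^esub> (Poly_Mapping.lookup r g :: int)"
  have c[simp]: "\<rho> g x \<in> carrier A" if "g \<in> carrier G" "x \<in> carrier A" for g x
    using cl[OF that(1)] that(2) by (auto simp: hom_def)
  have scl: "?s r x \<in> carrier A" if "Poly_Mapping.keys r \<subseteq> carrier G" "x \<in> carrier A" for r :: "_ \<Rightarrow>\<^sub>0 int" and x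
    using that by (auto intro!: A.finprod_closed A.int_pow_closed c)
  have sup: "?s r x = (\<Otimes>\<^bsub>A\<^esub>g\<in>K. \<rho> g x [^]\<^bsub>A\<^esub> Poly_Mapping.lookup r g)"
    if "finite K" "Poly_Mapping.keys r \<subseteq> K" "K \<subseteq> carrier G" "x \<in> carrier A" for r :: "_ \<Rightarrow>\<^sub>0 int" and x K
    using that by (intro A.finprod_mono_neutral_cong_left) (auto simp: in_keys_iff subset_iff intro!: A.int_pow_closed)
  have sadd: "?s (r + s) x = ?s r x \<otimes>\<^bsub>A\<^esub> ?s s x"
    if "Poly_Mapping.keys r \<subseteq> carrier G" "Poly_Mapping.keys s \<subseteq> carrier G" "x \<in> carrier A" for r s :: "_ \<Rightarrow>\<^sub>0 int" and x
  proof -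
    let ?K = "Poly_Mapping.keys r \<union> Poly_Mapping.keys s"
    have "?s (r + s) x = (\<Otimes>\<^bsub>A\<^esub>g\<in>?K. \<rho> g x [^]\<^bsub>A\<^esub> Poly_Mapping.lookup (r + s) g)"
      using that keys_add[of r s] by (intro sup) auto
    also have "\<dots> = (\<Otimes>\<^bsub>A\<^esub>g\<in>?K. \<rho> g x [^]\<^bsub>A\<^esub> Poly_Mapping.lookup r g \<otimes>\<^bsub>A\<^esub> \<rho> g x [^]\<^bsub>A\<^esub> Poly_Mapping.lookup s g)"
      using that by (intro A.finprod_cong') (auto simp: lookup_add A.int_pow_mult subset_iff)
    also have "\<dots> = (\<Otimes>\<^bsub>A\<^esub>g\<in>?K. \<rho> g x [^]\<^bsub>A\<^esub> Poly_Mapping.lookup r g) \<otimes>\<^bsub>A\<^esub> (\<Otimes>\<^bsub>A\<^esub>g\<in>?K. \<rho> g x [^]\<^bsub>A\<^esub> Poly_Mapping.lookup s g)"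
      using that by (intro A.finprod_multf) (auto simp: subset_iff)
    also have "(\<Otimes>\<^bsub>A\<^esub>g\<in>?K. \<rho> g x [^]\<^bsub>A\<^esub> Poly_Mapping.lookup r g) = ?s r x"
      using that by (intro sup[symmetric]) auto
    also have "(\<Otimes>\<^bsub>A\<^esub>g\<in>?K. \<rho> g x [^]\<^bsub>A\<^esub> Poly_Mapping.lookup s g) = ?s s x"
      using that by (intro sup[symmetric]) auto
    finally show ?thesis .
  qed
  have sof: "?s (frag_of g) x = \<rho> g x" if "g \<in> carrier G" "x \<in> carrier A" for g x
    using that by simp
  have smul: "?s r (x \<otimes>\<^bsub>A\<^esub> y) = ?s r x \<otimes>\<^bsub>A\<^esub> ?s r y" if "Poly_Mapping.keys r \<subseteq> carrier G" "x \<in> carrier A" "y \<in> carrier A" for r :: "_ \<Rightarrow>\<^sub>0 int" and x y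
  proof -
    have "?s r (x \<otimes>\<^bsub>A\<^esub> y) = (\<Otimes>\<^bsub>A\<^esub>g\<in>Poly_Mapping.keys r. \<rho> g x [^]\<^bsub>A\<^esub> Poly_Mapping.lookup r g \<otimes>\<^bsub>A\<^esub> \<rho> g y [^]\<^bsub>A\<^esub> Poly_Mapping.lookup r g)"
      using that by (intro A.finprod_cong') (auto simp: subset_iff hom_mult[OF cl] A.int_pow_distrib)
    also have "\<dots> = ?s r x \<otimes>\<^bsub>A\<^esub> ?s r y" using that by (intro A.finprod_multf) (auto simp: subset_iff)
    finally show ?thesis .
  qed
  define s where "s = ?s"
  let ?m = "\<lambda>r s. frag_extend (\<lambda>g. frag_extend (\<lambda>h. frag_of (g \<otimes>\<^bsub>G\<^esub> h)) s) r"
  have keysm: "Poly_Mapping.keys (?m r t) \<subseteq> carrier G" if "Poly_Mapping.keys r \<subseteq> carrier G" "Poly_Mapping.keys t \<subseteq> carrier G" for r t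
    using that by (intro order_trans[OF keys_frag_extend] UN_least) auto
  have sdiff: "s (a - b) x = s a x \<otimes>\<^bsub>A\<^esub> inv\<^bsub>A\<^esub> s b x"
    if "Poly_Mapping.keys a \<subseteq> carrier G" "Poly_Mapping.keys b \<subseteq> carrier G" "x \<in> carrier A" for a b x
  proof -
    have k: "Poly_Mapping.keys (a - b) \<subseteq> carrier G" using that keys_diff[of a b] by blast
    have "s a x = s (a - b) x \<otimes>\<^bsub>A\<^esub> s b x"
      using sadd[OF k that(2,3)] by (simp add: s_def)
    moreover have "s (a - b) x \<in> carrier A" "s b x \<in> carrier A"
      using scl[OF k that(3)] scl[OF that(2,3)] by (simp_all add: s_def)
    ultimately show ?thesis by (simp add: A.m_assoc)
  qed
  have s0: "s 0 x = \<one>\<^bsub>A\<^esub>" for x by (simp add: s_def)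
  have k: "Poly_Mapping.keys (frag_extend (\<lambda>h. frag_of (g \<otimes>\<^bsub>G\<^esub> h)) c) \<subseteq> carrier G"
    if "g \<in> carrier G" "Poly_Mapping.keys c \<subseteq> carrier G" for g c
    using that by (intro order_trans[OF keys_frag_extend] UN_least) auto
  have kd: "Poly_Mapping.keys (a - b) \<subseteq> carrier G"
    if "Poly_Mapping.keys a \<subseteq> carrier G" "Poly_Mapping.keys b \<subseteq> carrier G" for a b :: "'a \<Rightarrow>\<^sub>0 int"
    using that keys_diff[of a b] by blast
  have scl': "s r x \<in> carrier A" if "Poly_Mapping.keys r \<subseteq> carrier G" "x \<in> carrier A" for r x
    using scl[OF that] by (simp add: s_def)
  have sof': "s (frag_of g) x = \<rho> g x" if "g \<in> carrier G" "x \<in> carrier A" for g x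
    using sof[OF that] by (simp add: s_def)
  have assg: "s (frag_extend (\<lambda>h. frag_of (g \<otimes>\<^bsub>G\<^esub> h)) t) x = \<rho> g (s t x)"
    if g: "g \<in> carrier G" and t: "Poly_Mapping.keys t \<subseteq> carrier G" and x: "x \<in> carrier A" for g t x
  proof -
    interpret h: group_hom A A "\<rho> g" using cl[OF g] by unfold_locales
    have "Poly_Mapping.keys t \<subseteq> carrier G \<and> s (frag_extend (\<lambda>h. frag_of (g \<otimes>\<^bsub>G\<^esub> h)) t) x = \<rho> g (s t x)"
      using t
    proof (induction t rule: frag_induction)
      case zero
      show ?case by (simp add: s0)
    next
      case (one h)
      then show ?case using g x by (simp add: sof' mul)
    next
      case (diff a b)
      then show ?case using x
        by (simp add: frag_extend_diff sdiff k[OF g] scl' kd)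
    qed
    then show ?thesis by blast
  qed
  have ass: "s (?m r t) x = s r (s t x)" if r: "Poly_Mapping.keys r \<subseteq> carrier G" and t: "Poly_Mapping.keys t \<subseteq> carrier G" "x \<in> carrier A" for r t x
  proof -
    have "Poly_Mapping.keys r \<subseteq> carrier G \<and> s (?m r t) x = s r (s t x)"
      using r
    proof (induction r rule: frag_induction)
      case zero show ?case by (simp add: s0)
    next
      case (one g)
      then show ?case using assg[OF _ t] sof'[of g "s t x"] scl'[OF t] by simp
    next
      case (diff a b)
      then show ?case using t
        by (simp add: frag_extend_diff sdiff keysm scl' kd)
    qed
    then show ?thesis by blast
  qed
  have ab: "abelian_group (action_module A \<rho>)"
    by (rule abelian_groupI) (auto simp: action_module_def A.m_ac intro: bexI[of _ "inv\<^bsub>A\<^esub> _"])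
  show ?thesis
  proof (rule moduleI[OF cring_group_ring[OF G] ab], goal_cases)
    case (1 a x)
    then show ?case using scl' by (simp add: action_module_def group_ring_def s_def)
  next
    case (2 a b x)
    then show ?case using sadd[of a b x] by (simp add: action_module_def group_ring_def)
  next
    case (3 a x y)
    then show ?case using smul[of a x y] by (simp add: action_module_def group_ring_def)
  next
    case (4 a b x)
    then show ?case using ass[of a b x] by (simp add: action_module_def group_ring_def s_def)
  next
    case (5 x)
    then show ?case using sof'[of "\<one>\<^bsub>G\<^esub>" x] one[of x] by (simp add: action_module_def group_ring_def s_def)
  qed
qed

lemma cyclic_shift_power:
  assumes "x \<in> extensional {1..n}" "n \<ge> 1"
  shows "(cyclic_shift n ^^ k) x = (\<lambda>i\<in>{1..n}. x ((i - 1 + k) mod n + 1))"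
proof (induction k)
  case 0
  then show ?case using assms by (auto simp: extensional_def fun_eq_iff)
next
  case (Suc k)
  show ?case
  proof
    fix i
    show "(cyclic_shift n ^^ Suc k) x i = (\<lambda>i\<in>{1..n}. x ((i - 1 + Suc k) mod n + 1)) i"
    proof (cases "i \<in> {1..n}")
      case True
      have "i mod n + 1 \<in> {1..n}" using assms(2) by (simp add: Suc_leI)
      moreover have "i - 1 + Suc k = i + k" using True by simp
      ultimately show ?thesis using True by (simp add: Suc cyclic_shift_def mod_add_left_eq)
    next
      case False
      then have "i \<notin> {1..n}" .
      then show ?thesis unfolding funpow.simps o_def cyclic_shift_def restrict_def by presburger
    qed
  qed
qed

lemma topspace_real_moment_angle_complex:
  "topspace (real_moment_angle_complex n K) = real_moment_angle_set n K"
proof -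
  have "real_moment_angle_set n K \<subseteq> (\<Pi>\<^sub>E i\<in>{1..n}. {0..1})"
    unfolding real_moment_angle_set_def by (intro UN_least PiE_mono) auto
  then show ?thesis by (auto simp: real_moment_angle_complex_def)
qed

lemma polygon_cyclic_shift:
  assumes "n \<ge> 1" "x \<in> real_moment_angle_set n (polygon_boundary n)"
  shows "cyclic_shift n x \<in> real_moment_angle_set n (polygon_boundary n)"
proof -
  obtain \<tau> j where t: "\<tau> \<subseteq> {j, j mod n + 1}" "j \<in> {1..n}" "x \<in> (\<Pi>\<^sub>E i\<in>{1..n}. if i \<in> \<tau> then {0..1} else {0, 1})"
    using assms unfolding real_moment_angle_set_def polygon_boundary_def by blast
  let ?t = "{i\<in>{1..n}. i mod n + 1 \<in> \<tau>}"
  have inj: "i = i'" if "i mod n = i' mod n" "i \<in> {1..n}" "i' \<in> {1..n}" for i i'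
    using that by (cases "i = n"; cases "i' = n") auto
  define j' where "j' = (if j = 1 then n else j - 1)"
  have j': "j' \<in> {1..n}" "j' mod n + 1 = j" using t(2) assms(1) by (auto simp: j'_def)
  have "?t \<subseteq> {j', j' mod n + 1}"
  proof
    fix i assume i: "i \<in> ?t"
    then have "i mod n + 1 = j \<or> i mod n + 1 = j mod n + 1" using t(1) by auto
    then show "i \<in> {j', j' mod n + 1}" using inj[of i j'] inj[of i j] i j' t(2) by fastforce
  qed
  then have "?t \<in> polygon_boundary n" using j'(1) unfolding polygon_boundary_def by blast
  moreover have "cyclic_shift n x \<in> (\<Pi>\<^sub>E i\<in>{1..n}. if i \<in> ?t then {0..1} else {0, 1})"
  proof -
    have *: "i mod n + 1 \<in> {1..n}" for i using assms(1) by (simp add: Suc_leI)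
    have "x (i mod n + 1) \<in> (if i mod n + 1 \<in> \<tau> then {0..1} else {0,1})" for i
      using PiE_mem[OF t(3) *] by blast
    then show ?thesis unfolding cyclic_shift_def restrict_PiE_iff by simp
  qed
  ultimately show ?thesis unfolding real_moment_angle_set_def by blast
qed

lemma continuous_map_cyclic_shift:
  assumes "n \<ge> 1"
  defines "X \<equiv> real_moment_angle_complex n (polygon_boundary n)"
  shows "continuous_map X X (cyclic_shift n)"
proof -
  have "continuous_map X (product_topology (\<lambda>_. top_of_set {0..1::real}) {1..n}) (cyclic_shift n)"
    unfolding continuous_map_componentwise
  proof (intro conjI ballI)
    show "cyclic_shift n ` topspace X \<subseteq> extensional {1..n}" by (auto simp: cyclic_shift_def)
    fix k assume k: "k \<in> {1..n}"
    have "continuous_map (product_topology (\<lambda>_. top_of_set {0..1::real}) {1..n}) (top_of_set {0..1}) (\<lambda>x. x (k mod n + 1))"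
      using assms(1) by (intro continuous_map_product_projection) (simp add: Suc_leI)
    then show "continuous_map X (top_of_set {0..1}) (\<lambda>x. cyclic_shift n x k)"
      using k by (simp add: X_def real_moment_angle_complex_def cyclic_shift_def continuous_map_from_subtopology)
  qed
  moreover have "cyclic_shift n \<in> topspace X \<rightarrow> real_moment_angle_set n (polygon_boundary n)"
    using polygon_cyclic_shift[OF assms(1)] by (simp add: X_def topspace_real_moment_angle_complex)
  ultimately show ?thesis
    unfolding X_def real_moment_angle_complex_def[of n "polygon_boundary n"] by (simp add: continuous_map_into_subtopology)
qed

lemma module_polygon_H1:
  assumes n: "n \<ge> 1"
  shows "Module.module (group_ring (integer_mod_group n)) (polygon_H1 n)"
proof -
  define X where "X = real_moment_angle_complex n (polygon_boundary n)"
  let ?s = "cyclic_shift n"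
  have cont: "continuous_map X X (?s ^^ k)" for k
  proof (induction k)
    case 0
    show ?case unfolding funpow.simps by simp
  next
    case (Suc k)
    then show ?case unfolding funpow.simps X_def by (rule continuous_map_compose[OF _ continuous_map_cyclic_shift[OF n]])
  qed
  have ext: "x \<in> extensional {1..n}" if "x \<in> topspace X" for x
    using that by (auto simp: X_def topspace_real_moment_angle_complex real_moment_angle_set_def PiE_def)
  have per: "(?s ^^ (k mod n)) x = (?s ^^ k) x" if "x \<in> topspace X" for x k
    unfolding cyclic_shift_power[OF ext[OF that] n] mod_add_right_eq ..
  show ?thesis
    unfolding polygon_H1_def Let_def X_def[symmetric]
  proof (rule module_action_module)
    show "hom_induced 1 X {} X {} (?s ^^ nat g) \<in> hom (homology_group 1 X) (homology_group 1 X)" for g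
      by (rule hom_induced_hom)
    show "hom_induced 1 X {} X {} (?s ^^ nat \<one>\<^bsub>integer_mod_group n\<^esub>) x = x"
      if "x \<in> carrier (homology_group 1 X)" for x
      using hom_induced_id[OF that] by (simp add: id_def)
    show "hom_induced 1 X {} X {} (?s ^^ nat (g \<otimes>\<^bsub>integer_mod_group n\<^esub> h)) x =
       hom_induced 1 X {} X {} (?s ^^ nat g) (hom_induced 1 X {} X {} (?s ^^ nat h) x)"
      if g: "g \<in> carrier (integer_mod_group n)" and h: "h \<in> carrier (integer_mod_group n)" for g h x
    proof -
      have "hom_induced 1 X {} X {} (?s ^^ nat (g \<otimes>\<^bsub>integer_mod_group n\<^esub> h)) = hom_induced 1 X {} X {} (?s ^^ (nat g + nat h))"
      proof (rule hom_induced_eq)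
        fix x assume x: "x \<in> topspace X"
        have "nat (g \<otimes>\<^bsub>integer_mod_group n\<^esub> h) = (nat g + nat h) mod n"
          using g h n by (auto simp: carrier_integer_mod_group nat_mod_distrib nat_add_distrib)
        then show "(?s ^^ nat (g \<otimes>\<^bsub>integer_mod_group n\<^esub> h)) x = (?s ^^ (nat g + nat h)) x"
          using per[OF x, of "nat g + nat h"] by argo
      qed
      also have "\<dots> = hom_induced 1 X {} X {} (?s ^^ nat g) o hom_induced 1 X {} X {} (?s ^^ nat h)"
        unfolding funpow_add by (rule hom_induced_compose_empty[OF cont cont])
      finally show ?thesis by simp
    qed
  qed auto
qed

lemma module_extend_scalars:
  fixes S :: "('s, 'a) ring_scheme" and R :: "('s, 'b) ring_scheme" and M :: "('s, 'x, 'c) module_scheme"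
  assumes S: "cring S" and R: "carrier R \<subseteq> carrier S"
    and M: "\<And>x y. x \<in> carrier M \<Longrightarrow> y \<in> carrier M \<Longrightarrow> x \<oplus>\<^bsub>M\<^esub> y \<in> carrier M"
    and RM: "\<And>r x. r \<in> carrier R \<Longrightarrow> x \<in> carrier M \<Longrightarrow> r \<odot>\<^bsub>M\<^esub> x \<in> carrier M"
  shows "Module.module S (extend_scalars S R M)"
proof -
  interpret S: cring S by fact
  define F where "F = tensor_free S M"
  define T where "T = tensor_kernel S R M"
  define act where "act = (\<lambda>s. frag_extend (\<lambda>(a, x::'x). frag_of (s \<otimes>\<^bsub>S\<^esub> a, x)))"
  interpret F: comm_group F by (simp add: F_def abelian_free_Abelian_group)
  have F: "monoid.mult F = (+)" "\<one>\<^bsub>F\<^esub> = 0" and FC: "carrier F = {c. Poly_Mapping.keys c \<subseteq> carrier S \<times> carrier M}"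
    by (simp_all add: F_def free_Abelian_group_def)
  have finv: "inv\<^bsub>F\<^esub> u = - u" if "u \<in> carrier F" for u
    using that unfolding FC F_def by simp
  have act0: "act s 0 = 0" and actadd: "act s (u + v) = act s u + act s v" and actm: "act s (u - v) = act s u - act s v"
    and actu: "act s (- u) = - act s u" and actof: "act s (frag_of (a,x)) = frag_of (s \<otimes>\<^bsub>S\<^esub> a, x)" for s u v a x
    by (simp_all add: act_def frag_extend_add frag_extend_diff frag_extend_minus)
  have actcl: "act s u \<in> carrier F" if "s \<in> carrier S" "u \<in> carrier F" for s u
    unfolding act_def FC mem_Collect_eq using that by (intro order_trans[OF keys_frag_extend] UN_least) (auto simp: FC)
  have add: "u + v \<in> carrier F" if "u \<in> carrier F" "v \<in> carrier F" for u v
    using F.m_closed[OF that] by (simp add: F)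
  have neg: "- u \<in> carrier F" if "u \<in> carrier F" for u
    using F.inv_closed[OF that] finv[OF that] by simp
  have sub: "u - v \<in> carrier F" if "u \<in> carrier F" "v \<in> carrier F" for u v
    using add[OF that(1) neg[OF that(2)]] by simp
  have of: "frag_of (a,x) \<in> carrier F" if "a \<in> carrier S" "x \<in> carrier M" for a x
    using that by (simp add: FC)
  have relF: "tensor_relations S R M \<subseteq> carrier F"
  proof
    fix v assume "v \<in> tensor_relations S R M"
    then show "v \<in> carrier F" unfolding tensor_relations_def
    proof (elim UnE CollectE exE conjE, goal_cases)
      case (1 a b x) then show ?case by (simp add: sub of)
    next
      case (2 a x y) then show ?case by (simp add: sub of M)
    next
      case (3 a r x)
      moreover have "r \<in> carrier S" using 3 R by blast
      ultimately show ?case by (simp add: sub of RM)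
    qed
  qed
  interpret T: subgroup T F
    unfolding T_def tensor_kernel_def F_def[symmetric] by (rule F.generate_is_subgroup[OF relF])
  have Tadd: "u + v \<in> T" if "u \<in> T" "v \<in> T" for u v using T.m_closed[OF that] by (simp add: F)
  have Tneg: "- u \<in> T" if "u \<in> T" for u using T.m_inv_closed[OF that] finv T.subset that by auto
  have T0: "0 \<in> T" using T.one_closed by (simp add: F)
  have relT: "v \<in> T" if "v \<in> tensor_relations S R M" for v
    unfolding T_def tensor_kernel_def using that by (rule generate.incl)
  have rel1: "frag_of (a \<oplus>\<^bsub>S\<^esub> b, x) - frag_of (a, x) - frag_of (b, x) \<in> tensor_relations S R M"
    if "a \<in> carrier S" "b \<in> carrier S" "x \<in> carrier M" for a b x
    unfolding tensor_relations_def using that by (intro UnI1 CollectI exI conjI) (rule refl | assumption)+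
  have rel2: "frag_of (a, x \<oplus>\<^bsub>M\<^esub> y) - frag_of (a, x) - frag_of (a, y) \<in> tensor_relations S R M"
    if "a \<in> carrier S" "x \<in> carrier M" "y \<in> carrier M" for a x y
    unfolding tensor_relations_def using that by (intro UnI1[OF UnI2] CollectI exI conjI) (rule refl | assumption)+
  have rel3: "frag_of (a \<otimes>\<^bsub>S\<^esub> r, x) - frag_of (a, r \<odot>\<^bsub>M\<^esub> x) \<in> tensor_relations S R M"
    if "a \<in> carrier S" "r \<in> carrier R" "x \<in> carrier M" for a r x
    unfolding tensor_relations_def using that by (intro UnI2 CollectI exI conjI) (rule refl | assumption)+
  have actrel: "act s v \<in> tensor_relations S R M" if s: "s \<in> carrier S" and "v \<in> tensor_relations S R M" for s v
    using that(2)[unfolded tensor_relations_def]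
  proof (elim UnE CollectE exE conjE, goal_cases)
    case (1 a b x)
    then show ?case using rel1[of "s \<otimes>\<^bsub>S\<^esub> a" "s \<otimes>\<^bsub>S\<^esub> b" x] s by (simp add: actm actof S.r_distr)
  next
    case (2 a x y)
    then show ?case using rel2[of "s \<otimes>\<^bsub>S\<^esub> a" x y] s by (simp add: actm actof)
  next
    case (3 a r x)
    moreover have "r \<in> carrier S" using 3 R by blast
    ultimately show ?case using rel3[of "s \<otimes>\<^bsub>S\<^esub> a" r x] s by (simp add: actm actof S.m_assoc)
  qed
  have actT: "act s t \<in> T" if s: "s \<in> carrier S" and "t \<in> T" for s t
    using that(2)[unfolded T_def tensor_kernel_def]
  proof (induction t rule: generate.induct)
    case one then show ?case using T0 by (simp add: act0 F[unfolded F_def])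
  next
    case (incl h) then show ?case using actrel[OF s] relT by blast
  next
    case (inv h)
    then have "inv\<^bsub>tensor_free S M\<^esub> h = - h" using finv[of h] relF by (auto simp: F_def)
    then show ?case using actrel[OF s inv] relT Tneg by (simp add: actu)
  next
    case (eng h1 h2) then show ?case using Tadd by (simp add: F[unfolded F_def] actadd)
  qed
  define cls where "cls u = T #>\<^bsub>F\<^esub> u" for u
  have cls: "cls u = {t + u | t. t \<in> T}" for u by (auto simp: cls_def r_coset_def F)
  have clsmem: "u \<in> cls u" for u unfolding cls using T0 by force
  have clseq: "cls u = cls v" if "u - v \<in> T" for u v
  proof -
    have "t + u = (t + (u - v)) + v" "t + v = (t + - (u - v)) + u" for t by simp_all
    then show ?thesis unfolding cls using Tadd[OF _ that] Tadd[OF _ Tneg[OF that]] by (intro equalityI subsetI; elim CollectE exE conjE) (metis (mono_tags, lifting) CollectI)+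
  qed
  define E where "E = extend_scalars S R M"
  have EC: "carrier E = cls ` carrier F"
    by (simp add: E_def extend_scalars_def carrier_FactGroup flip: F_def T_def cls_def)
  have T_nor: "T \<lhd> F" using F.normal_iff_subgroup T.subgroup_axioms by blast
  have Eadd: "cls u \<oplus>\<^bsub>E\<^esub> cls v = cls (u + v)" if "u \<in> carrier F" "v \<in> carrier F" for u v
    using normal.rcos_sum[OF T_nor that] by (simp add: E_def extend_scalars_def F cls_def flip: F_def T_def)
  have E0: "\<zero>\<^bsub>E\<^esub> = cls 0"
    using F.coset_join2[OF F.one_closed T.subgroup_axioms T.one_closed] by (simp add: E_def extend_scalars_def cls_def F flip: F_def T_def)
  have Esm: "s \<odot>\<^bsub>E\<^esub> cls u = cls (act s u)" if "s \<in> carrier S" "u \<in> carrier F" for s u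
  proof -
    have "s \<odot>\<^bsub>E\<^esub> cls u = T <#>\<^bsub>F\<^esub> (act s ` cls u)"
      by (simp add: E_def extend_scalars_def act_def flip: F_def T_def)
    also have "\<dots> = {t + act s (t' + u) | t t'. t \<in> T \<and> t' \<in> T}"
      unfolding cls set_mult_def F by blast
    also have "\<dots> = cls (act s u)"
    proof -
      have 1: "\<exists>t''. t + act s (t' + u) = t'' + act s u \<and> t'' \<in> T" if "t \<in> T" "t' \<in> T" for t t'
        using Tadd[OF that(1) actT[OF \<open>s \<in> carrier S\<close> that(2)]]
        by (intro exI[of _ "t + act s t'"]) (simp add: actadd add.assoc)
      have 2: "\<exists>t' t''. t + act s u = t' + act s (t'' + u) \<and> t' \<in> T \<and> t'' \<in> T" if "t \<in> T" for t
        using that T0 by (intro exI[of _ t] exI[of _ 0]) simp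
      show ?thesis unfolding cls using 1 2 by (intro equalityI subsetI CollectI; elim CollectE exE conjE) metis+
    qed
    finally show ?thesis .
  qed
  have ind: "P u" if "u \<in> carrier F" and "P 0" and "\<And>a x. a \<in> carrier S \<Longrightarrow> x \<in> carrier M \<Longrightarrow> P (frag_of (a,x))"
    and "\<And>u v. u \<in> carrier F \<Longrightarrow> v \<in> carrier F \<Longrightarrow> P u \<Longrightarrow> P v \<Longrightarrow> P (u - v)" for P u
  proof -
    have "Poly_Mapping.keys u \<subseteq> carrier S \<times> carrier M" using that(1) by (simp add: FC)
    then have "u \<in> carrier F \<and> P u"
    proof (induction u rule: frag_induction)
      case zero show ?case using that(2) F.one_closed by (simp add: F)
    next
      case (one x) then show ?case using that(3) of by (cases x) auto
    next
      case (diff a b) then show ?case using that(4) sub by blast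
    qed
    then show ?thesis by blast
  qed
  have dist: "act (a \<oplus>\<^bsub>S\<^esub> b) u - (act a u + act b u) \<in> T" if a: "a \<in> carrier S" "b \<in> carrier S" and u: "u \<in> carrier F" for a b u
    using u
  proof (induction u rule: ind[consumes 1])
    case 1 show ?case using T0 by (simp add: act0)
  next
    case (2 c x)
    have "frag_of ((a \<otimes>\<^bsub>S\<^esub> c) \<oplus>\<^bsub>S\<^esub> (b \<otimes>\<^bsub>S\<^esub> c), x) - frag_of (a \<otimes>\<^bsub>S\<^esub> c, x) - frag_of (b \<otimes>\<^bsub>S\<^esub> c, x) \<in> tensor_relations S R M"
      using a 2 by (intro rel1) auto
    from relT[OF this] show ?case using a 2 by (simp add: actof S.l_distr diff_diff_eq)
  next
    case (3 u v)
    have "act (a \<oplus>\<^bsub>S\<^esub> b) (u - v) - (act a (u - v) + act b (u - v)) =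
      (act (a \<oplus>\<^bsub>S\<^esub> b) u - (act a u + act b u)) + - (act (a \<oplus>\<^bsub>S\<^esub> b) v - (act a v + act b v))"
      by (simp add: actm)
    then show ?case using Tadd[OF 3(3) Tneg[OF 3(4)]] by simp
  qed
  have asso: "act (a \<otimes>\<^bsub>S\<^esub> b) u = act a (act b u)" if a: "a \<in> carrier S" "b \<in> carrier S" and u: "u \<in> carrier F" for a b u
    using u by (induction u rule: ind[consumes 1]) (simp_all add: act0 actm actof a S.m_assoc)
  have idd: "act \<one>\<^bsub>S\<^esub> u = u" if u: "u \<in> carrier F" for u
    using u by (induction u rule: ind[consumes 1]) (simp_all add: act0 actm actof)
  have o: "0 \<in> carrier F" using F.one_closed by (simp add: F)
  have ab: "abelian_group E"
  proof (rule abelian_groupI, goal_cases)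
    case (1 x y) then show ?case using add by (auto simp: EC Eadd)
  next
    case 2 show ?case using o by (auto simp: EC E0)
  next
    case (3 x y z) then show ?case using add by (auto simp: EC Eadd add.assoc)
  next
    case (4 x y) then show ?case by (auto simp: EC Eadd add.commute)
  next
    case (5 x) then show ?case using o by (auto simp: EC Eadd E0)
  next
    case (6 x)
    then obtain u where "u \<in> carrier F" "x = cls u" by (auto simp: EC)
    then show ?case using neg[of u] by (intro bexI[of _ "cls (- u)"]) (simp_all add: EC Eadd E0)
  qed
  show ?thesis
    unfolding E_def[symmetric]
  proof (rule moduleI[OF S ab], goal_cases)
    case (1 a x) then show ?case using actcl by (auto simp: EC Esm)
  next
    case (2 a b x)
    then obtain u where u: "u \<in> carrier F" "x = cls u" by (auto simp: EC)
    show ?case using 2 u clseq[OF dist[OF 2(1,2) u(1)]] actcl by (simp add: Esm Eadd)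
  next
    case (3 a x y) then show ?case using actcl add by (auto simp: EC Esm Eadd actadd)
  next
    case (4 a b x) then show ?case using actcl by (auto simp: EC Esm asso)
  next
    case (5 x) then show ?case by (auto simp: EC Esm idd)
  qed
qed

end

theory Submission
  imports Defs
begin

text \<open>
  For a proper subset \<open>J\<close> of the vertices, restricting coordinates to \<open>J\<close> and passing to the link of
  the point with all coordinates in \<open>J\<close> equal to 1 sends a class of degree 1 to an integral function
  with sum 0 on the set of arcs of \<open>J\<close>. These functions determine the class: the projections \<open>r\<^sub>i\<close>
  killing a coordinate commute, and if all \<open>r\<^sub>i\<close> with \<open>i \<in> J\<close> annihilate a class carried by small cycles
  near the hyperplanes, then the product of the \<open>1 - r\<^sub>i\<close> both fixes and annihilates it; induct on \<open>J\<close>.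
  They are moreover arbitrary, so \<open>H\<^sub>1\<close> is the direct sum over all \<open>J\<close> of the zero-sum functions on arcs,
  and \<open>\<sigma>\<close> permutes the summands by rotating \<open>J\<close>.

  Every \<open>J\<close> is a rotation of the set of positions of the letter 1 in a power of a unique Lyndon word
  \<open>w\<close> with \<open>|w|\<close> dividing \<open>n\<close>; the stabilizer of that set is generated by \<open>\<sigma>\<^sup>d\<close>, \<open>d = |w|\<close>, and it has
  \<open>\<iota>(w) n/d\<close> arcs. So the summands of an orbit form a module induced from \<open>\<langle>\<sigma>\<^sup>d\<rangle>\<close>. On the zero-sum
  functions \<open>\<sigma>\<^sup>d\<close> acts by permuting arcs in \<open>\<iota>(w)\<close> cycles of length \<open>n/d\<close>, which is the given matrix in
  suitable coordinates.
\<close>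

section \<open>Extension of scalars and group rings\<close>

text \<open>Degree 1 reduces to degree 0 because the positive part of a face contracts to the vertex
  with all coordinates in J equal to 1: the boundary map turns relative classes into zero-sum
  combinations of components of the link, and components are counted by labelling the points of
  0-chains.

  The full vertex set is special: its vertices form one closed chain, so its link is connected and a
  zero-sum function on it vanishes. It matters only for showing that the coefficients determine a
  class. A proper J with a single arc contributes nothing either; this is the origin of the
  condition iota w > 1 for words of length n, while for 1 < d < n there are at least n/d >= 2 arcs.

  Near a hyperplane means a coordinate below 1/2: excision and subdivision want an open condition,
  yet r_i fixes a point only if its coordinate is exactly 0. The map \<open>squash\<close>,
  homotopic to the identity, closes this gap.

  A class built on a face J has unknown coefficients at the proper subsets of J, so realising a
  prescribed function is a triangular elimination.\<close>

theorem extend_scalars_iso: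
  fixes S :: "('s, 'a) ring_scheme" and R :: "('s, 'b) ring_scheme"
    and N :: "('s, 'x, 'c) module_scheme" and M :: "('s, 'y, 'd) module_scheme" and e :: "'k \<Rightarrow> 's"
  assumes M: "Module.module S M" and RS: "carrier R \<subseteq> carrier S"
    and N: "abelian_group N" and Nsm: "\<And>r x. r \<in> carrier R \<Longrightarrow> x \<in> carrier N \<Longrightarrow> r \<odot>\<^bsub>N\<^esub> x \<in> carrier N"
    and f: "\<And>x. x \<in> carrier N \<Longrightarrow> f x \<in> carrier M"
    and fadd: "\<And>x y. x \<in> carrier N \<Longrightarrow> y \<in> carrier N \<Longrightarrow> f (x \<oplus>\<^bsub>N\<^esub> y) = f x \<oplus>\<^bsub>M\<^esub> f y"
    and fsm: "\<And>r x. r \<in> carrier R \<Longrightarrow> x \<in> carrier N \<Longrightarrow> f (r \<odot>\<^bsub>N\<^esub> x) = r \<odot>\<^bsub>M\<^esub> f x"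
    and K: "finite K" and e: "\<And>k. k \<in> K \<Longrightarrow> e k \<in> carrier S"
    and gen: "\<And>a. a \<in> carrier S \<Longrightarrow> \<exists>r\<in>K \<rightarrow> carrier R. a = (\<Oplus>\<^bsub>S\<^esub>k\<in>K. e k \<otimes>\<^bsub>S\<^esub> r k)"
    and surj: "\<And>m. m \<in> carrier M \<Longrightarrow> \<exists>y\<in>K \<rightarrow> carrier N. m = (\<Oplus>\<^bsub>M\<^esub>k\<in>K. e k \<odot>\<^bsub>M\<^esub> f (y k))"
    and inj: "\<And>y. y \<in> K \<rightarrow> carrier N \<Longrightarrow> (\<Oplus>\<^bsub>M\<^esub>k\<in>K. e k \<odot>\<^bsub>M\<^esub> f (y k)) = \<zero>\<^bsub>M\<^esub> \<Longrightarrow> \<forall>k\<in>K. y k = \<zero>\<^bsub>N\<^esub>"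
  shows "module_isomorphic S (extend_scalars S R N) M"
proof -
  interpret M: Module.module S M by (rule M)
  interpret N: abelian_group N by (rule N)
  define F where "F = tensor_free S N"
  define T where "T = tensor_kernel S R N"
  interpret F: comm_group F by (simp add: F_def abelian_free_Abelian_group)
  have Fm: "monoid.mult F = (+)" "\<one>\<^bsub>F\<^esub> = 0" and FC: "carrier F = {c. Poly_Mapping.keys c \<subseteq> carrier S \<times> carrier N}"
    by (simp_all add: F_def free_Abelian_group_def)
  have finv: "inv\<^bsub>F\<^esub> u = - u" if "u \<in> carrier F" for u
    using that unfolding FC F_def by simp
  have add: "u + v \<in> carrier F" if "u \<in> carrier F" "v \<in> carrier F" for u v
    using F.m_closed[OF that] by (simp add: Fm)
  have neg: "- u \<in> carrier F" if "u \<in> carrier F" for u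
    using F.inv_closed[OF that] finv[OF that] by simp
  have sub: "u - v \<in> carrier F" if "u \<in> carrier F" "v \<in> carrier F" for u v
    using add[OF that(1) neg[OF that(2)]] by simp
  have of: "frag_of (a,x) \<in> carrier F" if "a \<in> carrier S" "x \<in> carrier N" for a x
    using that by (simp add: FC)
  have F0: "0 \<in> carrier F" by (simp add: FC)
  have Fsum: "(\<Sum>k\<in>A. g k) \<in> carrier F" if "\<And>k. k \<in> A \<Longrightarrow> g k \<in> carrier F" for A :: "'k set" and g
    using that by (induction A rule: infinite_finite_induct) (auto simp: F0 add)
  have relF: "tensor_relations S R N \<subseteq> carrier F"
  proof
    fix v assume "v \<in> tensor_relations S R N"
    then show "v \<in> carrier F" unfolding tensor_relations_def
    proof (elim UnE CollectE exE conjE, goal_cases)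
      case (1 a b x) then show ?case by (simp add: sub of)
    next
      case (2 a x y) then show ?case by (simp add: sub of)
    next
      case (3 a r x)
      moreover have "r \<in> carrier S" using 3 RS by blast
      ultimately show ?case by (simp add: sub of Nsm)
    qed
  qed
  interpret T: subgroup T F
    unfolding T_def tensor_kernel_def F_def[symmetric] by (rule F.generate_is_subgroup[OF relF])
  have Tadd: "u + v \<in> T" if "u \<in> T" "v \<in> T" for u v using T.m_closed[OF that] by (simp add: Fm)
  have Tneg: "- u \<in> T" if "u \<in> T" for u using T.m_inv_closed[OF that] finv T.subset that by auto
  have Tsub: "u - v \<in> T" if "u \<in> T" "v \<in> T" for u v using Tadd[OF that(1) Tneg[OF that(2)]] by simp
  have T0: "0 \<in> T" using T.one_closed by (simp add: Fm)
  have relT: "v \<in> T" if "v \<in> tensor_relations S R N" for v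
    unfolding T_def tensor_kernel_def using that by (rule generate.incl)
  have rel1: "frag_of (a \<oplus>\<^bsub>S\<^esub> b, x) - frag_of (a, x) - frag_of (b, x) \<in> T"
    if "a \<in> carrier S" "b \<in> carrier S" "x \<in> carrier N" for a b x
    using that unfolding tensor_relations_def by (intro relT[unfolded tensor_relations_def] UnI1 CollectI exI conjI) (rule refl | assumption)+
  have rel2: "frag_of (a, x \<oplus>\<^bsub>N\<^esub> y) - frag_of (a, x) - frag_of (a, y) \<in> T"
    if "a \<in> carrier S" "x \<in> carrier N" "y \<in> carrier N" for a x y
    using that unfolding tensor_relations_def by (intro relT[unfolded tensor_relations_def] UnI1[OF UnI2] CollectI exI conjI) (rule refl | assumption)+
  have rel3: "frag_of (a \<otimes>\<^bsub>S\<^esub> r, x) - frag_of (a, r \<odot>\<^bsub>N\<^esub> x) \<in> T"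
    if "a \<in> carrier S" "r \<in> carrier R" "x \<in> carrier N" for a r x
    using that unfolding tensor_relations_def by (intro relT[unfolded tensor_relations_def] UnI2 CollectI exI conjI) (rule refl | assumption)+
  have zl: "frag_of (\<zero>\<^bsub>S\<^esub>, x) \<in> T" if "x \<in> carrier N" for x
    using Tneg[OF rel1[of "\<zero>\<^bsub>S\<^esub>" "\<zero>\<^bsub>S\<^esub>" x]] that by simp
  have zr: "frag_of (a, \<zero>\<^bsub>N\<^esub>) \<in> T" if "a \<in> carrier S" for a
    using Tneg[OF rel2[of a "\<zero>\<^bsub>N\<^esub>" "\<zero>\<^bsub>N\<^esub>"]] that by simp
  have rel2d: "frag_of (a, x) - frag_of (a, y) - frag_of (a, x \<ominus>\<^bsub>N\<^esub> y) \<in> T"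
    if "a \<in> carrier S" "x \<in> carrier N" "y \<in> carrier N" for a x y
  proof -
    have "(x \<ominus>\<^bsub>N\<^esub> y) \<oplus>\<^bsub>N\<^esub> y = x" using that by (simp add: N.minus_eq N.a_assoc N.l_neg)
    then show ?thesis using rel2[of a "x \<ominus>\<^bsub>N\<^esub> y" y] that by (simp add: algebra_simps)
  qed
  have canc: "(p \<oplus>\<^bsub>M\<^esub> q) \<ominus>\<^bsub>M\<^esub> p \<ominus>\<^bsub>M\<^esub> q = \<zero>\<^bsub>M\<^esub>" if "p \<in> carrier M" "q \<in> carrier M" for p q
  proof -
    have "(p \<oplus>\<^bsub>M\<^esub> q) \<ominus>\<^bsub>M\<^esub> p = q" using that by (simp add: M.minus_eq M.a_comm[of p q] M.a_assoc M.r_neg)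
    then show ?thesis using that by (simp add: M.minus_eq M.r_neg)
  qed
  obtain u where u: "u \<in> hom F (add_monoid M)" "\<And>p. p \<in> carrier S \<times> carrier N \<Longrightarrow> u (frag_of p) = (\<lambda>(a, x). a \<odot>\<^bsub>M\<^esub> f x) p"
    unfolding F_def
    by (rule comm_group.free_Abelian_group_universal[OF M.a_comm_group, of "\<lambda>(a, x). a \<odot>\<^bsub>M\<^esub> f x" "carrier S \<times> carrier N"]) (use f in auto)
  have uc: "u c \<in> carrier M" if "c \<in> carrier F" for c using hom_in_carrier[OF u(1) that] by simp
  have uof: "u (frag_of (a, x)) = a \<odot>\<^bsub>M\<^esub> f x" if "a \<in> carrier S" "x \<in> carrier N" for a x using u(2) that by simp
  have uadd: "u (c + c') = u c \<oplus>\<^bsub>M\<^esub> u c'" if "c \<in> carrier F" "c' \<in> carrier F" for c c'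
    using hom_mult[OF u(1) that] by (simp add: Fm)
  have u0: "u 0 = \<zero>\<^bsub>M\<^esub>" using hom_one[OF u(1) F.is_group M.add.is_group] by (simp add: Fm)
  have umin: "u (c - c') = u c \<ominus>\<^bsub>M\<^esub> u c'" if "c \<in> carrier F" "c' \<in> carrier F" for c c'
  proof -
    have "u (c - c') \<oplus>\<^bsub>M\<^esub> u c' = u c" using uadd[OF sub[OF that] that(2)] by simp
    then show ?thesis using uc sub that by (metis M.add.inv_solve_right' M.minus_eq)
  qed
  have usum: "u (\<Sum>k\<in>A. g k) = (\<Oplus>\<^bsub>M\<^esub>k\<in>A. u (g k))" if "finite A" "\<And>k. k \<in> A \<Longrightarrow> g k \<in> carrier F" for A :: "'k set" and g
    using that
  proof (induction A rule: finite_induct)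
    case (insert k A)
    then show ?case using Fsum[of A g] uc by (simp add: uadd Pi_def)
  qed (simp add: u0)
  have urel: "u h = \<zero>\<^bsub>M\<^esub>" if "h \<in> tensor_relations S R N" for h
    using that unfolding tensor_relations_def
  proof (elim UnE CollectE exE conjE, goal_cases)
    case (1 a b x)
    then show ?case using f canc by (simp add: umin of sub uof M.smult_l_distr)
  next
    case (2 a x y)
    then show ?case using f canc by (simp add: umin of sub uof fadd M.smult_r_distr)
  next
    case (3 a r x)
    moreover have "r \<in> carrier S" using 3 RS by blast
    ultimately show ?case using f by (simp add: umin of sub uof Nsm fsm M.smult_assoc1 M.minus_eq M.r_neg)
  qed
  have uT: "u t = \<zero>\<^bsub>M\<^esub>" if "t \<in> T" for t
    using that unfolding T_def tensor_kernel_def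
  proof (induction t rule: generate.induct)
    case one then show ?case using u0 Fm(2) by (simp add: F_def)
  next
    case (incl h) then show ?case by (rule urel)
  next
    case (inv h)
    then have h: "h \<in> carrier F" using relF by blast
    have "u (- h) = \<zero>\<^bsub>M\<^esub>" using umin[OF F0 h] u0 urel[OF inv] by (simp add: M.minus_eq)
    then show ?case using finv[OF h] by (simp add: F_def)
  next
    case (eng h1 h2)
    have "h1 \<in> carrier F" "h2 \<in> carrier F" using eng(1,2) T.subset unfolding T_def tensor_kernel_def by blast+
    then show ?case using eng uadd by (simp add: F_def)
  qed
  let ?s = "\<lambda>y. \<Sum>k\<in>K. frag_of (e k, y k)"
  have sF: "?s y \<in> carrier F" if "y \<in> K \<rightarrow> carrier N" for y using that e by (intro Fsum of) auto
  have us: "u (?s y) = (\<Oplus>\<^bsub>M\<^esub>k\<in>K. e k \<odot>\<^bsub>M\<^esub> f (y k))" if "y \<in> K \<rightarrow> carrier N" for y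
  proof -
    have "u (?s y) = (\<Oplus>\<^bsub>M\<^esub>k\<in>K. u (frag_of (e k, y k)))" by (rule usum[OF K]) (use that e in \<open>auto intro: of\<close>)
    also have "\<dots> = (\<Oplus>\<^bsub>M\<^esub>k\<in>K. e k \<odot>\<^bsub>M\<^esub> f (y k))" by (rule M.add.finprod_cong') (use that e f in \<open>auto simp: uof Pi_iff\<close>)
    finally show ?thesis .
  qed
  have Tsum: "(\<Sum>k\<in>A. g k) \<in> T" if "\<And>k. k \<in> A \<Longrightarrow> g k \<in> T" for A :: "'k set" and g
    using that by (induction A rule: infinite_finite_induct) (auto simp: T0 Tadd)
  \<comment> \<open>Since the \<open>e k\<close> span S over R, the R-coefficients of a move across
    the tensor sign, and every generator is congruent to a normal form, a sum of terms
    \<open>(e k, y k)\<close>.\<close>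
  have rep1: "\<exists>y\<in>K \<rightarrow> carrier N. frag_of (a, x) - ?s y \<in> T" if a: "a \<in> carrier S" and x: "x \<in> carrier N" for a x
  proof -
    obtain r where r: "r \<in> K \<rightarrow> carrier R" "a = (\<Oplus>\<^bsub>S\<^esub>k\<in>K. e k \<otimes>\<^bsub>S\<^esub> r k)" using gen[OF a] by blast
    have rS: "r k \<in> carrier S" "r k \<in> carrier R" if "k \<in> K" for k using r(1) that RS by blast+
    have "frag_of ((\<Oplus>\<^bsub>S\<^esub>k\<in>A. e k \<otimes>\<^bsub>S\<^esub> r k), x) - (\<Sum>k\<in>A. frag_of (e k \<otimes>\<^bsub>S\<^esub> r k, x)) \<in> T" if "A \<subseteq> K" for A
      using finite_subset[OF that K] that
    proof (induction A rule: finite_induct)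
      case empty then show ?case using zl[OF x] by simp
    next
      case (insert k A)
      have c: "(\<Oplus>\<^bsub>S\<^esub>k\<in>A. e k \<otimes>\<^bsub>S\<^esub> r k) \<in> carrier S" using insert.prems e rS by (intro M.R.finsum_closed) auto
      have "(\<Oplus>\<^bsub>S\<^esub>k\<in>insert k A. e k \<otimes>\<^bsub>S\<^esub> r k) = (e k \<otimes>\<^bsub>S\<^esub> r k) \<oplus>\<^bsub>S\<^esub> (\<Oplus>\<^bsub>S\<^esub>k\<in>A. e k \<otimes>\<^bsub>S\<^esub> r k)"
        using insert e rS by (intro M.R.finsum_insert) auto
      moreover have "e k \<otimes>\<^bsub>S\<^esub> r k \<in> carrier S" using insert.prems e rS by auto
      ultimately show ?case using Tadd[OF rel1[OF _ c x] insert.IH] insert by (simp add: algebra_simps)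
    qed
    from this[of K] have 1: "frag_of (a, x) - (\<Sum>k\<in>K. frag_of (e k \<otimes>\<^bsub>S\<^esub> r k, x)) \<in> T" using r(2) by simp
    have 2: "(\<Sum>k\<in>K. frag_of (e k \<otimes>\<^bsub>S\<^esub> r k, x) - frag_of (e k, r k \<odot>\<^bsub>N\<^esub> x)) \<in> T"
      using rel3 e rS x by (intro Tsum) auto
    show ?thesis
      by (rule bexI[of _ "\<lambda>k. r k \<odot>\<^bsub>N\<^esub> x"]) (use Tadd[OF 1 2] Nsm rS x in \<open>auto simp: sum_subtractf\<close>)
  qed
  have rep: "\<exists>y\<in>K \<rightarrow> carrier N. c - ?s y \<in> T" if "c \<in> carrier F" for c
  proof -
    have "Poly_Mapping.keys c \<subseteq> carrier S \<times> carrier N" using that by (simp add: FC)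
    then show ?thesis
    proof (induction c rule: frag_induction)
      case zero
      have "?s (\<lambda>_. \<zero>\<^bsub>N\<^esub>) \<in> T" using zr e by (intro Tsum) auto
      then show ?case using Tneg by (intro bexI[of _ "\<lambda>_. \<zero>\<^bsub>N\<^esub>"]) auto
    next
      case (one p) then show ?case using rep1 by (cases p) auto
    next
      case (diff c c')
      then obtain y y' where y: "y \<in> K \<rightarrow> carrier N" "c - ?s y \<in> T" and y': "y' \<in> K \<rightarrow> carrier N" "c' - ?s y' \<in> T" by blast
      have "(\<Sum>k\<in>K. frag_of (e k, y k) - frag_of (e k, y' k) - frag_of (e k, y k \<ominus>\<^bsub>N\<^esub> y' k)) \<in> T"
        using rel2d e y y' by (intro Tsum) (auto simp: Pi_iff)
      then have "?s y - ?s y' - ?s (\<lambda>k. y k \<ominus>\<^bsub>N\<^esub> y' k) \<in> T" by (simp add: sum_subtractf)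
      from Tadd[OF Tsub[OF y(2) y'(2)] this]
      show ?case using y y'
        by (intro bexI[of _ "\<lambda>k. y k \<ominus>\<^bsub>N\<^esub> y' k"]) (auto simp: algebra_simps Pi_iff)
    qed
  qed
  \<comment> \<open>A normal form with image 0 has all \<open>y k\<close> equal to 0 by
    \<open>inj\<close>, so \<open>u\<close> kills nothing beyond the tensor relations. Independence
    of the \<open>e k\<close> enters through \<open>inj\<close> alone.\<close>
  have ker: "kernel F (add_monoid M) u = T"
  proof
    show "T \<subseteq> kernel F (add_monoid M) u" using uT T.subset by (auto simp: kernel_def)
    show "kernel F (add_monoid M) u \<subseteq> T"
    proof
      fix c assume "c \<in> kernel F (add_monoid M) u"
      then have c: "c \<in> carrier F" "u c = \<zero>\<^bsub>M\<^esub>" by (auto simp: kernel_def)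
      obtain y where y: "y \<in> K \<rightarrow> carrier N" "c - ?s y \<in> T" using rep[OF c(1)] by blast
      have "u (?s y) = u (c - (c - ?s y))" by simp
      also have "\<dots> = \<zero>\<^bsub>M\<^esub>" using uT[OF y(2)] c T.subset y(2) umin[of c "c - ?s y"] by (simp add: M.minus_eq subset_iff)
      finally have "\<forall>k\<in>K. y k = \<zero>\<^bsub>N\<^esub>" using inj[OF y(1)] us[OF y(1)] by simp
      then have "?s y \<in> T" using zr e by (intro Tsum) auto
      then show "c \<in> T" using Tadd[OF y(2)] by fastforce
    qed
  qed
  interpret u: group_hom F "add_monoid M" u by unfold_locales (rule u(1))
  have img: "u ` carrier F = carrier (add_monoid M)"
  proof
    show "u ` carrier F \<subseteq> carrier (add_monoid M)" using uc by auto
    show "carrier (add_monoid M) \<subseteq> u ` carrier F"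
    proof
      fix m assume "m \<in> carrier (add_monoid M)"
      then obtain y where y: "y \<in> K \<rightarrow> carrier N" "m = (\<Oplus>\<^bsub>M\<^esub>k\<in>K. e k \<odot>\<^bsub>M\<^esub> f (y k))" using surj[of m] by auto
      show "m \<in> u ` carrier F" unfolding y(2) us[OF y(1), symmetric] by (rule imageI[OF sF[OF y(1)]])
    qed
  qed
  let ?E = "extend_scalars S R N"
  let ?g = "\<lambda>X. the_elem (u ` X)"
  have EC: "carrier ?E = carrier (F Mod T)" and Eadd: "add ?E = monoid.mult (F Mod T)"
    by (simp_all add: extend_scalars_def F_def T_def)
  have iso: "?g \<in> iso (add_monoid ?E) (add_monoid M)"
    using u.FactGroup_iso_set[OF img] unfolding ker iso_def hom_def by (simp add: EC Eadd)
  define act where "act = (\<lambda>s. frag_extend (\<lambda>(a, x::'x). frag_of (s \<otimes>\<^bsub>S\<^esub> a, x)))"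
  have actu: "act s c \<in> carrier F \<and> u (act s c) = s \<odot>\<^bsub>M\<^esub> u c" if s: "s \<in> carrier S" and c: "c \<in> carrier F" for s c
  proof -
    have "Poly_Mapping.keys c \<subseteq> carrier S \<times> carrier N" using c by (simp add: FC)
    then have "c \<in> carrier F \<and> act s c \<in> carrier F \<and> u (act s c) = s \<odot>\<^bsub>M\<^esub> u c"
    proof (induction c rule: frag_induction)
      case zero show ?case using s by (simp add: act_def F0 u0)
    next
      case (one p)
      then show ?case using s f by (cases p) (auto simp: act_def of uof M.smult_assoc1)
    next
      case (diff c c')
      have "act s (c - c') = act s c - act s c'" by (simp add: act_def frag_extend_diff)
      moreover have "s \<odot>\<^bsub>M\<^esub> (u c \<ominus>\<^bsub>M\<^esub> u c') = s \<odot>\<^bsub>M\<^esub> u c \<ominus>\<^bsub>M\<^esub> s \<odot>\<^bsub>M\<^esub> u c'"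
        using s uc diff by (simp add: M.minus_eq M.smult_r_distr M.smult_r_minus)
      ultimately show ?case using diff by (simp add: sub umin)
    qed
    then show ?thesis by blast
  qed
  have val: "?g X = v" if "X \<noteq> {}" "\<And>c. c \<in> X \<Longrightarrow> u c = v" for X v
  proof -
    have "u ` X = {v}" using that by auto
    then show ?thesis by simp
  qed
  have lin: "?g (s \<odot>\<^bsub>?E\<^esub> X) = s \<odot>\<^bsub>M\<^esub> ?g X" if s: "s \<in> carrier S" and X: "X \<in> carrier ?E" for s X
  proof -
    have "X \<in> (\<lambda>c. T #>\<^bsub>F\<^esub> c) ` carrier F"
      using X unfolding EC carrier_FactGroup .
    then obtain c where c: "c \<in> carrier F" "X = T #>\<^bsub>F\<^esub> c" by blast
    have Xc: "X = {t + c | t. t \<in> T}" unfolding c(2) r_coset_def Fm by blast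
    have uX: "u x = u c" "x \<in> carrier F" if x: "x \<in> X" for x
    proof -
      obtain t where t: "t \<in> T" "x = t + c" using x Xc by blast
      have tF: "t \<in> carrier F" using T.subset t(1) by (rule subsetD)
      show "x \<in> carrier F" unfolding t(2) by (rule add[OF tF c(1)])
      show "u x = u c" unfolding t(2) uadd[OF tF c(1)] uT[OF t(1)] using uc[OF c(1)] by simp
    qed
    have ne: "X \<noteq> {}" using Xc T0 by blast
    have gX: "?g X = u c" by (rule val[OF ne uX(1)])
    have sX: "s \<odot>\<^bsub>?E\<^esub> X = {t + act s x | t x. t \<in> T \<and> x \<in> X}"
    proof -
      have "s \<odot>\<^bsub>?E\<^esub> X = T <#>\<^bsub>F\<^esub> (act s ` X)" by (simp add: extend_scalars_def act_def F_def T_def)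
      then show ?thesis unfolding set_mult_def Fm by blast
    qed
    have "?g (s \<odot>\<^bsub>?E\<^esub> X) = s \<odot>\<^bsub>M\<^esub> u c"
    proof (rule val)
      show "s \<odot>\<^bsub>?E\<^esub> X \<noteq> {}" unfolding sX using ne T0 by blast
      fix z assume "z \<in> s \<odot>\<^bsub>?E\<^esub> X"
      then obtain t x where tx: "t \<in> T" "x \<in> X" "z = t + act s x" unfolding sX by blast
      have a: "act s x \<in> carrier F" "u (act s x) = s \<odot>\<^bsub>M\<^esub> u c" using actu[OF s uX(2)[OF tx(2)]] uX(1)[OF tx(2)] by auto
      have tF: "t \<in> carrier F" using T.subset tx(1) by (rule subsetD)
      show "u z = s \<odot>\<^bsub>M\<^esub> u c"
        unfolding tx(3) uadd[OF tF a(1)] uT[OF tx(1)] a(2) using s uc[OF c(1)] by simp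
    qed
    then show ?thesis using gX by simp
  qed
  show ?thesis unfolding module_isomorphic_def module_iso_def using iso lin by blast
qed

section \<open>Group rings of cyclic groups and sums of modules\<close>

lemma group_ring_simps:
  "carrier (group_ring G) = {r. Poly_Mapping.keys r \<subseteq> carrier G}" "add (group_ring G) = (+)" "zero (group_ring G) = 0"
  "one (group_ring G) = frag_of \<one>\<^bsub>G\<^esub>"
  "r \<otimes>\<^bsub>group_ring G\<^esub> s = frag_extend (\<lambda>g. frag_extend (\<lambda>h. frag_of (g \<otimes>\<^bsub>G\<^esub> h)) s) r"
  by (simp_all add: group_ring_def)

lemma group_ring_finsum:
  assumes "comm_group G" "finite A" "\<And>k. k \<in> A \<Longrightarrow> g k \<in> carrier (group_ring G)"
  shows "(\<Oplus>\<^bsub>group_ring G\<^esub>k\<in>A. g k) = (\<Sum>k\<in>A. g k)"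
proof -
  interpret cring "group_ring G" by (rule cring_group_ring[OF assms(1)])
  show ?thesis
    using assms(2,3)
  proof (induction A rule: finite_induct)
    case empty
    show ?case by (simp add: group_ring_simps(3))
  next
    case (insert k A)
    then have "(\<Oplus>\<^bsub>group_ring G\<^esub>k\<in>insert k A. g k) = g k \<oplus>\<^bsub>group_ring G\<^esub> (\<Oplus>\<^bsub>group_ring G\<^esub>k\<in>A. g k)"
      by (intro finsum_insert) auto
    then show ?case using insert by (simp add: group_ring_simps(2))
  qed
qed

lemma module_isomorphic_sym:
  assumes "module_isomorphic R M N" and M: "Module.module R M" and N: "Module.module R N"
  shows "module_isomorphic R N M"
proof -
  interpret M: Module.module R M by (rule M)
  interpret N: Module.module R N by (rule N)
  obtain f where f: "f \<in> iso (add_monoid M) (add_monoid N)"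
    and lin: "\<And>r x. r \<in> carrier R \<Longrightarrow> x \<in> carrier M \<Longrightarrow> f (r \<odot>\<^bsub>M\<^esub> x) = r \<odot>\<^bsub>N\<^esub> f x"
    using assms(1) unfolding module_isomorphic_def module_iso_def by blast
  let ?g = "inv_into (carrier M) f"
  have bij: "bij_betw f (carrier M) (carrier N)" using f by (simp add: iso_def)
  have "?g \<in> iso (add_monoid N) (add_monoid M)" using M.add.iso_set_sym[OF f] by simp
  moreover have "?g (r \<odot>\<^bsub>N\<^esub> y) = r \<odot>\<^bsub>M\<^esub> ?g y" if r: "r \<in> carrier R" and y: "y \<in> carrier N" for r y
  proof -
    have gy: "?g y \<in> carrier M" "f (?g y) = y"
      using bij y by (auto simp: bij_betw_def intro: inv_into_into f_inv_into_f)
    have "r \<odot>\<^bsub>N\<^esub> y = f (r \<odot>\<^bsub>M\<^esub> ?g y)" using lin[OF r gy(1)] gy(2) by simp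
    then show ?thesis using bij r gy(1) by (simp add: bij_betw_def inv_into_f_f)
  qed
  ultimately show ?thesis unfolding module_isomorphic_def module_iso_def by blast
qed

lemma carrier_sigma_subgroup:
  assumes n: "n \<ge> 2" and d: "d dvd n"
  shows "carrier (sigma_subgroup n d) = {g. 0 \<le> g \<and> g < int n \<and> int d dvd g}"
proof -
  interpret G: group "integer_mod_group n" by simp
  have s: "sigma_pow n d = int d mod int n" unfolding sigma_pow_def using n by simp
  have "int d mod int n \<in> carrier (integer_mod_group n)" using n by (simp add: carrier_integer_mod_group)
  then have "carrier (sigma_subgroup n d) = range (\<lambda>k::int. (int d mod int n) [^]\<^bsub>integer_mod_group n\<^esub> k)"
    unfolding sigma_subgroup_def s by (rule G.carrier_subgroup_generated_by_singleton)
  also have "\<dots> = range (\<lambda>k::int. (k * int d) mod int n)"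
    by (simp add: int_pow_integer_mod_group mod_mult_right_eq)
  also have "\<dots> = {g. 0 \<le> g \<and> g < int n \<and> int d dvd g}"
  proof
    show "range (\<lambda>k::int. (k * int d) mod int n) \<subseteq> {g. 0 \<le> g \<and> g < int n \<and> int d dvd g}"
      using n d by (auto simp: dvd_mod)
    show "{g. 0 \<le> g \<and> g < int n \<and> int d dvd g} \<subseteq> range (\<lambda>k::int. (k * int d) mod int n)"
    proof
      fix g assume g: "g \<in> {g. 0 \<le> g \<and> g < int n \<and> int d dvd g}"
      then obtain k where "g = int d * k" by (auto elim: dvdE)
      then have "g = (k * int d) mod int n" using g by (simp add: mult.commute)
      then show "g \<in> range (\<lambda>k::int. (k * int d) mod int n)" by (rule range_eqI)
    qed
  qed
  finally show ?thesis .
qed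

lemma group_ring_sigma_subset:
  assumes "n \<ge> 2" "d dvd n"
  shows "carrier (group_ring (sigma_subgroup n d)) \<subseteq> carrier (group_ring (integer_mod_group n))"
  using carrier_sigma_subgroup[OF assms] assms(1) by (auto simp: group_ring_simps carrier_integer_mod_group)

text \<open>Division with remainder: 0, ..., d - 1 represent the cosets of the subgroup generated by
  sigma^d, and group elements span the group ring.\<close>

lemma group_ring_generated:
  assumes n: "n \<ge> 2" and d: "d dvd n" and a: "a \<in> carrier (group_ring (integer_mod_group n))"
  shows "\<exists>r\<in>{..<d} \<rightarrow> carrier (group_ring (sigma_subgroup n d)).
    a = (\<Oplus>\<^bsub>group_ring (integer_mod_group n)\<^esub>k\<in>{..<d}. frag_of (int k) \<otimes>\<^bsub>group_ring (integer_mod_group n)\<^esub> r k)"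
proof -
  let ?S = "group_ring (integer_mod_group n)" and ?R = "group_ring (sigma_subgroup n d)"
  have d0: "0 < d" using d n by (cases "d = 0") auto
  have dn: "d \<le> n" using d n by (intro dvd_imp_le) auto
  interpret S: cring ?S by (rule cring_group_ring) simp
  have k: "frag_of (int k) \<in> carrier ?S" if "k < d" for k
    using that dn n by (simp add: group_ring_simps carrier_integer_mod_group)
  have sum: "(\<Oplus>\<^bsub>?S\<^esub>k\<in>{..<d}. frag_of (int k) \<otimes>\<^bsub>?S\<^esub> r k) = (\<Sum>k<d. frag_of (int k) \<otimes>\<^bsub>?S\<^esub> r k)"
    if r: "r \<in> {..<d} \<rightarrow> carrier ?R" for r
    by (rule group_ring_finsum) (use k r group_ring_sigma_subset[OF n d] in \<open>auto intro!: S.m_closed simp: Pi_iff subset_iff\<close>)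
  have "Poly_Mapping.keys a \<subseteq> carrier (integer_mod_group n)" using a by (simp add: group_ring_simps)
  then have "\<exists>r\<in>{..<d} \<rightarrow> carrier ?R. a = (\<Sum>k<d. frag_of (int k) \<otimes>\<^bsub>?S\<^esub> r k)"
  proof (induction a rule: frag_induction)
    case zero
    show ?case by (rule bexI[of _ "\<lambda>_. 0"]) (simp_all add: group_ring_simps(1,5))
  next
    case (one g)
    then have g: "0 \<le> g" "g < int n" using n by (auto simp: carrier_integer_mod_group)
    define k0 where "k0 = nat (g mod int d)"
    have k0: "k0 < d" "int k0 = g mod int d" using d0 by (auto simp: k0_def nat_less_iff)
    let ?r = "\<lambda>k. if k = k0 then frag_of (g - int k0) else 0"
    \<comment> \<open>The remainder does not exceed g, so the difference is already a reduced
      residue modulo n.\<close>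
    have ge: "g mod int d \<le> g" using g d0 by (simp add: zmod_le_nonneg_dividend)
    have "int d dvd g - g mod int d" by (simp add: minus_mod_eq_mult_div)
    then have "g - int k0 \<in> carrier (sigma_subgroup n d)"
      unfolding carrier_sigma_subgroup[OF n d] using g k0 ge by simp
    then have r: "?r \<in> {..<d} \<rightarrow> carrier ?R" by (simp add: group_ring_simps)
    have "(\<Sum>k<d. frag_of (int k) \<otimes>\<^bsub>?S\<^esub> ?r k) = (\<Sum>k<d. if k = k0 then frag_of g else 0)"
      by (rule sum.cong) (use g in \<open>auto simp: group_ring_simps\<close>)
    also have "\<dots> = frag_of g" using k0(1) by (simp add: sum.delta)
    finally show ?case by (intro bexI[OF _ r]) (rule sym)
  next
    case (diff a b)
    then obtain r r' where r: "r \<in> {..<d} \<rightarrow> carrier ?R" "a = (\<Sum>k<d. frag_of (int k) \<otimes>\<^bsub>?S\<^esub> r k)"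
      and r': "r' \<in> {..<d} \<rightarrow> carrier ?R" "b = (\<Sum>k<d. frag_of (int k) \<otimes>\<^bsub>?S\<^esub> r' k)" by blast
    have "(\<lambda>k. r k - r' k) \<in> {..<d} \<rightarrow> carrier ?R"
    proof
      fix k assume "k \<in> {..<d}"
      then have "Poly_Mapping.keys (r k) \<subseteq> carrier (sigma_subgroup n d)" "Poly_Mapping.keys (r' k) \<subseteq> carrier (sigma_subgroup n d)"
        using r(1) r'(1) by (auto simp: group_ring_simps Pi_iff)
      then show "r k - r' k \<in> carrier ?R" using keys_diff[of "r k" "r' k"] by (auto simp: group_ring_simps)
    qed
    moreover have "a - b = (\<Sum>k<d. frag_of (int k) \<otimes>\<^bsub>?S\<^esub> (r k - r' k))"
      unfolding r(2) r'(2) by (simp add: group_ring_simps frag_extend_diff sum_subtractf)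
    ultimately show ?case by (intro bexI[of _ "\<lambda>k. r k - r' k"])
  qed
  then obtain r where r: "r \<in> {..<d} \<rightarrow> carrier ?R" "a = (\<Sum>k<d. frag_of (int k) \<otimes>\<^bsub>?S\<^esub> r k)" by blast
  show ?thesis by (rule bexI[OF _ r(1)]) (simp only: sum[OF r(1)] r(2)[symmetric])
qed

text \<open>Equivariant projections that are jointly bijective identify H with a product, and over a
  finite index set the direct sum is the whole product.\<close>

lemma direct_sum_isomorphic:
  assumes I: "finite I"
    and p: "\<And>i x. i \<in> I \<Longrightarrow> x \<in> carrier H \<Longrightarrow> p i x \<in> carrier (E i)"
    and padd: "\<And>i x y. i \<in> I \<Longrightarrow> x \<in> carrier H \<Longrightarrow> y \<in> carrier H \<Longrightarrow> p i (x \<oplus>\<^bsub>H\<^esub> y) = p i x \<oplus>\<^bsub>E i\<^esub> p i y"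
    and plin: "\<And>i r x. i \<in> I \<Longrightarrow> r \<in> carrier R \<Longrightarrow> x \<in> carrier H \<Longrightarrow> p i (r \<odot>\<^bsub>H\<^esub> x) = r \<odot>\<^bsub>E i\<^esub> p i x"
    and inj: "\<And>x y. x \<in> carrier H \<Longrightarrow> y \<in> carrier H \<Longrightarrow> (\<And>i. i \<in> I \<Longrightarrow> p i x = p i y) \<Longrightarrow> x = y"
    and surj: "\<And>f. f \<in> (\<Pi> i\<in>I. carrier (E i)) \<Longrightarrow> \<exists>x\<in>carrier H. \<forall>i\<in>I. p i x = f i"
    and iso: "\<And>i. i \<in> I \<Longrightarrow> module_isomorphic R (E i) (M i)"
  shows "module_isomorphic R H (direct_sum_module I M)"
proof -
  have "\<exists>g. \<forall>i\<in>I. g i \<in> module_iso R (E i) (M i)"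
    by (rule bchoice, rule ballI) (use iso in \<open>auto simp: module_isomorphic_def\<close>)
  then obtain g where g: "\<forall>i\<in>I. g i \<in> module_iso R (E i) (M i)" by (rule exE)
  have gh: "g i (x \<oplus>\<^bsub>E i\<^esub> y) = g i x \<oplus>\<^bsub>M i\<^esub> g i y" if "i \<in> I" "x \<in> carrier (E i)" "y \<in> carrier (E i)" for i x y
    using g that by (auto simp: module_iso_def iso_def hom_def)
  have gl: "g i (r \<odot>\<^bsub>E i\<^esub> x) = r \<odot>\<^bsub>M i\<^esub> g i x" if "i \<in> I" "r \<in> carrier R" "x \<in> carrier (E i)" for i r x
    using g that by (auto simp: module_iso_def)
  have gb: "bij_betw (g i) (carrier (E i)) (carrier (M i))" if "i \<in> I" for i
    using g that by (auto simp: module_iso_def iso_def)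
  let ?F = "\<lambda>x. \<lambda>i\<in>I. g i (p i x)"
  have D: "carrier (direct_sum_module I M) = (\<Pi>\<^sub>E i\<in>I. carrier (M i))"
    using I by (simp add: direct_sum_module_def)
  have cl: "?F x \<in> carrier (direct_sum_module I M)" if "x \<in> carrier H" for x
    unfolding D using bij_betwE[OF gb] p that by auto
  have "bij_betw ?F (carrier H) (carrier (direct_sum_module I M))"
    unfolding bij_betw_def
  proof (intro conjI)
    show "inj_on ?F (carrier H)"
    proof (rule inj_onI)
      fix x y assume xy: "x \<in> carrier H" "y \<in> carrier H" "?F x = ?F y"
      show "x = y"
      proof (rule inj[OF xy(1,2)])
        fix i assume i: "i \<in> I"
        then have "g i (p i x) = g i (p i y)" using fun_cong[OF xy(3), of i] by simp
        then show "p i x = p i y" using gb[OF i] p[OF i] xy(1,2) by (auto simp: bij_betw_def dest: inj_onD)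
      qed
    qed
    show "?F ` carrier H = carrier (direct_sum_module I M)"
    proof
      show "?F ` carrier H \<subseteq> carrier (direct_sum_module I M)" using cl by blast
      show "carrier (direct_sum_module I M) \<subseteq> ?F ` carrier H"
      proof
        fix f assume f: "f \<in> carrier (direct_sum_module I M)"
        have fi: "f i \<in> carrier (M i)" if "i \<in> I" for i using f that unfolding D by blast
        let ?h = "\<lambda>i. inv_into (carrier (E i)) (g i) (f i)"
        have h: "?h i \<in> carrier (E i)" "g i (?h i) = f i" if "i \<in> I" for i
          using gb[OF that] fi[OF that] by (auto simp: bij_betw_def intro: inv_into_into f_inv_into_f)
        have "\<exists>x\<in>carrier H. \<forall>i\<in>I. p i x = ?h i" by (rule surj) (use h(1) in blast)
        then obtain x where x: "x \<in> carrier H" "\<forall>i\<in>I. p i x = ?h i" by blast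
        have "?F x = f"
        proof (rule extensionalityI[where A = I])
          show "f \<in> extensional I" using f unfolding D by (simp add: PiE_def)
          fix i assume "i \<in> I"
          then show "?F x i = f i" using x(2) h(2) by simp
        qed simp
        then show "f \<in> ?F ` carrier H" using x(1) by blast
      qed
    qed
  qed
  moreover have "?F (x \<oplus>\<^bsub>H\<^esub> y) = ?F x \<oplus>\<^bsub>direct_sum_module I M\<^esub> ?F y" if "x \<in> carrier H" "y \<in> carrier H" for x y
    using that padd p gh by (auto simp: direct_sum_module_def intro!: restrict_ext)
  moreover have "?F (r \<odot>\<^bsub>H\<^esub> x) = r \<odot>\<^bsub>direct_sum_module I M\<^esub> ?F x" if "r \<in> carrier R" "x \<in> carrier H" for r x
    using that plin p gl by (auto simp: direct_sum_module_def intro!: restrict_ext)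
  ultimately have "?F \<in> module_iso R H (direct_sum_module I M)"
    using cl by (simp add: module_iso_def iso_def hom_def)
  then show ?thesis unfolding module_isomorphic_def by blast
qed

section \<open>Faces of the polygon complex\<close>

definition cyc_succ :: "nat \<Rightarrow> nat \<Rightarrow> nat" where
  "cyc_succ n i = i mod n + 1"

abbreviation polygon_space :: "nat \<Rightarrow> (nat \<Rightarrow> real) topology" where
  "polygon_space n \<equiv> real_moment_angle_complex n (polygon_boundary n)"

text \<open>Faces smaller than an edge add no points, so the union over faces becomes a pointwise
  condition: some edge exists outside which all coordinates are 0 or 1.\<close>

lemma topspace_polygon_space_iff:
  "x \<in> topspace (polygon_space n) \<longleftrightarrow>
     x \<in> extensional {1..n} \<and> (\<forall>i\<in>{1..n}. 0 \<le> x i \<and> x i \<le> 1) \<and>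
     (\<exists>j\<in>{1..n}. \<forall>i\<in>{1..n}. x i = 0 \<or> x i = 1 \<or> i = j \<or> i = cyc_succ n j)"
  (is "?l \<longleftrightarrow> ?r")
proof
  assume ?l
  then obtain j t where j: "j \<in> {1..n}" "t \<subseteq> {j, cyc_succ n j}"
    and x: "x \<in> (\<Pi>\<^sub>E i\<in>{1..n}. if i \<in> t then {0..1} else {0, 1})"
    by (auto simp: topspace_real_moment_angle_complex real_moment_angle_set_def polygon_boundary_def cyc_succ_def)
  have "x i \<in> (if i \<in> t then {0..1} else {0, 1})" if "i \<in> {1..n}" for i using x that by blast
  then have "0 \<le> x i \<and> x i \<le> 1 \<and> (x i = 0 \<or> x i = 1 \<or> i \<in> t)" if "i \<in> {1..n}" for i
    using that by (smt (verit) atLeastAtMost_iff insertE singletonD)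
  then have "\<forall>i\<in>{1..n}. 0 \<le> x i \<and> x i \<le> 1" "\<forall>i\<in>{1..n}. x i = 0 \<or> x i = 1 \<or> i = j \<or> i = cyc_succ n j"
    using j(2) by blast+
  moreover have "x \<in> extensional {1..n}" using x by (simp add: PiE_def)
  ultimately show ?r using j(1) by blast
next
  assume r: ?r
  then obtain j where j: "j \<in> {1..n}" "\<forall>i\<in>{1..n}. x i = 0 \<or> x i = 1 \<or> i = j \<or> i = cyc_succ n j" by blast
  have "x \<in> (\<Pi>\<^sub>E i\<in>{1..n}. if i \<in> {j, cyc_succ n j} then {0..1} else {0, 1})"
    using r j(2) by (auto simp: PiE_iff)
  then show ?l using j(1) unfolding topspace_real_moment_angle_complex real_moment_angle_set_def polygon_boundary_def cyc_succ_def[symmetric]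
    by (intro UN_I[of "{j, cyc_succ n j}"]) auto
qed

text \<open>An edge that serves for x also serves for y. This covers every map acting coordinatewise
  on [0, 1] and preserving {0, 1}.\<close>

lemma topspace_polygon_spaceI:
  assumes "x \<in> topspace (polygon_space n)" "y \<in> extensional {1..n}"
    and "\<And>i. i \<in> {1..n} \<Longrightarrow> 0 \<le> y i \<and> y i \<le> 1"
    and "\<And>i. i \<in> {1..n} \<Longrightarrow> x i = 0 \<or> x i = 1 \<Longrightarrow> y i = 0 \<or> y i = 1"
  shows "y \<in> topspace (polygon_space n)"
proof -
  obtain j where j: "j \<in> {1..n}" "\<forall>i\<in>{1..n}. x i = 0 \<or> x i = 1 \<or> i = j \<or> i = cyc_succ n j"
    using assms(1) unfolding topspace_polygon_space_iff by blast
  have "\<forall>i\<in>{1..n}. y i = 0 \<or> y i = 1 \<or> i = j \<or> i = cyc_succ n j" using j(2) assms(4) by blast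
  then show ?thesis unfolding topspace_polygon_space_iff using assms j(1) by blast
qed

lemma continuous_map_polygon_space_iff:
  "continuous_map Y (polygon_space n) f \<longleftrightarrow>
     f \<in> topspace Y \<rightarrow> topspace (polygon_space n) \<and> (\<forall>i\<in>{1..n}. continuous_map Y euclideanreal (\<lambda>y. f y i))"
  (is "?l \<longleftrightarrow> ?r")
proof
  assume l: ?l
  have "continuous_map Y (product_topology (\<lambda>_. top_of_set {0..1}) {1..n}) f"
    using l by (simp add: real_moment_angle_complex_def continuous_map_in_subtopology)
  then show ?r using l continuous_map_funspace[OF l]
    by (auto simp: continuous_map_componentwise continuous_map_in_subtopology)
next
  assume r: ?r
  have "f y \<in> extensional {1..n} \<and> (\<forall>i\<in>{1..n}. f y i \<in> {0..1})" if "y \<in> topspace Y" for y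
    using r that unfolding Pi_iff topspace_polygon_space_iff by auto
  then have "continuous_map Y (product_topology (\<lambda>_. top_of_set {0..1}) {1..n}) f"
    using r by (auto simp: continuous_map_componentwise continuous_map_in_subtopology)
  moreover have "f \<in> topspace Y \<rightarrow> real_moment_angle_set n (polygon_boundary n)"
    using r by (simp add: topspace_real_moment_angle_complex)
  ultimately show ?l
    unfolding real_moment_angle_complex_def continuous_map_in_subtopology by blast
qed

lemma continuous_map_polygon_coordinate:
  "i \<in> {1..n} \<Longrightarrow> continuous_map (polygon_space n) euclideanreal (\<lambda>x. x i)"
  using continuous_map_polygon_space_iff[of "polygon_space n" n "\<lambda>x. x"] by auto

text \<open>Dropped coordinates become 0 instead of disappearing, so these are commuting self-maps
  of the space; dropping a single i gives the projection r_i.\<close>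

definition coord_restrict :: "nat \<Rightarrow> nat set \<Rightarrow> (nat \<Rightarrow> real) \<Rightarrow> nat \<Rightarrow> real" where
  "coord_restrict n J x = (\<lambda>i\<in>{1..n}. if i \<in> J then x i else 0)"

lemma coord_restrict_compose: "coord_restrict n I (coord_restrict n J x) = coord_restrict n (I \<inter> J) x"
  by (auto simp: coord_restrict_def)

lemma coord_restrict_id: "x \<in> topspace (polygon_space n) \<Longrightarrow> (\<And>i. i \<in> {1..n} \<Longrightarrow> i \<notin> J \<Longrightarrow> x i = 0) \<Longrightarrow> coord_restrict n J x = x"
  by (rule extensionalityI[of _ "{1..n}"]) (auto simp: coord_restrict_def topspace_polygon_space_iff)

lemma coord_restrict_in_space: "x \<in> topspace (polygon_space n) \<Longrightarrow> coord_restrict n J x \<in> topspace (polygon_space n)"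
  by (rule topspace_polygon_spaceI, assumption) (auto simp: coord_restrict_def topspace_polygon_space_iff)

lemma continuous_map_coord_restrict: "continuous_map (polygon_space n) (polygon_space n) (coord_restrict n J)"
  unfolding continuous_map_polygon_space_iff
proof (intro conjI ballI)
  fix i assume "i \<in> {1..n}"
  then show "continuous_map (polygon_space n) euclideanreal (\<lambda>y. coord_restrict n J y i)"
    using continuous_map_polygon_coordinate by (cases "i \<in> J") (simp_all add: coord_restrict_def)
qed (simp add: coord_restrict_in_space)

definition face_space :: "nat \<Rightarrow> nat set \<Rightarrow> (nat \<Rightarrow> real) topology" where
  "face_space n J = subtopology (polygon_space n) {x. \<forall>i\<in>{1..n} - J. x i = 0}"

lemma topspace_face_space: "topspace (face_space n J) = {x \<in> topspace (polygon_space n). \<forall>i\<in>{1..n} - J. x i = 0}"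
  by (auto simp: face_space_def)

lemma continuous_map_face_coordinate:
  "i \<in> {1..n} \<Longrightarrow> continuous_map (face_space n J) euclideanreal (\<lambda>x. x i)"
  unfolding face_space_def by (intro continuous_map_from_subtopology continuous_map_polygon_coordinate)

lemma continuous_map_coord_restrict_face: "continuous_map (polygon_space n) (face_space n J) (coord_restrict n J)"
  unfolding face_space_def continuous_map_in_subtopology using continuous_map_coord_restrict
  by (auto simp: coord_restrict_def)

lemma openin_face_less: "i \<in> {1..n} \<Longrightarrow> openin (face_space n J) {x \<in> topspace (face_space n J). x i < c}"
  using openin_continuous_map_preimage[OF continuous_map_face_coordinate[of i n J], of "{..<c}"] by simp

text \<open>The strict bound makes this an open condition on a face. The value 1/2 is matched by
  \<open>squash\<close>, which sends coordinates up to 1/2 to 0.\<close>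

definition near_zero :: "nat set \<Rightarrow> (nat \<Rightarrow> real) set" where
  "near_zero J = {x. \<exists>i\<in>J. x i < 1/2}"

definition some_zero :: "nat set \<Rightarrow> (nat \<Rightarrow> real) set" where
  "some_zero J = {x. \<exists>i\<in>J. x i = 0}"

definition squash :: "nat \<Rightarrow> (nat \<Rightarrow> real) \<Rightarrow> nat \<Rightarrow> real" where
  "squash n x = (\<lambda>i\<in>{1..n}. max 0 (2 * x i - 1))"

lemma squash_homotopic_id: "homotopic_with (\<lambda>h. True) (polygon_space n) (polygon_space n) id (squash n)"
proof -
  let ?X = "polygon_space n"
  \<comment> \<open>At every time the map fixes the values 0 and 1 and keeps [0, 1], hence preserves
    the complex; time 1 gives \<open>2 * x i - 1\<close> cut off at 0.\<close>
  let ?h = "\<lambda>(t::real, x). (\<lambda>i\<in>{1..n}. max 0 ((1 + t) * x i - t))"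
  have b: "(1 + t) * c - t \<le> 1" if "0 \<le> t" "c \<le> 1" for t c :: real
    using mult_left_mono[of c 1 "1 + t"] that by (simp add: algebra_simps)
  have "continuous_map (prod_topology (top_of_set {0..1}) ?X) ?X ?h"
    unfolding continuous_map_polygon_space_iff
  proof (intro conjI ballI)
    show "?h \<in> topspace (prod_topology (top_of_set {0..1}) ?X) \<rightarrow> topspace ?X"
    proof (clarsimp)
      fix t :: real and x assume t: "0 \<le> t" "t \<le> 1" and x: "x \<in> topspace ?X"
      show "(\<lambda>i\<in>{Suc 0..n}. max 0 ((1 + t) * x i - t)) \<in> topspace ?X"
        by (rule topspace_polygon_spaceI[OF x]) (use x t b[OF t(1)] in \<open>auto simp: topspace_polygon_space_iff\<close>)
    qed
    fix i assume i: "i \<in> {1..n}"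
    have 1: "continuous_map (prod_topology (top_of_set {0..1::real}) ?X) euclideanreal (\<lambda>z. snd z i)"
      using continuous_map_compose[OF continuous_map_snd continuous_map_polygon_coordinate[OF i]] by (simp add: o_def)
    have 2: "continuous_map (prod_topology (top_of_set {0..1::real}) ?X) euclideanreal fst"
      using continuous_map_fst[of "top_of_set {0..1::real}" ?X] by (simp add: continuous_map_in_subtopology)
    have "continuous_map (prod_topology (top_of_set {0..1::real}) ?X) euclideanreal (\<lambda>z. max 0 ((1 + fst z) * snd z i - fst z))"
      by (intro continuous_map_real_max continuous_map_real_mult continuous_map_diff continuous_map_add 1 2 continuous_map_const[THEN iffD2]) auto
    then show "continuous_map (prod_topology (top_of_set {0..1::real}) ?X) euclideanreal (\<lambda>y. ?h y i)"
      using i by (simp add: case_prod_unfold)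
  qed
  then show ?thesis
    by (subst homotopic_with, simp, intro exI[of _ "?h"] conjI)
       (auto simp: topspace_polygon_space_iff squash_def extensional_def fun_eq_iff)
qed

section \<open>Classes in degree zero and small cycles\<close>

lemma homologous_rel_set_mult:
  assumes "singular_relcycle p X S c" "singular_relcycle p X S d"
  shows "homologous_rel_set p X S c \<otimes>\<^bsub>relative_homology_group (int p) X S\<^esub> homologous_rel_set p X S d
    = homologous_rel_set p X S (c + d)"
  using normal.rcos_sum[OF normal_subgroup_singular_relboundary_relcycle, of c p X S d] assms
  by (simp add: nontrivial_relative_homology_group right_coset_singular_relboundary)

lemma homologous_rel_set_eq_one_iff:
  "homologous_rel_set p X S c = \<one>\<^bsub>relative_homology_group (int p) X S\<^esub> \<longleftrightarrow> singular_relboundary p X S c"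
  by (simp add: homologous_rel_set_eq_relboundary)

abbreviation vertex0 :: "nat \<Rightarrow> real" where
  "vertex0 \<equiv> (\<lambda>j. if j = 0 then 1 else 0)"

lemma vertex0_in: "vertex0 \<in> standard_simplex p"
  by (rule basis_in_standard_simplex[THEN iffD2]) simp

definition label_chain :: "('a \<Rightarrow> 'b) \<Rightarrow> 'a chain \<Rightarrow> 'b \<Rightarrow>\<^sub>0 int" where
  "label_chain a = frag_extend (\<lambda>f. frag_of (a (f vertex0)))"

lemma label_chain_simps [simp]:
  "label_chain a 0 = 0" "label_chain a (frag_of f) = frag_of (a (f vertex0))"
  "label_chain a (c + d) = label_chain a c + label_chain a d"
  "label_chain a (c - d) = label_chain a c - label_chain a d"
  "label_chain a (- c) = - label_chain a c"
  by (simp_all add: label_chain_def frag_extend_add frag_extend_diff frag_extend_minus)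

lemma label_chain_relabel:
  "label_chain (h \<circ> a) c = frag_extend (\<lambda>b. frag_of (h b)) (label_chain a c)"
  by (simp add: label_chain_def frag_extend_compose2)

text \<open>A 1-simplex is connected, so a continuous label with discrete values is constant along
  it and its two end points cancel.\<close>

lemma label_chain_boundary:
  assumes a: "continuous_map Y (discrete_topology U) a" and d: "singular_chain (Suc 0) Y d"
  shows "label_chain a (chain_boundary (Suc 0) d) = 0"
  using d unfolding singular_chain_def
proof (induction d rule: frag_induction)
  case (one g)
  then have g: "continuous_map (subtopology (powertop_real UNIV) (standard_simplex (Suc 0))) Y g"
    by (simp add: singular_simplex_def)
  let ?S = "standard_simplex (Suc 0)"
  have "connectedin (discrete_topology U) ((a \<circ> g) ` ?S)"
    by (rule connectedin_continuous_map_image[OF continuous_map_compose[OF g a]])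
       (simp add: connectedin_standard_simplex connectedin_subtopology)
  then obtain b where b: "\<And>p. p \<in> ?S \<Longrightarrow> a (g p) = b"
    unfolding connectedin_discrete_topology by fastforce
  have "a (singular_face (Suc 0) k g vertex0) = b" if "k \<le> 1" for k
    using that simplical_face_in_standard_simplex[of "Suc 0" k vertex0] vertex0_in[of 0]
    by (simp add: singular_face_def b)
  then show ?case by (simp add: chain_boundary_of)
next
  case (diff c d)
  then show ?case by (simp add: chain_boundary_diff)
qed simp

text \<open>A representing cycle is chosen; by \<open>H0_label_eq\<close> the choice does not matter
  when the label is continuous.\<close>

definition H0_label :: "'a topology \<Rightarrow> ('a \<Rightarrow> 'b) \<Rightarrow> 'a chain set \<Rightarrow> 'b \<Rightarrow>\<^sub>0 int" where
  "H0_label Y a x = label_chain a (SOME c. singular_relcycle 0 Y {} c \<and> x = homologous_rel_set 0 Y {} c)"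

lemma H0_label_eq:
  assumes a: "continuous_map Y (discrete_topology U) a" and c: "singular_relcycle 0 Y {} c"
  shows "H0_label Y a (homologous_rel_set 0 Y {} c) = label_chain a c"
proof -
  let ?P = "\<lambda>c'. singular_relcycle 0 Y {} c' \<and> homologous_rel_set 0 Y {} c = homologous_rel_set 0 Y {} c'"
  have "?P (SOME c'. ?P c')" by (rule someI[of ?P c]) (simp add: c)
  then have "homologous_rel 0 Y {} c (SOME c'. ?P c')"
    unfolding homologous_rel_set_eq by (rule conjunct2)
  then have "singular_relboundary 0 Y {} (c - (SOME c'. ?P c'))"
    unfolding homologous_rel_def .
  then obtain d where "singular_chain (Suc 0) Y d" "chain_boundary (Suc 0) d = c - (SOME c'. ?P c')"
    by (auto simp: singular_boundary)
  then have "label_chain a (c - (SOME c'. ?P c')) = 0" using label_chain_boundary[OF a] by metis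
  then show ?thesis by (simp add: H0_label_def)
qed

lemma H0_cycle_obtain:
  assumes "x \<in> carrier (homology_group 0 Y)"
  obtains c where "singular_relcycle 0 Y {} c" "x = homologous_rel_set 0 Y {} c"
  using assms by (auto simp: carrier_relative_homology_group_0)

lemma H0_label_mult:
  assumes a: "continuous_map Y (discrete_topology U) a"
    and "x \<in> carrier (homology_group 0 Y)" "y \<in> carrier (homology_group 0 Y)"
  shows "H0_label Y a (x \<otimes>\<^bsub>homology_group 0 Y\<^esub> y) = H0_label Y a x + H0_label Y a y"
proof -
  obtain c where c: "singular_relcycle 0 Y {} c" "x = homologous_rel_set 0 Y {} c" using H0_cycle_obtain assms by metis
  obtain d where d: "singular_relcycle 0 Y {} d" "y = homologous_rel_set 0 Y {} d" using H0_cycle_obtain assms by metis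
  show ?thesis
    using homologous_rel_set_mult[OF c(1) d(1)] H0_label_eq[OF a] c d singular_relcycle_add[OF c(1) d(1)] by simp
qed

lemma label_chain_chain_map:
  assumes "singular_chain 0 Y c" and "\<And>y. y \<in> topspace Y \<Longrightarrow> a' (f y) = a y"
  shows "label_chain a' (chain_map 0 f c) = label_chain a c"
  using assms(1) unfolding singular_chain_def
proof (induction c rule: frag_induction)
  case (one g)
  then have "g vertex0 \<in> topspace Y"
    using vertex0_in[of 0] by (auto simp: singular_simplex_def continuous_map_def)
  then show ?case using assms(2) vertex0_in[of 0] by (simp add: simplex_map_def)
qed (simp_all add: chain_map_diff)

lemma H0_label_natural:
  assumes a: "continuous_map Y (discrete_topology U) a" and a': "continuous_map Y' (discrete_topology U') a'"
    and f: "continuous_map Y Y' f" and eq: "\<And>y. y \<in> topspace Y \<Longrightarrow> a' (f y) = a y"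
    and x: "x \<in> carrier (homology_group 0 Y)"
  shows "H0_label Y' a' (hom_induced 0 Y {} Y' {} f x) = H0_label Y a x"
proof -
  obtain c where c: "singular_relcycle 0 Y {} c" "x = homologous_rel_set 0 Y {} c" using H0_cycle_obtain x by metis
  have "hom_induced 0 Y {} Y' {} f x = homologous_rel_set 0 Y' {} (chain_map 0 f c)"
    using hom_induced_chain_map[OF f _ c(1), of "{}"] c(2) by simp
  moreover have "singular_relcycle 0 Y' {} (chain_map 0 f c)"
    using singular_relcycle_chain_map[OF c(1) f] by simp
  moreover have "label_chain a' (chain_map 0 f c) = label_chain a c"
    using c(1) eq by (intro label_chain_chain_map) (auto simp: singular_cycle)
  ultimately show ?thesis
    using c H0_label_eq[OF a c(1)] H0_label_eq[OF a', of "chain_map 0 f c"] by simp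
qed

lemma singular_simplex_0_subtopology:
  assumes "singular_simplex 0 Y f" "f vertex0 \<in> F"
  shows "singular_simplex 0 (subtopology Y F) f"
  using assms by (auto simp: singular_simplex_subtopology standard_simplex_0)

text \<open>Points with equal labels are joined by a path, so each 0-simplex is homologous to a
  representative \<open>rep\<close> of its label, and a cycle whose labels cancel is homologous to
  0.\<close>

lemma H0_label_inj:
  assumes a: "continuous_map Y (discrete_topology U) a"
    and pc: "\<And>b. path_connectedin Y {y \<in> topspace Y. a y = b}"
    and x: "x \<in> carrier (homology_group 0 Y)" and 0: "H0_label Y a x = 0"
  shows "x = \<one>\<^bsub>homology_group 0 Y\<^esub>"
proof -
  obtain c where c: "singular_relcycle 0 Y {} c" "x = homologous_rel_set 0 Y {} c" using H0_cycle_obtain x by metis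
  define rep where "rep b = (SOME f. singular_simplex 0 Y f \<and> a (f vertex0) = b)" for b
  have rep: "singular_simplex 0 Y (rep (a (f vertex0))) \<and> a (rep (a (f vertex0)) vertex0) = a (f vertex0)"
    if "singular_simplex 0 Y f" for f
    unfolding rep_def by (rule someI[of _ f]) (use that in auto)
  have hom: "homologous_rel 0 Y {} (frag_of f) (frag_of (rep (a (f vertex0))))" if f: "singular_simplex 0 Y f" for f
  proof -
    let ?F = "{y \<in> topspace Y. a y = a (f vertex0)}"
    have top: "g vertex0 \<in> topspace Y" if "singular_simplex 0 Y g" for g
      using that vertex0_in[of 0] by (auto simp: singular_simplex_def continuous_map_def)
    have "homologous_rel 0 (subtopology Y ?F) {} (frag_of f) (frag_of (rep (a (f vertex0))))"
      using rep[OF f] f top pc[of "a (f vertex0)"]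
      by (intro iso_integer_zeroth_homology_group_aux singular_simplex_0_subtopology) (auto simp: path_connectedin_def)
    then show ?thesis
      using singular_boundary_mono[of ?F "topspace Y" 0 Y] by (simp add: homologous_rel_def)
  qed
  let ?r = "frag_extend (\<lambda>f. frag_of (rep (a (f vertex0))))"
  have "singular_chain 0 Y c" using c(1) by (simp add: singular_cycle)
  then have "homologous_rel 0 Y {} c (?r c)"
    unfolding singular_chain_def
    by (induction c rule: frag_induction) (use hom in \<open>auto simp: frag_extend_diff intro: homologous_rel_diff\<close>)
  moreover have "?r c = frag_extend (\<lambda>b. frag_of (rep b)) (label_chain a c)"
    by (simp add: label_chain_def frag_extend_compose2)
  moreover have "label_chain a c = 0" using 0 c H0_label_eq[OF a] by simp
  ultimately have "singular_relboundary 0 Y {} c" by (simp add: homologous_rel_def)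
  then show ?thesis using homologous_rel_set_eq_one_iff[of 0 Y "{}" c] c(2) by simp
qed

lemma H0_label_one:
  assumes a: "continuous_map Y (discrete_topology U) a"
  shows "H0_label Y a \<one>\<^bsub>homology_group 0 Y\<^esub> = 0"
proof -
  have "homologous_rel_set 0 Y {} 0 = \<one>\<^bsub>homology_group 0 Y\<^esub>"
    using homologous_rel_set_eq_one_iff[of 0 Y "{}" 0] by simp
  then show ?thesis using H0_label_eq[OF a, of 0] by simp
qed

text \<open>The label with a single value is the augmentation, and a path connected space has only
  one fibre.\<close>

lemma H0_label_unit_inj:
  assumes "path_connected_space Y" "x \<in> carrier (homology_group 0 Y)" "H0_label Y (\<lambda>_. ()) x = 0"
  shows "x = \<one>\<^bsub>homology_group 0 Y\<^esub>"
proof (rule H0_label_inj[where a = "\<lambda>_. ()" and U = UNIV])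
  show "path_connectedin Y {y \<in> topspace Y. () = b}" for b
    using assms(1) by (simp add: path_connectedin_topspace)
qed (use assms in auto)

text \<open>A class whose cycle has mesh subordinate to open sets \<open>U i\<close> is killed by the product of the
  commuting operators \<open>1 - r\<^sub>i\<close> once the maps \<open>r\<^sub>i\<close> restrict to the identity on \<open>U i\<close>.\<close>

definition kill :: "nat \<Rightarrow> ('a \<Rightarrow> 'a) \<Rightarrow> 'a chain \<Rightarrow> 'a chain" where
  "kill p r c = c - chain_map p r c"

lemma kill_0 [simp]: "kill p r 0 = 0" and kill_diff: "kill p r (c - d) = kill p r c - kill p r d"
  by (simp_all add: kill_def chain_map_diff)

lemma chain_map_commute:
  assumes "\<And>x. r (s x) = s (r x)"
  shows "chain_map p r (chain_map p s c) = chain_map p s (chain_map p r c)"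
proof -
  have "r \<circ> s = s \<circ> r" using assms by (simp add: fun_eq_iff)
  then have "chain_map p r \<circ> chain_map p s = chain_map p s \<circ> chain_map p r"
    by (simp flip: chain_map_compose)
  then show ?thesis by (simp add: fun_eq_iff)
qed

lemma kill_commute:
  assumes "\<And>x. r (s x) = s (r x)"
  shows "kill p r (kill p s c) = kill p s (kill p r c)"
  using chain_map_commute[of r s p c] assms by (simp add: kill_def chain_map_diff)

lemma fold_kill_diff: "fold (\<lambda>i. kill p (r i)) is (c - d) = fold (\<lambda>i. kill p (r i)) is c - fold (\<lambda>i. kill p (r i)) is d"
  by (induction "is" arbitrary: c d) (simp_all add: kill_diff)

lemma fold_kill_0: "fold (\<lambda>i. kill p (r i)) is 0 = 0"
  by (induction "is") simp_all

text \<open>Since the factors commute, being killed by the factor of i survives the factors applied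
  before it; the chain becomes 0 when the turn of i comes.\<close>

lemma fold_kill_eq_0:
  assumes "\<And>i j x. r i (r j x) = r j (r i x)" and "i \<in> set is" and "kill p (r i) c = 0"
  shows "fold (\<lambda>i. kill p (r i)) is c = 0"
  using assms(2,3)
proof (induction "is" arbitrary: c)
  case (Cons j js)
  show ?case
  proof (cases "i = j")
    case True
    then show ?thesis using Cons.prems by (simp add: fold_kill_0)
  next
    case False
    have "kill p (r i) (kill p (r j) c) = 0"
      using kill_commute[of "r i" "r j" p c] assms(1) Cons.prems(2) by simp
    then show ?thesis using Cons False by simp
  qed
qed simp

text \<open>On a cycle homologous to c, the factor of i subtracts a chain homologous to the image of
  c under \<open>r i\<close>, which is a boundary.\<close>

lemma fold_kill_homologous:
  assumes r: "\<And>i. i \<in> set is \<Longrightarrow> continuous_map X X (r i)"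
    and c: "singular_relcycle p X {} c"
    and 0: "\<And>i. i \<in> set is \<Longrightarrow> singular_relboundary p X {} (chain_map p (r i) c)"
  shows "homologous_rel p X {} (fold (\<lambda>i. kill p (r i)) is c) c"
proof -
  have "homologous_rel p X {} (fold (\<lambda>i. kill p (r i)) is b) c" if "homologous_rel p X {} b c" for b
    using that r 0
  proof (induction "is" arbitrary: b)
    case (Cons j js)
    have "singular_relboundary p X {} (chain_map p (r j) (b - c))"
      using Cons.prems(1,2) by (intro singular_relboundary_chain_map[where X = X and S = "{}"]) (auto simp: homologous_rel_def)
    then have "singular_relboundary p X {} (chain_map p (r j) b - chain_map p (r j) c + chain_map p (r j) c)"
      using Cons.prems(3)[of j] by (intro singular_relboundary_add) (auto simp: chain_map_diff)
    then have "singular_relboundary p X {} (b - c - chain_map p (r j) b)"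
      using Cons.prems(1) singular_relboundary_diff[of p X "{}" "b - c" "chain_map p (r j) b"] by (auto simp: homologous_rel_def)
    then have "homologous_rel p X {} (kill p (r j) b) c"
      by (simp add: homologous_rel_def kill_def algebra_simps)
    then show ?case using Cons by simp
  qed simp
  then show ?thesis by simp
qed

lemma kill_frag_of:
  assumes "\<And>t. t \<in> standard_simplex p \<Longrightarrow> r (f t) = f t" and f: "f \<in> extensional (standard_simplex p)"
  shows "kill p r (frag_of f) = 0"
proof -
  have "simplex_map p r f = f"
    unfolding simplex_map_def by (rule extensionalityI[OF _ f]) (use assms in auto)
  then show ?thesis by (simp add: kill_def)
qed

text \<open>Each simplex of c is fixed by one of the maps, so one factor kills it already as a
  chain, before passing to homology.\<close>

lemma fold_kill_small:
  assumes com: "\<And>i j x. r i (r j x) = r j (r i x)"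
    and small: "\<And>f. f \<in> Poly_Mapping.keys c \<Longrightarrow> f \<in> extensional (standard_simplex p) \<and> (\<exists>i\<in>set is. \<forall>t\<in>standard_simplex p. r i (f t) = f t)"
  shows "fold (\<lambda>i. kill p (r i)) is c = 0"
proof -
  let ?K = "{f. f \<in> extensional (standard_simplex p) \<and> (\<exists>i\<in>set is. \<forall>t\<in>standard_simplex p. r i (f t) = f t)}"
  have "Poly_Mapping.keys c \<subseteq> ?K" using small by blast
  then show ?thesis
  proof (induction c rule: frag_induction)
    case (one f)
    then obtain i where i: "i \<in> set is" "\<And>t. t \<in> standard_simplex p \<Longrightarrow> r i (f t) = f t" "f \<in> extensional (standard_simplex p)" by blast
    show ?case by (rule fold_kill_eq_0[where r = r, OF com i(1)]) (rule kill_frag_of[OF i(2,3)])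
  qed (simp_all add: fold_kill_diff fold_kill_0)
qed

section \<open>Links of the faces\<close>

text \<open>Both points lie in the same square of the edge at j: they share the remaining
  coordinates, all 0 or 1, and the square is convex.\<close>

lemma line_in_polygon_space:
  assumes x: "x \<in> topspace (polygon_space n)" and y: "y \<in> topspace (polygon_space n)"
    and j: "j \<in> {1..n}" "\<And>k. k \<in> {1..n} \<Longrightarrow> k \<noteq> j \<Longrightarrow> k \<noteq> cyc_succ n j \<Longrightarrow> x k = y k \<and> (x k = 0 \<or> x k = 1)"
    and t: "0 \<le> t" "t \<le> 1"
  shows "(\<lambda>k\<in>{1..n}. (1 - t) * x k + t * y k) \<in> topspace (polygon_space n)" (is "?z \<in> _")
  unfolding topspace_polygon_space_iff
proof (intro conjI ballI bexI[OF _ j(1)])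
  fix i assume i: "i \<in> {1..n}"
  have b: "0 \<le> x i" "x i \<le> 1" "0 \<le> y i" "y i \<le> 1" using x y i by (auto simp: topspace_polygon_space_iff)
  show "0 \<le> ?z i" using b t i by simp
  show "?z i \<le> 1" using i b t convex_bound_le[of "x i" 1 "y i" "1 - t" t] by simp
  show "?z i = 0 \<or> ?z i = 1 \<or> i = j \<or> i = cyc_succ n j"
  proof (cases "i = j \<or> i = cyc_succ n j")
    case False
    then have *: "y i = x i" "x i = 0 \<or> x i = 1" using j(2)[OF i] by auto
    have "?z i = x i" using i * by (simp add: left_diff_distrib)
    then show ?thesis using *(2) by metis
  qed blast
qed simp

lemma path_component_of_line:
  assumes x: "x \<in> topspace (subtopology (polygon_space n) S)" and y: "y \<in> topspace (subtopology (polygon_space n) S)"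
    and j: "j \<in> {1..n}" "\<And>k. k \<in> {1..n} \<Longrightarrow> k \<noteq> j \<Longrightarrow> k \<noteq> cyc_succ n j \<Longrightarrow> x k = y k \<and> (x k = 0 \<or> x k = 1)"
    and S: "\<And>t. 0 \<le> t \<Longrightarrow> t \<le> 1 \<Longrightarrow> (\<lambda>k\<in>{1..n}. (1 - t) * x k + t * y k) \<in> S"
  shows "path_component_of (subtopology (polygon_space n) S) x y"
proof -
  let ?g = "\<lambda>t::real. \<lambda>k\<in>{1..n}. (1 - t) * x k + t * y k"
  have x': "x \<in> topspace (polygon_space n)" and y': "y \<in> topspace (polygon_space n)" using x y by auto
  have "pathin (subtopology (polygon_space n) S) ?g"
    unfolding pathin_def continuous_map_in_subtopology continuous_map_polygon_space_iff
  proof (intro conjI ballI)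
    show "?g \<in> topspace (top_of_set {0..1}) \<rightarrow> topspace (polygon_space n)"
    proof
      fix t :: real assume "t \<in> topspace (top_of_set {0..1})"
      then have t: "0 \<le> t" "t \<le> 1" by auto
      show "?g t \<in> topspace (polygon_space n)"
        by (rule line_in_polygon_space[OF x' y' j(1) _ t]) (rule j(2))
    qed
    show "?g \<in> topspace (top_of_set {0..1}) \<rightarrow> S" by (rule Pi_I, rule S) simp_all
    fix i assume "i \<in> {1..n}"
    moreover have "continuous_on {0..1::real} (\<lambda>t. (1 - t) * x i + t * y i)" by (intro continuous_intros)
    ultimately show "continuous_map (top_of_set {0..1}) euclideanreal (\<lambda>t. ?g t i)" by simp
  qed
  moreover have "?g 0 = x" "?g 1 = y"
    using x' y' by (auto simp: topspace_polygon_space_iff intro!: extensionalityI[where A = "{1..n}"])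
  ultimately show ?thesis unfolding path_component_of_def by blast
qed

section \<open>The positive part of a face, its link, and excision\<close>

definition pos_space :: "nat \<Rightarrow> nat set \<Rightarrow> (nat \<Rightarrow> real) topology" where
  "pos_space n J = subtopology (face_space n J) (topspace (face_space n J) - some_zero J)"

abbreviation link_set :: "nat set \<Rightarrow> (nat \<Rightarrow> real) set" where
  "link_set J \<equiv> near_zero J - some_zero J"

text \<open>A thickened link of the vertex \<open>ones n J\<close>. It is the subspace left of the
  pair of a face and \<open>near_zero J\<close> once the hyperplanes are excised.\<close>

definition link_space :: "nat \<Rightarrow> nat set \<Rightarrow> (nat \<Rightarrow> real) topology" where
  "link_space n J = subtopology (pos_space n J) (link_set J)"

lemma topspace_pos_space:
  assumes "J \<subseteq> {1..n}"
  shows "topspace (pos_space n J) = {x \<in> topspace (face_space n J). \<forall>i\<in>J. 0 < x i}"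
proof -
  have "0 < x i \<longleftrightarrow> x i \<noteq> 0" if "x \<in> topspace (face_space n J)" "i \<in> J" for x i
    using that assms by (auto simp: topspace_face_space topspace_polygon_space_iff less_le)
  then show ?thesis by (auto simp: pos_space_def some_zero_def)
qed

lemma topspace_link_space:
  "J \<subseteq> {1..n} \<Longrightarrow> topspace (link_space n J) = {x \<in> topspace (pos_space n J). \<exists>i\<in>J. x i < 1/2}"
  by (auto simp: link_space_def topspace_pos_space near_zero_def some_zero_def)

lemma pos_space_eq:
  "pos_space n J = subtopology (polygon_space n) ({x. \<forall>i\<in>{1..n} - J. x i = 0} \<inter> (topspace (face_space n J) - some_zero J))"
  by (simp add: pos_space_def face_space_def subtopology_subtopology)

lemma link_space_eq:
  "link_space n J = subtopology (polygon_space n)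
     ({x. \<forall>i\<in>{1..n} - J. x i = 0} \<inter> (topspace (face_space n J) - some_zero J) \<inter> link_set J)"
  by (simp add: link_space_def pos_space_eq subtopology_subtopology)

lemma openin_near_zero:
  assumes "J \<subseteq> {1..n}"
  shows "openin (face_space n J) (topspace (face_space n J) \<inter> near_zero J)"
proof -
  have "topspace (face_space n J) \<inter> near_zero J = (\<Union>i\<in>J. {x \<in> topspace (face_space n J). x i < 1/2})"
    by (auto simp: near_zero_def)
  also have "openin (face_space n J) \<dots>" by (rule openin_Union) (use assms openin_face_less in blast)
  finally show ?thesis .
qed

lemma closedin_some_zero:
  assumes "J \<subseteq> {1..n}"
  shows "closedin (face_space n J) (topspace (face_space n J) \<inter> some_zero J)"
proof -
  have "closedin (face_space n J) {x \<in> topspace (face_space n J). x i \<in> {0}}" if "i \<in> J" for i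
    using closedin_continuous_map_preimage[OF continuous_map_face_coordinate[of i n J], of "{0}"] that assms by auto
  then have "closedin (face_space n J) (\<Union>i\<in>J. {x \<in> topspace (face_space n J). x i \<in> {0}})"
    using finite_subset[OF assms] by (intro closedin_Union) auto
  moreover have "topspace (face_space n J) \<inter> some_zero J = (\<Union>i\<in>J. {x \<in> topspace (face_space n J). x i \<in> {0}})"
    by (auto simp: some_zero_def)
  ultimately show ?thesis by simp
qed

abbreviation excision_map where
  "excision_map n J \<equiv> hom_induced 1 (pos_space n J) (link_set J) (face_space n J) (near_zero J) id"

text \<open>The removed set, where a coordinate in J is 0, is closed and lies in the open set
  \<open>near_zero J\<close>, which is the closure and interior condition for excision.\<close>

lemma excision_iso:
  assumes J: "J \<subseteq> {1..n}"
  shows "excision_map n J \<in> iso (relative_homology_group 1 (pos_space n J) (link_set J))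
           (relative_homology_group 1 (face_space n J) (near_zero J))"
proof -
  let ?Z = "face_space n J"
  let ?S = "topspace ?Z" let ?T = "?S \<inter> near_zero J" let ?U = "?S \<inter> some_zero J"
  have "?Z closure_of ?U = ?U" using closedin_some_zero[OF J] by (simp add: closure_of_eq)
  moreover have "?Z interior_of ?T = ?T" using openin_near_zero[OF J] by (simp add: interior_of_eq)
  moreover have "?U \<subseteq> ?T" by (force simp: some_zero_def near_zero_def)
  ultimately have *: "hom_induced 1 (subtopology ?Z (?S - ?U)) (?T - ?U) (subtopology ?Z ?S) ?T id
    \<in> iso (relative_homology_group 1 (subtopology ?Z (?S - ?U)) (?T - ?U)) (relative_homology_group 1 (subtopology ?Z ?S) ?T)"
    by (intro homology_excision_axiom) auto
  have 1: "?S - ?U = ?S - some_zero J" by auto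
  have 2: "?T - ?U = topspace (pos_space n J) \<inter> link_set J" by (auto simp: pos_space_def)
  have 3: "subtopology ?Z ?S = ?Z" by simp
  show ?thesis
    using *[unfolded 1 2 3, folded pos_space_def] by simp
qed

definition ones :: "nat \<Rightarrow> nat set \<Rightarrow> nat \<Rightarrow> real" where
  "ones n J = (\<lambda>k\<in>{1..n}. if k \<in> J then 1 else 0)"

text \<open>On the straight line to the vertex \<open>ones n J\<close> the coordinates in J stay
  positive, a coordinate 1 stays 1, and those outside J stay 0. No new coordinate becomes
  fractional, so the line remains in the complex.\<close>

lemma contractible_pos_space:
  assumes n: "n \<ge> 1" and J: "J \<subseteq> {1..n}"
  shows "contractible_space (pos_space n J)"
proof -
  let ?P = "pos_space n J"
  let ?h = "\<lambda>(t::real, x). (\<lambda>i\<in>{1..n}. (1 - t) * x i + t * ones n J i)"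
  have coord: "continuous_map ?P euclideanreal (\<lambda>x. x i)" if "i \<in> {1..n}" for i
    unfolding pos_space_def by (intro continuous_map_from_subtopology continuous_map_face_coordinate that)
  have "continuous_map (prod_topology (top_of_set {0..1}) ?P) ?P ?h"
    unfolding pos_space_eq[of n J] continuous_map_in_subtopology continuous_map_polygon_space_iff
    unfolding pos_space_eq[symmetric]
  proof (intro conjI ballI)
    have in1: "?h (t, x) \<in> topspace ?P" if t: "0 \<le> t" "t \<le> 1" and x: "x \<in> topspace ?P" for t x
    proof -
      have x': "x \<in> topspace (polygon_space n)" using x J by (simp add: topspace_pos_space topspace_face_space)
      have b: "0 \<le> x i" "x i \<le> 1" if "i \<in> {1..n}" for i using x' that by (auto simp: topspace_polygon_space_iff)
      have z: "x i = 0" if "i \<in> {1..n} - J" for i using x that J by (simp add: topspace_pos_space topspace_face_space)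
      have p: "0 < x i" if "i \<in> J" for i using x that J by (simp add: topspace_pos_space)
      have c: "(1 - t) * x i + t \<le> 1" "0 \<le> (1 - t) * x i + t" if "i \<in> {1..n}" for i
        using t b[OF that] convex_bound_le[of "x i" 1 1 "1 - t" t] by auto
      have "?h (t, x) \<in> topspace (polygon_space n)"
      proof (rule topspace_polygon_spaceI[OF x'])
        fix i assume i: "i \<in> {1..n}"
        show "0 \<le> ?h (t, x) i \<and> ?h (t, x) i \<le> 1" using i c[OF i] z[of i] by (cases "i \<in> J") (simp_all add: ones_def)
        show "?h (t, x) i = 0 \<or> ?h (t, x) i = 1" if "x i = 0 \<or> x i = 1"
          using that i z[of i] p[of i] by (cases "i \<in> J") (auto simp: ones_def)
      qed simp
      moreover have "0 < (1 - t) * x i + t" if "i \<in> J" for i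
        using t p[OF that] by (cases "t = 1") (auto intro: add_pos_nonneg)
      ultimately show ?thesis using J z by (auto simp: topspace_pos_space topspace_face_space ones_def)
    qed
    then have in2: "?h \<in> topspace (prod_topology (top_of_set {0..1}) ?P) \<rightarrow> topspace ?P" by auto
    have sub: "topspace ?P = topspace (polygon_space n) \<inter> ({x. \<forall>i\<in>{1..n} - J. x i = 0} \<inter> (topspace (face_space n J) - some_zero J))"
      by (simp add: pos_space_eq)
    show "?h \<in> topspace (prod_topology (top_of_set {0..1}) ?P) \<rightarrow> topspace (polygon_space n)"
      using in2 unfolding Pi_iff sub by blast
    show "?h \<in> topspace (prod_topology (top_of_set {0..1}) ?P) \<rightarrow>
        {x. \<forall>i\<in>{1..n} - J. x i = 0} \<inter> (topspace (face_space n J) - some_zero J)"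
      using in2 unfolding Pi_iff sub by blast
    fix i assume i: "i \<in> {1..n}"
    have 1: "continuous_map (prod_topology (top_of_set {0..1::real}) ?P) euclideanreal (\<lambda>z. snd z i)"
      using continuous_map_compose[OF continuous_map_snd coord[OF i]] by (simp add: o_def)
    have 2: "continuous_map (prod_topology (top_of_set {0..1::real}) ?P) euclideanreal fst"
      using continuous_map_fst[of "top_of_set {0..1::real}" ?P] by (simp add: continuous_map_in_subtopology)
    have "continuous_map (prod_topology (top_of_set {0..1::real}) ?P) euclideanreal (\<lambda>z. (1 - fst z) * snd z i + fst z * ones n J i)"
      by (intro continuous_map_real_mult continuous_map_diff continuous_map_add 1 2 continuous_map_const[THEN iffD2]) auto
    then show "continuous_map (prod_topology (top_of_set {0..1::real}) ?P) euclideanreal (\<lambda>y. ?h y i)"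
      using i by (simp add: case_prod_unfold)
  qed
  then have "homotopic_with (\<lambda>h. True) ?P ?P id (\<lambda>x. ones n J)"
    using J by (subst homotopic_with, simp, intro exI[of _ "?h"] conjI)
       (auto simp: topspace_pos_space topspace_face_space topspace_polygon_space_iff extensional_def fun_eq_iff ones_def)
  then show ?thesis unfolding contractible_space_def by blast
qed

section \<open>Arcs as components of the link\<close>

definition link_label :: "nat set \<Rightarrow> (nat \<Rightarrow> 'b) \<Rightarrow> (nat \<Rightarrow> real) \<Rightarrow> 'b" where
  "link_label J \<alpha> x = \<alpha> (SOME i. i \<in> J \<and> x i < 1)"

definition arc_label :: "nat \<Rightarrow> nat set \<Rightarrow> (nat \<Rightarrow> 'b) \<Rightarrow> bool" where
  "arc_label n J \<alpha> \<longleftrightarrow> (\<forall>i\<in>J. cyc_succ n i \<in> J \<longrightarrow> \<alpha> (cyc_succ n i) = \<alpha> i)"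

definition arc_adj :: "nat \<Rightarrow> nat set \<Rightarrow> (nat \<times> nat) set" where
  "arc_adj n J = {(i, i'). i \<in> J \<and> i' \<in> J \<and> (i' = cyc_succ n i \<or> i = cyc_succ n i')}"

lemma link_space_support:
  assumes J: "J \<subseteq> {1..n}" and x: "x \<in> topspace (pos_space n J)"
  obtains j where "j \<in> {1..n}" "\<And>k. k \<in> J \<Longrightarrow> k \<noteq> j \<Longrightarrow> k \<noteq> cyc_succ n j \<Longrightarrow> x k = 1"
    "\<And>k. k \<in> {1..n} \<Longrightarrow> k \<notin> J \<Longrightarrow> x k = 0"
proof -
  have "x \<in> topspace (polygon_space n)" using x J by (simp add: topspace_pos_space topspace_face_space)
  then obtain j where "j \<in> {1..n}" "\<forall>i\<in>{1..n}. x i = 0 \<or> x i = 1 \<or> i = j \<or> i = cyc_succ n j"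
    unfolding topspace_polygon_space_iff by blast
  moreover have "\<And>i. i \<in> J \<Longrightarrow> 0 < x i" "\<And>k. k \<in> {1..n} \<Longrightarrow> k \<notin> J \<Longrightarrow> x k = 0"
    using x J by (auto simp: topspace_pos_space topspace_face_space)
  ultimately show ?thesis using that[of j] J by (metis less_irrefl subsetD)
qed

text \<open>At a positive point the coordinates in J below 1 lie on one edge, so any two of them are
  equal or neighbours and carry the same label. The choice made by \<open>SOME\<close> in
  \<open>link_label\<close> is therefore harmless.\<close>

lemma link_label_eq:
  assumes J: "J \<subseteq> {1..n}" and \<alpha>: "arc_label n J \<alpha>" and x: "x \<in> topspace (pos_space n J)"
    and i: "i \<in> J" "x i < 1"
  shows "link_label J \<alpha> x = \<alpha> i"
proof -
  obtain j where j: "j \<in> {1..n}" "\<And>k. k \<in> J \<Longrightarrow> k \<noteq> j \<Longrightarrow> k \<noteq> cyc_succ n j \<Longrightarrow> x k = 1"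
    by (rule link_space_support[OF J x]) blast
  define i' where "i' = (SOME i. i \<in> J \<and> x i < 1)"
  have i': "i' \<in> J" "x i' < 1" using someI[of "\<lambda>i. i \<in> J \<and> x i < 1" i] i by (auto simp: i'_def)
  have "i \<in> {j, cyc_succ n j}" "i' \<in> {j, cyc_succ n j}" using j(2) i i' by force+
  then have "\<alpha> i' = \<alpha> i" using \<alpha> i(1) i'(1) unfolding arc_label_def by (elim insertE) auto
  then show ?thesis by (simp add: link_label_def i'_def)
qed

text \<open>Any coordinate below 1 determines the label, so the preimage of V is the union of the
  open sets \<open>x i < 1\<close> over the i whose label lies in V.\<close>

lemma continuous_map_link_label:
  assumes J: "J \<subseteq> {1..n}" and \<alpha>: "arc_label n J \<alpha>"
  shows "continuous_map (link_space n J) (discrete_topology UNIV) (link_label J \<alpha>)"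
  unfolding continuous_map_def
proof (intro conjI allI impI)
  let ?L = "link_space n J"
  fix V :: "'a set"
  have L: "x \<in> topspace (pos_space n J)" "\<exists>i\<in>J. x i < 1" if x: "x \<in> topspace ?L" for x
  proof -
    show "x \<in> topspace (pos_space n J)" using that J by (simp add: topspace_link_space)
    obtain i where "i \<in> J" "x i < 1/2" using x unfolding topspace_link_space[OF J] by blast
    then have "x i < 1" by linarith
    then show "\<exists>i\<in>J. x i < 1" using \<open>i \<in> J\<close> by blast
  qed
  have "openin ?L {x \<in> topspace ?L. x i < 1}" if "i \<in> J" for i
  proof -
    have "continuous_map ?L euclideanreal (\<lambda>x. x i)"
      unfolding link_space_def pos_space_def
      by (intro continuous_map_from_subtopology continuous_map_face_coordinate) (use that J in auto)
    from openin_continuous_map_preimage[OF this, of "{..<1}"] show ?thesis by simp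
  qed
  then have "openin ?L (\<Union>i\<in>{i\<in>J. \<alpha> i \<in> V}. {x \<in> topspace ?L. x i < 1})" by (intro openin_clauses(3)) auto
  moreover have "{x \<in> topspace ?L. link_label J \<alpha> x \<in> V} = (\<Union>i\<in>{i\<in>J. \<alpha> i \<in> V}. {x \<in> topspace ?L. x i < 1})"
    using L link_label_eq[OF J \<alpha>] by (auto; metis)
  ultimately show "openin ?L {x \<in> topspace ?L. link_label J \<alpha> x \<in> V}" by simp
qed simp

text \<open>The value 1/4 stands for any number strictly between 0 and 1/2, so that a dent inside J
  gives a point of the link. A is one vertex, for the base points of components, or an edge, for the
  points joining two of them.\<close>

definition dent :: "nat \<Rightarrow> nat set \<Rightarrow> nat set \<Rightarrow> nat \<Rightarrow> real" where
  "dent n J A = (\<lambda>k\<in>{1..n}. if k \<in> J then if k \<in> A then 1/4 else 1 else 0)"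

lemma dent_in:
  assumes J: "J \<subseteq> {1..n}" and i: "i \<in> J" and A: "i \<in> A" "A \<subseteq> {i, cyc_succ n i}"
  shows "dent n J A \<in> topspace (link_space n J)"
proof -
  have "i \<in> {1..n}" using i J by blast
  then have d: "dent n J A \<in> topspace (polygon_space n)"
    unfolding topspace_polygon_space_iff using A by (intro conjI bexI[of _ i]) (auto simp: dent_def)
   have "dent n J A i < 1/2" using i J A by (auto simp: dent_def)
  moreover have "0 < dent n J A k" if "k \<in> J" for k using that J by (auto simp: dent_def)
  moreover have "dent n J A k = 0" if "k \<in> {1..n} - J" for k using that by (simp add: dent_def)
  ultimately show ?thesis unfolding topspace_link_space[OF J] topspace_pos_space[OF J] topspace_face_space
    by (intro CollectI conjI ballI d bexI[OF _ i])
qed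

text \<open>Having some coordinate below 1/2 is not a convex condition; it becomes one when the
  index i is the same for both points.\<close>

lemma link_space_convex:
  assumes J: "J \<subseteq> {1..n}" and i: "i \<in> J" and x: "x \<in> topspace (link_space n J)" "x i < 1/2"
    and y: "y \<in> topspace (link_space n J)" "y i < 1/2" and t: "0 \<le> t" "t \<le> 1"
    and z: "z = (\<lambda>k\<in>{1..n}. (1 - t) * x k + t * y k)" "z \<in> topspace (polygon_space n)"
  shows "z \<in> topspace (link_space n J) \<and> z i < 1/2"
proof -
  have p: "0 < x k" "0 < y k" if "k \<in> J" for k using x y that J by (auto simp: topspace_link_space topspace_pos_space)
  have 0: "x k = 0" "y k = 0" if "k \<in> {1..n} - J" for k
    using x y that J by (auto simp: topspace_link_space topspace_pos_space topspace_face_space)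
  have "0 < z k" if "k \<in> J" for k
  proof -
    have "0 < (1 - t) * x k + t * y k"
      using t p[OF that] by (cases "t = 1") (auto intro: add_pos_nonneg)
    then show ?thesis using z that J by auto
  qed
  moreover have "z i < 1/2"
    using convex_bound_lt[of "x i" "1/2" "y i" "1 - t" t] x y t i J z by auto
  moreover have "z k = 0" if "k \<in> {1..n} - J" for k using 0[OF that] z that by simp
  ultimately show ?thesis using z(2) i J by (auto simp: topspace_link_space topspace_pos_space topspace_face_space)
qed

text \<open>Lowering coordinates never leaves \<open>near_zero J\<close>, because a coordinate below
  1/2 stays below 1/2. Fractional coordinates are lowered to 0 inside one square, then the
  coordinates equal to 1 drop one at a time, until the origin is reached.\<close>

lemma path_connected_near_zero:
  assumes J: "J \<subseteq> {1..n}" "J \<noteq> {}"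
  shows "path_connected_space (subtopology (face_space n J) (near_zero J))"
proof -
  let ?S = "{x. \<forall>i\<in>{1..n} - J. x i = 0} \<inter> near_zero J"
  have T: "subtopology (face_space n J) (near_zero J) = subtopology (polygon_space n) ?S"
    unfolding face_space_def subtopology_subtopology ..
  let ?pc = "path_component_of (subtopology (polygon_space n) ?S)"
  let ?T = "topspace (subtopology (polygon_space n) ?S)"
  let ?o = "\<lambda>k\<in>{1..n}. 0::real"
  have down: "?pc x y"
    if x: "x \<in> ?T" and y: "y \<in> topspace (polygon_space n)" and j: "j \<in> {1..n}"
      and xy: "\<And>k. k \<in> {1..n} \<Longrightarrow> k \<noteq> j \<Longrightarrow> k \<noteq> cyc_succ n j \<Longrightarrow> x k = y k \<and> (x k = 0 \<or> x k = 1)"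
      and le: "\<And>k. k \<in> {1..n} \<Longrightarrow> y k \<le> x k" for x y j
  proof (rule path_component_of_line[where j = j])
    show "x \<in> ?T" by (rule x)
    show "j \<in> {1..n}" by (rule j)
    show "x k = y k \<and> (x k = 0 \<or> x k = 1)" if "k \<in> {1..n}" "k \<noteq> j" "k \<noteq> cyc_succ n j" for k using that by (rule xy)
  next
    obtain i where i: "i \<in> J" "x i < 1/2" using x unfolding near_zero_def topspace_subtopology by blast
    have x0: "x k = 0" if "k \<in> {1..n} - J" for k using x that by auto
    have y0: "y k = 0" if "k \<in> {1..n} - J" for k
      using le[of k] x0[of k] that y by (auto simp: topspace_polygon_space_iff intro: antisym)
    have iN: "i \<in> {1..n}" using i J by blast
    show "y \<in> topspace (subtopology (polygon_space n) ?S)"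
    proof -
      have "y i < 1/2" using i le[OF iN] by linarith
      then show ?thesis using y y0 i(1) unfolding near_zero_def topspace_subtopology by blast
    qed
    fix t :: real assume t: "0 \<le> t" "t \<le> 1"
    have "(1 - t) * x i + t * y i < 1/2"
      using convex_bound_lt[of "x i" "1/2" "y i" "1 - t" t] i le[OF iN] t by simp
    then have "(\<lambda>k\<in>{1..n}. (1 - t) * x k + t * y k) i < 1/2" using iN by simp
    moreover have "(\<lambda>k\<in>{1..n}. (1 - t) * x k + t * y k) k = 0" if "k \<in> {1..n} - J" for k
      using x0[OF that] y0[OF that] that by simp
    ultimately show "(\<lambda>k\<in>{1..n}. (1 - t) * x k + t * y k) \<in> ?S"
      using i(1) unfolding near_zero_def by blast
  qed
  have vert: "?pc x ?o" if "x \<in> ?T" "\<forall>k\<in>{1..n}. x k = 0 \<or> x k = 1" for x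
    using that
  proof (induction "card {k \<in> {1..n}. x k = 1}" arbitrary: x rule: less_induct)
    case less
    have xp: "x \<in> topspace (polygon_space n)" using less.prems by simp
    show ?case
    proof (cases "\<exists>k\<in>{1..n}. x k = 1")
      case False
      then have "x = ?o" using less.prems(2) xp
        by (intro extensionalityI[where A = "{1..n}"]) (auto simp: topspace_polygon_space_iff)
      then show ?thesis using less.prems(1) by (simp add: path_component_of_refl)
    next
      case True
      then obtain j where j: "j \<in> {1..n}" "x j = 1" by blast
      let ?y = "x(j := 0)"
      have y: "?y \<in> topspace (polygon_space n)"
      proof (rule topspace_polygon_spaceI[OF xp])
        show "?y \<in> extensional {1..n}" using xp j(1) by (simp add: topspace_polygon_space_iff extensional_def)
        fix i assume "i \<in> {1..n}"
        then have "x i = 0 \<or> x i = 1" using less.prems(2) by blast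
        then show "0 \<le> ?y i \<and> ?y i \<le> 1" "?y i = 0 \<or> ?y i = 1" by auto
      qed
      have pc: "?pc x ?y"
      proof (rule down[where j = j])
        fix k assume "k \<in> {1..n}"
        then have "x k = 0 \<or> x k = 1" using less.prems(2) by blast
        then show "?y k \<le> x k" "k \<noteq> j \<Longrightarrow> x k = ?y k \<and> (x k = 0 \<or> x k = 1)" by auto
      qed (rule less.prems(1) y j(1))+
      have yT: "?y \<in> ?T" using pc by (simp add: path_component_of_equiv)
      have "{k \<in> {1..n}. ?y k = 1} \<subset> {k \<in> {1..n}. x k = 1}" using j by auto
      then have "card {k \<in> {1..n}. ?y k = 1} < card {k \<in> {1..n}. x k = 1}" by (intro psubset_card_mono) auto
      moreover have "\<forall>k\<in>{1..n}. ?y k = 0 \<or> ?y k = 1" using less.prems(2) by simp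
      ultimately have "?pc ?y ?o" by (rule less.hyps[OF _ yT])
      with pc show ?thesis by (rule path_component_of_trans)
    qed
  qed
  have "?pc x ?o" if x: "x \<in> ?T" for x
  proof -
    have xp: "x \<in> topspace (polygon_space n)" using x by simp
    obtain j where j: "j \<in> {1..n}" "\<And>i. i \<in> {1..n} \<Longrightarrow> i \<noteq> j \<Longrightarrow> i \<noteq> cyc_succ n j \<Longrightarrow> x i = 0 \<or> x i = 1"
      using xp unfolding topspace_polygon_space_iff by metis
    let ?y = "\<lambda>k\<in>{1..n}. if x k = 1 then 1 else 0 :: real"
    have y: "?y \<in> topspace (polygon_space n)" by (rule topspace_polygon_spaceI[OF xp]) auto
    have le: "?y k \<le> x k" if "k \<in> {1..n}" for k using xp that by (auto simp: topspace_polygon_space_iff)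
    have pc: "?pc x ?y"
    proof (rule down[where j = j])
      fix k assume k: "k \<in> {1..n}"
      show "?y k \<le> x k" by (rule le[OF k])
      show "x k = ?y k \<and> (x k = 0 \<or> x k = 1)" if "k \<noteq> j" "k \<noteq> cyc_succ n j"
        using j(2)[OF k that] k by auto
    qed (rule x y j(1))+
    have "?y \<in> ?T" using pc by (simp add: path_component_of_equiv)
    from vert[OF this] have "?pc ?y ?o" by simp
    with pc show ?thesis by (rule path_component_of_trans)
  qed
  then have "path_connected_space (subtopology (polygon_space n) ?S)"
    unfolding path_connected_space_iff_path_component by (blast intro: path_component_of_trans path_component_of_sym)
  then show ?thesis unfolding T .
qed

text \<open>A point moves inside a square to a point with one dent; dents at neighbours i and i + 1
  are joined through the point dented at both, and \<open>conn\<close> leads along an arc to any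
  vertex with the same label.\<close>

lemma path_connectedin_link_fiber:
  assumes J: "J \<subseteq> {1..n}" and \<alpha>: "arc_label n J \<alpha>"
    and conn: "\<And>i i'. i \<in> J \<Longrightarrow> i' \<in> J \<Longrightarrow> \<alpha> i = \<alpha> i' \<Longrightarrow> (i, i') \<in> (arc_adj n J)\<^sup>*"
  shows "path_connectedin (link_space n J) {x \<in> topspace (link_space n J). link_label J \<alpha> x = b}"
proof -
  let ?L = "link_space n J"
  let ?F = "{x \<in> topspace ?L. link_label J \<alpha> x = b}"
  let ?S = "{x. \<forall>i\<in>{1..n} - J. x i = 0} \<inter> (topspace (face_space n J) - some_zero J) \<inter> link_set J \<inter> ?F"
  have F: "subtopology ?L ?F = subtopology (polygon_space n) ?S"
    unfolding link_space_eq[of n J] subtopology_subtopology ..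
  have topF: "topspace (subtopology (polygon_space n) ?S) = ?F"
    unfolding F[symmetric] by auto
  have FS: "?F \<subseteq> ?S"
  proof -
    have "topspace ?L \<subseteq> {x. \<forall>i\<in>{1..n} - J. x i = 0} \<inter> (topspace (face_space n J) - some_zero J) \<inter> link_set J"
      by (subst link_space_eq) (unfold topspace_subtopology, blast)
    then show ?thesis by blast
  qed
  define pc where "pc = path_component_of (subtopology ?L ?F)"
  have trans: "pc x y \<Longrightarrow> pc y z \<Longrightarrow> pc x z" and sym: "pc x y \<longleftrightarrow> pc y x" for x y z
    unfolding pc_def by (rule path_component_of_trans) (auto simp: path_component_of_sym)
  have pos: "x \<in> topspace (pos_space n J)" if "x \<in> topspace ?L" for x using that J by (simp add: topspace_link_space)
  have poly: "x \<in> topspace (polygon_space n)" "k \<in> {1..n} \<Longrightarrow> k \<notin> J \<Longrightarrow> x k = 0" if "x \<in> topspace ?L" for x k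
    using pos[OF that] J by (auto simp: topspace_pos_space topspace_face_space)
  have label: "link_label J \<alpha> x = \<alpha> i" if "x \<in> topspace ?L" "i \<in> J" "x i < 1/2" for x i
    using link_label_eq[OF J \<alpha> pos[OF that(1)] that(2)] that(3) by simp
  have line: "pc x y"
    if i: "i \<in> J" "\<alpha> i = b" and x: "x \<in> topspace ?L" "x i < 1/2" and y: "y \<in> topspace ?L" "y i < 1/2"
      and j: "j \<in> {1..n}" "\<forall>k\<in>J. k \<noteq> j \<longrightarrow> k \<noteq> cyc_succ n j \<longrightarrow> x k = 1 \<and> y k = 1" for i j x y
    unfolding pc_def F
  proof (rule path_component_of_line[where j = j])
    show "j \<in> {1..n}" by (rule j(1))
    show "x \<in> topspace (subtopology (polygon_space n) ?S)" "y \<in> topspace (subtopology (polygon_space n) ?S)"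
      unfolding topF using label[OF x(1) i(1) x(2)] label[OF y(1) i(1) y(2)] x y i by simp_all
    show jj: "x k = y k \<and> (x k = 0 \<or> x k = 1)" if "k \<in> {1..n}" "k \<noteq> j" "k \<noteq> cyc_succ n j" for k
      using j(2) poly(2)[OF x(1), of k] poly(2)[OF y(1), of k] that by (cases "k \<in> J") auto
    fix t :: real assume t: "0 \<le> t" "t \<le> 1"
    let ?z = "\<lambda>k\<in>{1..n}. (1 - t) * x k + t * y k"
    have "?z \<in> topspace (polygon_space n)"
      by (rule line_in_polygon_space[OF poly(1)[OF x(1)] poly(1)[OF y(1)] j(1) _ t]) (rule jj)
    from link_space_convex[OF J i(1) x y t refl this]
    have z: "?z \<in> topspace ?L" "?z i < 1/2" by auto
    have "?z \<in> ?F" by (intro CollectI conjI z(1)) (rule label[OF z(1) i(1) z(2), unfolded i(2)])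
    then show "?z \<in> ?S" using FS by blast
  qed
  have d: "dent n J {i} \<in> topspace ?L" "dent n J {i} i < 1/2" if "i \<in> J" for i
    using dent_in[OF J that, of "{i}"] that J by (auto simp: dent_def)
  have to_dent: "\<exists>i\<in>J. \<alpha> i = b \<and> pc x (dent n J {i})" if x: "x \<in> ?F" for x
  proof -
    have xL: "x \<in> topspace ?L" using x by simp
    obtain i where i: "i \<in> J" "x i < 1/2" using xL unfolding topspace_link_space[OF J] by blast
    have b: "\<alpha> i = b" using label[OF xL i] x by simp
    obtain j where j: "j \<in> {1..n}" "\<And>k. k \<in> J \<Longrightarrow> k \<noteq> j \<Longrightarrow> k \<noteq> cyc_succ n j \<Longrightarrow> x k = 1"
      by (rule link_space_support[OF J pos[OF xL]]) blast
    have "i = j \<or> i = cyc_succ n j" using j(2)[OF i(1)] i(2) by force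
    then have "\<forall>k\<in>J. k \<noteq> j \<longrightarrow> k \<noteq> cyc_succ n j \<longrightarrow> x k = 1 \<and> dent n J {i} k = 1"
      using j(2) J by (auto simp: dent_def)
    from line[OF i(1) b xL i(2) d[OF i(1)] j(1) this] show ?thesis using i(1) b by blast
  qed
  have step: "pc (dent n J {i}) (dent n J {cyc_succ n i})" if i: "i \<in> J" "cyc_succ n i \<in> J" "\<alpha> i = b" for i
  proof -
    let ?A = "{i, cyc_succ n i}"
    have A: "dent n J ?A \<in> topspace ?L" by (rule dent_in[OF J i(1)]) auto
    have A': "dent n J ?A i < 1/2" "dent n J ?A (cyc_succ n i) < 1/2" using i J by (auto simp: dent_def)
    have b': "\<alpha> (cyc_succ n i) = b" using \<alpha> i unfolding arc_label_def by simp
    have 1: "\<forall>k\<in>J. k \<noteq> i \<longrightarrow> k \<noteq> cyc_succ n i \<longrightarrow> dent n J B k = 1 \<and> dent n J C k = 1"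
      if "B \<subseteq> ?A" "C \<subseteq> ?A" for B C
      using that J by (auto simp: dent_def)
    have iN: "i \<in> {1..n}" using i J by blast
    have "pc (dent n J {i}) (dent n J ?A)"
      by (rule line[OF i(1,3) d[OF i(1)] A A'(1) iN 1]) auto
    moreover have "pc (dent n J ?A) (dent n J {cyc_succ n i})"
      by (rule line[OF i(2) b' A A'(2) d[OF i(2)] iN 1]) auto
    ultimately show ?thesis by (rule trans)
  qed
  have chain: "\<alpha> i' = b \<and> pc (dent n J {i}) (dent n J {i'})" if ii: "(i, i') \<in> (arc_adj n J)\<^sup>*" and i: "i \<in> J" "\<alpha> i = b" for i i'
    using ii
  proof (induction rule: rtrancl_induct)
    case base
    have "pc (dent n J {i}) (dent n J {i})"
      by (rule line[OF i d[OF i(1)] d[OF i(1)], of i]) (use i(1) J in \<open>auto simp: dent_def\<close>)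
    then show ?case using i by blast
  next
    case (step k k')
    have k: "k \<in> J" "k' \<in> J" "k' = cyc_succ n k \<or> k = cyc_succ n k'" using step.hyps by (auto simp: arc_adj_def)
    have kb: "\<alpha> k = b" and pck: "pc (dent n J {i}) (dent n J {k})" using step.IH by auto
    have *: "\<alpha> k' = b" using k(3)
    proof
      assume "k' = cyc_succ n k" then show ?thesis using \<alpha> k kb unfolding arc_label_def by simp
    next
      assume "k = cyc_succ n k'" then show ?thesis using \<alpha> k kb unfolding arc_label_def by simp
    qed
    have "pc (dent n J {k}) (dent n J {k'})"
      using k(3)
    proof
      assume "k' = cyc_succ n k"
      then show ?thesis using \<open>\<And>i. i \<in> J \<Longrightarrow> cyc_succ n i \<in> J \<Longrightarrow> \<alpha> i = b \<Longrightarrow> pc (dent n J {i}) (dent n J {cyc_succ n i})\<close>[of k] k kb by simp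
    next
      assume "k = cyc_succ n k'"
      then show ?thesis using \<open>\<And>i. i \<in> J \<Longrightarrow> cyc_succ n i \<in> J \<Longrightarrow> \<alpha> i = b \<Longrightarrow> pc (dent n J {i}) (dent n J {cyc_succ n i})\<close>[of k'] k * sym by simp
    qed
    with pck have "pc (dent n J {i}) (dent n J {k'})" by (rule trans)
    then show ?case using * by simp
  qed
  have pcF: "pc x y" if xy: "x \<in> ?F" "y \<in> ?F" for x y
  proof -
    obtain i where i: "i \<in> J" "\<alpha> i = b" "pc x (dent n J {i})" using to_dent[OF xy(1)] by blast
    obtain i' where i': "i' \<in> J" "\<alpha> i' = b" "pc y (dent n J {i'})" using to_dent[OF xy(2)] by blast
    have "(i, i') \<in> (arc_adj n J)\<^sup>*" by (rule conn[OF i(1) i'(1)]) (simp add: i i')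
    from chain[OF this i(1,2)] have "pc (dent n J {i}) (dent n J {i'})" by simp
    with i(3) have "pc x (dent n J {i'})" by (rule trans)
    moreover have "pc (dent n J {i'}) y" using i'(3) sym by simp
    ultimately show ?thesis by (rule trans)
  qed
  have "path_connected_space (subtopology ?L ?F)"
    unfolding path_connected_space_iff_path_component
  proof (intro ballI)
    fix x y assume "x \<in> topspace (subtopology ?L ?F)" "y \<in> topspace (subtopology ?L ?F)"
    then show "path_component_of (subtopology ?L ?F) x y"
      unfolding F topF using pcF[unfolded pc_def F] by simp
  qed
  then show ?thesis unfolding path_connectedin_def by auto
qed

section \<open>The class of a cycle on the arcs of a vertex set\<close>

lemma hom_boundary_one_imp:
  assumes "x \<in> carrier (relative_homology_group p X S)" "hom_boundary p X S x = \<one>\<^bsub>homology_group (p - 1) (subtopology X S)\<^esub>"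
  obtains y where "y \<in> carrier (homology_group p X)" "x = hom_induced p X {} X S id y"
proof -
  have "kernel (relative_homology_group p X S) (homology_group (p - 1) (subtopology X S)) (hom_boundary p X S) = hom_induced p X {} X S id ` carrier (homology_group p X)"
    using homology_exactness_axiom_1[of p X S] by simp
  then show ?thesis using assms that unfolding kernel_def by blast
qed

lemma hom_boundary_obtain:
  assumes "y \<in> carrier (homology_group (p - 1) (subtopology X S))"
    and "hom_induced (p - 1) (subtopology X S) {} X {} id y = \<one>\<^bsub>homology_group (p - 1) X\<^esub>"
  obtains x where "x \<in> carrier (relative_homology_group p X S)" "y = hom_boundary p X S x"
proof -
  have "kernel (homology_group (p - 1) (subtopology X S)) (homology_group (p - 1) X) (hom_induced (p - 1) (subtopology X S) {} X {} id) = hom_boundary p X S ` carrier (relative_homology_group p X S)"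
    using homology_exactness_axiom_2[of p X S] by simp
  then show ?thesis using assms that unfolding kernel_def by blast
qed

lemma hom_induced_boundary:
  assumes "x \<in> carrier (relative_homology_group p X S)"
  shows "hom_induced (p - 1) (subtopology X S) {} X {} id (hom_boundary p X S x) = \<one>\<^bsub>homology_group (p - 1) X\<^esub>"
  using homology_exactness_axiom_2[of p X S] assms by (auto simp: kernel_def set_eq_iff image_iff)

lemma hom_induced_relative_one_imp:
  assumes "y \<in> carrier (homology_group p X)" "hom_induced p X {} X S id y = \<one>\<^bsub>relative_homology_group p X S\<^esub>"
  obtains z where "z \<in> carrier (homology_group p (subtopology X S))" "y = hom_induced p (subtopology X S) {} X {} id z"
proof -
  have "kernel (homology_group p X) (relative_homology_group p X S) (hom_induced p X {} X S id) = hom_induced p (subtopology X S) {} X {} id ` carrier (homology_group p (subtopology X S))"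
    using homology_exactness_axiom_3[of p X S] by simp
  then show ?thesis using assms that unfolding kernel_def by blast
qed

lemma hom_induced_one:
  "hom_induced p X S Y T f \<one>\<^bsub>relative_homology_group p X S\<^esub> = \<one>\<^bsub>relative_homology_group p Y T\<^esub>"
  by (rule hom_one[OF hom_induced_hom]) auto

lemma hom_boundary_one:
  "hom_boundary p X S \<one>\<^bsub>relative_homology_group p X S\<^esub> = \<one>\<^bsub>homology_group (p - 1) (subtopology X S)\<^esub>"
  by (rule hom_one[OF hom_boundary_hom]) auto

text \<open>The image comes from a class of the subspace, which exactness kills in the relative
  group.\<close>

lemma hom_induced_into_subset:
  assumes f: "continuous_map W (subtopology X S) f" and y: "y \<in> carrier (homology_group p W)"
  shows "hom_induced p W {} X S f y = \<one>\<^bsub>relative_homology_group p X S\<^esub>"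
proof -
  let ?z = "hom_induced p W {} (subtopology X S) {} f y"
  have z: "?z \<in> carrier (homology_group p (subtopology X S))" by (rule hom_induced_carrier)
  have i: "continuous_map (subtopology X S) X id" by (rule continuous_map_from_subtopology) simp
  have "hom_induced p (subtopology X S) {} X {} id ?z \<in> kernel (homology_group p X) (relative_homology_group p X S) (hom_induced p X {} X S id)"
    using homology_exactness_axiom_3[of p X S] z by auto
  then have "hom_induced p X {} X S id (hom_induced p (subtopology X S) {} X {} id ?z) = \<one>\<^bsub>relative_homology_group p X S\<^esub>"
    by (simp add: kernel_def)
  moreover have "hom_induced p X {} X S id (hom_induced p (subtopology X S) {} X {} id ?z) = hom_induced p W {} X S f y"
  proof -
    have "hom_induced p (subtopology X S) {} X {} id ?z = hom_induced p W {} X {} (id \<circ> f) y"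
      by (rule hom_induced_compose'[OF f _ i]) auto
    moreover have "hom_induced p X {} X S id (hom_induced p W {} X {} (id \<circ> f) y) = hom_induced p W {} X S (id \<circ> (id \<circ> f)) y"
      using continuous_map_compose[OF f i] by (intro hom_induced_compose') auto
    ultimately show ?thesis by simp
  qed
  ultimately show ?thesis by simp
qed

abbreviation rel_to_face where
  "rel_to_face n J \<equiv> hom_induced 1 (polygon_space n) {} (face_space n J) (near_zero J) (coord_restrict n J)"

text \<open>The pair of a face and the part of it near some coordinate hyperplane \<open>x\<^sub>i = 0\<close>, \<open>i \<in> J\<close>, is
  excised to the contractible set of positive points relative to the link, so a relative class of
  degree 1 is a class of degree 0 on the link, whose components are the arcs of \<open>J\<close>.\<close>

definition arc_class :: "nat \<Rightarrow> nat set \<Rightarrow> (nat \<Rightarrow> 'b) \<Rightarrow> (nat \<Rightarrow> real) chain set \<Rightarrow> 'b \<Rightarrow>\<^sub>0 int" where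
  "arc_class n J \<alpha> x =
     H0_label (link_space n J) (link_label J \<alpha>)
       (hom_boundary 1 (pos_space n J) (link_set J)
         (inv_into (carrier (relative_homology_group 1 (pos_space n J) (link_set J))) (excision_map n J) (rel_to_face n J x)))"

lemma excision_map_obtain:
  assumes "J \<subseteq> {1..n}" "y \<in> carrier (relative_homology_group 1 (face_space n J) (near_zero J))"
  obtains u where "u \<in> carrier (relative_homology_group 1 (pos_space n J) (link_set J))" "excision_map n J u = y"
proof -
  have "y \<in> excision_map n J ` carrier (relative_homology_group 1 (pos_space n J) (link_set J))"
    using excision_iso[OF assms(1)] assms(2) by (simp add: iso_def bij_betw_def)
  then show ?thesis using that by blast
qed

text \<open>Excision is injective, so any excision preimage u of the relative class may be used in
  place of the one picked by \<open>inv_into\<close>.\<close>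

lemma arc_class_eq:
  assumes J: "J \<subseteq> {1..n}" and u: "u \<in> carrier (relative_homology_group 1 (pos_space n J) (link_set J))"
    and "excision_map n J u = rel_to_face n J x"
  shows "arc_class n J \<alpha> x = H0_label (link_space n J) (link_label J \<alpha>) (hom_boundary 1 (pos_space n J) (link_set J) u)"
proof -
  have "inj_on (excision_map n J) (carrier (relative_homology_group 1 (pos_space n J) (link_set J)))"
    using excision_iso[OF J] by (simp add: iso_def bij_betw_def)
  from inv_into_f_f[OF this u] show ?thesis unfolding arc_class_def assms(3)[symmetric] by simp
qed

lemma link_boundary_carrier:
  "hom_boundary 1 (pos_space n J) (link_set J) u \<in> carrier (homology_group 0 (link_space n J))"
  using hom_boundary_carrier[of 1 "pos_space n J" "link_set J" u] by (simp add: link_space_def)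

lemma arc_class_mult:
  assumes J: "J \<subseteq> {1..n}" and \<alpha>: "arc_label n J \<alpha>"
    and x: "x \<in> carrier (homology_group 1 (polygon_space n))" and y: "y \<in> carrier (homology_group 1 (polygon_space n))"
  shows "arc_class n J \<alpha> (x \<otimes>\<^bsub>homology_group 1 (polygon_space n)\<^esub> y) = arc_class n J \<alpha> x + arc_class n J \<alpha> y"
proof -
  let ?R = "relative_homology_group 1 (pos_space n J) (link_set J)"
  let ?Q = "relative_homology_group 1 (face_space n J) (near_zero J)"
  let ?d = "hom_boundary 1 (pos_space n J) (link_set J)"
  obtain u where u: "u \<in> carrier ?R" "excision_map n J u = rel_to_face n J x"
    by (rule excision_map_obtain[OF J hom_induced_carrier])
  obtain v where v: "v \<in> carrier ?R" "excision_map n J v = rel_to_face n J y"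
    by (rule excision_map_obtain[OF J hom_induced_carrier])
  interpret R: comm_group ?R by simp
  have "excision_map n J (u \<otimes>\<^bsub>?R\<^esub> v) = rel_to_face n J x \<otimes>\<^bsub>?Q\<^esub> rel_to_face n J y"
    using hom_mult[OF hom_induced_hom u(1) v(1)] u(2) v(2) by metis
  also have "\<dots> = rel_to_face n J (x \<otimes>\<^bsub>homology_group 1 (polygon_space n)\<^esub> y)"
    using hom_mult[OF hom_induced_hom x y] by metis
  finally have "arc_class n J \<alpha> (x \<otimes>\<^bsub>homology_group 1 (polygon_space n)\<^esub> y)
      = H0_label (link_space n J) (link_label J \<alpha>) (?d (u \<otimes>\<^bsub>?R\<^esub> v))"
    using u v by (intro arc_class_eq[OF J]) auto
  also have "?d (u \<otimes>\<^bsub>?R\<^esub> v) = ?d u \<otimes>\<^bsub>homology_group 0 (link_space n J)\<^esub> ?d v"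
    using hom_mult[OF hom_boundary_hom u(1) v(1)] by (simp add: link_space_def)
  finally show ?thesis
    using H0_label_mult[OF continuous_map_link_label[OF J \<alpha>] link_boundary_carrier link_boundary_carrier]
      arc_class_eq[OF J u] arc_class_eq[OF J v] by metis
qed

text \<open>By \<open>conn\<close> the labels separate the components of the link, so the boundary
  of the excised class is trivial. The class then comes from the absolute homology of the positive
  part, which is contractible.\<close>

lemma rel_to_face_eq_one:
  assumes J: "J \<subseteq> {1..n}" and n: "n \<ge> 1" and \<alpha>: "arc_label n J \<alpha>"
    and conn: "\<And>i i'. i \<in> J \<Longrightarrow> i' \<in> J \<Longrightarrow> \<alpha> i = \<alpha> i' \<Longrightarrow> (i, i') \<in> (arc_adj n J)\<^sup>*"
    and 0: "arc_class n J \<alpha> x = 0"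
  shows "rel_to_face n J x = \<one>\<^bsub>relative_homology_group 1 (face_space n J) (near_zero J)\<^esub>"
proof -
  let ?P = "pos_space n J"
  obtain u where u: "u \<in> carrier (relative_homology_group 1 ?P (link_set J))" "excision_map n J u = rel_to_face n J x"
    by (rule excision_map_obtain[OF J hom_induced_carrier])
  have "hom_boundary 1 ?P (link_set J) u = \<one>\<^bsub>homology_group 0 (link_space n J)\<^esub>"
    by (rule H0_label_inj[OF continuous_map_link_label[OF J \<alpha>] path_connectedin_link_fiber[OF J \<alpha> conn] link_boundary_carrier])
       (use 0 arc_class_eq[OF J u, of \<alpha>] in simp_all)
  then have "hom_boundary 1 ?P (link_set J) u = \<one>\<^bsub>homology_group (1 - 1) (subtopology ?P (link_set J))\<^esub>"
    by (simp add: link_space_def)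
  then obtain y where y: "y \<in> carrier (homology_group 1 ?P)" "u = hom_induced 1 ?P {} ?P (link_set J) id y"
    by (rule hom_boundary_one_imp[OF u(1)])
  have "trivial_group (homology_group 1 ?P)"
    using trivial_reduced_homology_group_contractible_space[OF contractible_pos_space[OF n J], of 1]
    by (simp add: un_reduced_homology_group)
  then have "y = \<one>\<^bsub>homology_group 1 ?P\<^esub>" using y(1) by (auto simp: trivial_group_def)
  then have "u = \<one>\<^bsub>relative_homology_group 1 ?P (link_set J)\<^esub>" using y(2) hom_induced_one by metis
  then show ?thesis using u(2) hom_induced_one by metis
qed

text \<open>The boundary of a relative class dies in the positive part, and inclusion preserves the
  augmentation, so the coefficients add up to 0.\<close>

lemma arc_class_keys_total:
  assumes J: "J \<subseteq> {1..n}" and \<alpha>: "arc_label n J \<alpha>"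
  shows "Poly_Mapping.keys (arc_class n J \<alpha> x) \<subseteq> \<alpha> ` J" and "frag_extend (\<lambda>_. frag_of ()) (arc_class n J \<alpha> x) = 0"
proof -
  let ?P = "pos_space n J" let ?L = "link_space n J"
  obtain u where u: "u \<in> carrier (relative_homology_group 1 ?P (link_set J))" "excision_map n J u = rel_to_face n J x"
    by (rule excision_map_obtain[OF J hom_induced_carrier])
  let ?y = "hom_boundary 1 ?P (link_set J) u"
  obtain c where c: "singular_relcycle 0 ?L {} c" "?y = homologous_rel_set 0 ?L {} c"
    by (rule H0_cycle_obtain[OF link_boundary_carrier])
  have ac: "arc_class n J \<alpha> x = label_chain (link_label J \<alpha>) c"
    using arc_class_eq[OF J u] H0_label_eq[OF continuous_map_link_label[OF J \<alpha>] c(1)] c(2) by metis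
  have "link_label J \<alpha> y \<in> \<alpha> ` J" if y: "y \<in> topspace ?L" for y
  proof -
    obtain i where i: "i \<in> J" "y i < 1/2" using y unfolding topspace_link_space[OF J] by blast
    have "y \<in> topspace ?P" using y J by (simp add: topspace_link_space)
    from link_label_eq[OF J \<alpha> this i(1)] show ?thesis using i by simp
  qed
  moreover have "f vertex0 \<in> topspace ?L" if "f \<in> Poly_Mapping.keys c" for f
  proof -
    have "singular_simplex 0 ?L f" using c(1) that by (auto simp: singular_cycle singular_chain_def)
    then show ?thesis using vertex0_in[of 0] by (auto simp: singular_simplex_def continuous_map_def)
  qed
  ultimately show "Poly_Mapping.keys (arc_class n J \<alpha> x) \<subseteq> \<alpha> ` J"
    unfolding ac label_chain_def by (intro order_trans[OF keys_frag_extend] UN_least) auto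
  have "hom_induced 0 ?L {} ?P {} id ?y = \<one>\<^bsub>homology_group 0 ?P\<^esub>"
    using hom_induced_boundary[OF u(1)] by (simp add: link_space_def)
  moreover have cont: "continuous_map ?L ?P id"
    unfolding link_space_def by (rule continuous_map_from_subtopology) simp
  have "H0_label ?P (\<lambda>_. ()) (hom_induced 0 ?L {} ?P {} id ?y) = H0_label ?L (\<lambda>_. ()) ?y"
    by (rule H0_label_natural[OF _ _ cont _ link_boundary_carrier, where U = UNIV and U' = UNIV]) auto
  moreover have "H0_label ?P (\<lambda>_. ()) \<one>\<^bsub>homology_group 0 ?P\<^esub> = 0"
    by (rule H0_label_one[where U = UNIV]) simp
  moreover have "H0_label ?L (\<lambda>_. ()) ?y = label_chain (\<lambda>_. ()) c"
    unfolding c(2) by (rule H0_label_eq[OF _ c(1), where U = UNIV]) simp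
  ultimately have "label_chain (\<lambda>_. ()) c = 0" by simp
  moreover have "label_chain (\<lambda>_. ()) c = frag_extend (\<lambda>_. frag_of ()) (label_chain (link_label J \<alpha>) c)"
    using label_chain_relabel[of "\<lambda>_. ()" "link_label J \<alpha>" c] by (simp add: o_def)
  ultimately show "frag_extend (\<lambda>_. frag_of ()) (arc_class n J \<alpha> x) = 0" by (simp add: ac)
qed

lemma face_inclusion: "continuous_map (face_space n J) (polygon_space n) id"
  unfolding face_space_def by (rule continuous_map_from_subtopology) simp

lemma rel_to_face_inclusion:
  assumes "z \<in> carrier (homology_group 1 (face_space n J))"
  shows "rel_to_face n J (hom_induced 1 (face_space n J) {} (polygon_space n) {} id z)
    = hom_induced 1 (face_space n J) {} (face_space n J) (near_zero J) id z"
proof -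
  have "rel_to_face n J (hom_induced 1 (face_space n J) {} (polygon_space n) {} id z)
    = hom_induced 1 (face_space n J) {} (face_space n J) (near_zero J) (coord_restrict n J \<circ> id) z"
    by (rule hom_induced_compose'[OF face_inclusion _ continuous_map_coord_restrict_face]) auto
  also have "hom_induced 1 (face_space n J) {} (face_space n J) (near_zero J) (coord_restrict n J \<circ> id) =
    hom_induced 1 (face_space n J) {} (face_space n J) (near_zero J) id"
    by (rule hom_induced_eq) (auto simp: topspace_face_space intro: coord_restrict_id)
  finally show ?thesis .
qed

text \<open>The boundary of y has augmentation 0, since it dies in the face; as
  \<open>near_zero J\<close> is path connected there, this boundary is trivial and y lifts.\<close>

lemma relativization_surj:
  assumes J: "J \<subseteq> {1..n}" "J \<noteq> {}" and y: "y \<in> carrier (relative_homology_group 1 (face_space n J) (near_zero J))"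
  obtains z where "z \<in> carrier (homology_group 1 (face_space n J))"
    "y = hom_induced 1 (face_space n J) {} (face_space n J) (near_zero J) id z"
proof -
  let ?Z = "face_space n J" let ?T = "subtopology ?Z (near_zero J)"
  let ?d = "hom_boundary 1 ?Z (near_zero J) y"
  have d: "?d \<in> carrier (homology_group 0 ?T)" using hom_boundary_carrier[of 1 ?Z "near_zero J" y] by simp
  have cont: "continuous_map ?T ?Z id" by (rule continuous_map_from_subtopology) simp
  have "hom_induced 0 ?T {} ?Z {} id ?d = \<one>\<^bsub>homology_group 0 ?Z\<^esub>"
    using hom_induced_boundary[OF y] by simp
  moreover have "H0_label ?Z (\<lambda>_. ()) (hom_induced 0 ?T {} ?Z {} id ?d) = H0_label ?T (\<lambda>_. ()) ?d"
    by (rule H0_label_natural[OF _ _ cont _ d, where U = UNIV and U' = UNIV]) auto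
  moreover have "H0_label ?Z (\<lambda>_. ()) \<one>\<^bsub>homology_group 0 ?Z\<^esub> = 0"
    by (rule H0_label_one[where U = UNIV]) simp
  ultimately have "H0_label ?T (\<lambda>_. ()) ?d = 0" by simp
  then have "?d = \<one>\<^bsub>homology_group 0 ?T\<^esub>"
    by (rule H0_label_unit_inj[OF path_connected_near_zero[OF J] d])
  then have "?d = \<one>\<^bsub>homology_group (1 - 1) ?T\<^esub>" by simp
  from hom_boundary_one_imp[OF y this] show ?thesis using that by blast
qed

text \<open>The points dented at one chosen vertex per label, with multiplicities v, form a 0-cycle
  of augmentation 0 in the link. It bounds in the contractible positive part, which yields a
  relative class of the face, and this lifts to an absolute one.\<close>

lemma arc_class_surj:
  assumes J: "J \<subseteq> {1..n}" "J \<noteq> {}" and n: "n \<ge> 1" and \<alpha>: "arc_label n J \<alpha>"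
    and v: "Poly_Mapping.keys v \<subseteq> \<alpha> ` J" "frag_extend (\<lambda>_. frag_of ()) v = 0"
  obtains z where "z \<in> carrier (homology_group 1 (face_space n J))"
    "arc_class n J \<alpha> (hom_induced 1 (face_space n J) {} (polygon_space n) {} id z) = v"
proof -
  let ?P = "pos_space n J" let ?L = "link_space n J" let ?Z = "face_space n J"
  \<comment> \<open>The 0-simplex at the point dented at a chosen vertex with label b.\<close>
  define f where "f b = restrict (\<lambda>_. dent n J {inv_into J \<alpha> b}) (standard_simplex 0)" for b
  have i: "inv_into J \<alpha> b \<in> J" "\<alpha> (inv_into J \<alpha> b) = b" if "b \<in> \<alpha> ` J" for b
    using that by (auto intro: inv_into_into f_inv_into_f)
  have d: "dent n J {inv_into J \<alpha> b} \<in> topspace ?L" if "b \<in> \<alpha> ` J" for b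
    using dent_in[OF J(1) i(1)[OF that]] by blast
  have f: "singular_simplex 0 ?L (f b)" if "b \<in> \<alpha> ` J" for b
    using d[OF that] by (simp add: singular_simplex_def f_def)
  have lab: "link_label J \<alpha> (f b vertex0) = b" if b: "b \<in> \<alpha> ` J" for b
  proof -
    have "dent n J {inv_into J \<alpha> b} \<in> topspace ?P" using d[OF b] J by (simp add: topspace_link_space)
    moreover have "dent n J {inv_into J \<alpha> b} (inv_into J \<alpha> b) < 1" using i(1)[OF b] J by (auto simp: dent_def)
    ultimately have "link_label J \<alpha> (dent n J {inv_into J \<alpha> b}) = b"
      using link_label_eq[OF J(1) \<alpha> _ i(1)[OF b]] i(2)[OF b] by simp
    then show ?thesis using vertex0_in[of 0] by (simp add: f_def)
  qed
  define c where "c = frag_extend (\<lambda>b. frag_of (f b)) v"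
  have ch: "singular_chain 0 ?L c"
    unfolding c_def by (rule singular_chain_extend) (use v(1) f in \<open>auto simp: singular_chain_of\<close>)
  then have cyc: "singular_relcycle 0 ?L {} c" by (simp add: singular_cycle chain_boundary_def)
  have lc: "label_chain (link_label J \<alpha>) c = v"
  proof -
    have "label_chain (link_label J \<alpha>) c = frag_extend (\<lambda>b. frag_of (link_label J \<alpha> (f b vertex0))) v"
      by (simp add: c_def label_chain_def frag_extend_compose2)
    also have "\<dots> = frag_extend frag_of v" by (rule frag_extend_eq) (use v(1) lab in auto)
    finally show ?thesis using frag_expansion[of v] by simp
  qed
  let ?y = "homologous_rel_set 0 ?L {} c"
  have y: "?y \<in> carrier (homology_group 0 ?L)" using cyc by (auto simp: carrier_relative_homology_group_0)
  have cont: "continuous_map ?L ?P id"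
    unfolding link_space_def by (rule continuous_map_from_subtopology) simp
  have "H0_label ?P (\<lambda>_. ()) (hom_induced 0 ?L {} ?P {} id ?y) = H0_label ?L (\<lambda>_. ()) ?y"
    by (rule H0_label_natural[OF _ _ cont _ y, where U = UNIV and U' = UNIV]) auto
  also have "\<dots> = label_chain (\<lambda>_. ()) c" by (rule H0_label_eq[OF _ cyc, where U = UNIV]) simp
  also have "\<dots> = 0"
    using label_chain_relabel[of "\<lambda>_. ()" "link_label J \<alpha>" c] v(2) lc by (simp add: o_def)
  finally have "hom_induced 0 ?L {} ?P {} id ?y = \<one>\<^bsub>homology_group 0 ?P\<^esub>"
    by (rule H0_label_unit_inj[OF contractible_imp_path_connected_space[OF contractible_pos_space[OF n J(1)]] hom_induced_carrier])
  then obtain u where u: "u \<in> carrier (relative_homology_group 1 ?P (link_set J))" "?y = hom_boundary 1 ?P (link_set J) u"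
    using hom_boundary_obtain[of ?y 1 ?P "link_set J"] y by (auto simp: link_space_def)
  obtain z where z: "z \<in> carrier (homology_group 1 ?Z)" "excision_map n J u = hom_induced 1 ?Z {} ?Z (near_zero J) id z"
    by (rule relativization_surj[OF J hom_induced_carrier])
  have "arc_class n J \<alpha> (hom_induced 1 ?Z {} (polygon_space n) {} id z) = H0_label ?L (link_label J \<alpha>) (hom_boundary 1 ?P (link_set J) u)"
    by (rule arc_class_eq[OF J(1) u(1)]) (simp add: z(2) rel_to_face_inclusion[OF z(1)])
  also have "\<dots> = v" using u(2) H0_label_eq[OF continuous_map_link_label[OF J(1) \<alpha>] cyc] lc by simp
  finally show ?thesis using that z(1) by blast
qed

lemma arc_class_one:
  assumes J: "J \<subseteq> {1..n}" and \<alpha>: "arc_label n J \<alpha>"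
    and "rel_to_face n J x = \<one>\<^bsub>relative_homology_group 1 (face_space n J) (near_zero J)\<^esub>"
  shows "arc_class n J \<alpha> x = 0"
proof -
  let ?R = "relative_homology_group 1 (pos_space n J) (link_set J)"
  have "arc_class n J \<alpha> x = H0_label (link_space n J) (link_label J \<alpha>) (hom_boundary 1 (pos_space n J) (link_set J) \<one>\<^bsub>?R\<^esub>)"
    using assms(3) hom_induced_one[of 1 "pos_space n J" "link_set J" "face_space n J" "near_zero J" id]
    by (intro arc_class_eq[OF J]) (auto intro!: group.is_monoid monoid.one_closed)
  also have "hom_boundary 1 (pos_space n J) (link_set J) \<one>\<^bsub>?R\<^esub> = \<one>\<^bsub>homology_group 0 (link_space n J)\<^esub>"
    using hom_boundary_one[of 1 "pos_space n J" "link_set J"] by (simp add: link_space_def)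
  also have "H0_label (link_space n J) (link_label J \<alpha>) \<dots> = 0"
    by (rule H0_label_one[OF continuous_map_link_label[OF J \<alpha>]])
  finally show ?thesis .
qed

text \<open>The restricted points have coordinate i equal to 0, so the map to the face J lands in
  \<open>near_zero J\<close> and the relative class vanishes. This is the source of triangularity: a
  class living on the face I has no coefficients at sets not contained in I.\<close>

lemma arc_class_coord_restrict:
  assumes J: "J \<subseteq> {1..n}" and \<alpha>: "arc_label n J \<alpha>" and i: "i \<in> J" "i \<notin> I"
    and x: "x \<in> carrier (homology_group 1 (polygon_space n))"
  shows "arc_class n J \<alpha> (hom_induced 1 (polygon_space n) {} (polygon_space n) {} (coord_restrict n I) x) = 0"
proof (rule arc_class_one[OF J \<alpha>])
  let ?X = "polygon_space n" let ?Z = "face_space n J"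
  let ?r = "coord_restrict n J \<circ> coord_restrict n I"
  have "rel_to_face n J (hom_induced 1 ?X {} ?X {} (coord_restrict n I) x) = hom_induced 1 ?X {} ?Z (near_zero J) ?r x"
    by (rule hom_induced_compose'[OF continuous_map_coord_restrict _ continuous_map_coord_restrict_face]) auto
  also have "continuous_map ?X (subtopology ?Z (near_zero J)) ?r"
    unfolding continuous_map_in_subtopology
    using continuous_map_compose[OF continuous_map_coord_restrict continuous_map_coord_restrict_face] i J
    by (force simp: near_zero_def coord_restrict_def)
  then have "hom_induced 1 ?X {} ?Z (near_zero J) ?r x = \<one>\<^bsub>relative_homology_group 1 ?Z (near_zero J)\<^esub>"
    by (rule hom_induced_into_subset[OF _ x])
  finally show "rel_to_face n J (hom_induced 1 ?X {} ?X {} (coord_restrict n I) x) = \<one>\<^bsub>relative_homology_group 1 ?Z (near_zero J)\<^esub>" .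
qed

lemma squash_coord: "i \<in> {1..n} \<Longrightarrow> squash n x i = max 0 (2 * x i - 1)"
  by (simp add: squash_def)

abbreviation drop_coord :: "nat \<Rightarrow> nat \<Rightarrow> (nat \<Rightarrow> real) \<Rightarrow> nat \<Rightarrow> real" where
  "drop_coord n i \<equiv> coord_restrict n (UNIV - {i})"

abbreviation restrict_hom where
  "restrict_hom n J \<equiv> hom_induced 1 (polygon_space n) {} (polygon_space n) {} (coord_restrict n J)"

section \<open>Vanishing of classes\<close>

lemma restrict_hom_compose:
  "restrict_hom n I (restrict_hom n J x) = restrict_hom n (I \<inter> J) x"
proof -
  have "restrict_hom n I (restrict_hom n J x)
      = hom_induced 1 (polygon_space n) {} (polygon_space n) {} (coord_restrict n I \<circ> coord_restrict n J) x"
    by (rule hom_induced_compose'[OF continuous_map_coord_restrict _ continuous_map_coord_restrict]) auto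
  also have "coord_restrict n I \<circ> coord_restrict n J = coord_restrict n (I \<inter> J)"
    by (simp add: fun_eq_iff coord_restrict_compose)
  finally show ?thesis .
qed

lemma restrict_hom_factor:
  "restrict_hom n J x = hom_induced 1 (face_space n J) {} (polygon_space n) {} id
     (hom_induced 1 (polygon_space n) {} (face_space n J) {} (coord_restrict n J) x)"
  by (subst hom_induced_compose'[OF continuous_map_coord_restrict_face _ face_inclusion]) auto

text \<open>Subdivision makes one coordinate in J smaller than 1/2 on each simplex, not 0. Composing
  with \<open>squash\<close> makes it 0 without changing the class, and only then is the simplex
  fixed by \<open>drop_coord n i\<close> as a function.\<close>

lemma near_zero_class_vanishes:
  assumes J: "J \<subseteq> {1..n}"
    and t: "t \<in> carrier (homology_group 1 (subtopology (face_space n J) (near_zero J)))"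
    and 0: "\<And>i. i \<in> J \<Longrightarrow> restrict_hom n (UNIV - {i})
       (hom_induced 1 (subtopology (face_space n J) (near_zero J)) {} (polygon_space n) {} id t) = \<one>\<^bsub>homology_group 1 (polygon_space n)\<^esub>"
  shows "hom_induced 1 (subtopology (face_space n J) (near_zero J)) {} (polygon_space n) {} id t = \<one>\<^bsub>homology_group 1 (polygon_space n)\<^esub>"
proof -
  let ?X = "polygon_space n" let ?T = "subtopology (face_space n J) (near_zero J)"
  let ?U = "\<lambda>i. {x \<in> topspace ?T. x i < 1/2}"
  have "t \<in> homologous_rel_set 1 ?T {} ` singular_relcycle_set 1 ?T {}"
    using t carrier_relative_homology_group[of 1 ?T "{}"] by simp
  then obtain c where c: "singular_relcycle 1 ?T {} c" "t = homologous_rel_set 1 ?T {} c" by blast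
  have op: "openin ?T U" if U: "U \<in> ?U ` J" for U
  proof -
    obtain i where i: "i \<in> J" "U = ?U i" using U by blast
    then have iN: "i \<in> {1..n}" using J by blast
    have "U = {x \<in> topspace (face_space n J). x i < 1/2} \<inter> near_zero J" using i by (auto simp: near_zero_def)
    then show ?thesis using openin_face_less[OF iN, of J "1/2"] by (auto simp: openin_subtopology)
  qed
  have cover: "topspace ?T \<subseteq> \<Union> (?U ` J)" by (auto simp: near_zero_def)
  obtain c' where c': "singular_relcycle 1 ?T {} c'" "homologous_rel 1 ?T {} c c'"
    "\<And>f. f \<in> Poly_Mapping.keys c' \<Longrightarrow> \<exists>V\<in>?U ` J. f \<in> standard_simplex 1 \<rightarrow> V"
    by (rule small_homologous_rel_relcycle_exists[OF op cover c(1)]) (assumption, rule that, assumption, assumption, blast)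
  have t': "t = homologous_rel_set 1 ?T {} c'" using c(2) c'(2) by (simp add: homologous_rel_set_eq)
  have TX: "continuous_map ?T ?X id"
    unfolding face_space_def by (intro continuous_map_from_subtopology) simp
  have hi: "hom_induced 1 Y {} Z {} g (homologous_rel_set 1 Y {} d) = homologous_rel_set 1 Z {} (chain_map 1 g d)"
    if "continuous_map Y Z g" "singular_relcycle 1 Y {} d" for Y :: "(nat \<Rightarrow> real) topology" and Z :: "(nat \<Rightarrow> real) topology" and g d
    using hom_induced_chain_map[OF that(1) _ that(2), of "{}"] by simp
  have sub: "singular_relcycle 1 ?X {} c'"
    using singular_relcycle_chain_map[OF c'(1) TX, of "{}"] chain_map_id_gen[of 1 ?T c' id] c'(1)
    by (simp add: singular_cycle)
  have idc: "chain_map 1 id c' = c'" using chain_map_id_gen[of 1 ?T c' id] c'(1) by (simp add: singular_cycle)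
  have cq: "continuous_map ?X ?X (squash n)"
    using homotopic_with_imp_continuous_maps[OF squash_homotopic_id] by simp
  \<comment> \<open>The flattened cycle: same class, and each of its simplices lies in some
    hyperplane of J.\<close>
  let ?c0 = "chain_map 1 (squash n) c'"
  have c0: "singular_relcycle 1 ?X {} ?c0" using singular_relcycle_chain_map[OF sub cq] by simp
  let ?y = "hom_induced 1 ?T {} ?X {} id t"
  have y1: "?y = homologous_rel_set 1 ?X {} c'" using hi[OF TX c'(1)] t' idc by simp
  have "hom_induced 1 ?X {} ?X {} id = hom_induced 1 ?X {} ?X {} (squash n)"
    by (rule homology_homotopy_empty[OF squash_homotopic_id])
  then have y: "?y = homologous_rel_set 1 ?X {} ?c0"
    using hi[OF cq sub] y1 hom_induced_id[of ?y 1 ?X "{}"] hom_induced_carrier[of 1 ?T "{}" ?X "{}" id t] by metis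
  obtain xs where xs: "set xs = J" using finite_list[OF finite_subset[OF J finite_atLeastAtMost]] by blast
  let ?f = "fold (\<lambda>i. kill 1 (drop_coord n i)) xs ?c0"
  have "?f = 0"
  proof (rule fold_kill_small)
    show "drop_coord n i (drop_coord n j x) = drop_coord n j (drop_coord n i x)" for i j x
      by (simp add: coord_restrict_compose Int_commute)
    fix f assume "f \<in> Poly_Mapping.keys ?c0"
    then obtain g where g: "g \<in> Poly_Mapping.keys c'" "f = simplex_map 1 (squash n) g"
      using keys_frag_extend[of "frag_of \<circ> simplex_map 1 (squash n)" c'] by (auto simp: chain_map_def)
    obtain i where i: "i \<in> J" "g \<in> standard_simplex 1 \<rightarrow> ?U i" using c'(3)[OF g(1)] by blast
    have iN: "i \<in> {1..n}" using i J by blast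
    have "drop_coord n i (f s) = f s" if s: "s \<in> standard_simplex 1" for s
    proof -
      have "g s i < 1/2" using i(2) s by auto
      then have "squash n (g s) i = 0" using iN by (simp add: squash_coord)
      then show ?thesis using s g(2)
        by (auto simp: simplex_map_def coord_restrict_def squash_def fun_eq_iff)
    qed
    then show "f \<in> extensional (standard_simplex 1) \<and> (\<exists>i\<in>set xs. \<forall>s\<in>standard_simplex 1. drop_coord n i (f s) = f s)"
      using i(1) xs g(2) by (auto simp: simplex_map_def)
  qed
  moreover have "homologous_rel 1 ?X {} ?f ?c0"
  proof (rule fold_kill_homologous[OF continuous_map_coord_restrict c0])
    fix i assume "i \<in> set xs"
    then have "restrict_hom n (UNIV - {i}) ?y = \<one>\<^bsub>homology_group 1 ?X\<^esub>" using 0 xs by blast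
    then have "homologous_rel_set 1 ?X {} (chain_map 1 (drop_coord n i) ?c0) = \<one>\<^bsub>homology_group 1 ?X\<^esub>"
      using hi[OF continuous_map_coord_restrict c0, of "UNIV - {i}"] y by metis
    then show "singular_relboundary 1 ?X {} (chain_map 1 (drop_coord n i) ?c0)"
      using homologous_rel_set_eq_one_iff[of 1 ?X "{}"] by simp
  qed
  ultimately have "singular_relboundary 1 ?X {} ?c0"
    by (metis homologous_rel_def homologous_rel_sym diff_zero)
  then show ?thesis using homologous_rel_set_eq_one_iff[of 1 ?X "{}"] y by simp
qed

text \<open>The face on the empty set is the origin alone, which has no homology in degree
  1.\<close>

lemma restrict_hom_empty:
  assumes n: "n \<ge> 1" and x: "x \<in> carrier (homology_group 1 (polygon_space n))"
  shows "restrict_hom n {} x = \<one>\<^bsub>homology_group 1 (polygon_space n)\<^esub>"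
proof -
  let ?o = "\<lambda>i\<in>{1..n}. 0::real"
  have "topspace (face_space n {}) = {?o}"
  proof
    show "topspace (face_space n {}) \<subseteq> {?o}"
      by (auto simp: topspace_face_space topspace_polygon_space_iff extensional_def fun_eq_iff)
    show "{?o} \<subseteq> topspace (face_space n {})"
      using n by (auto simp: topspace_face_space topspace_polygon_space_iff intro!: bexI[of _ 1])
  qed
  then have "trivial_group (homology_group 1 (face_space n {}))" by (rule homology_dimension_axiom) simp
  then have "hom_induced 1 (polygon_space n) {} (face_space n {}) {} (coord_restrict n {}) x = \<one>\<^bsub>homology_group 1 (face_space n {})\<^esub>"
    using hom_induced_carrier by (fastforce simp: trivial_group_def)
  then show ?thesis unfolding restrict_hom_factor using hom_induced_one by simp
qed

text \<open>Induction on the size of J: the hypothesis pushes the restricted class into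
  \<open>near_zero J\<close>, and its restrictions to the smaller sets \<open>J - {i}\<close> vanish
  already. The full set J gives back x.\<close>

lemma homology_eq_one:
  assumes n: "n \<ge> 1" and x: "x \<in> carrier (homology_group 1 (polygon_space n))"
    and rel: "\<And>J. J \<subseteq> {1..n} \<Longrightarrow> J \<noteq> {} \<Longrightarrow> rel_to_face n J x = \<one>\<^bsub>relative_homology_group 1 (face_space n J) (near_zero J)\<^esub>"
  shows "x = \<one>\<^bsub>homology_group 1 (polygon_space n)\<^esub>"
proof -
  let ?X = "polygon_space n"
  have "restrict_hom n J x = \<one>\<^bsub>homology_group 1 ?X\<^esub>" if "J \<subseteq> {1..n}" for J
    using that
  proof (induction "card J" arbitrary: J rule: less_induct)
    case less
    let ?Z = "face_space n J" let ?T = "subtopology ?Z (near_zero J)"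
    show ?case
    proof (cases "J = {}")
      case True
      then show ?thesis using restrict_hom_empty[OF n x] by simp
    next
      case False
      let ?z = "hom_induced 1 ?X {} ?Z {} (coord_restrict n J) x"
      have "hom_induced 1 ?Z {} ?Z (near_zero J) id ?z = rel_to_face n J x"
        by (subst hom_induced_compose'[OF continuous_map_coord_restrict_face]) auto
      also have "\<dots> = \<one>\<^bsub>relative_homology_group 1 ?Z (near_zero J)\<^esub>" by (rule rel[OF less.prems False])
      finally obtain t where t: "t \<in> carrier (homology_group 1 ?T)" "?z = hom_induced 1 ?T {} ?Z {} id t"
        by (rule hom_induced_relative_one_imp[OF hom_induced_carrier])
      have TZ: "continuous_map ?T ?Z id" by (rule continuous_map_from_subtopology) simp
      have eq: "restrict_hom n J x = hom_induced 1 ?T {} ?X {} id t"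
        unfolding restrict_hom_factor t(2) by (subst hom_induced_compose'[OF TZ _ face_inclusion]) auto
      show ?thesis
        unfolding eq
      proof (rule near_zero_class_vanishes[OF less.prems t(1)])
        fix i assume i: "i \<in> J"
        have "card (J - {i}) < card J" using i finite_subset[OF less.prems] by (intro psubset_card_mono) auto
        then have "restrict_hom n (J - {i}) x = \<one>\<^bsub>homology_group 1 ?X\<^esub>" using less by blast
        moreover have "(UNIV - {i}) \<inter> J = J - {i}" by auto
        ultimately show "restrict_hom n (UNIV - {i}) (hom_induced 1 ?T {} ?X {} id t) = \<one>\<^bsub>homology_group 1 ?X\<^esub>"
          unfolding eq[symmetric] restrict_hom_compose by simp
      qed
    qed
  qed
  then have "restrict_hom n {1..n} x = \<one>\<^bsub>homology_group 1 ?X\<^esub>" by blast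
  moreover have "restrict_hom n {1..n} x = x"
    by (rule hom_induced_id_gen[OF continuous_map_coord_restrict _ x]) (auto intro: coord_restrict_id)
  ultimately show ?thesis by simp
qed

section \<open>Rotations of the vertices and their effect on arc classes\<close>

lemma cyc_succ_in: "n \<ge> 1 \<Longrightarrow> cyc_succ n i \<in> {1..n}"
  by (simp add: cyc_succ_def Suc_leI)

lemma inj_on_cyc_succ: "inj_on (cyc_succ n) {1..n}"
proof (rule inj_onI)
  fix i j assume "i \<in> {1..n}" "j \<in> {1..n}" "cyc_succ n i = cyc_succ n j"
  then show "i = j" by (cases "i = n"; cases "j = n") (auto simp: cyc_succ_def)
qed

lemma cyclic_shift_apply: "i \<in> {1..n} \<Longrightarrow> cyclic_shift n x i = x (cyc_succ n i)"
  by (simp add: cyclic_shift_def cyc_succ_def)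

abbreviation shift_hom where
  "shift_hom n \<equiv> hom_induced 1 (polygon_space n) {} (polygon_space n) {} (cyclic_shift n)"

lemma cyc_succ_image_iff:
  "J \<subseteq> {1..n} \<Longrightarrow> i \<in> {1..n} \<Longrightarrow> cyc_succ n i \<in> cyc_succ n ` J \<longleftrightarrow> i \<in> J"
  using inj_on_cyc_succ by (rule inj_on_image_mem_iff) 

text \<open>Off the link no coordinate in J need be below 1 and the two link labels may differ
  there; naturality along the identity compares them on the link only.\<close>

lemma arc_class_cong:
  assumes J: "J \<subseteq> {1..n}" and \<alpha>: "arc_label n J \<alpha>" and \<beta>: "arc_label n J \<beta>" and eq: "\<And>i. i \<in> J \<Longrightarrow> \<alpha> i = \<beta> i"
  shows "arc_class n J \<alpha> x = arc_class n J \<beta> x"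
proof -
  let ?L = "link_space n J"
  obtain u where u: "u \<in> carrier (relative_homology_group 1 (pos_space n J) (link_set J))" "excision_map n J u = rel_to_face n J x"
    by (rule excision_map_obtain[OF J hom_induced_carrier])
  let ?y = "hom_boundary 1 (pos_space n J) (link_set J) u"
  have lab: "link_label J \<alpha> p = link_label J \<beta> p" if p: "p \<in> topspace ?L" for p
  proof -
    obtain i where i: "i \<in> J" "p i < 1/2" using p unfolding topspace_link_space[OF J] by blast
    have "p \<in> topspace (pos_space n J)" using p J by (simp add: topspace_link_space)
    from link_label_eq[OF J \<alpha> this i(1)] link_label_eq[OF J \<beta> this i(1)] show ?thesis using i eq by simp
  qed
  have "H0_label ?L (link_label J \<alpha>) (hom_induced 0 ?L {} ?L {} id ?y) = H0_label ?L (link_label J \<beta>) ?y"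
    using lab by (intro H0_label_natural[OF continuous_map_link_label[OF J \<beta>] continuous_map_link_label[OF J \<alpha>] _ _ link_boundary_carrier]) auto
  then show ?thesis
    unfolding hom_induced_id[OF link_boundary_carrier] by (simp only: arc_class_eq[OF J u])
qed

lemma arc_class_relabel: "arc_class n J (h \<circ> \<alpha>) x = frag_extend (\<lambda>b. frag_of (h b)) (arc_class n J \<alpha> x)"
proof -
  have "link_label J (h \<circ> \<alpha>) = h \<circ> link_label J \<alpha>" by (simp add: link_label_def fun_eq_iff)
  then show ?thesis by (simp add: arc_class_def H0_label_def label_chain_relabel)
qed

lemma arc_class_shift:
  assumes n: "n \<ge> 1" and J: "J \<subseteq> {1..n}" and \<alpha>: "arc_label n (cyc_succ n ` J) \<alpha>"
    and x: "x \<in> carrier (homology_group 1 (polygon_space n))"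
  shows "arc_class n J (\<alpha> \<circ> cyc_succ n) (shift_hom n x) = arc_class n (cyc_succ n ` J) \<alpha> x"
proof -
  let ?X = "polygon_space n" and ?s = "cyclic_shift n"
  let ?I = "cyc_succ n ` J"
  have I: "?I \<subseteq> {1..n}" using cyc_succ_in[OF n] by blast
  have JN: "i \<in> {1..n}" if "i \<in> J" for i using that J by blast
  have ap: "?s y i = y (cyc_succ n i)" if "i \<in> J" for i y using cyclic_shift_apply[OF JN[OF that]] .
  have \<alpha>': "arc_label n J (\<alpha> \<circ> cyc_succ n)" using \<alpha> by (auto simp: arc_label_def)
  have sX: "continuous_map ?X ?X ?s" using continuous_map_cyclic_shift[OF n] .
  have nz: "?s y \<in> near_zero J" if "y \<in> near_zero ?I" for y using that ap by (auto simp: near_zero_def)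
  have sz: "?s y \<in> some_zero J \<longleftrightarrow> y \<in> some_zero ?I" for y using ap by (auto simp: some_zero_def)
  have fz: "?s y \<in> topspace (face_space n J)" if "y \<in> topspace (face_space n ?I)" for y
  proof -
    have "?s y \<in> topspace ?X" using continuous_map_funspace[OF sX] that by (auto simp: topspace_face_space)
    moreover have "?s y i = 0" if "i \<in> {1..n} - J" for i
    proof -
      have "cyc_succ n i \<in> {1..n} - ?I" using that cyc_succ_in[OF n] cyc_succ_image_iff[OF J] by blast
      then show ?thesis using that \<open>y \<in> topspace (face_space n ?I)\<close> by (simp add: cyclic_shift_apply topspace_face_space)
    qed
    ultimately show ?thesis by (simp add: topspace_face_space)
  qed
  have sF: "continuous_map (face_space n ?I) (face_space n J) ?s"
  proof -
    have "continuous_map (face_space n ?I) ?X ?s" unfolding face_space_def by (rule continuous_map_from_subtopology[OF sX])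
    then show ?thesis unfolding face_space_def[of n J] continuous_map_in_subtopology
      using fz by (auto simp: topspace_face_space)
  qed
  have sP: "continuous_map (pos_space n ?I) (pos_space n J) ?s"
  proof -
    have "continuous_map (pos_space n ?I) (face_space n J) ?s" unfolding pos_space_def by (rule continuous_map_from_subtopology[OF sF])
    then show ?thesis unfolding pos_space_def[of n J] continuous_map_in_subtopology
      using fz sz by (auto simp: pos_space_def)
  qed
  have sB: "?s \<in> link_set ?I \<rightarrow> link_set J" using nz sz by blast
  have sL: "continuous_map (link_space n ?I) (link_space n J) ?s"
  proof -
    have "continuous_map (link_space n ?I) (pos_space n J) ?s" unfolding link_space_def by (rule continuous_map_from_subtopology[OF sP])
    then show ?thesis unfolding link_space_def[of n J] continuous_map_in_subtopology
      using sB by (auto simp: link_space_def)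
  qed
  obtain u where u: "u \<in> carrier (relative_homology_group 1 (pos_space n ?I) (link_set ?I))" "excision_map n ?I u = rel_to_face n ?I x"
    by (rule excision_map_obtain[OF I hom_induced_carrier])
  let ?u = "hom_induced 1 (pos_space n ?I) (link_set ?I) (pos_space n J) (link_set J) ?s u"
  have idPF: "continuous_map (pos_space n K) (face_space n K) id" for K
    unfolding pos_space_def by (rule continuous_map_from_subtopology) simp
  have sNZ: "?s \<in> near_zero ?I \<rightarrow> near_zero J" using nz by blast
  \<comment> \<open>The image of u under the shift is an excision preimage for the shifted class,
    since inclusion and coordinate restriction commute with the shift.\<close>
  have "excision_map n J ?u = hom_induced 1 (pos_space n ?I) (link_set ?I) (face_space n J) (near_zero J) (id \<circ> ?s) u"
    by (rule hom_induced_compose'[OF sP sB idPF]) auto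
  also have "\<dots> = hom_induced 1 (face_space n ?I) (near_zero ?I) (face_space n J) (near_zero J) ?s (excision_map n ?I u)"
    by (subst hom_induced_compose'[OF idPF _ sF sNZ]) auto
  also have "\<dots> = hom_induced 1 ?X {} (face_space n J) (near_zero J) (?s \<circ> coord_restrict n ?I) x"
    unfolding u(2) by (rule hom_induced_compose'[OF continuous_map_coord_restrict_face _ sF sNZ]) auto
  also have "?s \<circ> coord_restrict n ?I = coord_restrict n J \<circ> ?s"
  proof
    fix y
    show "(?s \<circ> coord_restrict n ?I) y = (coord_restrict n J \<circ> ?s) y"
    proof (rule extensionalityI[where A = "{1..n}"])
      fix i assume i: "i \<in> {1..n}"
      show "(?s \<circ> coord_restrict n ?I) y i = (coord_restrict n J \<circ> ?s) y i"
        using i cyc_succ_in[OF n, of i] cyc_succ_image_iff[OF J i] by (simp add: cyclic_shift_apply coord_restrict_def)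
    qed (auto simp: cyclic_shift_def coord_restrict_def)
  qed
  also have "hom_induced 1 ?X {} (face_space n J) (near_zero J) (coord_restrict n J \<circ> ?s) x = rel_to_face n J (shift_hom n x)"
    by (rule hom_induced_compose'[OF sX _ continuous_map_coord_restrict_face, symmetric]) auto
  finally have ex: "excision_map n J ?u = rel_to_face n J (shift_hom n x)" .
  have "arc_class n J (\<alpha> \<circ> cyc_succ n) (shift_hom n x)
      = H0_label (link_space n J) (link_label J (\<alpha> \<circ> cyc_succ n)) (hom_boundary 1 (pos_space n J) (link_set J) ?u)"
    by (rule arc_class_eq[OF J hom_induced_carrier ex])
  also have "hom_boundary 1 (pos_space n J) (link_set J) ?u
      = hom_induced 0 (link_space n ?I) {} (link_space n J) {} ?s (hom_boundary 1 (pos_space n ?I) (link_set ?I) u)"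
    using fun_cong[OF naturality_hom_induced[OF sP sB, of 1], of u] by (simp add: link_space_def)
  also have "H0_label (link_space n J) (link_label J (\<alpha> \<circ> cyc_succ n)) \<dots>
      = H0_label (link_space n ?I) (link_label ?I \<alpha>) (hom_boundary 1 (pos_space n ?I) (link_set ?I) u)"
  proof (rule H0_label_natural[OF continuous_map_link_label[OF I \<alpha>] continuous_map_link_label[OF J \<alpha>'] sL _ link_boundary_carrier])
    fix p assume p: "p \<in> topspace (link_space n ?I)"
    have sp: "?s p \<in> topspace (pos_space n J)"
      using continuous_map_funspace[OF sP] p I by (auto simp: topspace_link_space)
    obtain i where i: "i \<in> ?I" "p i < 1/2" using p unfolding topspace_link_space[OF I] by blast
    then obtain j where j: "j \<in> J" "i = cyc_succ n j" by blast
    have "p \<in> topspace (pos_space n ?I)" using p I by (simp add: topspace_link_space)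
    from link_label_eq[OF I \<alpha> this i(1)] have 1: "link_label ?I \<alpha> p = \<alpha> i" using i by simp
    have "?s p j < 1" using i j ap[OF j(1)] by simp
    from link_label_eq[OF J \<alpha>' sp j(1) this] show "link_label J (\<alpha> \<circ> cyc_succ n) (?s p) = link_label ?I \<alpha> p"
      using 1 j by simp
  qed
  also have "\<dots> = arc_class n ?I \<alpha> x" by (rule arc_class_eq[OF I u, symmetric])
  finally show ?thesis .
qed

section \<open>Walking backwards, and the arcs of a proper vertex set\<close>

definition cyc_pred :: "nat \<Rightarrow> nat \<Rightarrow> nat" where
  "cyc_pred n i = (if i = 1 then n else i - 1)"

lemma cyc_pred_in: "i \<in> {1..n} \<Longrightarrow> cyc_pred n i \<in> {1..n}"
  by (auto simp: cyc_pred_def)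

lemma cyc_succ_pred: "i \<in> {1..n} \<Longrightarrow> cyc_succ n (cyc_pred n i) = i"
  by (cases "i = 1") (auto simp: cyc_pred_def cyc_succ_def)

lemma cyc_pred_succ: "i \<in> {1..n} \<Longrightarrow> cyc_pred n (cyc_succ n i) = i"
  by (cases "i = n") (auto simp: cyc_pred_def cyc_succ_def)

lemma cyc_pred_pow_in: "i \<in> {1..n} \<Longrightarrow> (cyc_pred n ^^ k) i \<in> {1..n}"
proof (induction k)
  case (Suc k)
  then show ?case using cyc_pred_in[of "(cyc_pred n ^^ k) i" n] by simp
qed simp

lemma cyc_pred_pow_succ: "i \<in> {1..n} \<Longrightarrow> (cyc_pred n ^^ k) (cyc_succ n i) = cyc_succ n ((cyc_pred n ^^ k) i)"
proof (induction k)
  case (Suc k)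
  have "(cyc_pred n ^^ k) i \<in> {1..n}" by (rule cyc_pred_pow_in[OF Suc.prems])
  then show ?case using Suc by (simp add: cyc_pred_succ cyc_succ_pred del: atLeastAtMost_iff)
qed simp

lemma cyc_pred_reaches:
  assumes "i \<in> {1..n}" "m \<in> {1..n}"
  shows "\<exists>k. (cyc_pred n ^^ k) i = m"
proof -
  have down: "(cyc_pred n ^^ k) i = i - k" if "k < i" for k and i
    using that by (induction k) (auto simp: cyc_pred_def)
  have 1: "\<exists>k. (cyc_pred n ^^ k) i = m" if "m \<le> i" "1 \<le> m" for i
    using down[of "i - m" i] that by (intro exI[of _ "i - m"]) simp
  show ?thesis
  proof (cases "m \<le> i")
    case True then show ?thesis using 1 assms by simp
  next
    case False
    \<comment> \<open>For m above i the walk goes down to 1, wraps to n in one step, and descends to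
      m.\<close>
    have "(cyc_pred n ^^ (i - 1)) i = 1" using down[of "i - 1" i] assms(1) by simp
    then have "(cyc_pred n ^^ Suc (i - 1)) i = n" by (simp only: funpow.simps o_apply) (simp add: cyc_pred_def)
    moreover obtain k where "(cyc_pred n ^^ k) n = m" using 1[of n] assms by auto
    ultimately have "(cyc_pred n ^^ (k + Suc (i - 1))) i = m" unfolding funpow_add by simp
    then show ?thesis by blast
  qed
qed

text \<open>The arcs of a proper subset \<open>J\<close> of the circle are labelled by the vertices preceding them.\<close>

definition arc_starts :: "nat \<Rightarrow> nat set \<Rightarrow> nat set" where
  "arc_starts n J = {i \<in> {1..n}. i \<notin> J \<and> cyc_succ n i \<in> J}"

text \<open>The first vertex outside J met when walking backwards from i; it exists when J is
  proper.\<close>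

definition arc_start :: "nat \<Rightarrow> nat set \<Rightarrow> nat \<Rightarrow> nat" where
  "arc_start n J i = (cyc_pred n ^^ (LEAST k. (cyc_pred n ^^ k) i \<notin> J)) i"

lemma arc_start_reach:
  assumes J: "J \<subset> {1..n}" and i: "i \<in> J"
  obtains k where "arc_start n J i = (cyc_pred n ^^ Suc k) i" "(cyc_pred n ^^ Suc k) i \<notin> J"
    "\<And>m. m \<le> k \<Longrightarrow> (cyc_pred n ^^ m) i \<in> J"
proof -
  have iN: "i \<in> {1..n}" using i J by blast
  obtain m where m: "m \<in> {1..n}" "m \<notin> J" using J by blast
  let ?P = "\<lambda>k. (cyc_pred n ^^ k) i \<notin> J"
  have ex: "\<exists>k. ?P k" using cyc_pred_reaches[OF iN m(1)] m(2) by metis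
  have L: "?P (LEAST k. ?P k)" using ex by (rule LeastI_ex)
  then have "(LEAST k. ?P k) \<noteq> 0" using i by (metis funpow_0)
  then obtain k where k: "(LEAST k. ?P k) = Suc k" using not0_implies_Suc by blast
  show ?thesis
  proof (rule that[of k])
    show "arc_start n J i = (cyc_pred n ^^ Suc k) i" unfolding arc_start_def k ..
    show "(cyc_pred n ^^ Suc k) i \<notin> J" using L unfolding k .
    show "(cyc_pred n ^^ m) i \<in> J" if "m \<le> k" for m
      using not_less_Least[of m ?P] that unfolding k by auto
  qed
qed

lemma arc_start_in:
  assumes J: "J \<subset> {1..n}" and i: "i \<in> J"
  shows "arc_start n J i \<in> arc_starts n J" and "(i, cyc_succ n (arc_start n J i)) \<in> (arc_adj n J)\<^sup>*"
proof -
  obtain k where k: "arc_start n J i = (cyc_pred n ^^ Suc k) i" "(cyc_pred n ^^ Suc k) i \<notin> J"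
    "\<And>m. m \<le> k \<Longrightarrow> (cyc_pred n ^^ m) i \<in> J"
    by (rule arc_start_reach[OF J i]) blast
  have iN: "i \<in> {1..n}" using i J by blast
  have s: "cyc_succ n ((cyc_pred n ^^ Suc m) i) = (cyc_pred n ^^ m) i" for m
    using cyc_succ_pred[OF cyc_pred_pow_in[OF iN]] by simp
  show "arc_start n J i \<in> arc_starts n J"
    using cyc_pred_pow_in[OF iN, of "Suc k"] k(2) k(3)[of k] s[of k] unfolding k(1) arc_starts_def by simp
  have "(i, (cyc_pred n ^^ m) i) \<in> (arc_adj n J)\<^sup>*" if "m \<le> k" for m
    using that
  proof (induction m)
    case (Suc m)
    have "((cyc_pred n ^^ m) i, (cyc_pred n ^^ Suc m) i) \<in> arc_adj n J"
      using k(3)[of m] k(3)[of "Suc m"] Suc.prems s[of m] unfolding arc_adj_def by simp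
    then show ?case using Suc by (meson Suc_leD rtrancl.rtrancl_into_rtrancl)
  qed simp
  from this[of k] show "(i, cyc_succ n (arc_start n J i)) \<in> (arc_adj n J)\<^sup>*" using s[of k] k(1) by simp
qed

lemma arc_start_conn:
  assumes J: "J \<subset> {1..n}" and i: "i \<in> J" and i': "i' \<in> J" and eq: "arc_start n J i = arc_start n J i'"
  shows "(i, i') \<in> (arc_adj n J)\<^sup>*"
proof -
  have "sym (arc_adj n J)" by (auto simp: sym_def arc_adj_def)
  then have "sym ((arc_adj n J)\<^sup>*)" by (rule sym_rtrancl)
  then have "(cyc_succ n (arc_start n J i'), i') \<in> (arc_adj n J)\<^sup>*" using arc_start_in(2)[OF J i'] by (auto dest: symD)
  then show ?thesis using arc_start_in(2)[OF J i] eq by simp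
qed

lemma arc_start_of_succ:
  assumes J: "J \<subset> {1..n}" and i: "i \<in> J" "cyc_succ n i \<in> J"
  shows "arc_start n J (cyc_succ n i) = arc_start n J i"
proof -
  have iN: "i \<in> {1..n}" using i J by blast
  have pow: "(cyc_pred n ^^ Suc k) (cyc_succ n i) = (cyc_pred n ^^ k) i" for k
    using cyc_pred_succ[OF iN] by (simp only: funpow_Suc_right o_def)
  obtain k where k: "(cyc_pred n ^^ Suc k) i \<notin> J"
    by (rule arc_start_reach[OF J i(1)]) blast
  \<comment> \<open>The walk from the successor starts inside J and reaches i after one step, so its
    exit comes exactly one step later.\<close>
  have "(LEAST k. (cyc_pred n ^^ k) (cyc_succ n i) \<notin> J) = Suc (LEAST k. (cyc_pred n ^^ Suc k) (cyc_succ n i) \<notin> J)"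
    by (rule Least_Suc[of _ "Suc (Suc k)"]) (use k pow[of "Suc k"] i in simp_all)
  then show ?thesis unfolding arc_start_def by (simp only: pow)
qed

lemma arc_label_arc_start: "J \<subset> {1..n} \<Longrightarrow> arc_label n J (arc_start n J)"
  unfolding arc_label_def using arc_start_of_succ by blast

lemma arc_start_image: "J \<subset> {1..n} \<Longrightarrow> arc_start n J ` J = arc_starts n J"
proof
  assume J: "J \<subset> {1..n}"
  show "arc_start n J ` J \<subseteq> arc_starts n J" using arc_start_in(1)[OF J] by blast
  show "arc_starts n J \<subseteq> arc_start n J ` J"
  proof
    fix i assume i: "i \<in> arc_starts n J"
    then have iN: "i \<in> {1..n}" "i \<notin> J" and s: "cyc_succ n i \<in> J" by (auto simp: arc_starts_def)
    have "(LEAST k. (cyc_pred n ^^ k) (cyc_succ n i) \<notin> J) = Suc 0"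
      using s iN cyc_pred_succ[OF iN(1)] by (intro Least_equality) (auto simp: Suc_le_eq intro: gr0I)
    then have "arc_start n J (cyc_succ n i) = i" using cyc_pred_succ[OF iN(1)] by (simp add: arc_start_def)
    then show "i \<in> arc_start n J ` J" using s by force
  qed
qed

lemma cyc_succ_image_proper:
  assumes n: "n \<ge> 1" and J: "J \<subset> {1..n}"
  shows "cyc_succ n ` J \<subset> {1..n}"
proof -
  have "card (cyc_succ n ` J) = card J" by (rule card_image[OF inj_on_subset[OF inj_on_cyc_succ]]) (use J in blast)
  moreover have "card J < card {1..n}" by (rule psubset_card_mono[OF _ J]) simp
  ultimately show ?thesis using cyc_succ_in[OF n] by (metis image_subsetI less_irrefl psubsetI)
qed

lemma arc_starts_shift:
  assumes n: "n \<ge> 1" and J: "J \<subseteq> {1..n}"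
  shows "arc_starts n (cyc_succ n ` J) = cyc_succ n ` arc_starts n J"
proof
  show "cyc_succ n ` arc_starts n J \<subseteq> arc_starts n (cyc_succ n ` J)"
    using cyc_succ_in[OF n] cyc_succ_image_iff[OF J] by (auto simp: arc_starts_def)
  show "arc_starts n (cyc_succ n ` J) \<subseteq> cyc_succ n ` arc_starts n J"
  proof
    fix i assume "i \<in> arc_starts n (cyc_succ n ` J)"
    then have i: "i \<in> {1..n}" "i \<notin> cyc_succ n ` J" "cyc_succ n i \<in> cyc_succ n ` J" by (auto simp: arc_starts_def)
    have "i \<in> J" using i cyc_succ_image_iff[OF J i(1)] by blast
    have p: "cyc_pred n i \<in> {1..n}" "cyc_succ n (cyc_pred n i) = i" using cyc_pred_in[OF i(1)] cyc_succ_pred[OF i(1)] by blast+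
    have "cyc_pred n i \<notin> J" using i(2) p(2) by force
    then have "cyc_pred n i \<in> arc_starts n J" using p \<open>i \<in> J\<close> by (simp add: arc_starts_def)
    then show "i \<in> cyc_succ n ` arc_starts n J" using p(2) by force
  qed
qed

lemma arc_start_shift:
  assumes J: "J \<subseteq> {1..n}" and i: "i \<in> J" "J \<subset> {1..n}"
  shows "arc_start n (cyc_succ n ` J) (cyc_succ n i) = cyc_succ n (arc_start n J i)"
proof -
  have iN: "i \<in> {1..n}" using i J by blast
  have "(cyc_pred n ^^ k) (cyc_succ n i) \<notin> cyc_succ n ` J \<longleftrightarrow> (cyc_pred n ^^ k) i \<notin> J" for k
    unfolding cyc_pred_pow_succ[OF iN] using cyc_succ_image_iff[OF J cyc_pred_pow_in[OF iN]] by simp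
  then show ?thesis unfolding arc_start_def using cyc_pred_pow_succ[OF iN] by simp
qed

section \<open>Arc coefficients as coordinates on the first homology\<close>

definition arc_coeff :: "nat \<Rightarrow> (nat \<Rightarrow> real) chain set \<Rightarrow> nat set \<Rightarrow> nat \<Rightarrow> int" where
  "arc_coeff n x J i = (if J \<subset> {1..n} then Poly_Mapping.lookup (arc_class n J (arc_start n J) x) i else 0)"

text \<open>Extension by 0 makes equality of these total functions meaningful. It agrees with the
  default 0 of \<open>arc_coeff\<close> at the full set, which carries no nonzero zero-sum
  function.\<close>

definition arc_functions :: "nat \<Rightarrow> (nat set \<Rightarrow> nat \<Rightarrow> int) set" where
  "arc_functions n = {f. (\<forall>J i. f J i \<noteq> 0 \<longrightarrow> J \<subset> {1..n} \<and> i \<in> arc_starts n J) \<and> (\<forall>J. (\<Sum>i\<in>arc_starts n J. f J i) = 0)}"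

lemma finite_arc_starts [simp]: "finite (arc_starts n J)"
  by (simp add: arc_starts_def)

lemma total_eq_sum:
  assumes "Poly_Mapping.keys v \<subseteq> A" "finite A"
  shows "Poly_Mapping.lookup (frag_extend (\<lambda>_. frag_of ()) v) () = (\<Sum>i\<in>A. Poly_Mapping.lookup v i)"
proof -
  have "Poly_Mapping.lookup (frag_extend (\<lambda>_. frag_of ()) v) () = (\<Sum>i\<in>Poly_Mapping.keys v. Poly_Mapping.lookup v i)"
    by (simp add: frag_extend_def lookup_sum)
  also have "\<dots> = (\<Sum>i\<in>A. Poly_Mapping.lookup v i)"
    by (rule sum.mono_neutral_left) (use assms in \<open>auto simp: in_keys_iff\<close>)
  finally show ?thesis .
qed

lemma arc_coeff_in: "arc_coeff n x \<in> arc_functions n"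
proof -
  have 1: "J \<subset> {1..n} \<and> i \<in> arc_starts n J" if "arc_coeff n x J i \<noteq> 0" for J i
  proof -
    have J: "J \<subset> {1..n}" and "i \<in> Poly_Mapping.keys (arc_class n J (arc_start n J) x)"
      using that by (auto simp: arc_coeff_def in_keys_iff split: if_splits)
    then show ?thesis using arc_class_keys_total(1)[OF _ arc_label_arc_start[OF J], of x] arc_start_image[OF J] by blast
  qed
  have 2: "(\<Sum>i\<in>arc_starts n J. arc_coeff n x J i) = 0" for J
  proof (cases "J \<subset> {1..n}")
    case J: True
    have "Poly_Mapping.keys (arc_class n J (arc_start n J) x) \<subseteq> arc_starts n J"
      using arc_class_keys_total(1)[OF _ arc_label_arc_start[OF J], of x] arc_start_image[OF J] J by blast
    from total_eq_sum[OF this] show ?thesis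
      using arc_class_keys_total(2)[OF _ arc_label_arc_start[OF J], of x] J by (simp add: arc_coeff_def psubset_imp_subset)
  qed (simp add: arc_coeff_def)
  show ?thesis unfolding arc_functions_def using 1 2 by blast
qed

lemma arc_coeff_mult:
  assumes "x \<in> carrier (homology_group 1 (polygon_space n))" "y \<in> carrier (homology_group 1 (polygon_space n))"
  shows "arc_coeff n (x \<otimes>\<^bsub>homology_group 1 (polygon_space n)\<^esub> y) J i = arc_coeff n x J i + arc_coeff n y J i"
  using arc_class_mult[OF _ arc_label_arc_start assms] by (simp add: arc_coeff_def lookup_add psubset_imp_subset)

lemma arc_coeff_inj:
  assumes n: "n \<ge> 1" and x: "x \<in> carrier (homology_group 1 (polygon_space n))" and 0: "\<And>J i. arc_coeff n x J i = 0"
  shows "x = \<one>\<^bsub>homology_group 1 (polygon_space n)\<^esub>"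
proof (rule homology_eq_one[OF n x])
  fix J :: "nat set" assume J: "J \<subseteq> {1..n}" "J \<noteq> {}"
  show "rel_to_face n J x = \<one>\<^bsub>relative_homology_group 1 (face_space n J) (near_zero J)\<^esub>"
  proof (cases "J = {1..n}")
    case False
    then have J': "J \<subset> {1..n}" using J by blast
    have "Poly_Mapping.lookup (arc_class n J (arc_start n J) x) i = 0" for i
      using 0[of J i] J' by (simp add: arc_coeff_def)
    then have "arc_class n J (arc_start n J) x = 0" by (intro poly_mapping_eqI) simp
    then show ?thesis using arc_start_conn[OF J'] by (intro rel_to_face_eq_one[OF J(1) n arc_label_arc_start[OF J']])
  next
    \<comment> \<open>The full vertex set is a single closed chain: the constant label already
      separates its components, and a coefficient with sum 0 on one label is 0.\<close>
    case True
    let ?a = "\<lambda>_::nat. ()"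
    have a: "arc_label n J ?a" by (simp add: arc_label_def)
    have conn1: "(i, 1) \<in> (arc_adj n J)\<^sup>*" if "i \<in> {1..n}" for i
      using that
    proof (induction i)
      case (Suc i)
      show ?case
      proof (cases "i = 0")
        case False
        then have "(Suc i, i) \<in> arc_adj n J" using Suc.prems True by (auto simp: arc_adj_def cyc_succ_def)
        then show ?thesis using Suc False by (simp add: converse_rtrancl_into_rtrancl)
      qed simp
    qed simp
    have sym: "sym ((arc_adj n J)\<^sup>*)" by (rule sym_rtrancl) (auto simp: sym_def arc_adj_def)
    have conn: "(i, i') \<in> (arc_adj n J)\<^sup>*" if "i \<in> J" "i' \<in> J" for i i'
      using conn1[of i] symD[OF sym conn1[of i']] that True by simp
    have "Poly_Mapping.keys (arc_class n J ?a x) \<subseteq> {()}" by auto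
    from total_eq_sum[OF this] have "Poly_Mapping.lookup (arc_class n J ?a x) () = 0"
      using arc_class_keys_total(2)[OF J(1) a, of x] by simp
    then have "arc_class n J ?a x = 0" by (intro poly_mapping_eqI) simp
    then show ?thesis using conn by (intro rel_to_face_eq_one[OF J(1) n a])
  qed
qed

lemma arc_coeff_one: "arc_coeff n \<one>\<^bsub>homology_group 1 (polygon_space n)\<^esub> J i = 0"
proof -
  interpret G: comm_group "homology_group 1 (polygon_space n)" by (rule abelian_homology_group)
  show ?thesis using arc_coeff_mult[OF G.one_closed G.one_closed, of J i] by simp
qed

lemma arc_coeff_inv:
  assumes "x \<in> carrier (homology_group 1 (polygon_space n))"
  shows "arc_coeff n (inv\<^bsub>homology_group 1 (polygon_space n)\<^esub> x) J i = - arc_coeff n x J i"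
proof -
  interpret G: comm_group "homology_group 1 (polygon_space n)" by (rule abelian_homology_group)
  show ?thesis using arc_coeff_mult[OF assms G.inv_closed[OF assms], of J i] assms by (simp add: arc_coeff_one)
qed

lemma arc_coeff_finprod:
  assumes "finite A" "\<And>a. a \<in> A \<Longrightarrow> z a \<in> carrier (homology_group 1 (polygon_space n))"
  shows "arc_coeff n (finprod (homology_group 1 (polygon_space n)) z A) J i = (\<Sum>a\<in>A. arc_coeff n (z a) J i)"
proof -
  interpret G: comm_group "homology_group 1 (polygon_space n)" by (rule abelian_homology_group)
  show ?thesis using assms
  proof (induction A rule: finite_induct)
    case empty then show ?case by (simp add: arc_coeff_one)
  next
    case (insert a A)
    then show ?case by (simp add: Pi_def arc_coeff_mult)
  qed
qed

lemma sum_arc_starts_arc_functions: "f \<in> arc_functions n \<Longrightarrow> (\<Sum>i\<in>arc_starts n J. f J i) = 0"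
  by (simp add: arc_functions_def)

text \<open>A class on the face J with the right coefficients at J has none at sets not contained in
  J, but arbitrary ones at proper subsets of J. These are subtracted with the help of the induction
  hypothesis.\<close>

lemma arc_coeff_single:
  assumes n: "n \<ge> 1" and f: "f \<in> arc_functions n" and J: "J \<subset> {1..n}"
  shows "\<exists>x\<in>carrier (homology_group 1 (polygon_space n)). \<forall>I i. arc_coeff n x I i = (if I = J then f J i else 0)"
  using f J
proof (induction "card J" arbitrary: J f rule: less_induct)
  case less
  let ?X = "polygon_space n" let ?H = "homology_group 1 (polygon_space n)"
  interpret G: comm_group ?H by (rule abelian_homology_group)
  have J: "J \<subseteq> {1..n}" using less.prems by blast
  show ?case
  proof (cases "J = {}")
    case True
    have "f J i = 0" for i using less.prems(1) True by (auto simp: arc_functions_def arc_starts_def)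
    then show ?thesis by (intro bexI[of _ "\<one>\<^bsub>?H\<^esub>"]) (simp_all add: arc_coeff_one)
  next
    case False
    have fin: "finite {i. f J i \<noteq> 0}"
      by (rule finite_subset[OF _ finite_arc_starts[of n J]]) (use less.prems in \<open>auto simp: arc_functions_def\<close>)
    define v where "v = Abs_poly_mapping (f J)"
    have v: "Poly_Mapping.lookup v i = f J i" for i using fin by (simp add: v_def)
    have keys: "Poly_Mapping.keys v \<subseteq> arc_starts n J"
      using less.prems(1) by (auto simp: in_keys_iff v arc_functions_def)
    have "frag_extend (\<lambda>_. frag_of ()) v = 0"
      by (rule poly_mapping_eqI) (use total_eq_sum[OF keys] sum_arc_starts_arc_functions[OF less.prems(1), of J] v in simp)
    then obtain z where z: "z \<in> carrier (homology_group 1 (face_space n J))"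
      "arc_class n J (arc_start n J) (hom_induced 1 (face_space n J) {} ?X {} id z) = v"
      using arc_class_surj[OF J False n arc_label_arc_start[OF less.prems(2)], of v] keys
      unfolding arc_start_image[OF less.prems(2)] by blast
    let ?y = "hom_induced 1 (face_space n J) {} ?X {} id z"
    have y: "?y \<in> carrier ?H" by (rule hom_induced_carrier)
    have rest: "restrict_hom n J ?y = ?y"
    proof -
      have "restrict_hom n J ?y = hom_induced 1 (face_space n J) {} ?X {} (coord_restrict n J \<circ> id) z"
        by (rule hom_induced_compose'[OF face_inclusion _ continuous_map_coord_restrict]) auto
      also have "hom_induced 1 (face_space n J) {} ?X {} (coord_restrict n J \<circ> id) = hom_induced 1 (face_space n J) {} ?X {} id"
        by (rule hom_induced_eq) (auto simp: topspace_face_space intro: coord_restrict_id)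
      finally show ?thesis .
    qed
    have yJ: "arc_coeff n ?y J i = f J i" for i using z(2) v less.prems(2) by (simp add: arc_coeff_def)
    have out: "arc_coeff n ?y I i = 0" if nI: "\<not> I \<subseteq> J" for I i
    proof (cases "I \<subset> {1..n}")
      case I: True
      obtain k where k: "k \<in> I" "k \<notin> J" using nI by blast
      have "arc_class n I (arc_start n I) (restrict_hom n J ?y) = 0"
        by (rule arc_class_coord_restrict[OF _ arc_label_arc_start[OF I] k y]) (use I in blast)
      then show ?thesis unfolding rest by (simp add: arc_coeff_def)
    qed (simp add: arc_coeff_def)
    have "\<exists>w. \<forall>I\<in>{I. I \<subset> J}. w I \<in> carrier ?H \<and> (\<forall>K i. arc_coeff n (w I) K i = (if K = I then arc_coeff n ?y I i else 0))"
    proof (rule bchoice, rule ballI)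
      fix I assume I: "I \<in> {I. I \<subset> J}"
      then have "card I < card J" using finite_subset[OF J] by (intro psubset_card_mono) auto
      moreover have "I \<subset> {1..n}" using I J by blast
      ultimately show "\<exists>x. x \<in> carrier ?H \<and> (\<forall>K i. arc_coeff n x K i = (if K = I then arc_coeff n ?y I i else 0))"
        using less.hyps[OF _ arc_coeff_in, of I ?y] by blast
    qed
    then obtain w where w: "\<forall>I\<in>{I. I \<subset> J}. w I \<in> carrier ?H \<and> (\<forall>K i. arc_coeff n (w I) K i = (if K = I then arc_coeff n ?y I i else 0))"
      by (rule exE)
    \<comment> \<open>The correction: it has the coefficients of \<open>?y\<close> at all proper
      subsets of J and 0 elsewhere.\<close>
    let ?p = "finprod ?H w {I. I \<subset> J}"
    have finS: "finite {I. I \<subset> J}"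
      by (rule finite_subset[of _ "Pow {1..n}"]) (use J in auto)
    have p: "?p \<in> carrier ?H" using w by (intro G.finprod_closed) blast
    have pc: "arc_coeff n ?p K i = (if K \<subset> J then arc_coeff n ?y K i else 0)" for K i
    proof -
      have "arc_coeff n ?p K i = (\<Sum>I\<in>{I. I \<subset> J}. arc_coeff n (w I) K i)"
        by (rule arc_coeff_finprod[OF finS]) (use w in blast)
      also have "\<dots> = (\<Sum>I\<in>{I. I \<subset> J}. if I = K then arc_coeff n ?y K i else 0)"
      proof (rule sum.cong[OF refl])
        fix I assume "I \<in> {I. I \<subset> J}"
        from bspec[OF w this] show "arc_coeff n (w I) K i = (if I = K then arc_coeff n ?y K i else 0)" by auto
      qed
      also have "\<dots> = (if K \<subset> J then arc_coeff n ?y K i else 0)" using finS by (simp add: sum.delta)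
      finally show ?thesis .
    qed
    let ?x = "?y \<otimes>\<^bsub>?H\<^esub> inv\<^bsub>?H\<^esub> ?p"
    have "arc_coeff n ?x K i = (if K = J then f J i else 0)" for K i
    proof -
      have "arc_coeff n ?x K i = arc_coeff n ?y K i - (if K \<subset> J then arc_coeff n ?y K i else 0)"
        unfolding arc_coeff_mult[OF y G.inv_closed[OF p]] arc_coeff_inv[OF p] pc by simp
      moreover have "arc_coeff n ?y K i = (if K = J then f J i else 0)" if "\<not> K \<subset> J"
      proof (cases "K = J")
        case True
        then show ?thesis using yJ[of i] by simp
      next
        case False
        then have "\<not> K \<subseteq> J" using that by blast
        from out[OF this] show ?thesis using False by simp
      qed
      moreover have "K \<noteq> J" if "K \<subset> J" using that by blast
      ultimately show ?thesis by (cases "K \<subset> J") simp_all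
    qed
    moreover have "?x \<in> carrier ?H" by (intro G.m_closed y G.inv_closed p)
    ultimately show ?thesis by (rule_tac bexI[of _ ?x]) (intro allI)
  qed
qed

lemma arc_coeff_surj:
  assumes n: "n \<ge> 1" and f: "f \<in> arc_functions n"
  shows "\<exists>x\<in>carrier (homology_group 1 (polygon_space n)). arc_coeff n x = f"
proof -
  let ?H = "homology_group 1 (polygon_space n)"
  interpret G: comm_group ?H by (rule abelian_homology_group)
  let ?S = "{J. J \<subset> {1..n}}"
  have "\<exists>w. \<forall>J\<in>?S. w J \<in> carrier ?H \<and> (\<forall>I i. arc_coeff n (w J) I i = (if I = J then f J i else 0))"
    by (rule bchoice, rule ballI) (use arc_coeff_single[OF n f] in blast)
  then obtain w where w: "\<forall>J\<in>?S. w J \<in> carrier ?H \<and> (\<forall>I i. arc_coeff n (w J) I i = (if I = J then f J i else 0))"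
    by (rule exE)
  have fin: "finite ?S" by (rule finite_subset[of _ "Pow {1..n}"]) auto
  have "arc_coeff n (finprod ?H w ?S) I i = f I i" for I i
  proof -
    have "arc_coeff n (finprod ?H w ?S) I i = (\<Sum>J\<in>?S. arc_coeff n (w J) I i)"
      by (rule arc_coeff_finprod[OF fin]) (use w in blast)
    also have "\<dots> = (\<Sum>J\<in>?S. if J = I then f I i else 0)"
    proof (rule sum.cong[OF refl])
      fix J assume "J \<in> ?S"
      from bspec[OF w this] show "arc_coeff n (w J) I i = (if J = I then f I i else 0)" by auto
    qed
    also have "\<dots> = (if I \<subset> {1..n} then f I i else 0)" using fin by (simp add: sum.delta)
    also have "\<dots> = f I i" using f by (auto simp: arc_functions_def)
    finally show ?thesis .
  qed
  then have "arc_coeff n (finprod ?H w ?S) = f" by (simp add: fun_eq_iff)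
  moreover have "finprod ?H w ?S \<in> carrier ?H" using w by (intro G.finprod_closed) blast
  ultimately show ?thesis by blast
qed

text \<open>The labels \<open>arc_start\<close> of the rotated set, read after
  \<open>cyc_succ n\<close>, agree on J with the successors of the arc starts of J. This turns the
  naturality of arc classes into a statement about coefficients.\<close>

lemma arc_coeff_shift:
  assumes n: "n \<ge> 1" and x: "x \<in> carrier (homology_group 1 (polygon_space n))" and J: "J \<subset> {1..n}" and i: "i \<in> {1..n}"
  shows "arc_coeff n (shift_hom n x) J i = arc_coeff n x (cyc_succ n ` J) (cyc_succ n i)"
proof -
  let ?I = "cyc_succ n ` J"
  have J': "J \<subseteq> {1..n}" using J by blast
  have I: "?I \<subset> {1..n}" by (rule cyc_succ_image_proper[OF n J])
  let ?v = "arc_class n J (arc_start n J) (shift_hom n x)"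
  have lab: "arc_label n J (arc_start n ?I \<circ> cyc_succ n)" "arc_label n J (cyc_succ n \<circ> arc_start n J)"
    using arc_label_arc_start[OF I] arc_label_arc_start[OF J] by (auto simp: arc_label_def)
  have "arc_class n ?I (arc_start n ?I) x = arc_class n J (arc_start n ?I \<circ> cyc_succ n) (shift_hom n x)"
    by (rule arc_class_shift[OF n J' arc_label_arc_start[OF I] x, symmetric])
  also have "\<dots> = arc_class n J (cyc_succ n \<circ> arc_start n J) (shift_hom n x)"
    by (rule arc_class_cong[OF J' lab]) (use arc_start_shift[OF J' _ J] in simp)
  also have "\<dots> = frag_extend (\<lambda>b. frag_of (cyc_succ n b)) ?v" by (rule arc_class_relabel)
  finally have eq: "arc_class n ?I (arc_start n ?I) x = frag_extend (\<lambda>b. frag_of (cyc_succ n b)) ?v" .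
  have keys: "Poly_Mapping.keys ?v \<subseteq> {1..n}"
    using arc_class_keys_total(1)[OF J' arc_label_arc_start[OF J], of "shift_hom n x"] arc_start_image[OF J]
    unfolding arc_starts_def by blast
  have "Poly_Mapping.lookup (frag_extend (\<lambda>b. frag_of (cyc_succ n b)) ?v) (cyc_succ n i)
      = (\<Sum>b\<in>Poly_Mapping.keys ?v. Poly_Mapping.lookup ?v b * (if cyc_succ n i = cyc_succ n b then 1 else 0))"
    by (simp add: frag_extend_def lookup_sum)
  also have "\<dots> = (\<Sum>b\<in>Poly_Mapping.keys ?v. if b = i then Poly_Mapping.lookup ?v i else 0)"
    by (rule sum.cong) (use inj_onD[OF inj_on_cyc_succ _ i] keys in \<open>auto split: if_splits\<close>)
  also have "\<dots> = Poly_Mapping.lookup ?v i" by (simp add: sum.delta in_keys_iff)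
  finally show ?thesis unfolding arc_coeff_def using eq J I by simp
qed

section \<open>Lyndon words and vertex sets\<close>

lemma cyc_succ_pow:
  assumes "i \<in> {1..n}"
  shows "(cyc_succ n ^^ k) i = (i - 1 + k) mod n + 1"
proof (induction k)
  case 0
  then show ?case using assms by auto
next
  case (Suc k)
  then show ?case by (simp add: cyc_succ_def mod_Suc_eq)
qed

text \<open>Writing vertices as \<open>t mod n + 1\<close> with t any natural number turns a
  rotation into the addition of k, so that sets become periodic predicates.\<close>

lemma cyc_succ_pow_image_iff:
  assumes n: "n \<ge> 1" and J: "J \<subseteq> {1..n}" and I: "I \<subseteq> {1..n}"
  shows "(cyc_succ n ^^ k) ` J = I \<longleftrightarrow> (\<forall>t. t mod n + 1 \<in> J \<longleftrightarrow> (t + k) mod n + 1 \<in> I)"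
proof -
  have in1: "t mod n + 1 \<in> {1..n}" for t using n by (simp add: Suc_leI)
  have pow: "(cyc_succ n ^^ k) (t mod n + 1) = (t + k) mod n + 1" for t
    using cyc_succ_pow[OF in1, of k t] by (simp add: mod_add_left_eq)
  have repr: "\<exists>t. i = t mod n + 1" if "i \<in> {1..n}" for i
    using that by (intro exI[of _ "i - 1"]) auto
  have bk: "\<exists>t. i = (t + k) mod n + 1" if i: "i \<in> {1..n}" for i
  proof -
    obtain j where j: "i = j + 1" "j < n" using i by (cases i) auto
    \<comment> \<open>Adding \<open>n * k\<close> before taking k off keeps the subtraction inside
      the naturals.\<close>
    have "k \<le> j + n * k" using n by (cases n) auto
    then have "j + n * k - k + k = j + n * k" by (rule le_add_diff_inverse2)
    then have "i = (j + n * k - k + k) mod n + 1" using j by simp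
    then show ?thesis by (rule exI)
  qed
  have inj: "t mod n = t' mod n" if "(t + k) mod n + 1 = (t' + k) mod n + 1" for t t'
  proof -
    have kn: "k \<le> n * k" using n by (cases n) auto
    have "(t + k + (n * k - k)) mod n = (t' + k + (n * k - k)) mod n"
      by (rule mod_add_cong) (use that in simp_all)
    moreover have "s + k + (n * k - k) = s + n * k" for s using kn by linarith
    ultimately show ?thesis by (simp only: mod_mult_self2)
  qed
  have mem: "(t + k) mod n + 1 \<in> (cyc_succ n ^^ k) ` J \<longleftrightarrow> t mod n + 1 \<in> J" for t
  proof
    assume "(t + k) mod n + 1 \<in> (cyc_succ n ^^ k) ` J"
    then obtain i where i: "i \<in> J" "(t + k) mod n + 1 = (cyc_succ n ^^ k) i" by blast
    obtain t' where t': "i = t' mod n + 1" using repr[of i] i J by blast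
    show "t mod n + 1 \<in> J" using i inj[of t t'] pow[of t'] t' by simp
  next
    assume "t mod n + 1 \<in> J"
    then show "(t + k) mod n + 1 \<in> (cyc_succ n ^^ k) ` J" unfolding pow[symmetric] by (rule imageI)
  qed
  have sub: "(cyc_succ n ^^ k) ` J \<subseteq> {1..n}"
  proof
    fix i assume "i \<in> (cyc_succ n ^^ k) ` J"
    then obtain j where "j \<in> J" "i = (cyc_succ n ^^ k) j" by blast
    then show "i \<in> {1..n}" using cyc_succ_pow[of j n k] in1 J by auto
  qed
  show ?thesis
  proof
    assume "(cyc_succ n ^^ k) ` J = I"
    then show "\<forall>t. t mod n + 1 \<in> J \<longleftrightarrow> (t + k) mod n + 1 \<in> I" using mem by blast
  next
    assume r: "\<forall>t. t mod n + 1 \<in> J \<longleftrightarrow> (t + k) mod n + 1 \<in> I"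
    have "i \<in> (cyc_succ n ^^ k) ` J \<longleftrightarrow> i \<in> I" if i: "i \<in> {1..n}" for i
    proof -
      obtain t where t: "i = (t + k) mod n + 1" using bk[OF i] by blast
      show ?thesis unfolding t mem using r by blast
    qed
    then show "(cyc_succ n ^^ k) ` J = I" using sub I by blast
  qed
qed

text \<open>Reading w at indices modulo its length stands for its power of length n; the shift by 1
  reconciles vertices from 1 with list positions from 0.\<close>

definition word_set :: "nat \<Rightarrow> nat list \<Rightarrow> nat set" where
  "word_set n w = {i \<in> {1..n}. w ! ((i - 1) mod length w) = 1}"

lemma word_set_subset: "word_set n w \<subseteq> {1..n}"
  by (auto simp: word_set_def)

lemma word_set_iff:
  assumes "n \<ge> 1" "length w dvd n"
  shows "t mod n + 1 \<in> word_set n w \<longleftrightarrow> w ! (t mod length w) = 1"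
  using assms by (simp add: word_set_def mod_mod_cancel Suc_leI)

lemma lyndon_wordsD:
  assumes "w \<in> lyndon_words d"
  shows "length w = d" "set w \<subseteq> {0, 1}" "inj_on (\<lambda>k. rotate k w) {..<d}" "\<And>k. ord_class.lexordp_eq w (rotate k w)"
proof -
  show len: "length w = d" and "set w \<subseteq> {0, 1}" using assms by (auto simp: lyndon_words_def)
  show "inj_on (\<lambda>k. rotate k w) {..<d}" using assms by (intro eq_card_imp_inj_on) (auto simp: lyndon_words_def)
  show "ord_class.lexordp_eq w (rotate k w)" for k
  proof (cases "d = 0")
    case True then show ?thesis using len by (simp add: lexordp_eq_refl)
  next
    case False
    then have "k mod d < d" by simp
    then have "ord_class.lexordp_eq w (rotate (k mod d) w)" using assms by (auto simp: lyndon_words_def)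
    then show ?thesis using rotate_conv_mod[of k w] len by simp
  qed
qed

text \<open>A binary word is determined by the positions of its letter 1, so rotations of words can
  be compared through periodic predicates.\<close>

lemma rotate_eq_iff_binary:
  assumes len: "length v = length w" "w \<noteq> []" and b: "set v \<subseteq> {0, 1::nat}" "set w \<subseteq> {0, 1}"
  shows "v = rotate k w \<longleftrightarrow> (\<forall>t. v ! (t mod length w) = 1 \<longleftrightarrow> w ! ((t + k) mod length w) = 1)"
proof
  assume v: "v = rotate k w"
  show "\<forall>t. v ! (t mod length w) = 1 \<longleftrightarrow> w ! ((t + k) mod length w) = 1"
    using len(2) by (auto simp: v nth_rotate mod_add_right_eq add.commute)
next
  assume r: "\<forall>t. v ! (t mod length w) = 1 \<longleftrightarrow> w ! ((t + k) mod length w) = 1"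
  show "v = rotate k w"
  proof (rule nth_equalityI)
    fix i assume i: "i < length v"
    have "v ! i \<in> {0, 1}" using i b(1) nth_mem by blast
    moreover have "w ! ((i + k) mod length w) \<in> {0, 1}" using len b(2) nth_mem mod_less_divisor by (metis length_greater_0_conv subsetD)
    moreover have "v ! i = 1 \<longleftrightarrow> w ! ((i + k) mod length w) = 1" using r[rule_format, of i] i len by simp
    ultimately show "v ! i = rotate k w ! i" using i len by (auto simp: nth_rotate add.commute)
  qed (simp add: len)
qed

lemma lyndon_rotate_eq_iff:
  assumes "w \<in> lyndon_words d" "d > 0"
  shows "rotate k w = w \<longleftrightarrow> d dvd k"
proof
  assume "rotate k w = w"
  then have "rotate (k mod d) w = rotate 0 w" using lyndon_wordsD(1)[OF assms(1)] rotate_conv_mod[of k w] by simp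
  then have "k mod d = 0"
    by (rule inj_onD[OF lyndon_wordsD(3)[OF assms(1)]]) (use assms(2) in auto)
  then show "d dvd k" by auto
next
  assume "d dvd k"
  then show "rotate k w = w" using lyndon_wordsD(1)[OF assms(1)] rotate_conv_mod[of k w] by simp
qed

lemma word_set_shift_iff:
  assumes n: "n \<ge> 1" and w: "length w dvd n" and v: "length v dvd n"
  shows "(cyc_succ n ^^ k) ` word_set n v = word_set n w \<longleftrightarrow> (\<forall>t. v ! (t mod length v) = 1 \<longleftrightarrow> w ! ((t + k) mod length w) = 1)"
  unfolding cyc_succ_pow_image_iff[OF n word_set_subset word_set_subset] word_set_iff[OF n w] word_set_iff[OF n v] ..

lemma word_set_stabilizer:
  assumes n: "n \<ge> 1" and w: "w \<in> lyndon_words d" and d: "d dvd n"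
  shows "(cyc_succ n ^^ k) ` word_set n w = word_set n w \<longleftrightarrow> d dvd k"
proof -
  have d0: "d > 0" using d n by (cases "d = 0") auto
  have len: "length w = d" by (rule lyndon_wordsD(1)[OF w])
  have "w \<noteq> []" using len d0 by auto
  then show ?thesis
    using word_set_shift_iff[OF n, of w w k] rotate_eq_iff_binary[OF refl, of w k] lyndon_wordsD(2)[OF w]
      lyndon_rotate_eq_iff[OF w d0, of k] len d by auto
qed

text \<open>The periodic sequences of v and w are shifts of each other, so each is invariant under
  the length of the other word, and the stabilizers force equal lengths. Then v and w are rotations
  of each other, and both are lexicographically least.\<close>

lemma word_set_orbit_unique:
  assumes n: "n \<ge> 1" and v: "v \<in> lyndon_words e" "e dvd n" and w: "w \<in> lyndon_words d" "d dvd n"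
    and eq: "(cyc_succ n ^^ k) ` word_set n v = word_set n w"
  shows "v = w"
proof -
  have d0: "d > 0" "e > 0" using v w n by (auto intro: Nat.gr0I)
  have kd: "k \<le> d * k" using d0 by (cases d) auto
  have len: "length w = d" "length v = e" using lyndon_wordsD(1) v w by blast+
  have r: "v ! (t mod e) = 1 \<longleftrightarrow> w ! ((t + k) mod d) = 1" for t
    using eq word_set_shift_iff[OF n, of w v k] len v w by auto
  have "w ! (t mod d) = 1 \<longleftrightarrow> w ! ((t + e) mod d) = 1" for t
  proof -
    \<comment> \<open>As \<open>d * k - k\<close> is -k modulo d, the relation \<open>r\<close> can
      be read with w at an arbitrary index.\<close>
    have "(t + (d * k - k)) + k = t + d * k" using kd by linarith
    then have 1: "((t + (d * k - k)) + k) mod d = t mod d" by (simp only: mod_mult_self2)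
    have "((t + (d * k - k)) + e + k) = t + e + d * k" using kd by linarith
    then have 2: "((t + (d * k - k)) + e + k) mod d = (t + e) mod d" by (simp only: mod_mult_self2)
    show ?thesis using r[of "t + (d * k - k)"] r[of "t + (d * k - k) + e"] unfolding 1 2 by simp
  qed
  then have "(cyc_succ n ^^ e) ` word_set n w = word_set n w" using word_set_shift_iff[OF n, of w w e] len w by simp
  then have de: "d dvd e" using word_set_stabilizer[OF n w] by blast
  have "v ! (t mod e) = 1 \<longleftrightarrow> v ! ((t + d) mod e) = 1" for t
  proof -
    have "t + d + k = t + k + d" by simp
    then have "(t + d + k) mod d = (t + k) mod d" by (simp only: mod_add_self2)
    then show ?thesis using r[of t] r[of "t + d"] by simp
  qed
  then have "(cyc_succ n ^^ d) ` word_set n v = word_set n v" using word_set_shift_iff[OF n, of v v d] len v by simp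
  then have "e dvd d" using word_set_stabilizer[OF n v] by blast
  then have ed: "e = d" using de by (rule dvd_antisym)
  have "w \<noteq> []" using len d0 by auto
  then have vr: "v = rotate k w"
    using rotate_eq_iff_binary[of v w k] r len ed lyndon_wordsD(2)[OF v(1)] lyndon_wordsD(2)[OF w(1)] by auto
  have "rotate (d * k - k) v = w"
  proof -
    have "rotate (d * k - k) v = rotate (d * k) w" unfolding vr rotate_rotate using kd by simp
    then show ?thesis using lyndon_rotate_eq_iff[OF w(1) d0(1)] by simp
  qed
  then have "ord_class.lexordp_eq v w" using lyndon_wordsD(4)[OF v(1)] by metis
  moreover have "ord_class.lexordp_eq w v" using lyndon_wordsD(4)[OF w(1)] vr by metis
  ultimately show ?thesis by (rule lexordp_eq_antisym)
qed

text \<open>The first letters force the head of v to be 0, and what remains is the same comparison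
  for the tail. It serves for a word ending in 0 against the rotation that brings this 0 to the
  front.\<close>

lemma lexordp_eq_shift_zero:
  assumes "set v \<subseteq> {0, 1::nat}" "ord_class.lexordp_eq (v @ [0]) (0 # v)"
  shows "set v \<subseteq> {0}"
  using assms
proof (induction v)
  case (Cons a v)
  then have "a = 0" by auto
  then show ?case using Cons by auto
qed simp

lemma rotate1_replicate: "rotate1 (replicate m x) = replicate m x"
  by (cases m) (simp_all add: replicate_append_same)

lemma lyndon_not_constant:
  assumes w: "w \<in> lyndon_words d" "d > 1"
  shows "\<exists>x\<in>set w. x \<noteq> c"
proof (rule ccontr)
  assume "\<not> ?thesis"
  then have "w = replicate (length w) c" by (auto simp: list_eq_iff_nth_eq)
  then have "rotate 1 w = w" using rotate1_replicate[of "length w" c] by simp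
  then have "d dvd 1" using lyndon_rotate_eq_iff[OF w(1), of 1] w(2) by simp
  then show False using w(2) by simp
qed

text \<open>A final 0 moved to the front must not give a smaller word, which forces all letters to
  be 0 and contradicts having several rotations. Hence no occurrence of 01 straddles two copies of w
  in a power, and \<open>iota\<close> misses no arc.\<close>

lemma lyndon_last:
  assumes w: "w \<in> lyndon_words d" "d > 1"
  shows "w ! (d - 1) = 1"
proof (rule ccontr)
  assume n1: "w ! (d - 1) \<noteq> 1"
  have len: "length w = d" and b: "set w \<subseteq> {0, 1}" using lyndon_wordsD[OF w(1)] by blast+
  have ne: "w \<noteq> []" using len w(2) by auto
  have "w ! (d - 1) \<in> set w" using len w(2) by (intro nth_mem) auto
  then have "w ! (d - 1) = 0" using n1 b by blast
  then have last: "last w = 0" using ne len by (simp add: last_conv_nth)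
  then have app: "w = butlast w @ [0]" using ne by (metis append_butlast_last_id)
  have "rotate (d - 1) w = drop (d - 1) w @ take (d - 1) w"
    using rotate_drop_take[of "d - 1" w] len w(2) by simp
  also have "drop (d - 1) w = [0]" using app len by (metis append_eq_conv_conj length_butlast)
  also have "take (d - 1) w = butlast w" using len by (simp add: butlast_conv_take)
  finally have "ord_class.lexordp_eq (butlast w @ [0]) (0 # butlast w)"
    using lyndon_wordsD(4)[OF w(1), of "d - 1"] app by (metis append_Cons append_Nil)
  moreover have "set (butlast w) \<subseteq> {0, 1}" using b in_set_butlastD by fast
  ultimately have "set (butlast w) \<subseteq> {0}" by (intro lexordp_eq_shift_zero)
  then have "set w \<subseteq> {0}" using app by (metis (no_types) Un_subset_iff empty_set list.simps(15) set_append subset_refl)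
  then show False using lyndon_not_constant[OF w, of 0] by blast
qed

section \<open>Rises of Lyndon words and arcs of their vertex sets\<close>

definition rises :: "nat list \<Rightarrow> nat set" where
  "rises w = {i. Suc i < length w \<and> w ! i = 0 \<and> w ! Suc i = 1}"

lemma finite_rises: "finite (rises w)"
  by (rule finite_subset[of _ "{..<length w}"]) (auto simp: rises_def)

lemma iota_eq_card_rises: "iota w = card (rises w)"
  by (simp add: iota_def rises_def)

text \<open>Some letter is 0 and the last one is 1; the first 1 after that 0 is preceded by a
  0.\<close>

lemma iota_pos:
  assumes w: "w \<in> lyndon_words d" "d > 1"
  shows "iota w \<ge> 1"
proof -
  have len: "length w = d" and b: "set w \<subseteq> {0, 1}" using lyndon_wordsD[OF w(1)] by blast+
  obtain z where z: "z < d" "w ! z \<noteq> 1" using lyndon_not_constant[OF w, of 1] len by (auto simp: in_set_conv_nth)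
  let ?P = "\<lambda>p. z < p \<and> w ! p = 1"
  have zd: "z \<noteq> d - 1" using z lyndon_last[OF w] by metis
  then have ex: "?P (d - 1)" using lyndon_last[OF w] z(1) by auto
  define p where "p = (LEAST p. ?P p)"
  have p: "?P p" unfolding p_def by (rule LeastI[of ?P, OF ex])
  have pd: "p \<le> d - 1" unfolding p_def by (rule Least_le[of ?P, OF ex])
  have "w ! (p - 1) \<noteq> 1"
  proof (cases "p - 1 = z")
    case False
    then have "\<not> ?P (p - 1)" using not_less_Least[of "p - 1" ?P] p unfolding p_def[symmetric] by auto
    moreover have "z < p - 1" using p False by linarith
    ultimately show ?thesis by simp
  qed (use z in simp)
  moreover have "w ! (p - 1) \<in> {0, 1}"
  proof -
    have "p - 1 < length w" using pd w(2) len by linarith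
    then show ?thesis using b nth_mem by blast
  qed
  ultimately have "w ! (p - 1) = 0" by blast
  moreover have "Suc (p - 1) = p" using p by simp
  moreover have "p < d" using pd w(2) by linarith
  ultimately have "p - 1 \<in> rises w" using p len unfolding rises_def by simp
  then have "rises w \<noteq> {}" by blast
  then show ?thesis unfolding iota_eq_card_rises using finite_rises[of w] by (simp add: Suc_le_eq card_gt_0_iff)
qed

text \<open>An arc starts where a 0 is followed by a 1, and because w ends in 1 both letters lie in
  one copy of w: a is the position of the rise in w and k the number of the copy.\<close>

lemma arc_starts_word_set:
  assumes n: "n \<ge> 1" and w: "w \<in> lyndon_words d" "d > 1" and d: "d dvd n"
  shows "bij_betw (\<lambda>(a, k). a + d * k + 1) (rises w \<times> {..<n div d}) (arc_starts n (word_set n w))"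
  unfolding bij_betw_def
proof
  have len: "length w = d" and b: "set w \<subseteq> {0, 1}" using lyndon_wordsD[OF w(1)] by blast+
  have nd: "n = d * (n div d)" using d by simp
  have ad: "a < d" "(a + d * k) mod d = a" "(a + d * k) div d = k" if "a \<in> rises w" for a k
    using that len w(2) by (auto simp: rises_def)
  show "inj_on (\<lambda>(a, k). a + d * k + 1) (rises w \<times> {..<n div d})"
  proof (rule inj_onI, clarsimp)
    fix a k a' k' assume *: "a \<in> rises w" "a' \<in> rises w" "a + d * k = a' + d * k'"
    have "a = (a + d * k) mod d" using ad(2)[OF *(1)] by simp
    also have "\<dots> = a'" unfolding *(3) by (rule ad(2)[OF *(2)])
    finally have "a = a'" .
    then show "a = a' \<and> k = k'" using *(3) w(2) by simp
  qed
  have mem: "i \<in> arc_starts n (word_set n w) \<longleftrightarrow> i \<in> {1..n} \<and> (i - 1) mod d \<in> rises w" for i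
  proof (cases "i \<in> {1..n}")
    case True
    let ?a = "(i - 1) mod d"
    have a: "?a < d" using w(2) by simp
    have "?a < length w" using a len by simp
    then have "w ! ?a \<in> {0, 1}" using b nth_mem by blast
    moreover have "i \<in> word_set n w \<longleftrightarrow> w ! ?a = 1" using True len by (simp add: word_set_def)
    moreover have "cyc_succ n i \<in> word_set n w \<longleftrightarrow> w ! (i mod d) = 1"
      using word_set_iff[OF n, of w i] unfolding len cyc_succ_def using d by blast
    moreover have "Suc ?a < d \<and> w ! Suc ?a = 1 \<longleftrightarrow> w ! (i mod d) = 1" if "w ! ?a = 0"
    proof -
      \<comment> \<open>A letter 0 is never the last one, so its successor needs no
        wrapping.\<close>
      have "?a \<noteq> d - 1" using that lyndon_last[OF w] by auto
      then have "Suc ?a < d" using a by auto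
      moreover have "i mod d = Suc ?a"
      proof -
        have "i = Suc (i - 1)" using True by simp
        then have "i mod d = Suc (i - 1) mod d" by (rule arg_cong)
        also have "\<dots> = Suc ?a mod d" by (simp only: mod_Suc_eq)
        also have "\<dots> = Suc ?a" using \<open>Suc ?a < d\<close> by simp
        finally show ?thesis .
      qed
      ultimately show ?thesis by simp
    qed
    ultimately show ?thesis using True len by (auto simp: arc_starts_def rises_def)
  qed (auto simp: arc_starts_def)
  show "(\<lambda>(a, k). a + d * k + 1) ` (rises w \<times> {..<n div d}) = arc_starts n (word_set n w)"
  proof
    show "(\<lambda>(a, k). a + d * k + 1) ` (rises w \<times> {..<n div d}) \<subseteq> arc_starts n (word_set n w)"
    proof (clarify)
      fix a k assume a: "a \<in> rises w" and k: "k < n div d"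
      have "d * k + d \<le> d * (n div d)" using mult_le_mono2[of "Suc k" "n div d" d] k by simp
      then have "a + d * k + 1 \<le> n" using ad(1)[OF a] nd by linarith
      then show "a + d * k + 1 \<in> arc_starts n (word_set n w)" unfolding mem using ad(2)[OF a, of k] a by simp
    qed
    show "arc_starts n (word_set n w) \<subseteq> (\<lambda>(a, k). a + d * k + 1) ` (rises w \<times> {..<n div d})"
    proof
      fix i assume "i \<in> arc_starts n (word_set n w)"
      then have i: "i \<in> {1..n}" "(i - 1) mod d \<in> rises w" unfolding mem by blast+
      have "i - 1 < n" using i(1) by auto
      then have "i - 1 < n div d * d" using nd by (simp add: mult.commute)
      then have "(i - 1) div d < n div d" by (rule less_mult_imp_div_less)
      moreover have "i = (i - 1) mod d + d * ((i - 1) div d) + 1" using i(1) by simp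
      ultimately show "i \<in> (\<lambda>(a, k). a + d * k + 1) ` (rises w \<times> {..<n div d})"
        using i(2) by (intro image_eqI[of _ _ "((i - 1) mod d, (i - 1) div d)"]) auto
    qed
  qed
qed

lemma lexordp_eq_least:
  fixes A :: "nat list set"
  assumes "finite A" "A \<noteq> {}"
  shows "\<exists>w\<in>A. \<forall>v\<in>A. ord_class.lexordp_eq w v"
  using assms
proof (induction A rule: finite_ne_induct)
  case (singleton x)
  then show ?case by (simp add: lexordp_eq_refl)
next
  case (insert x A)
  then obtain w where w: "w \<in> A" "\<forall>v\<in>A. ord_class.lexordp_eq w v" by blast
  consider "ord_class.lexordp_eq w x" | "ord_class.lexordp_eq x w" using lexordp_eq_linear by blast
  then show ?case
  proof cases
    case 1 then show ?thesis using w by blast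
  next
    case 2
    then have "\<forall>v\<in>A. ord_class.lexordp_eq x v" using w(2) lexordp_eq_trans by blast
    then show ?thesis by (intro bexI[of _ x]) (simp_all add: lexordp_eq_refl)
  qed
qed

text \<open>Let d be the least period of the characteristic sequence of J. It divides n, since the
  remainder of n would be a smaller period, and minimality makes the d rotations of the first d
  letters distinct; the least of them is a Lyndon word.\<close>

lemma word_set_orbit_exists:
  assumes n: "n \<ge> 1" and J: "J \<subseteq> {1..n}"
  shows "\<exists>d w k. d dvd n \<and> w \<in> lyndon_words d \<and> (cyc_succ n ^^ k) ` word_set n w = J"
proof -
  define ch where "ch t = (if t mod n + 1 \<in> J then 1 else 0 :: nat)" for t
  let ?P = "\<lambda>p. p > 0 \<and> (\<forall>t. ch (t + p) = ch t)"
  have Pn: "?P n" using n by (simp add: ch_def)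
  define d where "d = (LEAST p. ?P p)"
  have d: "d > 0" "\<And>t. ch (t + d) = ch t" using LeastI[of ?P, OF Pn] unfolding d_def by blast+
  have dmin: "d \<le> p" if "?P p" for p using Least_le[of ?P, OF that] unfolding d_def .
  have per: "ch (t + d * q) = ch t" for t q
  proof (induction q)
    case (Suc q)
    have "ch (t + d * Suc q) = ch (t + d * q + d)" by (simp add: algebra_simps)
    then show ?case using d(2) Suc by simp
  qed simp
  have modd: "ch (t mod d) = ch t" for t using per[of "t mod d" "t div d"] by simp
  have dn: "d dvd n"
  proof (rule ccontr)
    assume "\<not> d dvd n"
    then have "n mod d > 0" by (simp add: dvd_eq_mod_eq_0)
    moreover have "ch (t + n mod d) = ch t" for t
      using per[of "t + n mod d" "n div d"] Pn by (simp add: add.assoc)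
    ultimately show False using dmin[of "n mod d"] mod_less_divisor[OF d(1), of n] by force
  qed
  define v where "v = map ch [0..<d]"
  have lv: "length v = d" by (simp add: v_def)
  have rot: "rotate k v ! i = ch (i + k)" if "i < d" for i k
    using that d(1) lv by (simp add: nth_rotate modd add.commute v_def)
  have shift_inj: "i = j" if ij: "i < d" "j < d" "rotate i v = rotate j v" for i j
  proof -
    have *: "\<not> (i < j \<and> j < d \<and> rotate i v = rotate j v)" for i j
    proof
      assume a: "i < j \<and> j < d \<and> rotate i v = rotate j v"
      have e: "ch (t + i) = ch (t + j)" for t
      proof -
        have "ch (t mod d + i) = ch (t mod d + j)" using a rot[of "t mod d" i] rot[of "t mod d" j] d(1) by simp
        then show ?thesis using modd by (metis mod_add_left_eq)
      qed
      have "ch (t + (j - i)) = ch t" for t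
      proof -
        \<comment> \<open>\<open>d * i - i\<close> serves as -i modulo the period d.\<close>
        have id: "i \<le> d * i" using d(1) by (cases d) auto
        have "ch t = ch (t + d * i)" using per by simp
        also have "t + d * i = (t + (d * i - i)) + i" using id by linarith
        also have "ch \<dots> = ch ((t + (d * i - i)) + j)" by (rule e)
        also have "(t + (d * i - i)) + j = t + (j - i) + d * i" using id a by linarith
        also have "ch \<dots> = ch (t + (j - i))" by (rule per)
        finally show ?thesis by simp
      qed
      then have "d \<le> j - i" using a by (intro dmin) auto
      then show False using a by linarith
    qed
    show ?thesis using *[of i j] *[of j i] ij by (metis nat_neq_iff)
  qed
  let ?A = "(\<lambda>k. rotate k v) ` {..<d}"
  have "\<exists>w\<in>?A. \<forall>u\<in>?A. ord_class.lexordp_eq w u" by (rule lexordp_eq_least) (use d(1) in auto)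
  then obtain k where k: "k < d" "\<And>u. u \<in> ?A \<Longrightarrow> ord_class.lexordp_eq (rotate k v) u" by blast
  let ?w = "rotate k v"
  have rr: "rotate j ?w = rotate ((j + k) mod d) v" for j
    using rotate_conv_mod[of "j + k" v] lv by (simp add: rotate_rotate)
  have "?w \<in> lyndon_words d"
    unfolding lyndon_words_def
  proof (intro CollectI conjI allI impI)
    show "length ?w = d" by (simp add: lv)
    show "set ?w \<subseteq> {0, 1}" by (auto simp: v_def ch_def)
    show "ord_class.lexordp_eq ?w (rotate j ?w)" for j
      unfolding rr by (rule k(2)) (use d(1) in auto)
    have "inj_on (\<lambda>j. rotate j ?w) {..<d}"
    proof (rule inj_onI)
      fix i j assume ij: "i \<in> {..<d}" "j \<in> {..<d}" "rotate i ?w = rotate j ?w"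
      have "(i + k) mod d = (j + k) mod d" by (rule shift_inj) (use ij(3) d(1) in \<open>simp_all add: rr\<close>)
      then have "(i + k + (d - k)) mod d = (j + k + (d - k)) mod d" by (rule mod_add_cong) simp_all
      then show "i = j" using ij k(1) by simp
    qed
    then show "card ((\<lambda>j. rotate j ?w) ` {..<d}) = d" by (simp add: card_image)
  qed
  moreover have "(cyc_succ n ^^ k) ` word_set n ?w = J"
    unfolding cyc_succ_pow_image_iff[OF n word_set_subset J]
  proof
    fix t
    have "t mod n + 1 \<in> word_set n ?w \<longleftrightarrow> ?w ! (t mod d) = 1"
      using word_set_iff[OF n, of ?w t] lv dn by simp
    also have "?w ! (t mod d) = ch (t + k)" using rot[of "t mod d" k] d(1) modd by (metis mod_add_left_eq mod_less_divisor)
    finally show "t mod n + 1 \<in> word_set n ?w \<longleftrightarrow> (t + k) mod n + 1 \<in> J" by (simp add: ch_def)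
  qed
  ultimately show ?thesis using dn by blast
qed

section \<open>Submodules given by supports\<close>

lemma polygon_H1_simps:
  "carrier (polygon_H1 n) = carrier (homology_group 1 (polygon_space n))"
  "add (polygon_H1 n) = monoid.mult (homology_group 1 (polygon_space n))"
  "zero (polygon_H1 n) = \<one>\<^bsub>homology_group 1 (polygon_space n)\<^esub>"
  by (simp_all add: polygon_H1_def action_module_def Let_def)

abbreviation power_hom where
  "power_hom n k \<equiv> hom_induced 1 (polygon_space n) {} (polygon_space n) {} (cyclic_shift n ^^ k)"

lemma continuous_map_shift_power: "n \<ge> 1 \<Longrightarrow> continuous_map (polygon_space n) (polygon_space n) (cyclic_shift n ^^ k)"
proof (induction k)
  case (Suc k)
  then show ?case unfolding funpow.simps using continuous_map_compose continuous_map_cyclic_shift by blast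
qed (simp add: id_def)

lemma arc_coeff_power_hom:
  assumes n: "n \<ge> 1" and x: "x \<in> carrier (homology_group 1 (polygon_space n))" and "J \<subset> {1..n}" "i \<in> {1..n}"
  shows "arc_coeff n (power_hom n k x) J i = arc_coeff n x ((cyc_succ n ^^ k) ` J) ((cyc_succ n ^^ k) i)"
  using assms(3,4)
proof (induction k arbitrary: J i)
  case 0
  have "hom_induced 1 (polygon_space n) {} (polygon_space n) {} id x = x" using x by (rule hom_induced_id)
  then show ?case by (simp add: id_def)
next
  case (Suc k)
  have "power_hom n (Suc k) x = shift_hom n (power_hom n k x)"
    unfolding funpow.simps
    by (rule hom_induced_compose'[OF continuous_map_shift_power[OF n] _ continuous_map_cyclic_shift[OF n], symmetric]) auto
  then have "arc_coeff n (power_hom n (Suc k) x) J i = arc_coeff n (power_hom n k x) (cyc_succ n ` J) (cyc_succ n i)"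
    using arc_coeff_shift[OF n hom_induced_carrier Suc.prems] by simp
  also have "\<dots> = arc_coeff n x ((cyc_succ n ^^ k) ` cyc_succ n ` J) ((cyc_succ n ^^ k) (cyc_succ n i))"
    by (rule Suc.IH[OF cyc_succ_image_proper[OF n Suc.prems(1)] cyc_succ_in[OF n]])
  finally have eq: "arc_coeff n (power_hom n (Suc k) x) J i = arc_coeff n x ((cyc_succ n ^^ k) ` cyc_succ n ` J) ((cyc_succ n ^^ k) (cyc_succ n i))" .
  have pow: "cyc_succ n ^^ Suc k = cyc_succ n ^^ k \<circ> cyc_succ n" by (rule funpow_Suc_right)
  show ?case unfolding eq pow by (simp add: image_comp o_def)
qed

lemma arc_coeff_int_pow:
  assumes x: "x \<in> carrier (homology_group 1 (polygon_space n))"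
  shows "arc_coeff n (x [^]\<^bsub>homology_group 1 (polygon_space n)\<^esub> (k::int)) J i = k * arc_coeff n x J i"
proof -
  let ?H = "homology_group 1 (polygon_space n)"
  interpret G: comm_group ?H by (rule abelian_homology_group)
  have nat: "arc_coeff n (x [^]\<^bsub>?H\<^esub> (m::nat)) J i = int m * arc_coeff n x J i" for m
    using x by (induction m) (simp_all add: arc_coeff_one arc_coeff_mult algebra_simps)
  show ?thesis
  proof (cases k)
    case (nonneg m)
    then show ?thesis using nat by (simp add: int_pow_int)
  next
    case (neg m)
    have "x [^]\<^bsub>?H\<^esub> k = inv\<^bsub>?H\<^esub> (x [^]\<^bsub>?H\<^esub> int (Suc m))" unfolding neg by (rule G.int_pow_neg[OF x])
    then show ?thesis using nat[of "Suc m"] x unfolding neg by (simp add: arc_coeff_inv int_pow_int algebra_simps del: of_nat_Suc)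
  qed
qed

lemma arc_coeff_smult:
  assumes n: "n \<ge> 1" and r: "Poly_Mapping.keys r \<subseteq> {0..<int n}" and x: "x \<in> carrier (polygon_H1 n)"
    and J: "J \<subset> {1..n}" "i \<in> {1..n}"
  shows "arc_coeff n (r \<odot>\<^bsub>polygon_H1 n\<^esub> x) J i =
    (\<Sum>g\<in>Poly_Mapping.keys r. Poly_Mapping.lookup r g * arc_coeff n x ((cyc_succ n ^^ nat g) ` J) ((cyc_succ n ^^ nat g) i))"
proof -
  let ?H = "homology_group 1 (polygon_space n)"
  interpret G: comm_group ?H by (rule abelian_homology_group)
  have x': "x \<in> carrier ?H" using x by (simp add: polygon_H1_simps)
  have eq: "r \<odot>\<^bsub>polygon_H1 n\<^esub> x = (\<Otimes>\<^bsub>?H\<^esub>g\<in>Poly_Mapping.keys r. power_hom n (nat g) x [^]\<^bsub>?H\<^esub> Poly_Mapping.lookup r g)"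
    unfolding polygon_H1_def Let_def action_module_def module.simps ..
  have "arc_coeff n (\<Otimes>\<^bsub>?H\<^esub>g\<in>Poly_Mapping.keys r. power_hom n (nat g) x [^]\<^bsub>?H\<^esub> Poly_Mapping.lookup r g) J i
      = (\<Sum>g\<in>Poly_Mapping.keys r. arc_coeff n (power_hom n (nat g) x [^]\<^bsub>?H\<^esub> Poly_Mapping.lookup r g) J i)"
    by (rule arc_coeff_finprod[OF finite_keys]) (rule G.int_pow_closed[OF hom_induced_carrier])
  then show ?thesis
    unfolding eq by (simp only: arc_coeff_int_pow[OF hom_induced_carrier] arc_coeff_power_hom[OF n x' J])
qed

lemma arc_coeff_smult_of:
  assumes n: "n \<ge> 1" and g: "0 \<le> g" "g < int n" and x: "x \<in> carrier (polygon_H1 n)"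
    and J: "J \<subset> {1..n}" "i \<in> {1..n}"
  shows "arc_coeff n (frag_of g \<odot>\<^bsub>polygon_H1 n\<^esub> x) J i = arc_coeff n x ((cyc_succ n ^^ nat g) ` J) ((cyc_succ n ^^ nat g) i)"
  using arc_coeff_smult[OF n _ x J, of "frag_of g"] g by simp

lemma arc_coeff_nonzero:
  assumes "arc_coeff n x J i \<noteq> 0"
  shows "J \<subset> {1..n}" "i \<in> arc_starts n J" "i \<in> {1..n}"
proof -
  show "J \<subset> {1..n}" "i \<in> arc_starts n J" using arc_coeff_in[of n x] assms unfolding arc_functions_def by blast+
  then show "i \<in> {1..n}" by (simp add: arc_starts_def)
qed

lemma arc_coeff_eqI:
  assumes n: "n \<ge> 1" and x: "x \<in> carrier (polygon_H1 n)" and y: "y \<in> carrier (polygon_H1 n)"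
    and eq: "\<And>J i. J \<subset> {1..n} \<Longrightarrow> i \<in> {1..n} \<Longrightarrow> arc_coeff n x J i = arc_coeff n y J i"
  shows "x = y"
proof -
  let ?H = "homology_group 1 (polygon_space n)"
  interpret G: comm_group ?H by (rule abelian_homology_group)
  have xy: "x \<in> carrier ?H" "y \<in> carrier ?H" using x y by (simp_all add: polygon_H1_simps)
  have "arc_coeff n (x \<otimes>\<^bsub>?H\<^esub> inv\<^bsub>?H\<^esub> y) J i = 0" for J i
  proof -
    have "arc_coeff n x J i = arc_coeff n y J i"
      using eq[of J i] arc_coeff_nonzero[of n x J i] arc_coeff_nonzero[of n y J i] by metis
    then show ?thesis using arc_coeff_mult[OF xy(1) G.inv_closed[OF xy(2)], of J i] arc_coeff_inv[OF xy(2), of J i] by simp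
  qed
  then have "x \<otimes>\<^bsub>?H\<^esub> inv\<^bsub>?H\<^esub> y = \<one>\<^bsub>?H\<^esub>" using xy by (intro arc_coeff_inj[OF n]) auto
  then have "inv\<^bsub>?H\<^esub> (inv\<^bsub>?H\<^esub> y) = x" using xy by (intro G.inv_equality) auto
  then show ?thesis using xy(2) by simp
qed

text \<open>Taking for A the single set \<open>word_set n w\<close> gives the summand N_w, and
  taking its orbit gives the module induced from it.\<close>

definition supported :: "nat \<Rightarrow> nat set set \<Rightarrow> (nat \<Rightarrow> real) chain set set" where
  "supported n A = {x \<in> carrier (polygon_H1 n). \<forall>J i. arc_coeff n x J i \<noteq> 0 \<longrightarrow> J \<in> A}"

lemma supportedD: "x \<in> supported n A \<Longrightarrow> x \<in> carrier (polygon_H1 n)"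
  and supported_coeffD: "x \<in> supported n A \<Longrightarrow> arc_coeff n x J i \<noteq> 0 \<Longrightarrow> J \<in> A"
  by (simp_all add: supported_def) blast

lemma supportedI:
  "x \<in> carrier (polygon_H1 n) \<Longrightarrow> (\<And>J i. arc_coeff n x J i \<noteq> 0 \<Longrightarrow> J \<in> A) \<Longrightarrow> x \<in> supported n A"
  unfolding supported_def by blast

lemma supported_closed:
  assumes x: "x \<in> supported n A"
  shows "y \<in> supported n A \<Longrightarrow> x \<oplus>\<^bsub>polygon_H1 n\<^esub> y \<in> supported n A"
    and "inv\<^bsub>homology_group 1 (polygon_space n)\<^esub> x \<in> supported n A"
proof -
  let ?H = "homology_group 1 (polygon_space n)"
  interpret G: comm_group ?H by (rule abelian_homology_group)
  have xc: "x \<in> carrier ?H" using supportedD[OF x] by (simp only: polygon_H1_simps)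
  show "x \<oplus>\<^bsub>polygon_H1 n\<^esub> y \<in> supported n A" if y: "y \<in> supported n A"
  proof (rule supportedI)
    have yc: "y \<in> carrier ?H" using supportedD[OF y] by (simp only: polygon_H1_simps)
    show "x \<oplus>\<^bsub>polygon_H1 n\<^esub> y \<in> carrier (polygon_H1 n)"
      unfolding polygon_H1_simps by (rule G.m_closed[OF xc yc])
    fix J i assume "arc_coeff n (x \<oplus>\<^bsub>polygon_H1 n\<^esub> y) J i \<noteq> 0"
    then have "arc_coeff n x J i \<noteq> 0 \<or> arc_coeff n y J i \<noteq> 0"
      unfolding polygon_H1_simps arc_coeff_mult[OF xc yc] by linarith
    then show "J \<in> A" using supported_coeffD x y by blast
  qed
  show "inv\<^bsub>?H\<^esub> x \<in> supported n A"
  proof (rule supportedI)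
    show "inv\<^bsub>?H\<^esub> x \<in> carrier (polygon_H1 n)" unfolding polygon_H1_simps by (rule G.inv_closed[OF xc])
    fix J i assume "arc_coeff n (inv\<^bsub>?H\<^esub> x) J i \<noteq> 0"
    then have "arc_coeff n x J i \<noteq> 0" unfolding arc_coeff_inv[OF xc] by linarith
    then show "J \<in> A" by (rule supported_coeffD[OF x])
  qed
qed

lemma supported_zero: "\<zero>\<^bsub>polygon_H1 n\<^esub> \<in> supported n A"
proof (rule supportedI)
  interpret G: comm_group "homology_group 1 (polygon_space n)" by (rule abelian_homology_group)
  show "\<zero>\<^bsub>polygon_H1 n\<^esub> \<in> carrier (polygon_H1 n)" unfolding polygon_H1_simps by (rule G.one_closed)
  show "J \<in> A" if "arc_coeff n \<zero>\<^bsub>polygon_H1 n\<^esub> J i \<noteq> 0" for J i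
    using that unfolding polygon_H1_simps arc_coeff_one by blast
qed

lemma subgroup_supported: "subgroup (supported n A) (add_monoid (polygon_H1 n))"
proof -
  let ?H = "homology_group 1 (polygon_space n)"
  have inv: "inv\<^bsub>add_monoid (polygon_H1 n)\<^esub> x = inv\<^bsub>?H\<^esub> x" for x
    unfolding m_inv_def by (simp add: polygon_H1_simps)
  show ?thesis
  proof (rule subgroup.intro)
    show "supported n A \<subseteq> carrier (add_monoid (polygon_H1 n))" using supportedD by auto
    show "\<one>\<^bsub>add_monoid (polygon_H1 n)\<^esub> \<in> supported n A" using supported_zero by simp
    show "x \<otimes>\<^bsub>add_monoid (polygon_H1 n)\<^esub> y \<in> supported n A" if "x \<in> supported n A" "y \<in> supported n A" for x y
      using supported_closed(1)[OF that] by simp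
    show "inv\<^bsub>add_monoid (polygon_H1 n)\<^esub> x \<in> supported n A" if "x \<in> supported n A" for x
      unfolding inv by (rule supported_closed(2)[OF that])
  qed
qed

text \<open>At J the translate of x by g has the coefficients of x at the rotation of J, so A has to
  absorb every proper J that some group element rotates into A.\<close>

lemma supported_submodule:
  assumes n: "n \<ge> 1" and G: "carrier G \<subseteq> {0..<int n}"
    and A: "\<And>g J. g \<in> carrier G \<Longrightarrow> J \<subset> {1..n} \<Longrightarrow> (cyc_succ n ^^ nat g) ` J \<in> A \<Longrightarrow> J \<in> A"
  shows "submodule (supported n A) (group_ring G) (polygon_H1 n)"
proof (rule submodule.intro[OF subgroup_supported], unfold_locales)
  fix r x assume r: "r \<in> carrier (group_ring G)" and x: "x \<in> supported n A"
  have rk: "Poly_Mapping.keys r \<subseteq> {0..<int n}" using r G by (auto simp: group_ring_simps)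
  have xc: "x \<in> carrier (polygon_H1 n)" using x by (simp add: supported_def)
  interpret H: Module.module "group_ring (integer_mod_group n)" "polygon_H1 n" by (rule module_polygon_H1[OF n])
  have "r \<odot>\<^bsub>polygon_H1 n\<^esub> x \<in> carrier (polygon_H1 n)"
    using rk n xc by (intro H.smult_closed) (auto simp: group_ring_simps carrier_integer_mod_group)
  moreover have "J \<in> A" if nz: "arc_coeff n (r \<odot>\<^bsub>polygon_H1 n\<^esub> x) J i \<noteq> 0" for J i
  proof -
    have J: "J \<subset> {1..n}" "i \<in> {1..n}" using arc_coeff_nonzero[OF nz] by blast+
    obtain g where g: "g \<in> Poly_Mapping.keys r" "arc_coeff n x ((cyc_succ n ^^ nat g) ` J) ((cyc_succ n ^^ nat g) i) \<noteq> 0"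
      using nz unfolding arc_coeff_smult[OF n rk xc J] by (metis (no_types, lifting) mult_zero_right sum.neutral)
    have "(cyc_succ n ^^ nat g) ` J \<in> A" using x g(2) unfolding supported_def by blast
    moreover have "g \<in> carrier G" using g(1) r by (auto simp: group_ring_simps)
    ultimately show "J \<in> A" using A J(1) by blast
  qed
  ultimately show "r \<odot>\<^bsub>polygon_H1 n\<^esub> x \<in> supported n A" unfolding supported_def by blast
qed

text \<open>The projection onto the coefficients in A: such a class exists because
  \<open>arc_coeff\<close> is onto, and is unique because its coefficients determine it.\<close>

definition part :: "nat \<Rightarrow> nat set set \<Rightarrow> (nat \<Rightarrow> real) chain set \<Rightarrow> (nat \<Rightarrow> real) chain set" where
  "part n A x = (SOME y. y \<in> carrier (polygon_H1 n) \<and> arc_coeff n y = (\<lambda>J i. if J \<in> A then arc_coeff n x J i else 0))"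

lemma part:
  assumes n: "n \<ge> 1"
  shows "part n A x \<in> carrier (polygon_H1 n)" "arc_coeff n (part n A x) J i = (if J \<in> A then arc_coeff n x J i else 0)"
proof -
  let ?f = "\<lambda>J i. if J \<in> A then arc_coeff n x J i else 0"
  have "?f \<in> arc_functions n"
  proof -
    have "(\<Sum>i\<in>arc_starts n J. ?f J i) = 0" for J
      using sum_arc_starts_arc_functions[OF arc_coeff_in, of n x J] by (cases "J \<in> A") simp_all
    moreover have "J \<subset> {1..n} \<and> i \<in> arc_starts n J" if "?f J i \<noteq> 0" for J i
      using that arc_coeff_nonzero[of n x J i] by presburger
    ultimately show ?thesis unfolding arc_functions_def by blast
  qed
  then have ex: "\<exists>y. y \<in> carrier (polygon_H1 n) \<and> arc_coeff n y = ?f"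
    using arc_coeff_surj[OF n, of ?f] unfolding polygon_H1_simps by blast
  have "part n A x \<in> carrier (polygon_H1 n) \<and> arc_coeff n (part n A x) = ?f"
    unfolding part_def by (rule someI_ex[OF ex])
  then show "part n A x \<in> carrier (polygon_H1 n)" "arc_coeff n (part n A x) J i = ?f J i" by auto
qed

lemma part_supported: "n \<ge> 1 \<Longrightarrow> part n A x \<in> supported n A"
  unfolding supported_def using part[of n A x] by auto

lemma arc_coeff_add:
  "x \<in> carrier (polygon_H1 n) \<Longrightarrow> y \<in> carrier (polygon_H1 n) \<Longrightarrow>
    arc_coeff n (x \<oplus>\<^bsub>polygon_H1 n\<^esub> y) J i = arc_coeff n x J i + arc_coeff n y J i"
  unfolding polygon_H1_simps by (rule arc_coeff_mult)

lemma supported_direct_summand: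
  assumes n: "n \<ge> 1"
  shows "abelian_direct_summand (supported n A) (polygon_H1 n)"
  unfolding abelian_direct_summand_def
proof (intro conjI exI[of _ "supported n (- A)"] subgroup_supported)
  interpret H: Module.module "group_ring (integer_mod_group n)" "polygon_H1 n" by (rule module_polygon_H1[OF n])
  have z: "arc_coeff n \<zero>\<^bsub>polygon_H1 n\<^esub> J i = 0" for J i unfolding polygon_H1_simps by (rule arc_coeff_one)
  show "supported n A \<inter> supported n (- A) = {\<zero>\<^bsub>polygon_H1 n\<^esub>}"
  proof
    show "supported n A \<inter> supported n (- A) \<subseteq> {\<zero>\<^bsub>polygon_H1 n\<^esub>}"
    proof
      fix x assume x: "x \<in> supported n A \<inter> supported n (- A)"
      then have "arc_coeff n x J i = 0" for J i unfolding supported_def by blast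
      moreover have "x \<in> carrier (polygon_H1 n)" using x by (simp add: supported_def)
      ultimately have "x = \<zero>\<^bsub>polygon_H1 n\<^esub>" by (intro arc_coeff_eqI[OF n]) (auto simp: z)
      then show "x \<in> {\<zero>\<^bsub>polygon_H1 n\<^esub>}" by simp
    qed
    show "{\<zero>\<^bsub>polygon_H1 n\<^esub>} \<subseteq> supported n A \<inter> supported n (- A)" using supported_zero by blast
  qed
  show "supported n A <+>\<^bsub>polygon_H1 n\<^esub> supported n (- A) = carrier (polygon_H1 n)"
  proof
    show "supported n A <+>\<^bsub>polygon_H1 n\<^esub> supported n (- A) \<subseteq> carrier (polygon_H1 n)"
      unfolding set_add_def set_mult_def by (auto simp: supported_def)
    show "carrier (polygon_H1 n) \<subseteq> supported n A <+>\<^bsub>polygon_H1 n\<^esub> supported n (- A)"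
    proof
      fix x assume x: "x \<in> carrier (polygon_H1 n)"
      have "x = part n A x \<oplus>\<^bsub>polygon_H1 n\<^esub> part n (- A) x"
        by (rule arc_coeff_eqI[OF n x]) (use part[OF n] in \<open>auto simp: arc_coeff_add\<close>)
      then show "x \<in> supported n A <+>\<^bsub>polygon_H1 n\<^esub> supported n (- A)"
        unfolding set_add_def set_mult_def
        by (intro UN_I[OF part_supported[OF n, of A x]] UN_I[OF part_supported[OF n, of "- A" x]]) simp
    qed
  qed
qed

section \<open>Inverse rotations and orbits of vertex sets\<close>

lemma cyc_succ_pow_in: "i \<in> {1..n} \<Longrightarrow> (cyc_succ n ^^ k) i \<in> {1..n}"
  by (cases "n = 0") (auto simp: cyc_succ_pow Suc_leI)

text \<open>Reducing \<open>n - k\<close> modulo n matters for k = 0: the exponent becomes 0 instead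
  of n and so names an element of the cyclic group.\<close>

lemma cyc_succ_pow_cancel:
  assumes i: "i \<in> {1..n}" and k: "k \<le> n"
  shows "(cyc_succ n ^^ ((n - k) mod n)) ((cyc_succ n ^^ k) i) = i" "(cyc_succ n ^^ k) ((cyc_succ n ^^ ((n - k) mod n)) i) = i"
proof -
  let ?m = "(n - k) mod n"
  have n: "n \<ge> 1" using i by auto
  obtain j where j: "i = j + 1" "j < n" using i by (cases i) auto
  have "(j + k + ?m) mod n = (j + k + (n - k)) mod n" by (rule mod_add_right_eq)
  also have "j + k + (n - k) = j + n" using k by linarith
  also have "(j + n) mod n = j" using j(2) by simp
  finally have e: "(j + k + ?m) mod n = j" .
  have "(cyc_succ n ^^ (?m + k)) i = i" "(cyc_succ n ^^ (k + ?m)) i = i"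
    using cyc_succ_pow[OF i] e j(1) by (simp_all add: add.assoc add.commute[of ?m k])
  then show "(cyc_succ n ^^ ?m) ((cyc_succ n ^^ k) i) = i" "(cyc_succ n ^^ k) ((cyc_succ n ^^ ?m) i) = i"
    by (simp_all only: funpow_add o_apply)
qed

lemma cyc_succ_pow_image_cancel:
  assumes J: "J \<subseteq> {1..n}" and k: "k \<le> n"
  shows "(cyc_succ n ^^ ((n - k) mod n)) ` (cyc_succ n ^^ k) ` J = J" "(cyc_succ n ^^ k) ` (cyc_succ n ^^ ((n - k) mod n)) ` J = J"
proof -
  have "((cyc_succ n ^^ ((n - k) mod n)) ((cyc_succ n ^^ k) i)) = i" "((cyc_succ n ^^ k) ((cyc_succ n ^^ ((n - k) mod n)) i)) = i" if "i \<in> J" for i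
    using cyc_succ_pow_cancel[of i n k] that J k by blast+
  then show "(cyc_succ n ^^ ((n - k) mod n)) ` (cyc_succ n ^^ k) ` J = J" "(cyc_succ n ^^ k) ` (cyc_succ n ^^ ((n - k) mod n)) ` J = J"
    unfolding image_image by simp_all
qed

lemma cyc_succ_pow_image_proper:
  assumes "n \<ge> 1" "J \<subset> {1..n}"
  shows "(cyc_succ n ^^ k) ` J \<subset> {1..n}"
proof (induction k)
  case (Suc k)
  have "(cyc_succ n ^^ Suc k) ` J = cyc_succ n ` (cyc_succ n ^^ k) ` J" by (simp add: image_image)
  then show ?case using cyc_succ_image_proper[OF assms(1) Suc] by simp
qed (use assms in simp)

lemma card_arc_starts_pow:
  assumes n: "n \<ge> 1" and J: "J \<subset> {1..n}"
  shows "card (arc_starts n ((cyc_succ n ^^ k) ` J)) = card (arc_starts n J)"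
proof (induction k)
  case (Suc k)
  let ?I = "(cyc_succ n ^^ k) ` J"
  have I: "?I \<subseteq> {1..n}" using cyc_succ_pow_image_proper[OF assms, of k] by blast
  have "(cyc_succ n ^^ Suc k) ` J = cyc_succ n ` ?I" by (simp add: image_image)
  then have "card (arc_starts n ((cyc_succ n ^^ Suc k) ` J)) = card (cyc_succ n ` arc_starts n ?I)"
    using arc_starts_shift[OF n I] by simp
  also have "\<dots> = card (arc_starts n ?I)"
    by (rule card_image[OF inj_on_subset[OF inj_on_cyc_succ]]) (auto simp: arc_starts_def)
  finally show ?case using Suc by simp
qed simp

lemma word_set_pow_iff:
  assumes n: "n \<ge> 1" and J: "J \<subseteq> {1..n}" and w: "length w dvd n"
  shows "(cyc_succ n ^^ k) ` J = word_set n w \<longleftrightarrow> (\<forall>t. t mod n + 1 \<in> J \<longleftrightarrow> w ! ((t + k) mod length w) = 1)"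
  unfolding cyc_succ_pow_image_iff[OF n J word_set_subset] word_set_iff[OF n w] ..

text \<open>Oriented from J to \<open>word_set n w\<close>: since sigma^k x has at J the
  coefficients of x at the k-th rotation of J, this k is the exponent that carries N_w to the
  summand at J.\<close>

definition word_orbit :: "nat \<Rightarrow> nat list \<Rightarrow> nat set set" where
  "word_orbit n w = {J. J \<subseteq> {1..n} \<and> (\<exists>k. (cyc_succ n ^^ k) ` J = word_set n w)}"

lemma word_orbit_unique:
  assumes n: "n \<ge> 1" and w: "w \<in> lyndon_words d" "d dvd n" and J: "J \<in> word_orbit n w"
  shows "\<exists>!k. k < d \<and> (cyc_succ n ^^ k) ` J = word_set n w"
proof -
  have len: "length w = d" by (rule lyndon_wordsD(1)[OF w(1)])
  have ldn: "length w dvd n" using len w by simp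
  have d0: "d > 0" using w n by (auto intro: Nat.gr0I)
  have ne: "w \<noteq> []" using len d0 by auto
  obtain k where JN: "J \<subseteq> {1..n}" and k: "(cyc_succ n ^^ k) ` J = word_set n w" using J unfolding word_orbit_def by blast
  show ?thesis
  proof (rule ex1I[of _ "k mod d"])
    show "k mod d < d \<and> (cyc_succ n ^^ (k mod d)) ` J = word_set n w"
      using k d0 unfolding word_set_pow_iff[OF n JN ldn] len by (simp add: mod_add_right_eq)
    fix k' assume k': "k' < d \<and> (cyc_succ n ^^ k') ` J = word_set n w"
    have e: "w ! ((t + k') mod d) = 1 \<longleftrightarrow> w ! ((t + k) mod d) = 1" for t
      using k k' unfolding word_set_pow_iff[OF n JN ldn] len by blast
    let ?v = "rotate k' w"
    have "?v ! (t mod length w) = 1 \<longleftrightarrow> w ! ((t + k) mod length w) = 1" for t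
    proof -
      have "?v ! (t mod d) = w ! ((t + k') mod d)"
        using d0 len by (simp add: nth_rotate mod_add_right_eq add.commute)
      then show ?thesis using e len by simp
    qed
    then have "?v = rotate k w"
      using rotate_eq_iff_binary[of ?v w k] lyndon_wordsD(2)[OF w(1)] ne by simp
    then have "rotate k' w = rotate (k mod d) w" using rotate_conv_mod[of k w] len by simp
    then show "k' = k mod d"
      by (rule inj_onD[OF lyndon_wordsD(3)[OF w(1)]]) (use k' d0 in auto)
  qed
qed

lemma word_orbit_pow_iff:
  assumes n: "n \<ge> 1" and J: "J \<subseteq> {1..n}" and k: "k \<le> n"
  shows "(cyc_succ n ^^ k) ` J \<in> word_orbit n w \<longleftrightarrow> J \<in> word_orbit n w"
proof
  assume "(cyc_succ n ^^ k) ` J \<in> word_orbit n w"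
  then obtain m where "(cyc_succ n ^^ m) ` (cyc_succ n ^^ k) ` J = word_set n w" unfolding word_orbit_def by blast
  then have "(cyc_succ n ^^ (m + k)) ` J = word_set n w" by (simp add: funpow_add image_comp)
  then show "J \<in> word_orbit n w" using J unfolding word_orbit_def by blast
next
  have sub: "(cyc_succ n ^^ k) ` I \<subseteq> {1..n}" if "I \<subseteq> {1..n}" for k I using cyc_succ_pow_in[of _ n k] that by blast
  assume "J \<in> word_orbit n w"
  then obtain m where m: "(cyc_succ n ^^ m) ` J = word_set n w" unfolding word_orbit_def by blast
  have "(cyc_succ n ^^ m) ` (cyc_succ n ^^ ((n - k) mod n)) ` (cyc_succ n ^^ k) ` J = word_set n w"
    unfolding cyc_succ_pow_image_cancel(1)[OF J k] by (rule m)
  then have "(cyc_succ n ^^ (m + (n - k) mod n)) ` (cyc_succ n ^^ k) ` J = word_set n w" by (simp add: funpow_add image_comp)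
  then show "(cyc_succ n ^^ k) ` J \<in> word_orbit n w" using sub[OF J] unfolding word_orbit_def by blast
qed

lemma abelian_group_supported: "abelian_group ((polygon_H1 n)\<lparr>carrier := supported n A\<rparr>)"
proof -
  let ?H = "homology_group 1 (polygon_space n)"
  interpret G: comm_group ?H by (rule abelian_homology_group)
  have c: "x \<in> carrier ?H" if "x \<in> supported n A" for x using supportedD[OF that] by (simp only: polygon_H1_simps)
  show ?thesis
  proof (rule abelian_groupI, goal_cases)
    case (1 x y) then show ?case using supported_closed(1) by simp
  next
    case 2 then show ?case using supported_zero by simp
  next
    case (3 x y z) then show ?case using c by (simp add: polygon_H1_simps G.m_assoc)
  next
    case (4 x y) then show ?case using c by (simp add: polygon_H1_simps G.m_comm)
  next
    case (5 x) then show ?case using c by (simp add: polygon_H1_simps)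
  next
    case (6 x)
    then have x: "x \<in> supported n A" by simp
    have "inv\<^bsub>?H\<^esub> x \<otimes>\<^bsub>?H\<^esub> x = \<one>\<^bsub>?H\<^esub>" using c[OF x] by (rule G.l_inv)
    then show ?case using supported_closed(2)[OF x] by (intro bexI[of _ "inv\<^bsub>?H\<^esub> x"]) (simp_all add: polygon_H1_simps)
  qed
qed

lemma arc_coeff_finsum:
  assumes "finite B" "\<And>b. b \<in> B \<Longrightarrow> g b \<in> supported n A"
  shows "(\<Oplus>\<^bsub>(polygon_H1 n)\<lparr>carrier := supported n A\<rparr>\<^esub>b\<in>B. g b) \<in> supported n A"
    and "arc_coeff n (\<Oplus>\<^bsub>(polygon_H1 n)\<lparr>carrier := supported n A\<rparr>\<^esub>b\<in>B. g b) J i = (\<Sum>b\<in>B. arc_coeff n (g b) J i)"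
proof -
  let ?M = "(polygon_H1 n)\<lparr>carrier := supported n A\<rparr>"
  interpret M: abelian_group ?M by (rule abelian_group_supported)
  have "(\<Oplus>\<^bsub>?M\<^esub>b\<in>B. g b) \<in> supported n A \<and> arc_coeff n (\<Oplus>\<^bsub>?M\<^esub>b\<in>B. g b) J i = (\<Sum>b\<in>B. arc_coeff n (g b) J i)"
    using assms
  proof (induction B rule: finite_induct)
    case empty
    show ?case using supported_zero[of n A] arc_coeff_one[of n J i] by (simp add: polygon_H1_simps)
  next
    case (insert b B)
    then have IH: "(\<Oplus>\<^bsub>?M\<^esub>b\<in>B. g b) \<in> supported n A" "arc_coeff n (\<Oplus>\<^bsub>?M\<^esub>b\<in>B. g b) J i = (\<Sum>b\<in>B. arc_coeff n (g b) J i)" by simp_all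
    have eq: "(\<Oplus>\<^bsub>?M\<^esub>b\<in>insert b B. g b) = g b \<oplus>\<^bsub>polygon_H1 n\<^esub> (\<Oplus>\<^bsub>?M\<^esub>b\<in>B. g b)"
      using M.finsum_insert[OF insert.hyps, of g] insert.prems by simp
    have gb: "g b \<in> supported n A" using insert.prems by simp
    show ?case
      unfolding eq arc_coeff_add[OF supportedD[OF gb] supportedD[OF IH(1)]]
      using supported_closed(1)[OF gb IH(1)] IH(2) insert.hyps by simp
  qed
  then show "(\<Oplus>\<^bsub>?M\<^esub>b\<in>B. g b) \<in> supported n A" "arc_coeff n (\<Oplus>\<^bsub>?M\<^esub>b\<in>B. g b) J i = (\<Sum>b\<in>B. arc_coeff n (g b) J i)"
    by blast+
qed

text \<open>Powers of sigma^d fix \<open>word_set n w\<close>, so a set that one of them rotates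
  onto it is that set itself.\<close>

lemma word_supported_submodule:
  assumes n: "n \<ge> 2" and w: "w \<in> lyndon_words d" "d dvd n"
  shows "submodule (supported n {word_set n w}) (group_ring (sigma_subgroup n d)) (polygon_H1 n)"
proof (rule supported_submodule)
  show "carrier (sigma_subgroup n d) \<subseteq> {0..<int n}" unfolding carrier_sigma_subgroup[OF n w(2)] by auto
  fix g J assume g: "g \<in> carrier (sigma_subgroup n d)" and J: "J \<subset> {1..n}" and e: "(cyc_succ n ^^ nat g) ` J \<in> {word_set n w}"
  have n1: "n \<ge> 1" using n by simp
  have g': "0 \<le> g" "g < int n" "int d dvd g" using g unfolding carrier_sigma_subgroup[OF n w(2)] by blast+
  have "int d dvd int (nat g)" using g'(1,3) by simp
  then have "d dvd nat g" by (simp only: int_dvd_int_iff)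
  then have s: "(cyc_succ n ^^ nat g) ` word_set n w = word_set n w" by (rule iffD2[OF word_set_stabilizer[OF n1 w]])
  have gn: "nat g \<le> n" using g'(2) by linarith
  have "J = (cyc_succ n ^^ ((n - nat g) mod n)) ` (cyc_succ n ^^ nat g) ` J"
    by (rule cyc_succ_pow_image_cancel(1)[symmetric, OF _ gn]) (use J in blast)
  also have "\<dots> = (cyc_succ n ^^ ((n - nat g) mod n)) ` (cyc_succ n ^^ nat g) ` word_set n w" using e s by simp
  also have "\<dots> = word_set n w" by (rule cyc_succ_pow_image_cancel(1)[OF word_set_subset gn])
  finally show "J \<in> {word_set n w}" by simp
qed (use n in simp)

lemma orbit_supported_submodule:
  assumes n: "n \<ge> 1"
  shows "submodule (supported n (word_orbit n w)) (group_ring (integer_mod_group n)) (polygon_H1 n)"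
proof (rule supported_submodule[OF n])
  show c: "carrier (integer_mod_group n) \<subseteq> {0..<int n}" using n by (simp add: carrier_integer_mod_group)
  fix g J assume g: "g \<in> carrier (integer_mod_group n)" and J: "J \<subset> {1..n}" "(cyc_succ n ^^ nat g) ` J \<in> word_orbit n w"
  have "g < int n" using subsetD[OF c g] by simp
  then have "nat g \<le> n" by linarith
  then show "J \<in> word_orbit n w" using word_orbit_pow_iff[OF n, of J "nat g" w] J by blast
qed

lemma supported_mono: "A \<subseteq> B \<Longrightarrow> supported n A \<subseteq> supported n B"
  unfolding supported_def by blast

lemma word_set_in_orbit: "word_set n w \<in> word_orbit n w"
proof -
  have "(cyc_succ n ^^ 0) ` word_set n w = word_set n w" by simp
  then show ?thesis using word_set_subset unfolding word_orbit_def by blast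
qed

lemma keys_rotation_subset:
  assumes "k < n"
  shows "Poly_Mapping.keys (frag_of (int k)) \<subseteq> carrier (integer_mod_group n)"
  using assms by (simp add: carrier_integer_mod_group)

text \<open>The orbit summand is the sum of the translates sigma^k N_w with k < d. Each J in the
  orbit is reached by exactly one k, so the coefficients of a combination at J come from the single
  term \<open>y k\<close>; this is the unique representation required by
  \<open>extend_scalars_iso\<close>, with f the inclusion.\<close>

lemma orbit_isomorphic_induced:
  assumes n: "n \<ge> 2" and w: "w \<in> lyndon_words d" "d dvd n"
  shows "module_isomorphic (group_ring (integer_mod_group n)) ((polygon_H1 n)\<lparr>carrier := supported n (word_orbit n w)\<rparr>)
    (induced_module (integer_mod_group n) (sigma_subgroup n d) ((polygon_H1 n)\<lparr>carrier := supported n {word_set n w}\<rparr>))"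
proof -
  define S where "S = group_ring (integer_mod_group n)"
  define R where "R = group_ring (sigma_subgroup n d)"
  define E where "E = (polygon_H1 n)\<lparr>carrier := supported n (word_orbit n w)\<rparr>"
  define N where "N = (polygon_H1 n)\<lparr>carrier := supported n {word_set n w}\<rparr>"
  define e where "e = (\<lambda>k. frag_of (int k))"
  define J0 where "J0 = word_set n w"
  have n1: "n \<ge> 1" using n by simp
  have dn: "d \<le> n" using w(2) n1 by (intro dvd_imp_le) simp_all
  have G: "comm_group (integer_mod_group n)" by simp
  have cS: "cring S" unfolding S_def by (rule cring_group_ring[OF G])
  have RS: "carrier R \<subseteq> carrier S" unfolding R_def S_def by (rule group_ring_sigma_subset[OF n w(2)])
  have H: "Module.module S (polygon_H1 n)" unfolding S_def by (rule module_polygon_H1[OF n1])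
  have subE: "submodule (supported n (word_orbit n w)) S (polygon_H1 n)" unfolding S_def by (rule orbit_supported_submodule[OF n1])
  have subN: "submodule (supported n {J0}) R (polygon_H1 n)" unfolding R_def J0_def by (rule word_supported_submodule[OF n w])
  have ME: "Module.module S E" unfolding E_def by (rule submodule.submodule_is_module[OF subE H])
  have NE: "supported n {J0} \<subseteq> supported n (word_orbit n w)" unfolding J0_def
    by (rule supported_mono) (simp add: word_set_in_orbit)
  have ecl: "e k \<in> carrier S" if "k < n" for k
    using keys_rotation_subset[OF that] unfolding e_def S_def group_ring_simps by simp
  have ecE: "e k \<odot>\<^bsub>polygon_H1 n\<^esub> x \<in> supported n (word_orbit n w)" if "k < n" "x \<in> supported n (word_orbit n w)" for k x
    by (rule submodule.smult_closed[OF subE ecl[OF that(1)] that(2)])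
  have ecoef: "arc_coeff n (e k \<odot>\<^bsub>polygon_H1 n\<^esub> x) J i = arc_coeff n x ((cyc_succ n ^^ k) ` J) ((cyc_succ n ^^ k) i)"
    if "k < n" "x \<in> carrier (polygon_H1 n)" "J \<subset> {1..n}" "i \<in> {1..n}" for k x J i
    using arc_coeff_smult_of[OF n1 _ _ that(2-4), of "int k"] that(1) unfolding e_def by simp
  define comb where "comb = (\<lambda>y. \<Oplus>\<^bsub>E\<^esub>k\<in>{..<d}. e k \<odot>\<^bsub>E\<^esub> y k)"
  have comb_in: "comb y \<in> supported n (word_orbit n w)"
    and comb_sum: "\<lbrakk>J \<subset> {1..n}; i \<in> {1..n}\<rbrakk> \<Longrightarrow>
      arc_coeff n (comb y) J i = (\<Sum>k<d. arc_coeff n (y k) ((cyc_succ n ^^ k) ` J) ((cyc_succ n ^^ k) i))"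
    if y: "y \<in> {..<d} \<rightarrow> supported n {J0}" for y J i
  proof -
    have yk: "y k \<in> supported n {J0}" if "k < d" for k using y that by blast
    have t: "e k \<odot>\<^bsub>E\<^esub> y k \<in> supported n (word_orbit n w)" if "k \<in> {..<d}" for k
    proof -
      have k: "k < d" using that by simp
      have "k < n" using k dn by simp
      then show ?thesis using ecE[of k "y k"] subsetD[OF NE yk[OF k]] unfolding E_def by simp
    qed
    show "comb y \<in> supported n (word_orbit n w)"
      using arc_coeff_finsum(1)[OF finite_lessThan, of d "\<lambda>k. e k \<odot>\<^bsub>E\<^esub> y k"] t unfolding comb_def E_def by simp
    assume J: "J \<subset> {1..n}" "i \<in> {1..n}"
    have "arc_coeff n (comb y) J i = (\<Sum>k<d. arc_coeff n (e k \<odot>\<^bsub>E\<^esub> y k) J i)"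
      using arc_coeff_finsum(2)[OF finite_lessThan, of d "\<lambda>k. e k \<odot>\<^bsub>E\<^esub> y k"] t unfolding comb_def E_def by simp
    also have "\<dots> = (\<Sum>k<d. arc_coeff n (y k) ((cyc_succ n ^^ k) ` J) ((cyc_succ n ^^ k) i))"
    proof (rule sum.cong[OF refl])
      fix k assume "k \<in> {..<d}"
      then have k: "k < d" "k < n" using dn by simp_all
      show "arc_coeff n (e k \<odot>\<^bsub>E\<^esub> y k) J i = arc_coeff n (y k) ((cyc_succ n ^^ k) ` J) ((cyc_succ n ^^ k) i)"
        using ecoef[OF k(2) supportedD[OF yk[OF k(1)]] J] unfolding E_def by simp
    qed
    finally show "arc_coeff n (comb y) J i = \<dots>" .
  qed
  have comb_coeff: "arc_coeff n (comb y) J i = arc_coeff n (y k) J0 ((cyc_succ n ^^ k) i)"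
    if y: "y \<in> {..<d} \<rightarrow> supported n {J0}" and J: "J \<subset> {1..n}" "i \<in> {1..n}" and k: "k < d" "(cyc_succ n ^^ k) ` J = J0" for y J i k
  proof -
    have JO: "J \<in> word_orbit n w" using J(1) k(2) unfolding word_orbit_def J0_def by blast
    have z: "arc_coeff n (y l) ((cyc_succ n ^^ l) ` J) ((cyc_succ n ^^ l) i) = 0" if l: "l \<in> {..<d} - {k}" for l
    proof (rule ccontr)
      assume nz: "\<not> ?thesis"
      have "y l \<in> supported n {J0}" using y l by blast
      then have "(cyc_succ n ^^ l) ` J = J0" using supported_coeffD nz by blast
      then show False using word_orbit_unique[OF n1 w JO] k l unfolding J0_def by blast
    qed
    have "(\<Sum>l<d. arc_coeff n (y l) ((cyc_succ n ^^ l) ` J) ((cyc_succ n ^^ l) i))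
      = (\<Sum>l\<in>{k}. arc_coeff n (y l) ((cyc_succ n ^^ l) ` J) ((cyc_succ n ^^ l) i))"
      by (rule sum.mono_neutral_right) (use k(1) z in auto)
    then show ?thesis using comb_sum[OF y J] k(2) by simp
  qed
  have iso: "module_isomorphic S (extend_scalars S R N) E"
  proof (rule extend_scalars_iso[where K = "{..<d}" and e = e and f = "\<lambda>x. x"])
    show "Module.module S E" by (rule ME)
    show "carrier R \<subseteq> carrier S" by (rule RS)
    show "abelian_group N" unfolding N_def by (rule abelian_group_supported)
    show "r \<odot>\<^bsub>N\<^esub> x \<in> carrier N" if "r \<in> carrier R" "x \<in> carrier N" for r x
      using submodule.smult_closed[OF subN, of r x] that unfolding N_def J0_def by simp
    show "x \<in> carrier E" if "x \<in> carrier N" for x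
      using that NE unfolding N_def E_def J0_def by auto
    show "x \<oplus>\<^bsub>N\<^esub> y = x \<oplus>\<^bsub>E\<^esub> y" for x y unfolding N_def E_def by simp
    show "r \<odot>\<^bsub>N\<^esub> x = r \<odot>\<^bsub>E\<^esub> x" for r x unfolding N_def E_def by simp
    show "finite {..<d}" by simp
    show "e k \<in> carrier S" if "k \<in> {..<d}" for k using that dn by (intro ecl) simp
    show "\<exists>r\<in>{..<d} \<rightarrow> carrier R. a = (\<Oplus>\<^bsub>S\<^esub>k\<in>{..<d}. e k \<otimes>\<^bsub>S\<^esub> r k)" if "a \<in> carrier S" for a
      using group_ring_generated[OF n w(2)] that unfolding S_def R_def e_def by blast
  next
    fix m assume "m \<in> carrier E"
    then have m: "m \<in> supported n (word_orbit n w)" unfolding E_def by simp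
    \<comment> \<open>The component at the k-th set is rotated back to \<open>J0\<close> and cut out
      there.\<close>
    define y where "y = (\<lambda>k. part n {J0} (e ((n - k) mod n) \<odot>\<^bsub>polygon_H1 n\<^esub> m))"
    have y: "y \<in> {..<d} \<rightarrow> supported n {J0}" unfolding y_def using part_supported[OF n1] by blast
    have "m = comb y"
    proof (rule arc_coeff_eqI[OF n1 supportedD[OF m] supportedD[OF comb_in[OF y]]])
      fix J i assume J: "J \<subset> {1..n}" and i: "i \<in> {1..n}"
      show "arc_coeff n m J i = arc_coeff n (comb y) J i"
      proof (cases "J \<in> word_orbit n w")
        case True
        then obtain k where k: "k < d" "(cyc_succ n ^^ k) ` J = J0" using word_orbit_unique[OF n1 w] unfolding J0_def by blast
        have kn: "k \<le> n" using k(1) dn by simp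
        have J0s: "J0 \<subset> {1..n}" using cyc_succ_pow_image_proper[OF n1 J, of k] k(2) by simp
        have "arc_coeff n (comb y) J i = arc_coeff n (y k) J0 ((cyc_succ n ^^ k) i)" by (rule comb_coeff[OF y J i k])
        also have "\<dots> = arc_coeff n (e ((n - k) mod n) \<odot>\<^bsub>polygon_H1 n\<^esub> m) J0 ((cyc_succ n ^^ k) i)"
          unfolding y_def part(2)[OF n1] by simp
        also have "\<dots> = arc_coeff n m ((cyc_succ n ^^ ((n - k) mod n)) ` J0) ((cyc_succ n ^^ ((n - k) mod n)) ((cyc_succ n ^^ k) i))"
          by (rule ecoef[OF _ supportedD[OF m] J0s cyc_succ_pow_in[OF i]]) (use n1 in simp)
        also have "\<dots> = arc_coeff n m J i"
          unfolding k(2)[symmetric] cyc_succ_pow_cancel(1)[OF i kn] cyc_succ_pow_image_cancel(1)[OF psubset_imp_subset[OF J] kn] ..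
        finally show ?thesis by simp
      next
        case False
        then have "arc_coeff n m J i = 0" "arc_coeff n (comb y) J i = 0"
          using supported_coeffD[OF m] supported_coeffD[OF comb_in[OF y]] by blast+
        then show ?thesis by simp
      qed
    qed
    then show "\<exists>y\<in>{..<d} \<rightarrow> carrier N. m = (\<Oplus>\<^bsub>E\<^esub>k\<in>{..<d}. e k \<odot>\<^bsub>E\<^esub> y k)"
      using y unfolding comb_def N_def J0_def by (intro bexI[of _ y]) simp_all
  next
    fix y assume "y \<in> {..<d} \<rightarrow> carrier N" and z: "(\<Oplus>\<^bsub>E\<^esub>k\<in>{..<d}. e k \<odot>\<^bsub>E\<^esub> y k) = \<zero>\<^bsub>E\<^esub>"
    then have y: "y \<in> {..<d} \<rightarrow> supported n {J0}" unfolding N_def J0_def by simp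
    have zero: "arc_coeff n (comb y) J i = 0" for J i
      using z arc_coeff_one[of n J i] unfolding comb_def E_def by (simp add: polygon_H1_simps)
    show "\<forall>k\<in>{..<d}. y k = \<zero>\<^bsub>N\<^esub>"
    proof
      fix k assume "k \<in> {..<d}"
      then have k: "k < d" "k \<le> n" using dn by simp_all
      have yk: "y k \<in> supported n {J0}" using y k(1) by blast
      have "y k = \<zero>\<^bsub>polygon_H1 n\<^esub>"
      proof (rule arc_coeff_eqI[OF n1 supportedD[OF yk] supportedD[OF supported_zero]])
        fix J i assume J: "J \<subset> {1..n}" and i: "i \<in> {1..n}"
        have "arc_coeff n (y k) J i = 0"
        proof (cases "J = J0")
          case True
          \<comment> \<open>The set and vertex whose k-th rotations are J and i; there the vanishing
            combination displays the coefficient of \<open>y k\<close>.\<close>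
          define J' where "J' = (cyc_succ n ^^ ((n - k) mod n)) ` J"
          define i' where "i' = (cyc_succ n ^^ ((n - k) mod n)) i"
          have J': "J' \<subset> {1..n}" "i' \<in> {1..n}" "(cyc_succ n ^^ k) ` J' = J0" "(cyc_succ n ^^ k) i' = i"
            unfolding J'_def i'_def
            using cyc_succ_pow_image_proper[OF n1 J] cyc_succ_pow_in[OF i] cyc_succ_pow_image_cancel(2)[OF psubset_imp_subset[OF J] k(2)]
              cyc_succ_pow_cancel(2)[OF i k(2)] True by simp_all
          show ?thesis using comb_coeff[OF y J'(1,2) k(1) J'(3)] zero J'(4) True by simp
        next
          case False then show ?thesis using supported_coeffD[OF yk] by blast
        qed
        then show "arc_coeff n (y k) J i = arc_coeff n \<zero>\<^bsub>polygon_H1 n\<^esub> J i"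
          using arc_coeff_one[of n J i] by (simp add: polygon_H1_simps)
      qed
      then show "y k = \<zero>\<^bsub>N\<^esub>" unfolding N_def by simp
    qed
  qed
  have "Module.module S (extend_scalars S R N)"
  proof (rule module_extend_scalars[OF cS RS])
    show "x \<oplus>\<^bsub>N\<^esub> y \<in> carrier N" if "x \<in> carrier N" "y \<in> carrier N" for x y
      using supported_closed(1) that unfolding N_def by simp
    show "r \<odot>\<^bsub>N\<^esub> x \<in> carrier N" if "r \<in> carrier R" "x \<in> carrier N" for r x
      using submodule.smult_closed[OF subN, of r x] that unfolding N_def J0_def by simp
  qed
  then show ?thesis
    using module_isomorphic_sym[OF iso _ ME] unfolding induced_module_def S_def R_def E_def N_def by blast
qed

section \<open>Decomposition of the first homology by orbits\<close>

lemma polygon_wordsD: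
  assumes "n \<ge> 2" "w \<in> polygon_words n"
  shows "w \<in> lyndon_words (length w)" "length w dvd n" "length w > 1" "length w = n \<Longrightarrow> iota w > 1"
proof -
  consider d where "d dvd n" "1 < d" "d < n" "w \<in> lyndon_words d" | "w \<in> lyndon_words n" "iota w > 1"
    using assms(2) unfolding polygon_words_def by blast
  then have "w \<in> lyndon_words (length w) \<and> length w dvd n \<and> length w > 1 \<and> (length w = n \<longrightarrow> iota w > 1)"
  proof cases
    case 1 then show ?thesis using lyndon_wordsD(1)[OF 1(4)] by simp
  next
    case 2 then show ?thesis using lyndon_wordsD(1)[OF 2(1)] assms(1) by simp
  qed
  then show "w \<in> lyndon_words (length w)" "length w dvd n" "length w > 1" "length w = n \<Longrightarrow> iota w > 1" by blast+
qed

lemma finite_polygon_words: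
  assumes "n \<ge> 2"
  shows "finite (polygon_words n)"
proof (rule finite_subset)
  show "polygon_words n \<subseteq> {w. set w \<subseteq> {0, 1} \<and> length w \<le> n}"
  proof
    fix w assume "w \<in> polygon_words n"
    note w = polygon_wordsD[OF assms this]
    have "length w \<le> n" using w(2) assms by (intro dvd_imp_le) simp_all
    then show "w \<in> {w. set w \<subseteq> {0, 1} \<and> length w \<le> n}" using lyndon_wordsD(2)[OF w(1)] by simp
  qed
  show "finite {w. set w \<subseteq> {0, 1::nat} \<and> length w \<le> n}" by (rule finite_lists_length_le) simp
qed

lemma cyc_succ_pow_mod_image:
  assumes "J \<subseteq> {1..n}"
  shows "(cyc_succ n ^^ k) ` J = (cyc_succ n ^^ (k mod n)) ` J"
proof (rule image_cong[OF refl])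
  fix i assume "i \<in> J"
  then have i: "i \<in> {1..n}" using assms by blast
  show "(cyc_succ n ^^ k) i = (cyc_succ n ^^ (k mod n)) i"
    unfolding cyc_succ_pow[OF i] by (simp add: mod_add_right_eq)
qed

lemma cyc_succ_pow_image_inverse:
  assumes n: "n \<ge> 1" and J: "J \<subseteq> {1..n}"
  obtains m where "(cyc_succ n ^^ m) ` (cyc_succ n ^^ k) ` J = J"
proof -
  have k: "k mod n \<le> n" using n by (simp add: mod_less_divisor less_imp_le)
  have "(cyc_succ n ^^ ((n - k mod n) mod n)) ` (cyc_succ n ^^ k) ` J = J"
    unfolding cyc_succ_pow_mod_image[OF J, of k] by (rule cyc_succ_pow_image_cancel(1)[OF J k])
  then show thesis by (rule that)
qed

lemma word_orbits_disjoint: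
  assumes n: "n \<ge> 2" and v: "v \<in> polygon_words n" and w: "w \<in> polygon_words n"
    and J: "J \<in> word_orbit n v" "J \<in> word_orbit n w"
  shows "v = w"
proof -
  have n1: "n \<ge> 1" using n by simp
  obtain k l where k: "J \<subseteq> {1..n}" "(cyc_succ n ^^ k) ` J = word_set n v" "(cyc_succ n ^^ l) ` J = word_set n w"
    using J unfolding word_orbit_def by blast
  obtain m where m: "(cyc_succ n ^^ m) ` (cyc_succ n ^^ k) ` J = J" by (rule cyc_succ_pow_image_inverse[OF n1 k(1)])
  have "(cyc_succ n ^^ (l + m)) ` word_set n v = (cyc_succ n ^^ l) ` (cyc_succ n ^^ m) ` (cyc_succ n ^^ k) ` J"
    unfolding k(2) by (simp add: funpow_add image_comp)
  then have "(cyc_succ n ^^ (l + m)) ` word_set n v = word_set n w" unfolding m k(3) .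
  then show ?thesis
    by (rule word_set_orbit_unique[OF n1 polygon_wordsD(1,2)[OF n v] polygon_wordsD(1,2)[OF n w]])
qed

text \<open>A nonzero function with sum 0 needs at least two arcs. This excludes words of length 1,
  which give the empty or the full set, and for length n the number of arcs is
  \<open>iota w\<close>.\<close>

lemma arc_coeff_nonzero_orbit:
  assumes n: "n \<ge> 2" and nz: "arc_coeff n x J i \<noteq> 0"
  shows "\<exists>w\<in>polygon_words n. J \<in> word_orbit n w"
proof -
  have n1: "n \<ge> 1" using n by simp
  have J: "J \<subset> {1..n}" and i: "i \<in> arc_starts n J" using arc_coeff_nonzero[OF nz] by blast+
  have "card (arc_starts n J) \<noteq> 0" using i by auto
  moreover have "card (arc_starts n J) \<noteq> 1"
  proof
    assume "card (arc_starts n J) = 1"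
    then have "arc_starts n J = {i}" using i by (auto simp: card_1_singleton_iff)
    then show False using sum_arc_starts_arc_functions[OF arc_coeff_in, of n x J] nz by simp
  qed
  ultimately have two: "card (arc_starts n J) \<ge> 2" by linarith
  obtain d w k where d: "d dvd n" and w: "w \<in> lyndon_words d" and k: "(cyc_succ n ^^ k) ` word_set n w = J"
    using word_set_orbit_exists[OF n1 psubset_imp_subset[OF J]] by blast
  have len: "length w = d" by (rule lyndon_wordsD(1)[OF w])
  obtain m where "(cyc_succ n ^^ m) ` (cyc_succ n ^^ k) ` word_set n w = word_set n w"
    by (rule cyc_succ_pow_image_inverse[OF n1 word_set_subset])
  then have m: "(cyc_succ n ^^ m) ` J = word_set n w" unfolding k .
  have W: "word_set n w \<subset> {1..n}" using cyc_succ_pow_image_proper[OF n1 J, of m] unfolding m .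
  have two': "card (arc_starts n (word_set n w)) \<ge> 2" using card_arc_starts_pow[OF n1 J, of m] two unfolding m by simp
  have d0: "d \<noteq> 0" using d n1 by auto
  have d1: "d > 1"
  proof (rule ccontr)
    assume "\<not> d > 1"
    then have "d = 1" using d0 by simp
    then have "word_set n w = {} \<or> word_set n w = {1..n}" unfolding word_set_def len by auto
    then have "word_set n w = {}" using W by blast
    then have "arc_starts n (word_set n w) = {}" unfolding arc_starts_def by blast
    then show False using two' by simp
  qed
  have "w \<in> polygon_words n"
  proof (cases "d = n")
    case True
    have "card (rises w \<times> {..<n div d}) = card (arc_starts n (word_set n w))"
      by (rule bij_betw_same_card[OF arc_starts_word_set[OF n1 w d1 d]])
    then have "iota w = card (arc_starts n (word_set n w))"
      using True n1 by (simp add: iota_eq_card_rises card_cartesian_product)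
    then show ?thesis using two' w True unfolding polygon_words_def by simp
  next
    case False
    then have "d < n" using d n1 by (simp add: dvd_imp_le le_neq_implies_less)
    then show ?thesis using d d1 w unfolding polygon_words_def by blast
  qed
  moreover have "J \<in> word_orbit n w" using m J unfolding word_orbit_def by blast
  ultimately show ?thesis by blast
qed

text \<open>An orbit is closed under rotations in both directions, so cutting coefficients down to
  it commutes with the action.\<close>

lemma part_smult:
  assumes n: "n \<ge> 1" and r: "r \<in> carrier (group_ring (integer_mod_group n))" and x: "x \<in> carrier (polygon_H1 n)"
  shows "part n (word_orbit n w) (r \<odot>\<^bsub>polygon_H1 n\<^esub> x) = r \<odot>\<^bsub>polygon_H1 n\<^esub> part n (word_orbit n w) x"
proof (rule arc_coeff_eqI[OF n part(1)[OF n]])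
  have M: "Module.module (group_ring (integer_mod_group n)) (polygon_H1 n)" by (rule module_polygon_H1[OF n])
  show "r \<odot>\<^bsub>polygon_H1 n\<^esub> part n (word_orbit n w) x \<in> carrier (polygon_H1 n)"
    by (rule module.smult_closed[OF M r part(1)[OF n]])
  have keys: "Poly_Mapping.keys r \<subseteq> {0..<int n}" using r n by (simp add: group_ring_simps carrier_integer_mod_group)
  fix J i assume J: "J \<subset> {1..n}" and i: "i \<in> {1..n}"
  have eq: "(if J \<in> word_orbit n w then arc_coeff n x ((cyc_succ n ^^ nat g) ` J) ((cyc_succ n ^^ nat g) i) else 0)
      = arc_coeff n (part n (word_orbit n w) x) ((cyc_succ n ^^ nat g) ` J) ((cyc_succ n ^^ nat g) i)"
    if "g \<in> Poly_Mapping.keys r" for g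
  proof -
    have "g < int n" using subsetD[OF keys that] by simp
    then have "nat g \<le> n" by linarith
    then have "(cyc_succ n ^^ nat g) ` J \<in> word_orbit n w \<longleftrightarrow> J \<in> word_orbit n w"
      by (rule word_orbit_pow_iff[OF n psubset_imp_subset[OF J]])
    then show ?thesis unfolding part(2)[OF n] by simp
  qed
  show "arc_coeff n (part n (word_orbit n w) (r \<odot>\<^bsub>polygon_H1 n\<^esub> x)) J i
      = arc_coeff n (r \<odot>\<^bsub>polygon_H1 n\<^esub> part n (word_orbit n w) x) J i"
    unfolding part(2)[OF n, of _ "r \<odot>\<^bsub>polygon_H1 n\<^esub> x"] arc_coeff_smult[OF n keys x J i] arc_coeff_smult[OF n keys part(1)[OF n] J i]
    using eq by (auto intro!: sum.cong simp flip: eq)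
qed

lemma part_add:
  assumes n: "n \<ge> 1" and x: "x \<in> carrier (polygon_H1 n)" and y: "y \<in> carrier (polygon_H1 n)"
  shows "part n A (x \<oplus>\<^bsub>polygon_H1 n\<^esub> y) = part n A x \<oplus>\<^bsub>polygon_H1 n\<^esub> part n A y"
proof (rule arc_coeff_eqI[OF n part(1)[OF n]])
  show "part n A x \<oplus>\<^bsub>polygon_H1 n\<^esub> part n A y \<in> carrier (polygon_H1 n)"
    by (rule supportedD[OF supported_closed(1)[OF part_supported[OF n] part_supported[OF n]]])
  fix J i
  show "arc_coeff n (part n A (x \<oplus>\<^bsub>polygon_H1 n\<^esub> y)) J i = arc_coeff n (part n A x \<oplus>\<^bsub>polygon_H1 n\<^esub> part n A y) J i"
    unfolding arc_coeff_add[OF part(1)[OF n] part(1)[OF n]] part(2)[OF n] arc_coeff_add[OF x y] by simp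
qed

text \<open>The parts on the orbits are jointly injective because every nonzero coefficient sits in
  the orbit of some word, and jointly surjective because different words have disjoint
  orbits.\<close>

theorem polygon_H1_decomposition:
  assumes n: "n \<ge> 2"
  shows "module_isomorphic (group_ring (integer_mod_group n)) (polygon_H1 n)
      (direct_sum_module (polygon_words n)
         (\<lambda>w. induced_module (integer_mod_group n) (sigma_subgroup n (length w))
                ((polygon_H1 n)\<lparr>carrier := supported n {word_set n w}\<rparr>)))"
proof -
  have n1: "n \<ge> 1" using n by simp
  let ?E = "\<lambda>w. (polygon_H1 n)\<lparr>carrier := supported n (word_orbit n w)\<rparr>"
  show ?thesis
  proof (rule direct_sum_isomorphic[where E = ?E and p = "\<lambda>w. part n (word_orbit n w)"])
    show "finite (polygon_words n)" by (rule finite_polygon_words[OF n])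
    show "part n (word_orbit n w) x \<in> carrier (?E w)" for w x using part_supported[OF n1] by simp
    show "part n (word_orbit n w) (x \<oplus>\<^bsub>polygon_H1 n\<^esub> y) = part n (word_orbit n w) x \<oplus>\<^bsub>?E w\<^esub> part n (word_orbit n w) y"
      if "x \<in> carrier (polygon_H1 n)" "y \<in> carrier (polygon_H1 n)" for w x y
      using part_add[OF n1 that] by simp
    show "part n (word_orbit n w) (r \<odot>\<^bsub>polygon_H1 n\<^esub> x) = r \<odot>\<^bsub>?E w\<^esub> part n (word_orbit n w) x"
      if "r \<in> carrier (group_ring (integer_mod_group n))" "x \<in> carrier (polygon_H1 n)" for w r x
      using part_smult[OF n1 that] by simp
    show "module_isomorphic (group_ring (integer_mod_group n)) (?E w)
        (induced_module (integer_mod_group n) (sigma_subgroup n (length w)) ((polygon_H1 n)\<lparr>carrier := supported n {word_set n w}\<rparr>))"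
      if "w \<in> polygon_words n" for w
      by (rule orbit_isomorphic_induced[OF n polygon_wordsD(1,2)[OF n that]])
  next
    fix x y assume x: "x \<in> carrier (polygon_H1 n)" and y: "y \<in> carrier (polygon_H1 n)"
      and eq: "\<And>w. w \<in> polygon_words n \<Longrightarrow> part n (word_orbit n w) x = part n (word_orbit n w) y"
    show "x = y"
    proof (rule arc_coeff_eqI[OF n1 x y])
      fix J i
      show "arc_coeff n x J i = arc_coeff n y J i"
      proof (cases "\<exists>w\<in>polygon_words n. J \<in> word_orbit n w")
        case True
        then obtain w where w: "w \<in> polygon_words n" "J \<in> word_orbit n w" by blast
        then show ?thesis using part(2)[OF n1, of "word_orbit n w" x J i] part(2)[OF n1, of "word_orbit n w" y J i] eq[OF w(1)] by simp
      next
        case False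
        then have "arc_coeff n x J i = 0" "arc_coeff n y J i = 0" using arc_coeff_nonzero_orbit[OF n] by blast+
        then show ?thesis by simp
      qed
    qed
  next
    fix f assume f: "f \<in> (\<Pi> w\<in>polygon_words n. carrier (?E w))"
    then have fw: "f w \<in> supported n (word_orbit n w)" if "w \<in> polygon_words n" for w using that by fastforce
    have fU: "f w \<in> supported n UNIV" if "w \<in> polygon_words n" for w
      by (rule subsetD[OF supported_mono fw[OF that]]) simp
    define x where "x = (\<Oplus>\<^bsub>(polygon_H1 n)\<lparr>carrier := supported n UNIV\<rparr>\<^esub>w\<in>polygon_words n. f w)"
    have x: "x \<in> carrier (polygon_H1 n)"
      unfolding x_def by (rule supportedD[OF arc_coeff_finsum(1)[OF finite_polygon_words[OF n] fU]])
    have xc: "arc_coeff n x J i = (\<Sum>w\<in>polygon_words n. arc_coeff n (f w) J i)" for J i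
      unfolding x_def by (rule arc_coeff_finsum(2)[OF finite_polygon_words[OF n] fU])
    have "part n (word_orbit n w) x = f w" if w: "w \<in> polygon_words n" for w
    proof (rule arc_coeff_eqI[OF n1 part(1)[OF n1] supportedD[OF fw[OF w]]])
      fix J i
      show "arc_coeff n (part n (word_orbit n w) x) J i = arc_coeff n (f w) J i"
      proof (cases "J \<in> word_orbit n w")
        case True
        have z: "arc_coeff n (f v) J i = 0" if v: "v \<in> polygon_words n - {w}" for v
        proof (rule ccontr)
          assume "\<not> ?thesis"
          then have "J \<in> word_orbit n v" using supported_coeffD[OF fw] v by blast
          then show False using word_orbits_disjoint[OF n _ w _ True] v by blast
        qed
        have "(\<Sum>v\<in>polygon_words n. arc_coeff n (f v) J i) = (\<Sum>v\<in>{w}. arc_coeff n (f v) J i)"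
          by (rule sum.mono_neutral_right[OF finite_polygon_words[OF n]]) (use w z in auto)
        then show ?thesis using True unfolding part(2)[OF n1] xc by simp
      next
        case False
        then have "arc_coeff n (f w) J i = 0" using supported_coeffD[OF fw[OF w]] by blast
        then show ?thesis using False unfolding part(2)[OF n1] by simp
      qed
    qed
    then show "\<exists>x\<in>carrier (polygon_H1 n). \<forall>w\<in>polygon_words n. part n (word_orbit n w) x = f w" using x by blast
  qed
qed

section \<open>The block matrix\<close>

lemma dim_diag_block_replicate:
  assumes "A \<in> carrier_mat m m"
  shows "diag_block_mat (replicate q A) \<in> carrier_mat (q * m) (q * m)"
proof (induction q)
  case (Suc q)
  then show ?case using four_block_carrier_mat[OF assms Suc] by (simp add: Let_def)
qed (simp add: carrier_matI)

lemma index_diag_block_replicate: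
  fixes A :: "'a::zero mat"
  assumes A: "A \<in> carrier_mat m m" and m: "m > 0" and "i < q * m" "j < q * m"
  shows "diag_block_mat (replicate q A) $$ (i, j) = (if i div m = j div m then A $$ (i mod m, j mod m) else 0)"
  using assms(3,4)
proof (induction q arbitrary: i j)
  case (Suc q)
  let ?B = "diag_block_mat (replicate q A)"
  have B: "?B \<in> carrier_mat (q * m) (q * m)" by (rule dim_diag_block_replicate[OF A])
  have e: "diag_block_mat (replicate (Suc q) A) $$ (i, j) = (if i < m then if j < m then A $$ (i, j) else 0 else if j < m then 0 else ?B $$ (i - m, j - m))"
    using Suc.prems A B by (auto simp: Let_def)
  consider "i < m" "j < m" | "i < m" "j \<ge> m" | "i \<ge> m" "j < m" | "i \<ge> m" "j \<ge> m" by linarith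
  then show ?case
  proof cases
    case 1 then show ?thesis unfolding e by simp
  next
    case 2
    then have "j div m > 0" using m by (simp add: div_greater_zero_iff)
    then show ?thesis using 2 unfolding e by simp
  next
    case 3
    then have "i div m > 0" using m by (simp add: div_greater_zero_iff)
    then show ?thesis using 3 unfolding e by simp
  next
    case 4
    have l: "i - m < q * m" "j - m < q * m" using Suc.prems 4 by auto
    show ?thesis unfolding e using 4 m Suc.IH[OF l] by (simp add: le_div_geq le_mod_geq)
  qed
qed simp

lemma cycle_index_eq:
  assumes "i < m" "j < (m::nat)"
  shows "i = j + 1 \<or> i = 0 \<and> j + 1 = m \<longleftrightarrow> j = (i + m - 1) mod m"
proof (cases "i = 0")
  case True then show ?thesis using assms by auto
next
  case False
  then have "i + m - 1 = (i - 1) + m" by simp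
  then have "(i + m - 1) mod m = (i - 1) mod m" by simp
  then have "(i + m - 1) mod m = i - 1" using assms by simp
  then show ?thesis using False by auto
qed

text \<open>\<open>t div m * m + (t mod m + m - 1) mod m\<close> is the cyclic predecessor of t in
  its block of length m. The row with number \<open>(c - 1) * m\<close> is the zero row of the lower
  middle block and has only the -1 of the last column.\<close>

lemma index_action_mat:
  assumes m: "m \<ge> 2" and t: "t < (c - 1) * m + (m - 1)" and s: "s < (c - 1) * m + (m - 1)"
  shows "action_mat c m $$ (t, s) =
    (if s = (c - 1) * m + (m - 2) then - 1
     else if t < (c - 1) * m \<and> s = t div m * m + (t mod m + m - 1) mod m \<or> t > (c - 1) * m \<and> s = t - 1 then 1 else 0)"
proof -
  define p where "p = (c - 1) * m"
  let ?A = "diag_block_mat (replicate (c - 1) (cycle_mat m))"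
  have C: "cycle_mat m \<in> carrier_mat m m" by (simp add: cycle_mat_def)
  have A: "?A \<in> carrier_mat p p" unfolding p_def by (rule dim_diag_block_replicate[OF C])
  have dA: "dim_row ?A = p" "dim_col ?A = p" using A by auto
  have q: "p + (m - 2) + 1 = p + (m - 1)" using m by simp
  have div_lt: "t div m * m + (t mod m + m - 1) mod m < p" if "t < p"
  proof -
    have "t div m < c - 1" using that unfolding p_def by (simp add: less_mult_imp_div_less)
    then have "Suc (t div m) * m \<le> p" unfolding p_def by (intro mult_le_mono1) simp
    moreover have "(t mod m + m - 1) mod m < m" using m by simp
    ultimately show ?thesis by simp
  qed
  have bl: "?A $$ (t, s) = (if s = t div m * m + (t mod m + m - 1) mod m then 1 else 0)" if "t < p" "s < p"
  proof -
    have m0: "m > 0" using m by simp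
    have "?A $$ (t, s) = (if t div m = s div m then cycle_mat m $$ (t mod m, s mod m) else 0)"
      by (rule index_diag_block_replicate[OF C m0]) (use that in \<open>simp_all add: p_def\<close>)
    also have "\<dots> = (if t div m = s div m \<and> s mod m = (t mod m + m - 1) mod m then 1 else 0)"
    proof -
      have "cycle_mat m $$ (t mod m, s mod m) = (if t mod m = s mod m + 1 \<or> t mod m = 0 \<and> s mod m + 1 = m then 1 else 0)"
        using m0 by (simp add: cycle_mat_def)
      note e = this[unfolded cycle_index_eq[OF mod_less_divisor[OF m0] mod_less_divisor[OF m0]]]
      show ?thesis unfolding e by simp
    qed
    also have "t div m = s div m \<and> s mod m = (t mod m + m - 1) mod m \<longleftrightarrow> s = t div m * m + (t mod m + m - 1) mod m"
    proof
      assume "t div m = s div m \<and> s mod m = (t mod m + m - 1) mod m"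
      then show "s = t div m * m + (t mod m + m - 1) mod m" using div_mult_mod_eq[of s m] by simp
    next
      assume "s = t div m * m + (t mod m + m - 1) mod m"
      then show "t div m = s div m \<and> s mod m = (t mod m + m - 1) mod m" using m0 by simp
    qed
    finally show ?thesis .
  qed
  define B where "B = ?A"
  define Z where "Z = (0\<^sub>m 1 (m - 2) @\<^sub>r 1\<^sub>m (m - 2) :: int mat)"
  have B: "B \<in> carrier_mat p p" unfolding B_def by (rule A)
  have Z: "Z \<in> carrier_mat (m - 1) (m - 2)" using m unfolding Z_def append_rows_def by (intro carrier_matI) simp_all
  have E: "action_mat c m $$ (t, s) = (if s = p + (m - 2) then - 1 else if t < p then if s < p then B $$ (t, s) else 0
      else if s < p then 0 else Z $$ (t - p, s - p))"
  proof -
    have dB: "dim_row B = p" "dim_col B = p" "dim_row Z = m - 1" "dim_col Z = m - 2" using B Z by simp_all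
    define L where "L = four_block_mat B (0\<^sub>m p (m - 2)) (0\<^sub>m (m - 1) p) Z"
    have L: "dim_row L = p + (m - 1)" "dim_col L = p + (m - 2)" unfolding L_def by (simp_all add: dB)
    have a: "action_mat c m = four_block_mat L (Matrix.mat (p + (m - 1)) 1 (\<lambda>_. - 1)) (0\<^sub>m 0 (p + (m - 2))) (0\<^sub>m 0 1)"
      unfolding action_mat_def Let_def p_def[symmetric] B_def[symmetric] Z_def[symmetric] L_def[symmetric] ..
    have t': "t < p + (m - 1)" and s': "s < p + (m - 2) + 1" using t s m unfolding p_def[symmetric] by simp_all
    have e: "action_mat c m $$ (t, s) = (if s < p + (m - 2) then L $$ (t, s) else - 1)"
      unfolding a using t' s' by (subst index_mat_four_block(1)) (simp_all add: L)
    show ?thesis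
    proof (cases "s < p + (m - 2)")
      case True
      have "L $$ (t, s) = (if t < p then if s < p then B $$ (t, s) else 0 else if s < p then 0 else Z $$ (t - p, s - p))"
        unfolding L_def using t' True by (subst index_mat_four_block(1)) (simp_all add: dB less_diff_conv2)
      then show ?thesis using e True by simp
    next
      case False
      then show ?thesis using e s' by simp
    qed
  qed
  have Zi: "Z $$ (t - p, s - p) = (if t > p \<and> s = t - 1 then 1 else 0)" if tp: "\<not> t < p" and sp: "\<not> s < p" and sl: "s \<noteq> p + (m - 2)"
  proof -
    have l: "t - p < 1 + (m - 2)" "s - p < m - 2" using t s tp sp sl m unfolding p_def[symmetric] by linarith+
    have "Z $$ (t - p, s - p) = (if t - p < 1 then 0 else 1\<^sub>m (m - 2) $$ (t - p - 1, s - p))"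
      unfolding Z_def append_rows_def using l by (subst index_mat_four_block(1)) simp_all
    also have "\<dots> = (if t > p \<and> s = t - 1 then 1 else 0)"
    proof (cases "t > p")
      case True
      then have "t - p - 1 < m - 2" "(t - p - 1 = s - p) = (s = t - 1)" using l sp by linarith+
      then show ?thesis using True l by simp
    next
      case False then show ?thesis by simp
    qed
    finally show ?thesis .
  qed
  show ?thesis
  proof (cases "s = p + (m - 2)")
    case True then show ?thesis unfolding E p_def[symmetric] by simp
  next
    case sl: False
    show ?thesis
    proof (cases "t < p")
      case True
      show ?thesis
      proof (cases "s < p")
        case sp: True
        then show ?thesis unfolding E p_def[symmetric] B_def bl[OF True sp] using sl True by simp
      next
        case False
        then have "s \<noteq> t div m * m + (t mod m + m - 1) mod m" using div_lt[OF True] by linarith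
        then show ?thesis unfolding E p_def[symmetric] using sl True False by simp
      qed
    next
      case tp: False
      show ?thesis
      proof (cases "s < p")
        case True
        then have "\<not> (t > p \<and> s = t - 1)" using tp by linarith
        then show ?thesis unfolding E p_def[symmetric] using sl tp True by simp
      next
        case False
        then show ?thesis unfolding E p_def[symmetric] Zi[OF tp False sl] using sl tp False by simp
      qed
    qed
  qed
qed

lemma action_mat_carrier:
  assumes m: "m \<ge> 2"
  shows "action_mat c m \<in> carrier_mat ((c - 1) * m + (m - 1)) ((c - 1) * m + (m - 1))"
proof -
  have C: "cycle_mat m \<in> carrier_mat m m" by (simp add: cycle_mat_def)
  have "diag_block_mat (replicate (c - 1) (cycle_mat m)) \<in> carrier_mat ((c - 1) * m) ((c - 1) * m)" by (rule dim_diag_block_replicate[OF C])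
  note A = carrier_matD[OF this]
  show ?thesis
    unfolding action_mat_def Let_def using m by (intro carrier_matI) (simp_all add: append_rows_def A[simplified])
qed

lemma action_mat_mult:
  fixes v :: "int vec"
  assumes m: "m \<ge> 2" and v: "v \<in> carrier_vec ((c - 1) * m + (m - 1))" and t: "t < (c - 1) * m + (m - 1)"
  shows "(action_mat c m *\<^sub>v v) $ t =
    (if t < (c - 1) * m then v $ (t div m * m + (t mod m + m - 1) mod m) else if t > (c - 1) * m then v $ (t - 1) else 0)
    - v $ ((c - 1) * m + (m - 2))"
proof -
  define p where "p = (c - 1) * m"
  define D where "D = p + (m - 1)"
  define q where "q = (if t < p then t div m * m + (t mod m + m - 1) mod m else t - 1)"
  have tD: "t < D" using t unfolding D_def p_def .
  \<comment> \<open>The entry 1 of a row never falls into the last column, so the row sum splits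
    into one entry 1 and one entry -1.\<close>
  have qD: "q < p + (m - 2)" if "t \<noteq> p"
  proof (cases "t < p")
    case True
    then have "t div m < c - 1" unfolding p_def by (simp add: less_mult_imp_div_less)
    then have "Suc (t div m) * m \<le> p" unfolding p_def by (intro mult_le_mono1) simp
    moreover have "(t mod m + m - 1) mod m < m" using m by simp
    ultimately show ?thesis using True unfolding q_def by simp
  next
    case False then show ?thesis using that tD m unfolding q_def D_def by simp
  qed
  have "(action_mat c m *\<^sub>v v) $ t = (\<Sum>s<D. action_mat c m $$ (t, s) * v $ s)"
    using action_mat_carrier[OF m, of c] v tD unfolding D_def p_def
    by (auto simp: scalar_prod_def lessThan_atLeast0 intro!: sum.cong)
  also have "\<dots> = (\<Sum>s<D. (if s = q then if t \<noteq> p then v $ s else 0 else 0) + (if s = p + (m - 2) then - v $ s else 0))"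
  proof (rule sum.cong[OF refl])
    fix s assume "s \<in> {..<D}"
    then have s: "s < (c - 1) * m + (m - 1)" unfolding D_def p_def by simp
    show "action_mat c m $$ (t, s) * v $ s = (if s = q then if t \<noteq> p then v $ s else 0 else 0) + (if s = p + (m - 2) then - v $ s else 0)"
      unfolding index_action_mat[OF m t s] p_def[symmetric] using qD by (auto simp: q_def)
  qed
  also have "\<dots> = (if t \<noteq> p then v $ q else 0) - v $ (p + (m - 2))"
    unfolding sum.distrib using qD m by (auto simp: D_def)
  finally show ?thesis unfolding p_def[symmetric] q_def by auto
qed

text \<open>An array with total sum 0, shifted cyclically along its rows, is described by the block matrix
  once the partial column sums \<open>\<gamma>\<^sub>k\<close> are added to all rows but the last, and the last row is
  replaced by \<open>\<gamma>\<^sub>0, \<dots>, \<gamma>\<^sub>m\<^sub>-\<^sub>2\<close>.\<close>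

definition row_partial :: "nat \<Rightarrow> (nat \<Rightarrow> nat \<Rightarrow> int) \<Rightarrow> nat \<Rightarrow> int" where
  "row_partial c y k = (\<Sum>l\<le>k. \<Sum>a<c. y a l)"

definition cycle_vec :: "nat \<Rightarrow> nat \<Rightarrow> (nat \<Rightarrow> nat \<Rightarrow> int) \<Rightarrow> int vec" where
  "cycle_vec c m y = vec ((c - 1) * m + (m - 1))
     (\<lambda>t. if t < (c - 1) * m then y (t div m) (t mod m) + row_partial c y (t mod m) else row_partial c y (t - (c - 1) * m))"

lemma cycle_vec_carrier: "cycle_vec c m y \<in> carrier_vec ((c - 1) * m + (m - 1))"
  by (simp add: cycle_vec_def)

lemma row_partial_add: "row_partial c (\<lambda>a k. y a k + z a k) k = row_partial c y k + row_partial c z k"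
  by (simp add: row_partial_def sum.distrib)

lemma cycle_vec_add: "cycle_vec c m (\<lambda>a k. y a k + z a k) = cycle_vec c m y + cycle_vec c m z"
  by (rule eq_vecI) (auto simp: cycle_vec_def row_partial_add)

lemma cycle_vec_index:
  assumes "c \<ge> 1" "k < m"
  shows "a < c - 1 \<Longrightarrow> cycle_vec c m y $ (a * m + k) = y a k + row_partial c y k"
    and "k < m - 1 \<Longrightarrow> cycle_vec c m y $ ((c - 1) * m + k) = row_partial c y k"
proof -
  assume a: "a < c - 1"
  then have "Suc a * m \<le> (c - 1) * m" by (intro mult_le_mono1) simp
  then have "a * m + k < (c - 1) * m" using assms(2) by simp
  then show "cycle_vec c m y $ (a * m + k) = y a k + row_partial c y k" using assms(2) by (simp add: cycle_vec_def)
next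
  assume "k < m - 1"
  then show "cycle_vec c m y $ ((c - 1) * m + k) = row_partial c y k" by (simp add: cycle_vec_def)
qed

text \<open>Column k of the shifted array is the old column k - 1. Column 0 becomes the old column m
  - 1, whose sum is minus the partial sum up to m - 2 because the total is 0; this constant then
  stays in all later partial sums.\<close>

lemma row_partial_shift:
  assumes m: "m \<ge> 2" and k: "k < m" and total: "row_partial c y (m - 1) = 0"
  shows "row_partial c (\<lambda>a k. y a ((k + m - 1) mod m)) k = (if k = 0 then 0 else row_partial c y (k - 1)) - row_partial c y (m - 2)"
  using k
proof (induction k)
  case 0
  have "row_partial c y (m - 1) = row_partial c y (m - 2) + (\<Sum>a<c. y a (m - 1))"
  proof -
    have e: "m - 1 = Suc (m - 2)" using m by simp
    show ?thesis unfolding row_partial_def e by simp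
  qed
  then have "(\<Sum>a<c. y a (m - 1)) = - row_partial c y (m - 2)" using total by simp
  then show ?case using m by (simp add: row_partial_def)
next
  case (Suc k)
  have "(Suc k + m - 1) mod m = k" using Suc.prems by simp
  moreover have "row_partial c y k = (if k = 0 then 0 else row_partial c y (k - 1)) + (\<Sum>a<c. y a k)"
    unfolding row_partial_def by (cases k) simp_all
  moreover have "row_partial c (\<lambda>a k. y a ((k + m - 1) mod m)) (Suc k)
      = row_partial c (\<lambda>a k. y a ((k + m - 1) mod m)) k + (\<Sum>a<c. y a ((Suc k + m - 1) mod m))"
    unfolding row_partial_def by simp
  ultimately show ?case using Suc.IH Suc.prems by simp
qed

text \<open>Every shifted partial sum loses the partial sum up to m - 2, which is the last entry of
  the vector: hence the column of -1. In the cyclic blocks the wrapped index meets the partial sum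
  up to m - 1, which is 0.\<close>

lemma cycle_vec_shift:
  assumes m: "m \<ge> 2" and c: "c \<ge> 1" and total: "row_partial c y (m - 1) = 0"
  shows "cycle_vec c m (\<lambda>a k. y a ((k + m - 1) mod m)) = action_mat c m *\<^sub>v cycle_vec c m y"
proof (rule eq_vecI)
  let ?z = "\<lambda>a k. y a ((k + m - 1) mod m)"
  let ?p = "(c - 1) * m"
  have dim: "dim_vec (action_mat c m *\<^sub>v cycle_vec c m y) = ?p + (m - 1)" using action_mat_carrier[OF m, of c] by simp
  show "dim_vec (cycle_vec c m ?z) = dim_vec (action_mat c m *\<^sub>v cycle_vec c m y)" unfolding dim by (simp add: cycle_vec_def)
  fix t assume "t < dim_vec (action_mat c m *\<^sub>v cycle_vec c m y)"
  then have t: "t < ?p + (m - 1)" unfolding dim .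
  have last: "cycle_vec c m y $ (?p + (m - 2)) = row_partial c y (m - 2)" using m by (intro cycle_vec_index(2)[OF c]) linarith+
  note rhs = action_mat_mult[OF m cycle_vec_carrier t, of y, unfolded last]
  show "cycle_vec c m ?z $ t = (action_mat c m *\<^sub>v cycle_vec c m y) $ t"
  proof (cases "t < ?p")
    case True
    define a k where "a = t div m" and "k = t mod m"
    have k: "k < m" and a: "a < c - 1" using True m unfolding a_def k_def by (simp_all add: less_mult_imp_div_less)
    have ta: "t = a * m + k" unfolding a_def k_def by simp
    let ?l = "(k + m - 1) mod m"
    have l: "?l < m" using m by simp
    have "(action_mat c m *\<^sub>v cycle_vec c m y) $ t = y a ?l + row_partial c y ?l - row_partial c y (m - 2)"
      unfolding rhs using True cycle_vec_index(1)[OF c l a, of y] unfolding a_def k_def by simp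
    moreover have "cycle_vec c m ?z $ t = y a ?l + row_partial c ?z k"
      unfolding ta by (rule cycle_vec_index(1)[OF c k a])
    moreover have "row_partial c ?z k = row_partial c y ?l - row_partial c y (m - 2)"
    proof (cases "k = 0")
      case True
      then show ?thesis using row_partial_shift[OF m k total] total m by simp
    next
      case False
      then have "k + m - 1 = k - 1 + m" by simp
      then have "?l = (k - 1) mod m" by simp
      then have "?l = k - 1" using k by simp
      then show ?thesis using row_partial_shift[OF m k total] False by simp
    qed
    ultimately show ?thesis by simp
  next
    case False
    define k where "k = t - ?p"
    have k: "k < m - 1" "k < m" and tk: "t = ?p + k" using t False unfolding k_def by linarith+
    have lhs: "cycle_vec c m ?z $ t = row_partial c ?z k" unfolding tk by (rule cycle_vec_index(2)[OF c k(2,1)])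
    show ?thesis
    proof (cases "k = 0")
      case True
      then have "(action_mat c m *\<^sub>v cycle_vec c m y) $ t = - row_partial c y (m - 2)" unfolding rhs using tk by simp
      then show ?thesis unfolding lhs row_partial_shift[OF m k(2) total] using True by simp
    next
      case False
      have "cycle_vec c m y $ (?p + (k - 1)) = row_partial c y (k - 1)" using k by (intro cycle_vec_index(2)[OF c]) linarith+
      moreover have "t - 1 = ?p + (k - 1)" using False tk by simp
      ultimately have "(action_mat c m *\<^sub>v cycle_vec c m y) $ t = row_partial c y (k - 1) - row_partial c y (m - 2)"
        unfolding rhs using tk False by simp
      then show ?thesis unfolding lhs row_partial_shift[OF m k(2) total] using False by simp
    qed
  qed
qed

text \<open>The lower entries give the partial sums, the upper ones then give all rows but the last,
  and the last row follows from the column sums.\<close>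

lemma cycle_vec_inj:
  assumes m: "m \<ge> 2" and c: "c \<ge> 1" and total: "row_partial c y (m - 1) = 0"
    and z: "cycle_vec c m y = 0\<^sub>v ((c - 1) * m + (m - 1))" and a: "a < c" and k: "k < m"
  shows "y a k = 0"
proof -
  have R: "row_partial c y l = 0" if l: "l < m" for l
  proof (cases "l = m - 1")
    case False
    then have "l < m - 1" using l by simp
    then show ?thesis using cycle_vec_index(2)[OF c l, of y] unfolding z by simp
  qed (use total in simp)
  have B: "y b l = 0" if b: "b < c - 1" and l: "l < m" for b l
  proof -
    have "Suc b * m \<le> (c - 1) * m" using b by (intro mult_le_mono1) simp
    then have "b * m + l < (c - 1) * m + (m - 1)" using l by simp
    then show ?thesis using cycle_vec_index(1)[OF c l b, of y] R[OF l] unfolding z by simp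
  qed
  have "row_partial c y k = (if k = 0 then 0 else row_partial c y (k - 1)) + (\<Sum>a<c. y a k)"
    unfolding row_partial_def by (cases k) simp_all
  then have "(\<Sum>b<c. y b k) = 0" using R[OF k] R[of "k - 1"] k by (simp split: if_splits)
  moreover have "c = Suc (c - 1)" using c by simp
  ultimately have "(\<Sum>b<c - 1. y b k) + y (c - 1) k = 0" by (metis sum.lessThan_Suc)
  then have "y (c - 1) k = 0" using B[OF _ k] by simp
  then show ?thesis using B[OF _ k, of a] a by (cases "a = c - 1") simp_all
qed

lemma cycle_vec_surj:
  assumes m: "m \<ge> 2" and c: "c \<ge> 1" and v: "v \<in> carrier_vec ((c - 1) * m + (m - 1))"
  obtains y where "row_partial c y (m - 1) = 0" "cycle_vec c m y = v"
proof -
  \<comment> \<open>G prescribes the partial sums and is 0 at m - 1, so the total vanishes; the last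
    row of \<open>y\<close> makes column k add up to the difference of G at k and k - 1.\<close>
  define G where "G = (\<lambda>k. if k < m - 1 then v $ ((c - 1) * m + k) else 0)"
  define r where "r = (\<lambda>a k. v $ (a * m + k) - G k)"
  define y where "y = (\<lambda>a k. if a < c - 1 then r a k else G k - (if k = 0 then 0 else G (k - 1)) - (\<Sum>a<c - 1. r a k))"
  have "(\<Sum>a<Suc (c - 1). y a k) = G k - (if k = 0 then 0 else G (k - 1))" for k
    by (simp add: y_def)
  then have S: "(\<Sum>a<c. y a k) = G k - (if k = 0 then 0 else G (k - 1))" for k using c by simp
  have R: "row_partial c y k = G k" for k
    by (induction k) (simp_all add: row_partial_def S)
  show thesis
  proof (rule that)
    show "row_partial c y (m - 1) = 0" by (simp add: R G_def)
    show "cycle_vec c m y = v"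
    proof (rule eq_vecI)
      show "dim_vec (cycle_vec c m y) = dim_vec v" using v by (simp add: cycle_vec_def)
      fix t assume "t < dim_vec v"
      then have t: "t < (c - 1) * m + (m - 1)" using v by simp
      show "cycle_vec c m y $ t = v $ t"
      proof (cases "t < (c - 1) * m")
        case True
        then have "t div m < c - 1" by (simp add: less_mult_imp_div_less)
        then have "y (t div m) (t mod m) = r (t div m) (t mod m)" by (simp add: y_def)
        then show ?thesis using True t by (simp add: cycle_vec_def R r_def)
      next
        case False
        then have "t - (c - 1) * m < m - 1" using t by linarith
        then show ?thesis using False t by (simp add: cycle_vec_def R G_def)
      qed
    qed
  qed
qed

lemma cycle_vec_cong:
  assumes m: "m \<ge> 1" and c: "c \<ge> 1" and eq: "\<And>a k. a < c \<Longrightarrow> k < m \<Longrightarrow> y a k = z a k"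
  shows "cycle_vec c m y = cycle_vec c m z"
proof -
  have R: "row_partial c y k = row_partial c z k" if "k < m" for k
    unfolding row_partial_def using that eq by (intro sum.cong) auto
  show ?thesis
  proof (rule eq_vecI)
    fix t assume "t < dim_vec (cycle_vec c m z)"
    then have t: "t < (c - 1) * m + (m - 1)" by (simp add: cycle_vec_def)
    show "cycle_vec c m y $ t = cycle_vec c m z $ t"
    proof (cases "t < (c - 1) * m")
      case True
      then have "t div m < c - 1" by (simp add: less_mult_imp_div_less)
      then have "y (t div m) (t mod m) = z (t div m) (t mod m)" using m by (intro eq) simp_all
      moreover have "row_partial c y (t mod m) = row_partial c z (t mod m)" using m by (intro R) simp
      ultimately show ?thesis using t True by (simp add: cycle_vec_def)
    next
      case False
      then have "row_partial c y (t - (c - 1) * m) = row_partial c z (t - (c - 1) * m)" using t by (intro R) linarith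
      then show ?thesis using t False by (simp add: cycle_vec_def)
    qed
  qed (simp add: cycle_vec_def)
qed

section \<open>The summand of a word shorter than n\<close>

lemma sigma_pow_eq:
  assumes "d < n"
  shows "sigma_pow n d = int d"
  using assms by (simp add: sigma_pow_def pow_integer_mod_group)

text \<open>The arcs of \<open>word_set n w\<close> form an array with one row for each rise of w
  and one column for each of the n/d copies of w. Advancing by d vertices changes the copy and keeps
  the rise, so sigma^d shifts all rows cyclically.\<close>

theorem word_supported_cycle_iso:
  assumes n: "n \<ge> 2" and w: "w \<in> lyndon_words d" "1 < d" "d < n" "d dvd n"
  shows "\<exists>\<phi>\<in>iso (add_monoid ((polygon_H1 n)\<lparr>carrier := supported n {word_set n w}\<rparr>)) (monoid_vec TYPE(int) (iota w * (n div d) - 1)).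
      \<forall>x\<in>supported n {word_set n w}. \<phi> (frag_of (sigma_pow n d) \<odot>\<^bsub>polygon_H1 n\<^esub> x) = action_mat (iota w) (n div d) *\<^sub>v \<phi> x"
proof -
  define m where "m = n div d"
  define c where "c = iota w"
  define J0 where "J0 = word_set n w"
  have n1: "n \<ge> 1" using n by simp
  have nm: "n = d * m" unfolding m_def using w(4) by simp
  have m2: "m \<ge> 2"
  proof (rule ccontr)
    assume "\<not> m \<ge> 2"
    then consider "m = 0" | "m = 1" by linarith
    then show False using nm w(3) by cases simp_all
  qed
  have m1: "m \<ge> 1" using m2 by simp
  have c1: "c \<ge> 1" unfolding c_def by (rule iota_pos[OF w(1,2)])
  have dim: "c * m - 1 = (c - 1) * m + (m - 1)" using c1 m1 by (cases c) simp_all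
  obtain b where "bij_betw b {0..<card (rises w)} (rises w)" using ex_bij_betw_nat_finite[OF finite_rises] by blast
  then have b: "bij_betw b {..<c} (rises w)" unfolding c_def iota_eq_card_rises lessThan_atLeast0 .
  \<comment> \<open>sigma^d reads the coefficient d vertices further on. Numbering the copies
    backwards turns this into the cyclic predecessor of k, as the cycle matrix demands.\<close>
  have rev: "bij_betw (\<lambda>k. m - 1 - k) {..<m} {..<m}"
    by (rule bij_betw_byWitness[where f' = "\<lambda>k. m - 1 - k"]) auto
  have "bij_betw (map_prod b (\<lambda>k. m - 1 - k)) ({..<c} \<times> {..<m}) (rises w \<times> {..<m})"
    by (rule bij_betw_imageI[OF map_prod_inj_on[OF bij_betw_imp_inj_on[OF b] bij_betw_imp_inj_on[OF rev]]
          map_prod_surj_on[OF bij_betw_imp_surj_on[OF b] bij_betw_imp_surj_on[OF rev]]])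
  then have bij: "bij_betw ((\<lambda>(a, k). a + d * k + 1) \<circ> map_prod b (\<lambda>k. m - 1 - k)) ({..<c} \<times> {..<m}) (arc_starts n J0)"
    by (rule bij_betw_trans[OF _ arc_starts_word_set[OF n1 w(1,2,4), folded m_def J0_def]])
  define lab where "lab = (\<lambda>a k. b a + d * (m - 1 - k) + 1)"
  have "(\<lambda>(a, k). a + d * k + 1) \<circ> map_prod b (\<lambda>k. m - 1 - k) = (\<lambda>(a, k). lab a k)"
    unfolding lab_def by (rule ext) (simp add: split_def)
  note lab = bij[unfolded this]
  have lab_in: "lab a k \<in> arc_starts n J0" if "a < c" "k < m" for a k
    using bij_betw_apply[OF lab, of "(a, k)"] that by simp
  have lab_n: "lab a k \<in> {1..n}" if "a < c" "k < m" for a k using lab_in[OF that] unfolding arc_starts_def by blast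
  have "lab 0 0 \<in> {1..n}" "lab 0 0 \<notin> J0" using lab_in[of 0 0] c1 m1 unfolding arc_starts_def by auto
  then have J0: "J0 \<subset> {1..n}" unfolding J0_def using word_set_subset[of n w] by blast
  have lab_shift: "(cyc_succ n ^^ d) (lab a k) = lab a ((k + m - 1) mod m)" if a: "a < c" and k: "k < m" for a k
  proof -
    have "b a \<in> rises w" using bij_betw_apply[OF b] a by simp
    then have bd: "b a < d" using lyndon_wordsD(1)[OF w(1)] unfolding rises_def by simp
    have e: "(cyc_succ n ^^ d) (lab a k) = (b a + d * (m - 1 - k) + d) mod n + 1"
      unfolding cyc_succ_pow[OF lab_n[OF a k]] unfolding lab_def by simp
    show ?thesis
    proof (cases "k = 0")
      \<comment> \<open>Index 0 is the last copy of w; advancing by d passes the vertex n and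
        returns to the first copy, which has index m - 1.\<close>
      case True
      have "d * (m - 1) + d = n" using m1 unfolding nm by (cases m) simp_all
      then have "(b a + d * (m - 1 - k) + d) mod n = b a" using True bd w(3) by (simp add: add.assoc)
      moreover have "(k + m - 1) mod m = m - 1" using True m1 by simp
      ultimately show ?thesis unfolding e unfolding lab_def by simp
    next
      case False
      then have s: "m - 1 - (k - 1) = Suc (m - 1 - k)" using k by linarith
      have "k + m - 1 = k - 1 + m" using False by simp
      then have "(k + m - 1) mod m = (k - 1) mod m" by simp
      then have r: "(k + m - 1) mod m = k - 1" using k by simp
      have "lab a (k - 1) \<le> n" using lab_n[of a "k - 1"] a k by simp
      then have "b a + d * (m - 1 - k) + d < n" unfolding lab_def s by simp
      then show ?thesis unfolding e r unfolding lab_def s by simp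
    qed
  qed
  define \<theta> where "\<theta> = (\<lambda>x a k. arc_coeff n x J0 (lab a k))"
  have sum_lab: "row_partial c (\<lambda>a k. f (lab a k)) (m - 1) = (\<Sum>i\<in>arc_starts n J0. f i)" for f :: "nat \<Rightarrow> int"
  proof -
    have "{..m - 1} = {..<m}" using m1 by auto
    then have "row_partial c (\<lambda>a k. f (lab a k)) (m - 1) = (\<Sum>k<m. \<Sum>a<c. f (lab a k))" unfolding row_partial_def by simp
    also have "\<dots> = (\<Sum>a<c. \<Sum>k<m. f (lab a k))" by (rule sum.swap)
    also have "\<dots> = (\<Sum>x\<in>{..<c} \<times> {..<m}. f (case x of (a, k) \<Rightarrow> lab a k))" by (simp add: sum.cartesian_product split_def)
    also have "\<dots> = (\<Sum>i\<in>arc_starts n J0. f i)" by (rule sum.reindex_bij_betw[OF lab])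
    finally show ?thesis .
  qed
  have total: "row_partial c (\<theta> x) (m - 1) = 0" for x
    unfolding \<theta>_def sum_lab by (rule sum_arc_starts_arc_functions[OF arc_coeff_in])
  have eqI: "x = y" if x: "x \<in> supported n {J0}" and y: "y \<in> supported n {J0}" and eq: "\<And>a k. a < c \<Longrightarrow> k < m \<Longrightarrow> \<theta> x a k = \<theta> y a k" for x y
  proof (rule arc_coeff_eqI[OF n1 supportedD[OF x] supportedD[OF y]])
    fix J i
    show "arc_coeff n x J i = arc_coeff n y J i"
    proof (cases "J = J0 \<and> i \<in> arc_starts n J0")
      case True
      then have "i \<in> (\<lambda>(a, k). lab a k) ` ({..<c} \<times> {..<m})" unfolding bij_betw_imp_surj_on[OF lab] by (rule conjunct2)
      then obtain a k where "a < c" "k < m" "i = lab a k" by auto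
      then show ?thesis using eq True unfolding \<theta>_def by simp
    next
      case False
      have "arc_coeff n z J i = 0" if z: "z \<in> supported n {J0}" for z
      proof (rule ccontr)
        assume nz: "\<not> ?thesis"
        have "J = J0" using supported_coeffD[OF z nz] by simp
        then show False using arc_coeff_nonzero(2)[OF nz] False by simp
      qed
      then show ?thesis using x y by simp
    qed
  qed
  define \<phi> where "\<phi> = (\<lambda>x. cycle_vec c m (\<theta> x))"
  have add: "\<phi> (x \<oplus>\<^bsub>polygon_H1 n\<^esub> y) = \<phi> x + \<phi> y" if "x \<in> supported n {J0}" "y \<in> supported n {J0}" for x y
    unfolding \<phi>_def \<theta>_def arc_coeff_add[OF supportedD[OF that(1)] supportedD[OF that(2)]] by (rule cycle_vec_add)
  have inj: "inj_on \<phi> (supported n {J0})"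
  proof (rule inj_onI)
    fix x y assume x: "x \<in> supported n {J0}" and y: "y \<in> supported n {J0}" and eq: "\<phi> x = \<phi> y"
    define z where "z = (\<lambda>a k. \<theta> x a k - \<theta> y a k)"
    have xy: "\<theta> x = (\<lambda>a k. \<theta> y a k + z a k)" unfolding z_def by simp
    have "row_partial c (\<theta> x) (m - 1) = row_partial c (\<theta> y) (m - 1) + row_partial c z (m - 1)" unfolding xy by (rule row_partial_add)
    then have tz: "row_partial c z (m - 1) = 0" unfolding total by simp
    have "\<phi> x = \<phi> y + cycle_vec c m z" unfolding \<phi>_def xy by (rule cycle_vec_add)
    then have sum: "\<phi> y = \<phi> y + cycle_vec c m z" unfolding eq .
    have zz: "cycle_vec c m z = 0\<^sub>v ((c - 1) * m + (m - 1))"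
    proof (rule eq_vecI)
      fix t assume "t < dim_vec (0\<^sub>v ((c - 1) * m + (m - 1)) :: int vec)"
      then have t: "t < (c - 1) * m + (m - 1)" by simp
      have "\<phi> y $ t = (\<phi> y + cycle_vec c m z) $ t" using sum by (rule arg_cong)
      then show "cycle_vec c m z $ t = 0\<^sub>v ((c - 1) * m + (m - 1)) $ t"
        using t cycle_vec_carrier[of c m z] by simp
    qed (simp add: cycle_vec_def)
    have "\<theta> x a k = \<theta> y a k" if "a < c" "k < m" for a k
      using cycle_vec_inj[OF m2 c1 tz zz that] unfolding z_def by simp
    then show "x = y" by (rule eqI[OF x y])
  qed
  have surj: "\<exists>x\<in>supported n {J0}. \<phi> x = v" if v: "v \<in> carrier_vec ((c - 1) * m + (m - 1))" for v
  proof -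
    obtain y where y: "row_partial c y (m - 1) = 0" "cycle_vec c m y = v" by (rule cycle_vec_surj[OF m2 c1 v])
    define g where "g = (\<lambda>i. case inv_into ({..<c} \<times> {..<m}) (\<lambda>(a, k). lab a k) i of (a, k) \<Rightarrow> y a k)"
    have g: "g (lab a k) = y a k" if "a < c" "k < m" for a k
      using bij_betw_inv_into_left[OF lab, of "(a, k)"] that unfolding g_def by simp
    define f where "f = (\<lambda>J i. if J = J0 \<and> i \<in> arc_starts n J0 then g i else 0)"
    have "row_partial c y (m - 1) = row_partial c (\<lambda>a k. g (lab a k)) (m - 1)"
      unfolding row_partial_def using g m1 by (intro sum.cong) auto
    then have "(\<Sum>i\<in>arc_starts n J0. g i) = 0" unfolding sum_lab y(1) by simp
    then have "(\<Sum>i\<in>arc_starts n J. f J i) = 0" for J unfolding f_def by (cases "J = J0") simp_all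
    moreover have "J \<subset> {1..n} \<and> i \<in> arc_starts n J" if "f J i \<noteq> 0" for J i
      using that J0 unfolding f_def by (simp split: if_splits)
    ultimately have "f \<in> arc_functions n" unfolding arc_functions_def by blast
    then obtain x where x: "x \<in> carrier (homology_group 1 (polygon_space n))" "arc_coeff n x = f" using arc_coeff_surj[OF n1] by blast
    have xs: "x \<in> supported n {J0}"
    proof (rule supportedI)
      show "x \<in> carrier (polygon_H1 n)" unfolding polygon_H1_simps by (rule x(1))
      show "J \<in> {J0}" if "arc_coeff n x J i \<noteq> 0" for J i using that unfolding x(2) f_def by (simp split: if_splits)
    qed
    have "\<phi> x = cycle_vec c m y"
      unfolding \<phi>_def by (rule cycle_vec_cong[OF m1 c1]) (simp add: \<theta>_def x(2) f_def lab_in g)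
    then show ?thesis using xs y(2) by blast
  qed
  have shift: "\<phi> (frag_of (sigma_pow n d) \<odot>\<^bsub>polygon_H1 n\<^esub> x) = action_mat c m *\<^sub>v \<phi> x" if x: "x \<in> supported n {J0}" for x
  proof -
    have stab: "(cyc_succ n ^^ d) ` J0 = J0" unfolding J0_def by (rule iffD2[OF word_set_stabilizer[OF n1 w(1,4)] dvd_refl])
    have "\<phi> (frag_of (sigma_pow n d) \<odot>\<^bsub>polygon_H1 n\<^esub> x) = cycle_vec c m (\<lambda>a k. \<theta> x a ((k + m - 1) mod m))"
      unfolding \<phi>_def
    proof (rule cycle_vec_cong[OF m1 c1])
      fix a k assume ak: "a < c" "k < m"
      have "\<theta> (frag_of (sigma_pow n d) \<odot>\<^bsub>polygon_H1 n\<^esub> x) a k = arc_coeff n x ((cyc_succ n ^^ d) ` J0) ((cyc_succ n ^^ d) (lab a k))"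
        unfolding \<theta>_def sigma_pow_eq[OF w(3)]
        using arc_coeff_smult_of[OF n1 _ _ supportedD[OF x] J0 lab_n[OF ak], of "int d"] w(3) by simp
      then show "\<theta> (frag_of (sigma_pow n d) \<odot>\<^bsub>polygon_H1 n\<^esub> x) a k = \<theta> x a ((k + m - 1) mod m)"
        unfolding stab lab_shift[OF ak] \<theta>_def .
    qed
    also have "\<dots> = action_mat c m *\<^sub>v \<phi> x" unfolding \<phi>_def by (rule cycle_vec_shift[OF m2 c1 total])
    finally show ?thesis .
  qed
  have "\<phi> \<in> iso (add_monoid ((polygon_H1 n)\<lparr>carrier := supported n {J0}\<rparr>)) (monoid_vec TYPE(int) (c * m - 1))"
  proof (rule isoI)
    have cl: "\<phi> x \<in> carrier_vec ((c - 1) * m + (m - 1))" for x unfolding \<phi>_def by (rule cycle_vec_carrier)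
    show "\<phi> \<in> hom (add_monoid ((polygon_H1 n)\<lparr>carrier := supported n {J0}\<rparr>)) (monoid_vec TYPE(int) (c * m - 1))"
      unfolding dim by (rule homI) (simp_all add: monoid_vec_def cl add del: One_nat_def)
    have "\<phi> ` supported n {J0} = carrier_vec ((c - 1) * m + (m - 1))" using cl surj by blast
    then show "bij_betw \<phi> (carrier (add_monoid ((polygon_H1 n)\<lparr>carrier := supported n {J0}\<rparr>))) (carrier (monoid_vec TYPE(int) (c * m - 1)))"
      using inj unfolding bij_betw_def dim by (simp add: monoid_vec_def del: One_nat_def)
  qed
  then show ?thesis using shift unfolding c_def m_def J0_def by (intro bexI[of _ \<phi>] ballI)
qed

section \<open>Free summands\<close>

lemma module_direct_sum_regular:
  assumes S: "cring S" and I: "finite I"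
  shows "Module.module S (direct_sum_module I (\<lambda>_. regular_module S))"
proof -
  interpret cring S by fact
  have c: "carrier (direct_sum_module I (\<lambda>_. regular_module S)) = (\<Pi>\<^sub>E i\<in>I. carrier S)"
    using I by (simp add: direct_sum_module_def regular_module_def)
  have re: "f = (\<lambda>i\<in>I. f i)" if "f \<in> (\<Pi>\<^sub>E i\<in>I. carrier S)" for f using PiE_restrict[OF that] by simp
  let ?D = "direct_sum_module I (\<lambda>_. regular_module S)"
  have op: "add ?D = (\<lambda>f g. \<lambda>i\<in>I. f i \<oplus>\<^bsub>S\<^esub> g i)" "zero ?D = (\<lambda>i\<in>I. \<zero>\<^bsub>S\<^esub>)" "smult ?D = (\<lambda>r f. \<lambda>i\<in>I. r \<otimes>\<^bsub>S\<^esub> f i)"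
    by (simp_all add: direct_sum_module_def regular_module_def)
  have mem: "f i \<in> carrier S" if "f \<in> (\<Pi>\<^sub>E i\<in>I. carrier S)" "i \<in> I" for f i using that by (rule PiE_mem)
  have ab: "abelian_group ?D"
  proof (rule abelian_groupI, goal_cases)
    case (1 f g) then show ?case unfolding c op by (auto dest: mem)
  next
    case 2 show ?case unfolding c op by simp
  next
    case (3 f g h) then show ?case unfolding c op by (auto intro!: restrict_ext simp: mem a_assoc)
  next
    case (4 f g) then show ?case unfolding c op by (auto intro!: restrict_ext simp: mem a_comm)
  next
    case (5 f)
    then have f: "f \<in> (\<Pi>\<^sub>E i\<in>I. carrier S)" unfolding c .
    have "(\<lambda>i\<in>I. (\<lambda>i\<in>I. \<zero>\<^bsub>S\<^esub>) i \<oplus>\<^bsub>S\<^esub> f i) = (\<lambda>i\<in>I. f i)" by (rule restrict_ext) (simp add: mem[OF f])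
    then show ?case unfolding op using re[OF f] by simp
  next
    case (6 f)
    then have f: "f \<in> (\<Pi>\<^sub>E i\<in>I. carrier S)" unfolding c .
    have "(\<lambda>i\<in>I. (\<lambda>i\<in>I. \<ominus>\<^bsub>S\<^esub> f i) i \<oplus>\<^bsub>S\<^esub> f i) = (\<lambda>i\<in>I. \<zero>\<^bsub>S\<^esub>)" by (rule restrict_ext) (simp add: mem[OF f] l_neg)
    then show ?case unfolding op c by (intro bexI[of _ "\<lambda>i\<in>I. \<ominus>\<^bsub>S\<^esub> f i"]) (auto dest: mem[OF f])
  qed
  show ?thesis
  proof (rule moduleI[OF S ab], goal_cases)
    case (1 a f) then show ?case unfolding c op by (auto dest: mem)
  next
    case (2 a b f) then show ?case unfolding c op by (auto intro!: restrict_ext simp: mem l_distr)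
  next
    case (3 a f g) then show ?case unfolding c op by (auto intro!: restrict_ext simp: mem r_distr)
  next
    case (4 a b f) then show ?case unfolding c op by (auto intro!: restrict_ext simp: mem m_assoc)
  next
    case (5 f)
    then have f: "f \<in> (\<Pi>\<^sub>E i\<in>I. carrier S)" unfolding c .
    have "(\<lambda>i\<in>I. \<one>\<^bsub>S\<^esub> \<otimes>\<^bsub>S\<^esub> f i) = (\<lambda>i\<in>I. f i)" by (rule restrict_ext) (simp add: mem[OF f])
    then show ?case unfolding op using re[OF f] by simp
  qed
qed

lemma finsum_direct_sum_group_ring:
  assumes G: "comm_group G" and I: "finite I" and K: "finite K" and i: "i \<in> I"
    and g: "\<And>k. k \<in> K \<Longrightarrow> g k \<in> (\<Pi>\<^sub>E i\<in>I. carrier (group_ring G))"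
  shows "(\<Oplus>\<^bsub>direct_sum_module I (\<lambda>_. regular_module (group_ring G))\<^esub>k\<in>K. g k) i = (\<Sum>k\<in>K. g k i)"
proof -
  let ?D = "direct_sum_module I (\<lambda>_. regular_module (group_ring G))"
  interpret D: Module.module "group_ring G" ?D by (rule module_direct_sum_regular[OF cring_group_ring[OF G] I])
  have c: "carrier ?D = (\<Pi>\<^sub>E i\<in>I. carrier (group_ring G))"
    using I by (simp add: direct_sum_module_def regular_module_def)
  show ?thesis using K g
  proof (induction K rule: finite_induct)
    case empty
    show ?case using i by (simp add: D.finsum_empty) (simp add: direct_sum_module_def regular_module_def group_ring_simps)
  next
    case (insert k K)
    have "(\<Oplus>\<^bsub>?D\<^esub>k\<in>insert k K. g k) = g k \<oplus>\<^bsub>?D\<^esub> (\<Oplus>\<^bsub>?D\<^esub>k\<in>K. g k)"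
      using insert.hyps insert.prems by (intro D.finsum_insert) (simp_all add: c)
    moreover have "(g k \<oplus>\<^bsub>?D\<^esub> h) i = g k i + h i" for h
      using i by (simp add: direct_sum_module_def regular_module_def group_ring_simps)
    ultimately show ?case using insert by simp
  qed
qed

text \<open>For d = n the subgroup is trivial, so inducing only tensors the abelian group with the
  group ring. A zero-sum function on \<open>iota w\<close> arcs is free in all its values but the
  last one, and each free value contributes one copy of the group ring.\<close>

theorem induced_free:
  assumes n: "n \<ge> 2" and w: "w \<in> lyndon_words n"
  shows "module_isomorphic (group_ring (integer_mod_group n))
    (induced_module (integer_mod_group n) (sigma_subgroup n n) ((polygon_H1 n)\<lparr>carrier := supported n {word_set n w}\<rparr>))
    (direct_sum_module {..<iota w - 1} (\<lambda>_. regular_module (group_ring (integer_mod_group n))))"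
proof -
  define J0 where "J0 = word_set n w"
  define c where "c = iota w"
  define S where "S = group_ring (integer_mod_group n)"
  define R where "R = group_ring (sigma_subgroup n n)"
  define N where "N = (polygon_H1 n)\<lparr>carrier := supported n {J0}\<rparr>"
  let ?D = "direct_sum_module {..<c - 1} (\<lambda>_. regular_module S)"
  define e where "e = (\<lambda>k. frag_of (int k))"
  have n1: "n \<ge> 1" using n by simp
  have n2: "1 < n" using n by simp
  have G: "comm_group (integer_mod_group n)" by simp
  have cS: "cring S" unfolding S_def by (rule cring_group_ring[OF G])
  have c1: "c \<ge> 1" unfolding c_def by (rule iota_pos[OF w n2])
  have sub: "submodule (supported n {J0}) R (polygon_H1 n)"
    unfolding R_def J0_def by (rule word_supported_submodule[OF n w dvd_refl])
  have cD: "carrier ?D = (\<Pi>\<^sub>E i\<in>{..<c - 1}. carrier S)"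
    by (simp add: direct_sum_module_def regular_module_def)
  have "card (rises w \<times> {..<n div n}) = card (arc_starts n J0)"
    unfolding J0_def by (rule bij_betw_same_card[OF arc_starts_word_set[OF n1 w n2 dvd_refl]])
  then have "card (arc_starts n J0) = c" using n1 unfolding c_def by (simp add: iota_eq_card_rises card_cartesian_product)
  moreover obtain lab where "bij_betw lab {0..<card (arc_starts n J0)} (arc_starts n J0)"
    using ex_bij_betw_nat_finite[OF finite_arc_starts] by blast
  ultimately have lab: "bij_betw lab {..<c} (arc_starts n J0)" by (simp add: lessThan_atLeast0)
  have lab_in: "lab j \<in> arc_starts n J0" if "j < c" for j
    using bij_betw_apply[OF lab, of j] that by simp
  have lab_n: "lab j \<in> {1..n}" if "j < c" for j using lab_in[OF that] unfolding arc_starts_def by blast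
  have "lab 0 \<in> {1..n}" "lab 0 \<notin> J0" using lab_in[of 0] c1 unfolding arc_starts_def by auto
  then have J0: "J0 \<subset> {1..n}" unfolding J0_def using word_set_subset[of n w] by blast
  define co where "co = (\<lambda>x j. arc_coeff n x J0 (lab j))"
  have split_last: "(\<Sum>i\<in>arc_starts n J0. f i) = (\<Sum>j<c - 1. f (lab j)) + f (lab (c - 1))" for f :: "nat \<Rightarrow> int"
  proof -
    have "c = Suc (c - 1)" using c1 by simp
    then have "(\<Sum>j<c. f (lab j)) = (\<Sum>j<c - 1. f (lab j)) + f (lab (c - 1))" by (metis sum.lessThan_Suc)
    then show ?thesis using sum.reindex_bij_betw[OF lab, of f] by simp
  qed
  have eq0: "x = \<zero>\<^bsub>polygon_H1 n\<^esub>" if x: "x \<in> supported n {J0}" and z: "\<And>j. j < c - 1 \<Longrightarrow> co x j = 0" for x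
  proof (rule arc_coeff_eqI[OF n1 supportedD[OF x] supportedD[OF supported_zero]])
    fix J i
    have l: "co x j = 0" if "j < c" for j
    proof (cases "j = c - 1")
      case True
      have "(\<Sum>i\<in>arc_starts n J0. arc_coeff n x J0 i) = 0" by (rule sum_arc_starts_arc_functions[OF arc_coeff_in])
      then show ?thesis using z True unfolding split_last co_def by simp
    qed (use z that in simp)
    have "arc_coeff n x J i = 0"
    proof (rule ccontr)
      assume nz: "\<not> ?thesis"
      have J: "J = J0" using supported_coeffD[OF x nz] by simp
      have "i \<in> lab ` {..<c}" using arc_coeff_nonzero(2)[OF nz] unfolding bij_betw_imp_surj_on[OF lab] J .
      then show False using l nz unfolding J co_def by auto
    qed
    then show "arc_coeff n x J i = arc_coeff n \<zero>\<^bsub>polygon_H1 n\<^esub> J i"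
      using arc_coeff_one[of n J i] by (simp add: polygon_H1_simps)
  qed
  have ex: "\<exists>x\<in>supported n {J0}. \<forall>j<c - 1. co x j = z j" for z
  proof -
    \<comment> \<open>The last arc takes the value that makes the total 0.\<close>
    define y where "y = (\<lambda>j. if j = c - 1 then - (\<Sum>j<c - 1. z j) else z j)"
    define f where "f = (\<lambda>J i. if J = J0 \<and> i \<in> arc_starts n J0 then y (inv_into {..<c} lab i) else 0)"
    have fl: "f J0 (lab j) = y j" if "j < c" for j
      using bij_betw_inv_into_left[OF lab, of j] that lab_in[OF that] unfolding f_def by simp
    have "(\<Sum>i\<in>arc_starts n J0. f J0 i) = 0"
      unfolding split_last using fl c1 by (simp add: y_def)
    then have "(\<Sum>i\<in>arc_starts n J. f J i) = 0" for J by (cases "J = J0") (simp_all add: f_def)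
    moreover have "J \<subset> {1..n} \<and> i \<in> arc_starts n J" if "f J i \<noteq> 0" for J i
      using that J0 unfolding f_def by (simp split: if_splits)
    ultimately have "f \<in> arc_functions n" unfolding arc_functions_def by blast
    then obtain x where x: "x \<in> carrier (homology_group 1 (polygon_space n))" "arc_coeff n x = f" using arc_coeff_surj[OF n1] by blast
    have "x \<in> supported n {J0}"
    proof (rule supportedI)
      show "x \<in> carrier (polygon_H1 n)" unfolding polygon_H1_simps by (rule x(1))
      show "J \<in> {J0}" if "arc_coeff n x J i \<noteq> 0" for J i using that unfolding x(2) f_def by (simp split: if_splits)
    qed
    moreover have "\<forall>j<c - 1. co x j = z j" unfolding co_def x(2) using fl by (simp add: y_def)
    ultimately show ?thesis by blast
  qed
  \<comment> \<open>The free coefficients are placed at the unit \<open>frag_of 0\<close> of the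
    group ring; multiplication by \<open>e k\<close> moves them to the group element k.\<close>
  define f where "f = (\<lambda>x. \<lambda>j\<in>{..<c - 1}. frag_cmul (co x j) (frag_of (0::int)))"
  have f0: "frag_cmul a (frag_of (0::int)) \<in> carrier S" for a
    using keys_cmul[of a "frag_of (0::int)"] n1 unfolding S_def by (auto simp: group_ring_simps carrier_integer_mod_group)
  have fD: "f x \<in> carrier ?D" for x unfolding cD f_def using f0 by simp
  have mulk: "e k \<otimes>\<^bsub>S\<^esub> frag_cmul a (frag_of 0) = frag_cmul a (e k)" if "k < n" for k a
    using that unfolding e_def S_def group_ring_simps(5) by (simp add: frag_extend_cmul del: single_one)
  have term_D: "(e k \<odot>\<^bsub>?D\<^esub> f x) = (\<lambda>j\<in>{..<c - 1}. frag_cmul (co x j) (e k))" if "k < n" for k x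
    unfolding f_def using mulk[OF that] by (simp add: direct_sum_module_def regular_module_def cong: restrict_cong)
  have ecl: "e k \<in> carrier S" if "k < n" for k
    using keys_rotation_subset[OF that] unfolding e_def S_def group_ring_simps by simp
  have MD: "Module.module S ?D" by (rule module_direct_sum_regular[OF cS]) simp
  have comb: "(\<Oplus>\<^bsub>?D\<^esub>k\<in>{..<n}. e k \<odot>\<^bsub>?D\<^esub> f (y k)) j = (\<Sum>k<n. frag_cmul (co (y k) j) (e k))" if j: "j < c - 1" for y j
  proof -
    have "(\<Oplus>\<^bsub>?D\<^esub>k\<in>{..<n}. e k \<odot>\<^bsub>?D\<^esub> f (y k)) j = (\<Sum>k<n. (e k \<odot>\<^bsub>?D\<^esub> f (y k)) j)"
      unfolding S_def
    proof (rule finsum_direct_sum_group_ring[OF G])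
      show "e k \<odot>\<^bsub>direct_sum_module {..<c - 1} (\<lambda>_. regular_module (group_ring (integer_mod_group n)))\<^esub> f (y k)
          \<in> {..<c - 1} \<rightarrow>\<^sub>E carrier (group_ring (integer_mod_group n))" if "k \<in> {..<n}" for k
        using module.smult_closed[OF MD ecl fD, of k "y k"] that unfolding cD unfolding S_def by (simp del: One_nat_def)
    qed (use j in simp_all)
    also have "\<dots> = (\<Sum>k<n. frag_cmul (co (y k) j) (e k))"
    proof (rule sum.cong[OF refl])
      fix k assume "k \<in> {..<n}"
      then have k: "k < n" by simp
      show "(e k \<odot>\<^bsub>?D\<^esub> f (y k)) j = frag_cmul (co (y k) j) (e k)" unfolding term_D[OF k] using j by simp
    qed
    finally show ?thesis .
  qed
  have lk: "Poly_Mapping.lookup (\<Sum>k<n. frag_cmul (a k) (e k)) (int l) = (if l < n then a l else 0)" for a l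
    unfolding e_def lookup_sum by (simp add: if_distrib cong: if_cong)
  have "module_isomorphic S (extend_scalars S R N) ?D"
  proof (rule extend_scalars_iso[where K = "{..<n}" and e = e and f = f])
    show "Module.module S ?D" by (rule MD)
    show "carrier R \<subseteq> carrier S" unfolding R_def S_def by (rule group_ring_sigma_subset[OF n dvd_refl])
    show "abelian_group N" unfolding N_def by (rule abelian_group_supported)
    show "r \<odot>\<^bsub>N\<^esub> x \<in> carrier N" if "r \<in> carrier R" "x \<in> carrier N" for r x
      using submodule.smult_closed[OF sub, of r x] that unfolding N_def by simp
    show "f x \<in> carrier ?D" for x by (rule fD)
    show "f (x \<oplus>\<^bsub>N\<^esub> y) = f x \<oplus>\<^bsub>?D\<^esub> f y" if "x \<in> carrier N" "y \<in> carrier N" for x y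
    proof -
      have xy: "x \<in> carrier (polygon_H1 n)" "y \<in> carrier (polygon_H1 n)" using that supportedD unfolding N_def by simp_all
      have "co (x \<oplus>\<^bsub>N\<^esub> y) j = co x j + co y j" for j unfolding co_def N_def using arc_coeff_add[OF xy] by simp
      then show ?thesis unfolding f_def
        by (simp add: direct_sum_module_def regular_module_def S_def group_ring_simps frag_cmul_distrib cong: restrict_cong)
    qed
    show "f (r \<odot>\<^bsub>N\<^esub> x) = r \<odot>\<^bsub>?D\<^esub> f x" if r: "r \<in> carrier R" and x: "x \<in> carrier N" for r x
    proof -
      have "carrier (sigma_subgroup n n) \<subseteq> {0}"
      proof
        fix g assume "g \<in> carrier (sigma_subgroup n n)"
        then have g: "0 \<le> g" "g < int n" "int n dvd g" unfolding carrier_sigma_subgroup[OF n dvd_refl] by simp_all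
        then show "g \<in> {0}" using zdvd_imp_le[of "int n" g] by fastforce
      qed
      then have k0: "Poly_Mapping.keys r \<subseteq> {0}" using r unfolding R_def group_ring_simps by blast
      define a where "a = Poly_Mapping.lookup r 0"
      have ra: "r = frag_cmul a (frag_of 0)"
        by (rule poly_mapping_eqI) (use k0 in \<open>auto simp: a_def in_keys_iff subset_iff simp del: single_one\<close>)
      have kn: "Poly_Mapping.keys r \<subseteq> {0..<int n}" using k0 n1 by auto
      have xH: "x \<in> carrier (polygon_H1 n)" using x supportedD unfolding N_def by simp
      have "co (r \<odot>\<^bsub>N\<^esub> x) j = a * co x j" if j: "j < c - 1" for j
      proof -
        have j': "j < c" using j by simp
        have "co (r \<odot>\<^bsub>N\<^esub> x) j = (\<Sum>g\<in>Poly_Mapping.keys r. Poly_Mapping.lookup r g * arc_coeff n x ((cyc_succ n ^^ nat g) ` J0) ((cyc_succ n ^^ nat g) (lab j)))"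
          unfolding co_def N_def using arc_coeff_smult[OF n1 kn xH J0 lab_n[OF j']] by simp
        also have "\<dots> = (\<Sum>g\<in>{0}. Poly_Mapping.lookup r g * arc_coeff n x ((cyc_succ n ^^ nat g) ` J0) ((cyc_succ n ^^ nat g) (lab j)))"
          by (rule sum.mono_neutral_left) (use k0 in \<open>auto simp: in_keys_iff\<close>)
        also have "\<dots> = a * co x j" unfolding co_def a_def by simp
        finally show ?thesis .
      qed
      moreover have "r \<otimes>\<^bsub>S\<^esub> frag_cmul b (frag_of 0) = frag_cmul (a * b) (frag_of 0)" for b
        unfolding ra S_def group_ring_simps(5) using n1 by (simp add: frag_extend_cmul del: single_one)
      ultimately show ?thesis unfolding f_def
        by (simp add: direct_sum_module_def regular_module_def cong: restrict_cong)
    qed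
    show "finite {..<n}" by simp
    show "e k \<in> carrier S" if "k \<in> {..<n}" for k using that by (intro ecl) simp
    show "\<exists>r\<in>{..<n} \<rightarrow> carrier R. a = (\<Oplus>\<^bsub>S\<^esub>k\<in>{..<n}. e k \<otimes>\<^bsub>S\<^esub> r k)" if "a \<in> carrier S" for a
      using group_ring_generated[OF n dvd_refl] that unfolding S_def R_def e_def by blast
  next
    fix h assume "h \<in> carrier ?D"
    then have h: "h \<in> (\<Pi>\<^sub>E i\<in>{..<c - 1}. carrier S)" unfolding cD .
    \<comment> \<open>\<open>y k\<close> gathers the coefficients of all components of h at the
      group element k.\<close>
    define y where "y = (\<lambda>k. SOME x. x \<in> supported n {J0} \<and> (\<forall>j<c - 1. co x j = Poly_Mapping.lookup (h j) (int k)))"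
    have yy: "y k \<in> supported n {J0} \<and> (\<forall>j<c - 1. co (y k) j = Poly_Mapping.lookup (h j) (int k))" for k
    proof -
      have "\<exists>x. x \<in> supported n {J0} \<and> (\<forall>j<c - 1. co x j = Poly_Mapping.lookup (h j) (int k))"
        using ex[of "\<lambda>j. Poly_Mapping.lookup (h j) (int k)"] unfolding Bex_def .
      then show ?thesis unfolding y_def by (rule someI_ex)
    qed
    have y: "y k \<in> supported n {J0}" "j < c - 1 \<Longrightarrow> co (y k) j = Poly_Mapping.lookup (h j) (int k)" for k j
      using yy[of k] by simp_all
    have "(\<Oplus>\<^bsub>?D\<^esub>k\<in>{..<n}. e k \<odot>\<^bsub>?D\<^esub> f (y k)) \<in> (\<Pi>\<^sub>E i\<in>{..<c - 1}. carrier S)"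
      unfolding cD[symmetric]
      by (rule abelian_monoid.finsum_closed[OF abelian_group.axioms(1)[OF module.axioms(2)[OF MD]]])
        (use module.smult_closed[OF MD ecl fD] in \<open>simp del: One_nat_def\<close>)
    then have "h = (\<Oplus>\<^bsub>?D\<^esub>k\<in>{..<n}. e k \<odot>\<^bsub>?D\<^esub> f (y k))"
    proof (rule PiE_ext[OF h])
      fix j assume "j \<in> {..<c - 1}"
      then have j: "j < c - 1" by simp
      have hj: "Poly_Mapping.keys (h j) \<subseteq> {0..<int n}"
        using PiE_mem[OF h, of j] j n1 unfolding S_def by (simp add: group_ring_simps carrier_integer_mod_group)
      show "h j = (\<Oplus>\<^bsub>?D\<^esub>k\<in>{..<n}. e k \<odot>\<^bsub>?D\<^esub> f (y k)) j"
        unfolding comb[OF j] y(2)[OF j]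
      proof (rule poly_mapping_eqI)
        fix g
        show "Poly_Mapping.lookup (h j) g = Poly_Mapping.lookup (\<Sum>k<n. frag_cmul (Poly_Mapping.lookup (h j) (int k)) (e k)) g"
        proof (cases "g \<in> {0..<int n}")
          case True
          then obtain l where l: "g = int l" "l < n" by (metis atLeastLessThan_iff nonneg_int_cases of_nat_less_iff)
          show ?thesis unfolding l(1) lk using l(2) by simp
        next
          case False
          then have "Poly_Mapping.lookup (h j) g = 0" using hj by (auto simp: in_keys_iff)
          moreover have "Poly_Mapping.lookup (\<Sum>k<n. frag_cmul (Poly_Mapping.lookup (h j) (int k)) (e k)) g = 0"
            unfolding lookup_sum e_def using False by (intro sum.neutral) auto
          ultimately show ?thesis by simp
        qed
      qed
    qed
    then show "\<exists>y\<in>{..<n} \<rightarrow> carrier N. h = (\<Oplus>\<^bsub>?D\<^esub>k\<in>{..<n}. e k \<odot>\<^bsub>?D\<^esub> f (y k))"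
      using y(1) unfolding N_def by (intro bexI[of _ y]) simp_all
  next
    fix y assume y: "y \<in> {..<n} \<rightarrow> carrier N" and z: "(\<Oplus>\<^bsub>?D\<^esub>k\<in>{..<n}. e k \<odot>\<^bsub>?D\<^esub> f (y k)) = \<zero>\<^bsub>?D\<^esub>"
    show "\<forall>k\<in>{..<n}. y k = \<zero>\<^bsub>N\<^esub>"
    proof
      fix k assume k: "k \<in> {..<n}"
      have yk: "y k \<in> supported n {J0}" using y k unfolding N_def by auto
      have "co (y k) j = 0" if j: "j < c - 1" for j
      proof -
        have "(\<Sum>k<n. frag_cmul (co (y k) j) (e k)) = 0"
          using comb[OF j, of y] j unfolding z by (simp add: direct_sum_module_def regular_module_def S_def group_ring_simps)
        then show ?thesis using lk[of "\<lambda>k. co (y k) j" k] k by simp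
      qed
      then show "y k = \<zero>\<^bsub>N\<^esub>" using eq0[OF yk] unfolding N_def by simp
    qed
  qed
  then show ?thesis unfolding induced_module_def S_def R_def N_def J0_def c_def .
qed

theorem theorem4p3p3:
  fixes n :: nat
  assumes "n \<ge> 3"
  shows "\<exists>N :: nat list \<Rightarrow> (((nat \<Rightarrow> real) \<Rightarrow> (nat \<Rightarrow> real)) \<Rightarrow>\<^sub>0 int) set set.
    (\<forall>w\<in>polygon_words n.
       1 < length w \<and> length w dvd n \<and>
       submodule (N w) (group_ring (sigma_subgroup n (length w))) (polygon_H1 n) \<and>
       abelian_direct_summand (N w) (polygon_H1 n)) \<and>
    module_isomorphic (group_ring (integer_mod_group n))
      (polygon_H1 n)
      (direct_sum_module (polygon_words n)
         (\<lambda>w. induced_module (integer_mod_group n) (sigma_subgroup n (length w))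
                ((polygon_H1 n)\<lparr>carrier := N w\<rparr>))) \<and>
    (\<forall>w\<in>polygon_words n. length w < n \<longrightarrow>
       (\<exists>\<phi>\<in>iso (add_monoid ((polygon_H1 n)\<lparr>carrier := N w\<rparr>))
                (monoid_vec TYPE(int) (iota w * (n div length w) - 1)).
          \<forall>x\<in>N w. \<phi> (frag_of (sigma_pow n (length w)) \<odot>\<^bsub>polygon_H1 n\<^esub> x) =
                   action_mat (iota w) (n div length w) *\<^sub>v \<phi> x)) \<and>
    (\<forall>w\<in>polygon_words n. length w = n \<longrightarrow>
       module_isomorphic (group_ring (integer_mod_group n))
         (induced_module (integer_mod_group n) (sigma_subgroup n (length w))
            ((polygon_H1 n)\<lparr>carrier := N w\<rparr>))
         (direct_sum_module {..<iota w - 1}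
            (\<lambda>_. regular_module (group_ring (integer_mod_group n)))))"
proof -
  have n2: "n \<ge> 2" and n1: "n \<ge> 1" using assms by simp_all
  note W = polygon_wordsD[OF n2]
  show ?thesis
  \<comment> \<open>N_w consists of the classes with coefficients at one set of the orbit only,
    namely the set whose stabilizer is generated by sigma^d.\<close>
  proof (rule exI[of _ "\<lambda>w. supported n {word_set n w}"], intro conjI ballI impI)
    fix w assume w: "w \<in> polygon_words n"
    show "1 < length w" "length w dvd n" by (rule W(3)[OF w], rule W(2)[OF w])
    show "submodule (supported n {word_set n w}) (group_ring (sigma_subgroup n (length w))) (polygon_H1 n)"
      by (rule word_supported_submodule[OF n2 W(1,2)[OF w]])
    show "abelian_direct_summand (supported n {word_set n w}) (polygon_H1 n)"
      by (rule supported_direct_summand[OF n1])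
  next
    show "module_isomorphic (group_ring (integer_mod_group n)) (polygon_H1 n)
      (direct_sum_module (polygon_words n)
         (\<lambda>w. induced_module (integer_mod_group n) (sigma_subgroup n (length w))
                ((polygon_H1 n)\<lparr>carrier := supported n {word_set n w}\<rparr>)))"
      by (rule polygon_H1_decomposition[OF n2])
  next
    fix w assume w: "w \<in> polygon_words n" and l: "length w < n"
    show "\<exists>\<phi>\<in>iso (add_monoid ((polygon_H1 n)\<lparr>carrier := supported n {word_set n w}\<rparr>))
                (monoid_vec TYPE(int) (iota w * (n div length w) - 1)).
          \<forall>x\<in>supported n {word_set n w}. \<phi> (frag_of (sigma_pow n (length w)) \<odot>\<^bsub>polygon_H1 n\<^esub> x) =
                   action_mat (iota w) (n div length w) *\<^sub>v \<phi> x"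
      by (rule word_supported_cycle_iso[OF n2 W(1)[OF w] W(3)[OF w] l W(2)[OF w]])
  next
    fix w assume w: "w \<in> polygon_words n" and l: "length w = n"
    show "module_isomorphic (group_ring (integer_mod_group n))
         (induced_module (integer_mod_group n) (sigma_subgroup n (length w))
            ((polygon_H1 n)\<lparr>carrier := supported n {word_set n w}\<rparr>))
         (direct_sum_module {..<iota w - 1}
            (\<lambda>_. regular_module (group_ring (integer_mod_group n))))"
      unfolding l by (rule induced_free[OF n2 W(1)[OF w, unfolded l]])
  qed
qed

end
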